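(* Let $\alpha\in[0,1)$ and let $g\ge 7$ be an integer. It is NP-hard to approximate FLaMECaST (with one intermediate layer and cost parameter $\alpha$) within a factor of $$1+\frac{1+(g-1)^\alpha-g^\alpha}{n\cdot(2g)^\alpha},$$ where $n$ is the number of sources of the instance; here $g$ is the minimum size of a group of co-located sources in the hard instances. In particular (taking $g=7$), unless $\mathrm{P}=\mathrm{NP}$, FLaMECaST cannot be approximated within a factor of $1+\frac{1+6^\alpha-7^\alpha}{14^\alpha n}$.
   Context: FLaMECaST: an instance $I=(S,T,C,\alpha)$ consists of a finite set $S$ of sources and a finite set $T$ of sinks, each with a fixed position in $\mathbb{R}^2$ (several sources may share a position; a group is a maximal set of sources sharing a position), capacities $C=(c_0,\dots,c_{\lambda+1})$ with integers $c_0\ge c_1\ge\dots\ge c_{\lambda+1}\ge 1$ ($\lambda\ge 0$ is the number of intermediate layers), and a parameter $\alpha\in[0,1]$. A topology is a rooted forest (edges directed from child to parent) of height at most $\lambda+1$ whose leaves are exactly $S$ and whose roots form a subset of $T$; its other vertices are Steiner vertices. The layer of a vertex is the number of edges on its path to its root. The load $\ell(v)$ of a vertex is the number of sources in its subtree; the load of an edge $uv$ ($u$ child of $v$) is $\ell(u)$. A topology is valid if $\ell(v)\le c_i$ for every vertex $v$ in layer $i$. An embedding maps each vertex to a point of $\mathbb{R}^2$, sources and sinks to their given positions and Steiner vertices arbitrarily; a topology with an embedding is a layout (valid if its topology is valid). The cost of an edge $uv$ is $\|\mathrm{pos}(u)-\mathrm{pos}(v)\|\cdot\ell(uv)^\alpha$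 and the cost of a layout is the sum of its edge costs. The goal is to find a valid layout of minimum cost; approximating within factor $\rho$ means computing a valid layout of cost at most $\rho$ times the minimum. *)

theory Defs
  imports "HOL-Analysis.Analysis"
begin

section \<open>Polynomial time\<close>

text \<open>
  Deterministic multi-tape Turing machines. Symbol 0 is the blank, symbols 1 and 2 are the bits
  (see \<open>bit_sym\<close>); state 0 is initial and state 1 is the only halting state. All tapes are
  infinite in both directions. The input is written on tape 0 from cell 0 on, the output is
  read from tape 1 from cell 0 on, up to the first blank.
\<close>

record tm =
  tm_tapes :: nat
  tm_states :: nat
  tm_symbols :: nat
  tm_delta :: "nat \<Rightarrow> nat list \<Rightarrow> nat \<times> (nat \<times> int) list"

definition wf_tm :: "tm \<Rightarrow> bool" where
  "wf_tm M \<longleftrightarrow> 2 \<le> tm_tapes M \<and> 2 \<le> tm_states M \<and> 3 \<le> tm_symbols M \<and>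
     (\<forall>q rs. q < tm_states M \<and> length rs = tm_tapes M \<and> (\<forall>r \<in> set rs. r < tm_symbols M) \<longrightarrow>
        (case tm_delta M q rs of (q', acts) \<Rightarrow>
           q' < tm_states M \<and> length acts = tm_tapes M \<and>
           (\<forall>(s, d) \<in> set acts. s < tm_symbols M \<and> d \<in> {-1, 0, 1})))"

text \<open>A tape consists of its contents and the position of its head.\<close>

type_synonym tape = "(int \<Rightarrow> nat) \<times> int"
type_synonym config = "nat \<times> tape list"

definition bit_sym :: "bool \<Rightarrow> nat" where
  "bit_sym b = (if b then 2 else 1)"

definition tm_init :: "tm \<Rightarrow> bool list \<Rightarrow> config" where
  "tm_init M x =
     (0, ((\<lambda>i. if 0 \<le> i \<and> i < int (length x) then bit_sym (x ! nat i) else 0), 0)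
         # replicate (tm_tapes M - 1) ((\<lambda>_. 0), 0))"

definition tm_step :: "tm \<Rightarrow> config \<Rightarrow> config" where
  "tm_step M c = (case c of (q, tps) \<Rightarrow>
     if q = 1 then (q, tps)
     else (case tm_delta M q (map (\<lambda>(t, h). t h) tps) of (q', acts) \<Rightarrow>
             (q', map2 (\<lambda>(t, h) (s, d). (t(h := s), h + d)) tps acts)))"

definition tm_output :: "config \<Rightarrow> bool list \<Rightarrow> bool" where
  "tm_output c y \<longleftrightarrow> fst c = 1 \<and>
     (\<forall>i < length y. fst (snd c ! 1) (int i) = bit_sym (y ! i)) \<and>
     fst (snd c ! 1) (int (length y)) = 0"

definition polytime :: "(bool list \<Rightarrow> bool list) \<Rightarrow> bool" where
  "polytime f \<longleftrightarrow> (\<exists>M k. wf_tm M \<and>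
     (\<forall>x. tm_output ((tm_step M ^^ (length x ^ k + k)) (tm_init M x)) (f x)))"

definition class_P :: "bool list set set" where
  "class_P = {L. \<exists>f. polytime f \<and> (\<forall>x. f x = [True] \<longleftrightarrow> x \<in> L)}"

definition delimited :: "bool list \<Rightarrow> bool list" where
  "delimited x = concat (map (\<lambda>b. [True, b]) x) @ [False]"

definition pair_code :: "bool list \<Rightarrow> bool list \<Rightarrow> bool list" where
  "pair_code x y = delimited x @ y"

definition class_NP :: "bool list set set" where
  "class_NP = {L. \<exists>V \<in> class_P. \<exists>k. \<forall>x.
     x \<in> L \<longleftrightarrow> (\<exists>w. length w \<le> length x ^ k + k \<and> pair_code x w \<in> V)}"

section \<open>Search problems\<close>

text \<open>
  A search problem is a relation between (encoded) instances and (encoded) solutions; an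
  algorithm only has to succeed on the instances that have a solution.
\<close>

definition solves :: "(bool list \<Rightarrow> bool list) \<Rightarrow> (bool list \<times> bool list) set \<Rightarrow> bool" where
  "solves f R \<longleftrightarrow> (\<forall>x \<in> Domain R. (x, f x) \<in> R)"

text \<open>
  Hardness under reductions with one query: \<open>f\<close> turns an input into a solvable instance and
  \<open>h\<close> recovers the answer from the input together with an arbitrary solution of that instance.
\<close>

definition NP_hard_search :: "(bool list \<times> bool list) set \<Rightarrow> bool" where
  "NP_hard_search R \<longleftrightarrow> (\<forall>L \<in> class_NP. \<exists>f h. polytime f \<and> polytime h \<and>
     (\<forall>x. f x \<in> Domain R \<and>
          (\<forall>y. (f x, y) \<in> R \<longrightarrow> (h (pair_code x y) = [True] \<longleftrightarrow> x \<in> L))))"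

section \<open>FLaMECaST\<close>

type_synonym point = "real \<times> real"

record ('s, 't) flamecast =
  sources :: "'s set"
  sinks :: "'t set"
  source_pos :: "'s \<Rightarrow> point"
  sink_pos :: "'t \<Rightarrow> point"
  capacities :: "nat list"
  alpha :: real

text \<open>The capacities are \<open>c\<^sub>0, \<dots>, c\<^sub>\<lambda>\<^sub>+\<^sub>1\<close>, where \<open>\<lambda>\<close> is the number of intermediate layers.\<close>

definition intermediate_layers :: "('s, 't) flamecast \<Rightarrow> nat" where
  "intermediate_layers I = length (capacities I) - 2"

definition is_instance :: "('s, 't) flamecast \<Rightarrow> bool" where
  "is_instance I \<longleftrightarrow> finite (sources I) \<and> finite (sinks I) \<and>
     2 \<le> length (capacities I) \<and> sorted_wrt (\<ge>) (capacities I) \<and> (\<forall>c \<in> set (capacities I). 1 \<le> c) \<and>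
     0 \<le> alpha I \<and> alpha I \<le> 1"

definition groups :: "('s, 't) flamecast \<Rightarrow> 's set set" where
  "groups I = (\<lambda>p. {s \<in> sources I. source_pos I s = p}) ` source_pos I ` sources I"

definition has_min_group_size :: "nat \<Rightarrow> ('s, 't) flamecast \<Rightarrow> bool" where
  "has_min_group_size g I \<longleftrightarrow> sources I \<noteq> {} \<and> Min (card ` groups I) = g"

datatype ('s, 't) vertex = Source 's | Sink 't | Steiner nat

text \<open>Edges are directed from child to parent.\<close>

record ('s, 't) layout =
  verts :: "('s, 't) vertex set"
  edges :: "(('s, 't) vertex \<times> ('s, 't) vertex) set"
  pos :: "('s, 't) vertex \<Rightarrow> point"

definition leaves :: "('s, 't) layout \<Rightarrow> ('s, 't) vertex set" where
  "leaves L = verts L - Range (edges L)"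

definition roots :: "('s, 't) layout \<Rightarrow> ('s, 't) vertex set" where
  "roots L = verts L - Domain (edges L)"

definition layer :: "('s, 't) layout \<Rightarrow> ('s, 't) vertex \<Rightarrow> nat" where
  "layer L v = (THE k. \<exists>r \<in> roots L. (v, r) \<in> edges L ^^ k)"

definition load :: "('s, 't) flamecast \<Rightarrow> ('s, 't) layout \<Rightarrow> ('s, 't) vertex \<Rightarrow> nat" where
  "load I L v = card {s \<in> sources I. (Source s, v) \<in> (edges L)\<^sup>*}"

definition is_rooted_forest :: "('s, 't) layout \<Rightarrow> bool" where
  "is_rooted_forest L \<longleftrightarrow> finite (verts L) \<and> edges L \<subseteq> verts L \<times> verts L \<and>
     single_valued (edges L) \<and> acyclic (edges L)"

definition is_topology :: "('s, 't) flamecast \<Rightarrow> ('s, 't) layout \<Rightarrow> bool" where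
  "is_topology I L \<longleftrightarrow> is_rooted_forest L \<and>
     (\<forall>v \<in> verts L. layer L v \<le> intermediate_layers I + 1) \<and>
     leaves L = Source ` sources I \<and>
     roots L \<subseteq> Sink ` sinks I \<and>
     verts L - leaves L - roots L \<subseteq> range Steiner"

definition is_valid_topology :: "('s, 't) flamecast \<Rightarrow> ('s, 't) layout \<Rightarrow> bool" where
  "is_valid_topology I L \<longleftrightarrow> is_topology I L \<and>
     (\<forall>v \<in> verts L. load I L v \<le> capacities I ! layer L v)"

definition is_embedding :: "('s, 't) flamecast \<Rightarrow> ('s, 't) layout \<Rightarrow> bool" where
  "is_embedding I L \<longleftrightarrow>
     (\<forall>s. Source s \<in> verts L \<longrightarrow> pos L (Source s) = source_pos I s) \<and>
     (\<forall>t. Sink t \<in> verts L \<longrightarrow> pos L (Sink t) = sink_pos I t)"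

definition valid_layouts :: "('s, 't) flamecast \<Rightarrow> ('s, 't) layout set" where
  "valid_layouts I = {L. is_valid_topology I L \<and> is_embedding I L}"

text \<open>The norm on pairs of reals is the Euclidean one.\<close>

definition layout_cost :: "('s, 't) flamecast \<Rightarrow> ('s, 't) layout \<Rightarrow> real" where
  "layout_cost I L =
     (\<Sum>(u, v) \<in> edges L. norm (pos L u - pos L v) * real (load I L u) powr alpha I)"

definition min_cost :: "('s, 't) flamecast \<Rightarrow> real" where
  "min_cost I = (INF L \<in> valid_layouts I. layout_cost I L)"

definition is_approximation :: "real \<Rightarrow> ('s, 't) flamecast \<Rightarrow> ('s, 't) layout \<Rightarrow> bool" where
  "is_approximation \<rho> I L \<longleftrightarrow> L \<in> valid_layouts I \<and> layout_cost I L \<le> \<rho> * min_cost I"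

section \<open>Encodings\<close>

text \<open>
  All codes below are prefix-free. Coordinates in inputs and outputs are rational; the minimum
  cost still refers to arbitrary real embeddings.
\<close>

fun nat_bits :: "nat \<Rightarrow> bool list" where
  "nat_bits n = (if n = 0 then [] else odd n # nat_bits (n div 2))"

declare nat_bits.simps [simp del]

definition nat_code :: "nat \<Rightarrow> bool list" where
  "nat_code n = delimited (nat_bits n)"

definition int_code :: "int \<Rightarrow> bool list" where
  "int_code i = (i < 0) # nat_code (nat \<bar>i\<bar>)"

definition rat_code :: "rat \<Rightarrow> bool list" where
  "rat_code r = int_code (fst (quotient_of r)) @ int_code (snd (quotient_of r))"

definition point_code :: "rat \<times> rat \<Rightarrow> bool list" where
  "point_code p = rat_code (fst p) @ rat_code (snd p)"

fun vertex_code :: "(nat, nat) vertex \<Rightarrow> bool list" where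
  "vertex_code (Source i) = [False, False] @ nat_code i"
| "vertex_code (Sink i) = [False, True] @ nat_code i"
| "vertex_code (Steiner i) = [True] @ nat_code i"

definition list_code :: "('a \<Rightarrow> bool list) \<Rightarrow> 'a list \<Rightarrow> bool list" where
  "list_code code xs = concat (map (\<lambda>x. True # code x) xs) @ [False]"

definition prefix_free :: "('a \<Rightarrow> bool list) \<Rightarrow> bool" where
  "prefix_free code \<longleftrightarrow> (\<forall>a b u v. code a @ u = code b @ v \<longrightarrow> a = b \<and> u = v)"

lemma prefix_freeD: "prefix_free code \<Longrightarrow> code a @ u = code b @ v \<Longrightarrow> a = b \<and> u = v"
  unfolding prefix_free_def by blast

lemma prefix_freeI:
  assumes "\<And>a b u v. code a @ u = code b @ v \<Longrightarrow> a = b \<and> u = v"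
  shows "prefix_free code"
  using assms unfolding prefix_free_def by simp

lemma prefix_free_append:
  assumes c: "prefix_free c" and d: "prefix_free d"
    and inj: "\<And>a b. f a = f b \<Longrightarrow> g a = g b \<Longrightarrow> a = b"
  shows "prefix_free (\<lambda>a. c (f a) @ d (g a))"
proof (rule prefix_freeI)
  fix a b u v assume "(c (f a) @ d (g a)) @ u = (c (f b) @ d (g b)) @ v"
  then have "c (f a) @ (d (g a) @ u) = c (f b) @ (d (g b) @ v)" by simp
  from prefix_freeD[OF c this] have "f a = f b" "d (g a) @ u = d (g b) @ v" by simp_all
  with prefix_freeD[OF d this(2)] inj show "a = b \<and> u = v" by simp
qed

lemma delimited_prefix_free: "prefix_free delimited"
proof -
  have "x = y \<and> u = v" if "delimited x @ u = delimited y @ v" for x y u v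
    using that
  proof (induction x arbitrary: y)
    case Nil
    then show ?case by (cases y) (auto simp: delimited_def)
  next
    case (Cons b x)
    then show ?case by (cases y) (auto simp: delimited_def)
  qed
  then show ?thesis by (rule prefix_freeI)
qed

lemma nat_bits_0: "nat_bits 0 = []"
  by (subst nat_bits.simps) (simp only: if_True refl simp_thms)

lemma nat_bits_pos: "n \<noteq> 0 \<Longrightarrow> nat_bits n = odd n # nat_bits (n div 2)"
  by (subst nat_bits.simps) simp

lemma nat_bits_inj: "nat_bits m = nat_bits n \<Longrightarrow> m = n"
proof (induction m arbitrary: n rule: less_induct)
  case (less m)
  show ?case
  proof (cases "m = 0 \<or> n = 0")
    case True
    then show ?thesis
      using less.prems nat_bits_pos[of m] nat_bits_pos[of n]
      by (cases "m = 0"; cases "n = 0") (simp_all add: nat_bits_0)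
  next
    case False
    then have eq: "odd m = odd n" "nat_bits (m div 2) = nat_bits (n div 2)"
      using less.prems nat_bits_pos[of m] nat_bits_pos[of n] by auto
    have "m div 2 = n div 2"
      using less.IH[OF _ eq(2)] False by simp
    moreover have "m mod 2 = n mod 2"
      using eq(1) by (simp add: mod2_eq_if)
    ultimately show ?thesis
      using div_mult_mod_eq[of m 2] div_mult_mod_eq[of n 2] by linarith
  qed
qed

lemma nat_code_prefix_free: "prefix_free nat_code"
proof (rule prefix_freeI)
  fix a b u v assume "nat_code a @ u = nat_code b @ v"
  from prefix_freeD[OF delimited_prefix_free this[unfolded nat_code_def]] nat_bits_inj
  show "a = b \<and> u = v" by simp
qed

lemma int_code_prefix_free: "prefix_free int_code"
  unfolding prefix_free_def int_code_def
proof (intro allI impI)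
  fix a b u v assume "((a < 0) # nat_code (nat \<bar>a\<bar>)) @ u = ((b < 0) # nat_code (nat \<bar>b\<bar>)) @ v"
  then have "(a < 0) = (b < 0)" "nat_code (nat \<bar>a\<bar>) @ u = nat_code (nat \<bar>b\<bar>) @ v"
    by simp_all
  with prefix_freeD[OF nat_code_prefix_free this(2)] show "a = b \<and> u = v"
    by linarith
qed

lemma rat_code_prefix_free: "prefix_free rat_code"
  unfolding rat_code_def[abs_def]
  by (rule prefix_free_append[OF int_code_prefix_free int_code_prefix_free])
    (rule quotient_of_inject, rule prod_eqI)

lemma point_code_prefix_free: "prefix_free point_code"
  unfolding point_code_def[abs_def]
  by (rule prefix_free_append[OF rat_code_prefix_free rat_code_prefix_free]) (rule prod_eqI)

lemma vertex_code_prefix_free: "prefix_free vertex_code"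
proof (rule prefix_freeI)
  fix a b u v assume *: "vertex_code a @ u = vertex_code b @ v"
  note nat = prefix_freeD[OF nat_code_prefix_free]
  show "a = b \<and> u = v"
  proof (cases a)
    case (Source i)
    with * show ?thesis using nat[of i u] by (cases b) simp_all
  next
    case (Sink i)
    with * show ?thesis using nat[of i u] by (cases b) simp_all
  next
    case (Steiner i)
    with * show ?thesis using nat[of i u] by (cases b) simp_all
  qed
qed

lemma list_code_prefix_free:
  assumes "prefix_free code"
  shows "prefix_free (list_code code)"
proof -
  have "xs = ys \<and> u = v" if "list_code code xs @ u = list_code code ys @ v" for xs ys u v
    using that
  proof (induction xs arbitrary: ys)
    case Nil
    then show ?case by (cases ys) (auto simp: list_code_def)
  next
    case (Cons x xs)
    then obtain y ys' where ys: "ys = y # ys'"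
      by (cases ys) (auto simp: list_code_def)
    then have "code x @ list_code code xs @ u = code y @ list_code code ys' @ v"
      using Cons.prems by (simp add: list_code_def)
    from prefix_freeD[OF assms this] Cons.IH[of ys'] ys show ?case by simp
  qed
  then show ?thesis by (rule prefix_freeI)
qed

definition real_point :: "rat \<times> rat \<Rightarrow> point" where
  "real_point p = (of_rat (fst p), of_rat (snd p))"

text \<open>An input lists the positions of the sources, those of the sinks, and the capacities.\<close>

definition instance_code :: "(rat \<times> rat) list \<Rightarrow> (rat \<times> rat) list \<Rightarrow> nat list \<Rightarrow> bool list" where
  "instance_code ss ts cs =
     list_code point_code ss @ list_code point_code ts @ list_code nat_code cs"

definition the_instance ::
  "real \<Rightarrow> (rat \<times> rat) list \<Rightarrow> (rat \<times> rat) list \<Rightarrow> nat list \<Rightarrow> (nat, nat) flamecast" where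
  "the_instance \<alpha> ss ts cs =
     \<lparr> sources = {..<length ss}, sinks = {..<length ts},
       source_pos = (\<lambda>i. real_point (ss ! i)), sink_pos = (\<lambda>i. real_point (ts ! i)),
       capacities = cs, alpha = \<alpha> \<rparr>"

text \<open>An output lists the vertices with their positions, and the edges.\<close>

definition layout_code ::
  "((nat, nat) vertex \<times> rat \<times> rat) list \<Rightarrow> ((nat, nat) vertex \<times> (nat, nat) vertex) list \<Rightarrow> bool list" where
  "layout_code vs es =
     list_code (\<lambda>(v, p). vertex_code v @ point_code p) vs @
     list_code (\<lambda>(u, v). vertex_code u @ vertex_code v) es"

definition the_layout ::
  "((nat, nat) vertex \<times> rat \<times> rat) list \<Rightarrow> ((nat, nat) vertex \<times> (nat, nat) vertex) list \<Rightarrow> (nat, nat) layout" where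
  "the_layout vs es =
     \<lparr> verts = fst ` set vs, edges = set es, pos = (\<lambda>v. real_point (the (map_of vs v))) \<rparr>"

lemma instance_code_inj:
  assumes "instance_code ss ts cs = instance_code ss' ts' cs'"
  shows "ss = ss' \<and> ts = ts' \<and> cs = cs'"
proof -
  note point = prefix_freeD[OF list_code_prefix_free[OF point_code_prefix_free]]
  note 1 = point[OF assms[unfolded instance_code_def]]
  note 2 = point[OF conjunct2[OF 1]]
  have "list_code nat_code cs @ [] = list_code nat_code cs' @ []"
    using 2 by simp
  from prefix_freeD[OF list_code_prefix_free[OF nat_code_prefix_free] this] 1 2
  show ?thesis by simp
qed

lemma layout_code_inj:
  assumes "layout_code vs es = layout_code vs' es'"
  shows "vs = vs' \<and> es = es'"
proof -
  have v: "prefix_free (\<lambda>(v, p). vertex_code v @ point_code p)"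
    unfolding case_prod_unfold
    by (rule prefix_free_append[OF vertex_code_prefix_free point_code_prefix_free]) (rule prod_eqI)
  have e: "prefix_free (\<lambda>(u, v). vertex_code u @ vertex_code v)"
    unfolding case_prod_unfold
    by (rule prefix_free_append[OF vertex_code_prefix_free vertex_code_prefix_free]) (rule prod_eqI)
  from prefix_freeD[OF list_code_prefix_free[OF v] assms[unfolded layout_code_def]]
  show ?thesis
    using prefix_freeD[OF list_code_prefix_free[OF e], of es "[]" es' "[]"] by simp
qed

text \<open>
  Approximating, within the factor \<open>\<rho> n\<close> for \<open>n\<close> sources, the instances with cost parameter
  \<open>\<alpha>\<close>, one intermediate layer and property \<open>Q\<close>. As rational layouts are dense among the real
  ones, every instance with a valid layout has a solution in this sense whenever \<open>\<rho> n > 1\<close>.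
\<close>

definition flamecast_approx ::
  "real \<Rightarrow> ((nat, nat) flamecast \<Rightarrow> bool) \<Rightarrow> (nat \<Rightarrow> real) \<Rightarrow> (bool list \<times> bool list) set" where
  "flamecast_approx \<alpha> Q \<rho> =
     {(instance_code ss ts cs, layout_code vs es) | ss ts cs vs es.
        is_instance (the_instance \<alpha> ss ts cs) \<and>
        intermediate_layers (the_instance \<alpha> ss ts cs) = 1 \<and>
        Q (the_instance \<alpha> ss ts cs) \<and>
        is_approximation (\<rho> (card (sources (the_instance \<alpha> ss ts cs))))
          (the_instance \<alpha> ss ts cs) (the_layout vs es)}"

end

theory Submission
  imports Defs
begin

text \<open>
  The accepting computations of a verifier on inputs of a given size are the tilings of a rectangle by a
  fixed finite set of tiles whose bottom row encodes the input and leaves the witness open. A tiling is an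
  exact cover, and the exact cover is a perfect packing of items into equal bins: every cell owns a few
  bins, every item may only go to its own cell or to the two cells of its edge, and the item sizes are
  numbers of bounded size whose digits add up without ambiguity, so that only the intended combinations
  of items fill a bin.

  In the plane, bins are sinks on a lattice and an item is a group of co-located sources as near to the
  sinks of its cells as possible. As \<open>\<alpha> < 1\<close>, gathering a whole group at its own position and sending it to a
  nearest sink is optimal, and splitting a group, merging groups or using another sink costs a constant
  more. The optimum is at most \<open>n \<cdot> S \<cdot> A powr (\<alpha> - 1)\<close>, where \<open>S\<close> bounds the distances and \<open>A\<close> bounds the group
  sizes from below; a large constant \<open>A\<close> makes the additive error allowed by a factor \<open>1 + 1 / n\<close> smaller
  than that constant. Hence an approximate solution of an instance that admits a tiling is a perfect
  packing, and the witness can be read off it. Spare sinks at the origin make every instance solvable, and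
  \<open>g\<close> further sources there give it the prescribed minimum group size.
\<close>

section \<open>Polynomial-time functions: stack programs, their equivalence with machines, closure
  properties\<close>

section \<open>Stack programs\<close>

text \<open>Three obstacles shape the proof. (1) An item becomes a group whose sources are listed
  one by one in the input, so the packing must be hard for item sizes bounded by a constant. Hence a
  tile set fixed by the verifier: weights, numbering, spacing and the factor \<open>A\<close> depend
  only on the verifier, \<open>\<alpha>\<close> and \<open>g\<close>, and are hard-wired into the
  reduction without ever being computed. (2) The recovery function should not compare costs, which
  are sums of real powers. It reads a candidate witness from the layout and runs the verifier on it,
  so a wrong candidate is harmless and nothing has to be shown about the optimum of no-instances.
  The particular factor enters only through \<open>1 < \<rho> n\<close> and
  \<open>\<rho> n \<le> 1 + 1 / n\<close>. (3) \<open>polytime\<close> speaks of raw machines.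
  Composition, iteration and loops are proved for stack programs, with translations both ways:
  program to machine to conclude \<open>polytime\<close>, machine to program to use a
  \<open>polytime\<close> hypothesis as a subroutine.\<close>

datatype com = Push nat nat | Pop nat | Seq com com (infixr ";;" 60)
  | Cond nat "nat option => bool" com com | Loop nat "nat option => bool" com

type_synonym store = "nat => nat list"

definition topmost :: "nat list => nat option" where
  "topmost xs = (case xs of [] => None | a # _ => Some a)"

lemma topmost_simps [simp]: "topmost [] = None" "topmost (a # xs) = Some a" by (simp_all add: topmost_def)

text \<open>The third argument is the exact number of Turing machine steps of the compiled program.\<close>

inductive exec :: "com => store => nat => store => bool" where
  Push: "exec (Push r a) s 2 (s(r := a # s r))"
| Pop: "exec (Pop r) s 1 (s(r := tl (s r)))"
| Seq: "exec c s m s' ==> exec d s' n s'' ==> exec (c ;; d) s (m + n) s''"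
| CondT: "P (topmost (s r)) ==> exec c s n s' ==> exec (Cond r P c d) s (Suc n) s'"
| CondF: "~ P (topmost (s r)) ==> exec d s n s' ==> exec (Cond r P c d) s (Suc n) s'"
| LoopF: "~ P (topmost (s r)) ==> exec (Loop r P c) s 1 s"
| LoopT: "P (topmost (s r)) ==> exec c s m s' ==> exec (Loop r P c) s' n s'' ==>
    exec (Loop r P c) s (Suc (m + n)) s''"

fun bounded_com :: "com => nat => nat => bool" where
  "bounded_com (Push r a) N G \<longleftrightarrow> r < N & a < G"
| "bounded_com (Pop r) N G \<longleftrightarrow> r < N"
| "bounded_com (c ;; d) N G \<longleftrightarrow> bounded_com c N G & bounded_com d N G"
| "bounded_com (Cond r P c d) N G \<longleftrightarrow> r < N & bounded_com c N G & bounded_com d N G"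
| "bounded_com (Loop r P c) N G \<longleftrightarrow> r < N & bounded_com c N G"

lemma bounded_com_mono: "bounded_com c N G ==> N <= N' ==> G <= G' ==> bounded_com c N' G'"
  by (induction c) auto

lemma ex_bounded_com: "\<exists>N G. bounded_com c N G"
proof (induction c)
  case (Push r a) then show ?case by (intro exI[of _ "Suc r"] exI[of _ "Suc a"]) simp
next
  case (Pop r) then show ?case by (intro exI[of _ "Suc r"]) simp
next
  case (Seq c d)
  then obtain N G N' G' where "bounded_com c N G" "bounded_com d N' G'" by blast
  then show ?case by (intro exI[of _ "max N N'"] exI[of _ "max G G'"]) (auto elim: bounded_com_mono)
next
  case (Cond r P c d)
  then obtain N G N' G' where "bounded_com c N G" "bounded_com d N' G'" by blast
  then show ?case
    by (intro exI[of _ "max (Suc r) (max N N')"] exI[of _ "max G G'"]) (auto elim: bounded_com_mono)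
next
  case (Loop r P c)
  then obtain N G where "bounded_com c N G" by blast
  then show ?case by (intro exI[of _ "max (Suc r) N"] exI[of _ G]) (auto elim: bounded_com_mono)
qed

subsection \<open>Compilation to Turing machines\<close>

text \<open>An instruction acts on a single tape: the symbol read determines the next state, the symbol
  written and the move. On a stack tape the symbol \<open>a\<close> is stored as \<open>Suc a\<close>.\<close>

type_synonym instr = "nat \<times> (nat => nat \<times> nat \<times> int)"

definition read_opt :: "nat => nat option" where
  "read_opt a = (if a = 0 then None else Some (a - 1))"

text \<open>Register \<open>r\<close> lives on tape \<open>r + 2\<close>, because tapes 0 and 1 are
  kept for the input and the output of the machine.\<close>

definition test_instr :: "nat => (nat option => bool) => nat => nat => instr" where
  "test_instr r P p q = (r + 2, \<lambda>a. (if P (read_opt a) then p else q, a, 0))"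

fun com_size :: "com => nat" where
  "com_size (Push r a) = 2"
| "com_size (Pop r) = 1"
| "com_size (c ;; d) = com_size c + com_size d"
| "com_size (Cond r P c d) = Suc (com_size c + com_size d)"
| "com_size (Loop r P c) = Suc (com_size c)"

fun compile :: "com => nat => nat => instr list" where
  "compile (Push r a) p e = [(r + 2, \<lambda>b. (p + 1, b, 1)), (r + 2, \<lambda>b. (e, Suc a, 0))]"
| "compile (Pop r) p e = [(r + 2, \<lambda>b. (e, 0, if b = 0 then 0 else -1))]"
| "compile (c ;; d) p e = compile c p (p + com_size c) @ compile d (p + com_size c) e"
| "compile (Cond r P c d) p e = test_instr r P (p + 1) (p + 1 + com_size c) #
     compile c (p + 1) e @ compile d (p + 1 + com_size c) e"
| "compile (Loop r P c) p e = test_instr r P (p + 1) e # compile c (p + 1) p"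

lemma length_compile [simp]: "length (compile c p e) = com_size c" by (induction c arbitrary: p e) auto

definition instr_ok :: "nat => nat => nat => instr => bool" where
  "instr_ok K Q G i \<longleftrightarrow> fst i < K & (\<forall>a<G. case snd i a of (q, b, d) => q < Q & b < G & d \<in> {-1, 0, 1})"

lemma com_size_pos: "0 < com_size c" by (induction c) auto

lemma compile_ok:
  assumes "bounded_com c N G" "p + com_size c <= Q" "e < Q"
  shows "\<forall>i \<in> set (compile c p e). instr_ok (N + 2) Q (Suc G) i"
  using assms
proof (induction c arbitrary: p e)
  case (Seq c d)
  have "p + com_size c < Q" using Seq.prems com_size_pos[of d] by simp
  then show ?case
    using Seq.IH(1)[of p "p + com_size c"] Seq.IH(2)[of "p + com_size c" e] Seq.prems by auto
next
  case (Cond r P c d)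
  have "p + 1 + com_size c < Q" using Cond.prems com_size_pos[of d] by simp
  moreover have "instr_ok (N + 2) Q (Suc G) (test_instr r P (p + 1) (p + 1 + com_size c))"
    using Cond.prems calculation by (auto simp: instr_ok_def test_instr_def)
  ultimately show ?case
    using Cond.IH(1)[of "p + 1" e] Cond.IH(2)[of "p + 1 + com_size c" e] Cond.prems by auto
next
  case (Loop r P c)
  moreover have "instr_ok (N + 2) Q (Suc G) (test_instr r P (p + 1) e)"
    using Loop.prems com_size_pos[of c] by (auto simp: instr_ok_def test_instr_def)
  ultimately show ?case
    using Loop.IH[of "p + 1" p] Loop.prems by auto
qed (auto simp: instr_ok_def)

definition table_tm :: "nat => nat => instr list => tm" where
  "table_tm K G tab = \<lparr> tm_tapes = K, tm_states = length tab, tm_symbols = G,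
     tm_delta = (\<lambda>q rs. case snd (tab ! q) (rs ! fst (tab ! q)) of (q', a, d) =>
       (q', (map (\<lambda>a. (a, 0)) rs)[fst (tab ! q) := (a, d)])) \<rparr>"

lemma wf_table_tm:
  assumes "2 <= K" "2 <= length tab" "3 <= G" "\<forall>i \<in> set tab. instr_ok K (length tab) G i"
  shows "wf_tm (table_tm K G tab)"
  unfolding wf_tm_def
proof (intro conjI allI impI)
  fix q :: nat and rs :: "nat list"
  assume q: "q < tm_states (table_tm K G tab) & length rs = tm_tapes (table_tm K G tab) &
    (\<forall>r\<in>set rs. r < tm_symbols (table_tm K G tab))"
  then have q: "q < length tab" "length rs = K" "\<forall>r\<in>set rs. r < G" by (simp_all add: table_tm_def)
  define r F where "r = fst (tab ! q)" and "F = snd (tab ! q)"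
  have ok: "r < K" "\<forall>a<G. case F a of (q, b, d) => q < length tab & b < G & d \<in> {-1, 0, 1}"
    using assms(4) q(1) nth_mem[OF q(1)] unfolding instr_ok_def r_def F_def by auto
  obtain q' a d where F: "F (rs ! r) = (q', a, d)" by (metis prod_cases3)
  have "rs ! r < G" using q ok by simp
  with ok(2) F have *: "q' < length tab" "a < G" "d \<in> {-1, 0, 1}" by fastforce+
  have "set ((map (\<lambda>a. (a, 0)) rs)[r := (a, d)]) \<subseteq> insert (a, d) ((\<lambda>a. (a, 0)) ` set rs)"
    using set_update_subset_insert[of "map (\<lambda>a. (a, 0)) rs" r "(a, d)"] by simp
  then have "\<forall>(s, d) \<in> set ((map (\<lambda>a. (a, 0)) rs)[r := (a, d)]). s < G & d \<in> {-1, 0, 1}"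
    using * q(3) by fast
  with * show "case tm_delta (table_tm K G tab) q rs of (q', acts) =>
      q' < tm_states (table_tm K G tab) & length acts = tm_tapes (table_tm K G tab) &
      (\<forall>(s, d)\<in>set acts. s < tm_symbols (table_tm K G tab) & d \<in> {-1, 0, 1})"
    using F q by (simp add: table_tm_def r_def[symmetric] F_def[symmetric])
qed (use assms in \<open>simp_all add: table_tm_def\<close>)

lemma table_tm_step:
  assumes "q ~= 1" "q < length tab" "tab ! q = (r, F)" "r < length tps" "tps ! r = (t, h)"
    and "F (t h) = (q', a, d)"
  shows "tm_step (table_tm K G tab) (q, tps) = (q', tps[r := (t(h := a), h + d)])"
proof -
  have "map2 (\<lambda>(t, h) (s, d). (t(h := s), h + d)) tps
      ((map (\<lambda>a. (a, 0)) (map (\<lambda>(t, h). t h) tps))[r := (a, d)]) = tps[r := (t(h := a), h + d)]"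
    using assms(4,5) by (intro nth_equalityI) (auto simp: nth_list_update split: prod.split)
  then show ?thesis
    using assms by (simp add: tm_step_def table_tm_def)
qed

text \<open>The bottom of the stack is in cell 1 and cell 0 always holds a blank. The head is parked
  on the top symbol and therefore scans a blank exactly when the stack is empty.\<close>

definition stack_tape :: "nat list => tape" where
  "stack_tape xs = ((\<lambda>i. if 1 <= i & i <= int (length xs)
     then Suc (xs ! nat (int (length xs) - i)) else 0), int (length xs))"

lemma stack_tape_Nil: "stack_tape [] = ((\<lambda>_. 0), 0)" by (auto simp: stack_tape_def)

lemma stack_tape_read: "read_opt (fst (stack_tape xs) (snd (stack_tape xs))) = topmost xs"
  by (cases xs) (auto simp: stack_tape_def read_opt_def)

lemma stack_tape_read_0: "fst (stack_tape xs) (snd (stack_tape xs)) = 0 \<longleftrightarrow> xs = []"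
  by (cases xs) (auto simp: stack_tape_def)

lemma stack_tape_Cons: "stack_tape (a # xs) =
    ((fst (stack_tape xs))(snd (stack_tape xs) + 1 := Suc a), snd (stack_tape xs) + 1)"
proof (rule prod_eqI)
  show "fst (stack_tape (a # xs)) = fst ((fst (stack_tape xs))(snd (stack_tape xs) + 1 := Suc a),
      snd (stack_tape xs) + 1)"
  proof
    fix i :: int
    show "fst (stack_tape (a # xs)) i = fst ((fst (stack_tape xs))(snd (stack_tape xs) + 1 := Suc a),
        snd (stack_tape xs) + 1) i"
    proof (cases "i = 1 + int (length xs)")
      case False then have "1 <= i & i <= 1 + int (length xs) ==>
          nat (1 + int (length xs) - i) = Suc (nat (int (length xs) - i))" by linarith
      with False show ?thesis by (auto simp: stack_tape_def)
    qed (simp add: stack_tape_def)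
  qed
qed (simp add: stack_tape_def)

lemma stack_tape_tl: "stack_tape (tl xs) =
   ((fst (stack_tape xs))(snd (stack_tape xs) := 0), snd (stack_tape xs) + (if xs = [] then 0 else -1))"
proof (cases xs)
  case (Cons a ys)
  have "fst (stack_tape ys) (snd (stack_tape ys) + 1) = 0" by (simp add: stack_tape_def)
  then show ?thesis using Cons by (simp add: stack_tape_Cons fun_upd_idem)
qed (auto simp: stack_tape_def)

definition store_tapes :: "nat => store => tape list" where
  "store_tapes N s = map (\<lambda>r. stack_tape (s r)) [0..<N]"

lemma store_tapes_update:
  "r < N ==> (store_tapes N s)[r := stack_tape xs] = store_tapes N (s(r := xs))"
  by (intro nth_equalityI) (auto simp: store_tapes_def nth_list_update)

lemma length_store_tapes [simp]: "length (store_tapes N s) = N" by (simp add: store_tapes_def)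

lemma nth_store_tapes [simp]: "r < N ==> store_tapes N s ! r = stack_tape (s r)" by (simp add: store_tapes_def)

definition code_at :: "instr list => nat => instr list => bool" where
  "code_at tab p cs \<longleftrightarrow> (\<exists>us vs. tab = us @ cs @ vs & length us = p)"

lemma code_at_append: "code_at tab p (cs @ ds) \<longleftrightarrow> code_at tab p cs & code_at tab (p + length cs) ds"
proof
  assume "code_at tab p (cs @ ds)"
  then obtain us vs where *: "tab = us @ (cs @ ds) @ vs" "length us = p" by (auto simp: code_at_def)
  from * have "code_at tab p cs" unfolding code_at_def by (intro exI[of _ us] exI[of _ "ds @ vs"]) simp
  moreover from * have "code_at tab (p + length cs) ds"
    unfolding code_at_def by (intro exI[of _ "us @ cs"] exI[of _ "vs"]) simp
  ultimately show "code_at tab p cs & code_at tab (p + length cs) ds" ..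
next
  assume "code_at tab p cs & code_at tab (p + length cs) ds"
  then obtain us vs us' vs' where *: "tab = us @ cs @ vs" "length us = p"
    "tab = us' @ ds @ vs'" "length us' = p + length cs" unfolding code_at_def by blast
  then have "us' @ ds @ vs' = (us @ cs) @ vs" "length us' = length (us @ cs)" by auto
  then have "us' = us @ cs" "vs = ds @ vs'" by (metis append_eq_append_conv)+
  with * show "code_at tab p (cs @ ds)" unfolding code_at_def by auto
qed

lemma code_at_Cons: "code_at tab p (c # cs) \<longleftrightarrow> p < length tab & tab ! p = c & code_at tab (p + 1) cs"
proof -
  have "code_at tab p [c] \<longleftrightarrow> p < length tab & tab ! p = c"
    unfolding code_at_def by (auto simp: nth_append) (metis id_take_nth_drop length_take min.absorb4)
  then show ?thesis using code_at_append[of tab p "[c]" cs] by simp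
qed

lemma table_tm_step_reg:
  assumes "q ~= 1" "q < length tab" "tab ! q = (r + 2, F)" "r < N" "length io = 2"
    and "F (fst (stack_tape (s r)) (snd (stack_tape (s r)))) = (q', a, d)"
    and "stack_tape xs =
      ((fst (stack_tape (s r)))(snd (stack_tape (s r)) := a), snd (stack_tape (s r)) + d)"
  shows "tm_step (table_tm K G tab) (q, io @ store_tapes N s) = (q', io @ store_tapes N (s(r := xs)))"
proof -
  have "(io @ store_tapes N s)[r + 2 := stack_tape xs] = io @ store_tapes N (s(r := xs))"
    using store_tapes_update[OF assms(4), of s xs] assms(5) by (simp add: list_update_append)
  moreover have "(io @ store_tapes N s) ! (r + 2) = stack_tape (s r)"
    using assms by (simp add: nth_append)
  ultimately show ?thesis
    using table_tm_step[OF assms(1-3), of "io @ store_tapes N s"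
        "fst (stack_tape (s r))" "snd (stack_tape (s r))" q' a d] assms by simp
qed

lemma table_tm_step_test:
  assumes "q ~= 1" "q < length tab" "tab ! q = test_instr r P p p'" "r < N" "length io = 2"
  shows "tm_step (table_tm K G tab) (q, io @ store_tapes N s) =
    (if P (topmost (s r)) then p else p', io @ store_tapes N s)"
proof -
  have "tm_step (table_tm K G tab) (q, io @ store_tapes N s) =
    (if P (topmost (s r)) then p else p', io @ store_tapes N (s(r := s r)))"
    by (rule table_tm_step_reg[OF assms(1,2) assms(3)[unfolded test_instr_def] assms(4,5)])
      (auto simp: stack_tape_read)
  then show ?thesis by simp
qed

text \<open>The induction follows the execution and not the program, because a loop re-enters its
  own code: its body is compiled with the state \<open>p\<close> of the test as continuation. The
  bound \<open>2 \<le> p\<close> keeps the code away from state 1, in which every machine stands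
  still.\<close>

lemma compile_correct:
  assumes "exec c s n s'" "bounded_com c N G" "code_at tab p (compile c p e)" "2 <= p" "length io = 2"
  shows "(tm_step (table_tm K G' tab) ^^ n) (p, io @ store_tapes N s) = (e, io @ store_tapes N s')"
  using assms
proof (induction arbitrary: p e rule: exec.induct)
  case (Push r a s)
  let ?M = "table_tm K G' tab" and ?h = "snd (stack_tape (s r))" and ?t = "fst (stack_tape (s r))"
  from Push have tab: "p + 1 < length tab" "tab ! p = (r + 2, \<lambda>b. (p + 1, b, 1))"
      "tab ! (p + 1) = (r + 2, \<lambda>b. (e, Suc a, 0))" and r: "r < N" by (simp_all add: code_at_Cons)
  have nth: "(io @ ts) ! Suc (Suc r) = ts ! r" for ts using Push.prems by (simp add: nth_append)
  have upd: "(io @ ts)[Suc (Suc r) := x] = io @ ts[r := x]" for ts x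
    using Push.prems by (simp add: list_update_append)
  have 1: "tm_step ?M (p, io @ store_tapes N s) =
      (p + 1, io @ (store_tapes N s)[r := (?t, ?h + 1)])"
    using table_tm_step[of p tab "r + 2" _ "io @ store_tapes N s" ?t ?h "p + 1" "?t ?h" 1 K G'] tab r Push.prems
    by (simp add: nth upd)
  have 2: "tm_step ?M (p + 1, io @ (store_tapes N s)[r := (?t, ?h + 1)]) =
      (e, io @ store_tapes N (s(r := a # s r)))"
    using table_tm_step[of "p + 1" tab "r + 2" _ "io @ (store_tapes N s)[r := (?t, ?h + 1)]" ?t "?h + 1"
        e "Suc a" 0 K G'] tab r Push.prems store_tapes_update[OF r, of s "a # s r"]
    by (simp add: nth upd stack_tape_Cons)
  show ?case using 1 2 by (simp add: numeral_2_eq_2 fun_upd_def)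
next
  case (Pop r s)
  then have "tm_step (table_tm K G' tab) (p, io @ store_tapes N s) = (e, io @ store_tapes N (s(r := tl (s r))))"
    by (intro table_tm_step_reg[where d = "if s r = [] then 0 else -1" and a = 0
          and F = "\<lambda>b. (e, 0, if b = 0 then 0 else -1)"])
      (auto simp: code_at_Cons stack_tape_tl stack_tape_read_0)
  then show ?case by (simp add: fun_upd_def)
next
  case (Seq c s m s' d n s'') then have "(tm_step (table_tm K G' tab) ^^ m) (p, io @ store_tapes N s) =
      (p + com_size c, io @ store_tapes N s')" by (simp add: code_at_append)
  moreover have "(tm_step (table_tm K G' tab) ^^ n) (p + com_size c, io @ store_tapes N s') =
      (e, io @ store_tapes N s'')" using Seq by (simp add: code_at_append)
  ultimately show ?case by (simp add: add.commute[of m n] funpow_add)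
next
  case (CondT P s r c n s' d)
  then have "tm_step (table_tm K G' tab) (p, io @ store_tapes N s) = (p + 1, io @ store_tapes N s)"
    by (subst table_tm_step_test) (auto simp: code_at_Cons)
  then show ?case using CondT by (simp add: funpow_Suc_right code_at_Cons code_at_append del: funpow.simps)
next
  case (CondF P s r d n s' c) then have "tm_step (table_tm K G' tab) (p, io @ store_tapes N s) =
      (p + 1 + com_size c, io @ store_tapes N s)" by (subst table_tm_step_test) (auto simp: code_at_Cons)
  then show ?case using CondF by (simp add: funpow_Suc_right code_at_Cons code_at_append del: funpow.simps)
next
  case (LoopF P s r c)
  then have "tm_step (table_tm K G' tab) (p, io @ store_tapes N s) = (e, io @ store_tapes N s)"
    by (subst table_tm_step_test) (auto simp: code_at_Cons)
  then show ?case by simp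
next
  case (LoopT P s r c m s' n s'')
  then have "tm_step (table_tm K G' tab) (p, io @ store_tapes N s) = (p + 1, io @ store_tapes N s)"
    by (subst table_tm_step_test) (auto simp: code_at_Cons)
  moreover have "(tm_step (table_tm K G' tab) ^^ m) (p + 1, io @ store_tapes N s) =
      (p, io @ store_tapes N s')" using LoopT by (simp add: code_at_Cons)
  moreover have "(tm_step (table_tm K G' tab) ^^ n) (p, io @ store_tapes N s') =
      (e, io @ store_tapes N s'')" using LoopT by simp
  ultimately show ?case by (simp add: funpow_Suc_right add.commute[of m n] funpow_add del: funpow.simps)
qed

lemma tm_step_halted: "fst c = 1 ==> tm_step M c = c" by (cases c) (simp add: tm_step_def)

lemma tm_steps_halted: "fst c = 1 ==> (tm_step M ^^ n) c = c" by (induction n) (simp_all add: tm_step_halted)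

subsection \<open>Polynomial bounds\<close>

text \<open>The base \<open>n + 2\<close> is at least 2, so one power absorbs constants and sums.
  The form \<open>n ^ k + k\<close> of the clocks in \<open>polytime\<close> and
  \<open>class_NP\<close> is recovered by \<open>poly_bounded_iff\<close>.\<close>

definition poly_bounded :: "(nat => nat) => bool" where
  "poly_bounded b \<longleftrightarrow> (\<exists>k. \<forall>n. b n <= (n + 2) ^ k)"

text \<open>For \<open>n \<le> 1\<close> the left side is at most \<open>3 ^ k\<close>, which the
  additive term covers. For \<open>n \<ge> 2\<close> one has \<open>n + 2 \<le> n ^ 2\<close>, and
  the exponent \<open>2 * k\<close> suffices.\<close>

lemma power_add2_le: "(n + 2) ^ k <= n ^ (3 ^ k + 2 * k) + (3 ^ k + 2 * k)" for n k :: nat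
proof (cases "n <= 1")
  case True then have "(n + 2) ^ k <= 3 ^ k" by (intro power_mono) auto
  then show ?thesis by simp
next
  case False then have "2 * n <= n * n" by (intro mult_right_mono) auto
  with False have "n + 2 <= n ^ 2" unfolding power2_eq_square by linarith
  then have "(n + 2) ^ k <= (n ^ 2) ^ k" by (intro power_mono) auto
  also have "\<dots> = n ^ (2 * k)" by (simp add: power_mult)
  also have "\<dots> <= n ^ (3 ^ k + 2 * k)" using False by (intro power_increasing) auto
  finally show ?thesis by simp
qed

lemma poly_bounded_iff: "poly_bounded b \<longleftrightarrow> (\<exists>k. \<forall>n. b n <= n ^ k + k)"
proof
  assume "poly_bounded b"
  then obtain k where "\<forall>n. b n <= (n + 2) ^ k" by (auto simp: poly_bounded_def)
  then show "\<exists>k. \<forall>n. b n <= n ^ k + k"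
    using power_add2_le[of _ k] by (intro exI[of _ "3 ^ k + 2 * k"]) (blast intro: le_trans)
next
  assume "\<exists>k. \<forall>n. b n <= n ^ k + k"
  then obtain k where k: "\<forall>n. b n <= n ^ k + k" by auto
  have "n ^ k + k <= (n + 2) ^ (k + 1)" for n
  proof -
    have "k <= 2 ^ k" by (rule less_imp_le) (rule less_exp)
    also have "(2::nat) ^ k <= (n + 2) ^ k" by (intro power_mono) auto
    finally have "k <= (n + 2) ^ k" .
    moreover have "n ^ k <= (n + 2) ^ k" by (intro power_mono) auto
    ultimately have "n ^ k + k <= 2 * (n + 2) ^ k" by linarith
    also have "\<dots> <= (n + 2) * (n + 2) ^ k" by (intro mult_right_mono) auto
    finally show ?thesis by simp
  qed
  then show "poly_bounded b"
    unfolding poly_bounded_def using k by (blast intro: le_trans)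
qed

lemma poly_bounded_mono: "poly_bounded b ==> (\<And>n. a n <= b n) ==> poly_bounded a"
  unfolding poly_bounded_def by (blast intro: le_trans)

lemma poly_bounded_const: "poly_bounded (\<lambda>_. c)"
  unfolding poly_bounded_iff by (intro exI[of _ c]) simp

lemma poly_bounded_id: "poly_bounded (\<lambda>n. n)"
  unfolding poly_bounded_def by (intro exI[of _ 1]) simp

lemma poly_bounded_add:
  assumes "poly_bounded a" "poly_bounded b"
  shows "poly_bounded (\<lambda>n. a n + b n)"
proof -
  obtain k l where kl: "\<forall>n. a n <= (n + 2) ^ k" "\<forall>n. b n <= (n + 2) ^ l"
    using assms by (auto simp: poly_bounded_def)
  have "a n + b n <= (n + 2) ^ (k + l + 1)" for n
  proof -
    have "(n + 2) ^ k <= (n + 2) ^ (k + l)" "(n + 2) ^ l <= (n + 2) ^ (k + l)"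
      by (intro power_increasing; simp)+
    with kl have "a n + b n <= 2 * (n + 2) ^ (k + l)" by (smt (verit) add_mono le_trans mult_2)
    also have "\<dots> <= (n + 2) * (n + 2) ^ (k + l)" by (intro mult_right_mono) auto
    finally show ?thesis by simp
  qed
  then show ?thesis unfolding poly_bounded_def by blast
qed

lemma poly_bounded_mult:
  assumes "poly_bounded a" "poly_bounded b"
  shows "poly_bounded (\<lambda>n. a n * b n)"
proof -
  obtain k l where kl: "\<forall>n. a n <= (n + 2) ^ k" "\<forall>n. b n <= (n + 2) ^ l"
    using assms by (auto simp: poly_bounded_def)
  then have "a n * b n <= (n + 2) ^ (k + l)" for n
    unfolding power_add by (intro mult_mono) auto
  then show ?thesis unfolding poly_bounded_def by blast
qed

lemma poly_bounded_power: "poly_bounded a ==> poly_bounded (\<lambda>n. a n ^ k)"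
  by (induction k) (auto intro: poly_bounded_const poly_bounded_mult)

lemma poly_bounded_comp:
  assumes "poly_bounded a" "poly_bounded b"
  shows "poly_bounded (\<lambda>n. a (b n))"
proof -
  obtain k where k: "\<And>n. a n <= (n + 2) ^ k" using assms(1) by (auto simp: poly_bounded_def)
  have "poly_bounded (\<lambda>n. (b n + 2) ^ k)"
    by (intro poly_bounded_power poly_bounded_add poly_bounded_const assms)
  then show ?thesis by (rule poly_bounded_mono) (rule k)
qed

lemmas poly_bounded_intros = poly_bounded_const poly_bounded_id poly_bounded_add poly_bounded_mult
  poly_bounded_power

lemma poly_bounded_ex_mono:
  assumes "poly_bounded b"
  obtains b' where "poly_bounded b'" "mono b'" "\<And>n. b n <= b' n"
proof -
  obtain k where k: "\<And>n. b n <= (n + 2) ^ k" using assms by (auto simp: poly_bounded_def)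
  show ?thesis
  proof (rule that[of "\<lambda>n. (n + 2) ^ k"])
    show "poly_bounded (\<lambda>n. (n + 2) ^ k)" by (intro poly_bounded_intros)
    show "mono (\<lambda>n::nat. (n + 2) ^ k)" by (auto intro!: monoI power_mono)
  qed (rule k)
qed

subsection \<open>Stack programs run in polynomial time on a Turing machine\<close>

lemma exec_length: "exec c s n s' ==> length (s' r) <= length (s r) + n" by (induction rule: exec.induct) auto

text \<open>State 0 scans the input and branches to the two pushes at 2 and 4, which return to it.
  State 1 halts, and its entry only fills the table. States 6 and 7 write an output bit, the program
  occupies the states from 8 on, and the last state unloads register 1 onto the output tape. There
  the test is \<open>b = 2\<close>, since the bit symbol 1 is stored as 2.\<close>

definition stack_table :: "com => instr list" where
  "stack_table c =
     [(0, \<lambda>a. if a = 1 then (2, a, 1) else if a = 2 then (4, a, 1) else (8, a, 0)), (0, \<lambda>a. (1, a, 0))] @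
     compile (Push 2 1) 2 0 @ compile (Push 2 2) 4 0 @
     [(1, \<lambda>_. (8 + com_size c, 1, 1)), (1, \<lambda>_. (8 + com_size c, 2, 1))] @
     compile c 8 (8 + com_size c) @
     [(3, \<lambda>b. if b = 0 then (1, 0, 0) else if b = 2 then (6, 0, -1) else (7, 0, -1))]"

lemma stack_table_at:
  "code_at (stack_table c) 0
     [(0, \<lambda>a. if a = 1 then (2, a, 1) else if a = 2 then (4, a, 1) else (8, a, 0)), (0, \<lambda>a. (1, a, 0))]"
  "code_at (stack_table c) 2 (compile (Push 2 1) 2 0)"
  "code_at (stack_table c) 4 (compile (Push 2 2) 4 0)"
  "code_at (stack_table c) 6 [(1, \<lambda>_. (8 + com_size c, 1, 1)), (1, \<lambda>_. (8 + com_size c, 2, 1))]"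
  "code_at (stack_table c) 8 (compile c 8 (8 + com_size c))"
  "code_at (stack_table c) (8 + com_size c)
     [(3, \<lambda>b. if b = 0 then (1, 0, 0) else if b = 2 then (6, 0, -1) else (7, 0, -1))]"
proof -
  define tab where "tab = stack_table c"
  have "code_at tab 0 (
     [(0, \<lambda>a. if a = 1 then (2, a, 1) else if a = 2 then (4, a, 1) else (8, a, 0)), (0, \<lambda>a. (1, a, 0))] @
     compile (Push 2 1) 2 0 @ compile (Push 2 2) 4 0 @
     [(1, \<lambda>_. (8 + com_size c, 1, 1)), (1, \<lambda>_. (8 + com_size c, 2, 1))] @
     compile c 8 (8 + com_size c) @
     [(3, \<lambda>b. if b = 0 then (1, 0, 0) else if b = 2 then (6, 0, -1) else (7, 0, -1))])"
    unfolding code_at_def by (rule exI[of _ "[]"], rule exI[of _ "[]"]) (simp add: tab_def stack_table_def)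
  then have all: "code_at (stack_table c) 0
     [(0, \<lambda>a. if a = 1 then (2, a, 1) else if a = 2 then (4, a, 1) else (8, a, 0)), (0, \<lambda>a. (1, a, 0))] &
     code_at (stack_table c) 2 (compile (Push 2 1) 2 0) &
     code_at (stack_table c) 4 (compile (Push 2 2) 4 0) &
     code_at (stack_table c) 6 [(1, \<lambda>_. (8 + com_size c, 1, 1)), (1, \<lambda>_. (8 + com_size c, 2, 1))] &
     code_at (stack_table c) 8 (compile c 8 (8 + com_size c)) &
     code_at (stack_table c) (8 + com_size c)
     [(3, \<lambda>b. if b = 0 then (1, 0, 0) else if b = 2 then (6, 0, -1) else (7, 0, -1))]"
    unfolding tab_def[symmetric] code_at_append by (simp del: compile.simps add: numeral_eq_Suc)
  show
  "code_at (stack_table c) 0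
     [(0, \<lambda>a. if a = 1 then (2, a, 1) else if a = 2 then (4, a, 1) else (8, a, 0)), (0, \<lambda>a. (1, a, 0))]"
  "code_at (stack_table c) 2 (compile (Push 2 1) 2 0)"
  "code_at (stack_table c) 4 (compile (Push 2 2) 4 0)"
  "code_at (stack_table c) 6 [(1, \<lambda>_. (8 + com_size c, 1, 1)), (1, \<lambda>_. (8 + com_size c, 2, 1))]"
  "code_at (stack_table c) 8 (compile c 8 (8 + com_size c))"
  "code_at (stack_table c) (8 + com_size c)
     [(3, \<lambda>b. if b = 0 then (1, 0, 0) else if b = 2 then (6, 0, -1) else (7, 0, -1))]"
    using all by blast+
qed

definition bits :: "bool list => nat list" where
  "bits x = map bit_sym x"

lemma bits_simps [simp]: "bits [] = []" "bits (b # x) = bit_sym b # bits x"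
  "bits (x @ y) = bits x @ bits y" "length (bits x) = length x" "bits (rev x) = rev (bits x)"
  by (simp_all add: bits_def rev_map)

definition input_tape :: "bool list => int => nat" where
  "input_tape x = (\<lambda>i. if 0 <= i & i < int (length x) then bit_sym (x ! nat i) else 0)"

lemma stack_prologue:
  assumes "3 <= N" "i <= length x"
  shows "(tm_step (table_tm K G (stack_table c)) ^^ (3 * i))
     (0, [(input_tape x, 0), blank] @ store_tapes N (\<lambda>_. [])) =
     (0, [(input_tape x, int i), blank] @ store_tapes N ((\<lambda>_. [])(2 := rev (bits (take i x)))))"
  using assms(2)
proof (induction i)
  case 0 then show ?case by (simp add: fun_upd_def)
next
  case (Suc i)
  let ?M = "table_tm K G (stack_table c)" and ?s = "((\<lambda>_. []) :: store)(2 := rev (bits (take i x)))"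
  define b where "b = x ! i"
  have b: "input_tape x (int i) = bit_sym b" and take: "take (Suc i) x = take i x @ [b]"
    using Suc.prems by (auto simp: input_tape_def b_def take_Suc_conv_app_nth)
  have "tm_step ?M (0, [(input_tape x, int i), blank] @ store_tapes N ?s) =
     (if b then 4 else 2, [(input_tape x, int (Suc i)), blank] @ store_tapes N ?s)"
    using table_tm_step[of 0 "stack_table c" 0 _ "[(input_tape x, int i), blank] @ store_tapes N ?s"
        "input_tape x" "int i" "if b then 4 else 2" "bit_sym b" 1 K G] stack_table_at(1)[of c] b
    by (auto simp: code_at_Cons bit_sym_def fun_upd_idem add.commute)
  moreover have "(tm_step ?M ^^ 2) (if b then 4 else 2, [(input_tape x, int (Suc i)), blank] @ store_tapes N ?s) =
     (0, [(input_tape x, int (Suc i)), blank] @ store_tapes N (?s(2 := bit_sym b # ?s 2)))"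
  proof (cases b)
    case True show ?thesis
      using compile_correct[OF exec.Push[of 2 2 ?s], of N 3 "stack_table c" 4 0
          "[(input_tape x, int (Suc i)), blank]" K G] stack_table_at(3)[of c] assms(1) True
      by (simp add: bit_sym_def)
  next
    case False show ?thesis
      using compile_correct[OF exec.Push[of 2 1 ?s], of N 3 "stack_table c" 2 0
          "[(input_tape x, int (Suc i)), blank]" K G] stack_table_at(2)[of c] assms(1) False
      by (simp add: bit_sym_def)
  qed
  moreover have "?s(2 := bit_sym b # ?s 2) = (\<lambda>_. [])(2 := rev (bits (take (Suc i) x)))" by (simp add: take)
  moreover have "3 * Suc i = 2 + Suc (3 * i)" by simp
  ultimately show ?case
    using Suc by (simp only: funpow_add funpow.simps o_apply Suc_leD)
qed

lemma stack_epilogue: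
  assumes "2 <= N" "s 1 = bits y"
  shows "\<exists>tps. (tm_step (table_tm K G (stack_table c)) ^^ (2 * length y + 1))
     (8 + com_size c, [tin, (t, h)] @ store_tapes N s) =
     (1, [tin, (\<lambda>i. if h <= i & i < h + int (length y) then bit_sym (y ! nat (i - h)) else t i,
        h + int (length y))] @ tps)"
  using assms(2)
proof (induction y arbitrary: s t h)
  case Nil
  let ?M = "table_tm K G (stack_table c)"
  have "tm_step ?M (8 + com_size c, [tin, (t, h)] @ store_tapes N s) =
      (1, [tin, (t, h)] @ store_tapes N (s(1 := s 1)))"
    using stack_table_at(6)[of c] assms(1) Nil by (intro table_tm_step_reg[where d = 0 and a = 0
          and F = "\<lambda>b. if b = 0 then (1, 0, 0) else if b = 2 then (6, 0, -1) else (7, 0, -1)"])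
      (auto simp: code_at_Cons stack_tape_read_0[THEN iffD2] stack_tape_Nil)
  then show ?case by auto
next
  case (Cons b y)
  let ?M = "table_tm K G (stack_table c)" and ?s = "s(1 := bits y)"
  let ?t = "t(h := bit_sym b)"
  have "fst (stack_tape (s 1)) (snd (stack_tape (s 1))) = Suc (bit_sym b)"
    using Cons.prems by (simp add: stack_tape_Cons)
  then have 1: "tm_step ?M (8 + com_size c, [tin, (t, h)] @ store_tapes N s) =
      (if b then 7 else 6, [tin, (t, h)] @ store_tapes N ?s)"
    using stack_table_at(6)[of c] assms(1) Cons.prems stack_tape_tl[of "s 1"]
    by (intro table_tm_step_reg[where d = "-1" and a = 0
          and F = "\<lambda>b. if b = 0 then (1, 0, 0) else if b = 2 then (6, 0, -1) else (7, 0, -1)"])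
      (auto simp: code_at_Cons bit_sym_def)
  have 2: "tm_step ?M (if b then 7 else 6, [tin, (t, h)] @ store_tapes N ?s) =
      (8 + com_size c, [tin, (?t, h + 1)] @ store_tapes N ?s)"
    using table_tm_step[of "if b then 7 else 6" "stack_table c" 1 _ "[tin, (t, h)] @ store_tapes N ?s"
        t h "8 + com_size c" "bit_sym b" 1 K G] stack_table_at(4)[of c] by (auto simp: code_at_Cons bit_sym_def)
  have "?s 1 = bits y" by simp
  from Cons.IH[of ?s ?t "h + 1", OF this] obtain tps where 3: "(tm_step ?M ^^ (2 * length y + 1))
     (8 + com_size c, [tin, (?t, h + 1)] @ store_tapes N ?s) =
     (1, [tin, (\<lambda>i. if h + 1 <= i & i < h + 1 + int (length y) then bit_sym (y ! nat (i - (h + 1))) else ?t i,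
        h + 1 + int (length y))] @ tps)" by blast
  have "(\<lambda>i. if h + 1 <= i & i < h + 1 + int (length y) then bit_sym (y ! nat (i - (h + 1))) else ?t i) =
     (\<lambda>i. if h <= i & i < h + int (length (b # y)) then bit_sym ((b # y) ! nat (i - h)) else t i)"
  proof
    fix i
    have "h < i ==> nat (i - h) = Suc (nat (i - (h + 1)))" by linarith
    then show "(if h + 1 <= i & i < h + 1 + int (length y) then bit_sym (y ! nat (i - (h + 1))) else ?t i) =
      (if h <= i & i < h + int (length (b # y)) then bit_sym ((b # y) ! nat (i - h)) else t i)" by auto
  qed
  moreover have "2 * length (b # y) + 1 = (2 * length y + 1) + Suc (Suc 0)" by simp
  ultimately show ?case
    using 1 2 3 by (intro exI[of _ tps]) (simp only: funpow_add funpow.simps o_apply id_apply, simp)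
qed

text \<open>The scan leaves the input reversed in register 2. The result is no longer than the
  running time of the program, as every push costs time; this bounds the epilogue by
  \<open>2 * b n + 1\<close>. Running on to the clock \<open>n ^ k + k\<close> changes nothing,
  because a halted configuration is a fixed point.\<close>

theorem stack_polytime:
  assumes b: "poly_bounded b"
    and c: "\<And>x. \<exists>n s. exec c ((\<lambda>_. [])(2 := rev (bits x))) n s & n <= b (length x) & s 1 = bits (f x)"
  shows "polytime f"
proof -
  obtain N0 G0 where "bounded_com c N0 G0" using ex_bounded_com by blast
  define N G where "N = max 3 N0" and "G = max 3 G0"
  have NG: "bounded_com c N G" "3 <= N" "3 <= G"
    unfolding N_def G_def using bounded_com_mono[OF \<open>bounded_com c N0 G0\<close>] by auto
  define M where "M = table_tm (N + 2) (Suc G) (stack_table c)"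
  have len: "length (stack_table c) = 9 + com_size c" by (simp add: stack_table_def)
  have "\<forall>i \<in> set (stack_table c). instr_ok (N + 2) (length (stack_table c)) (Suc G) i"
    using compile_ok[OF NG(1), of 8 "9 + com_size c" "8 + com_size c"] NG(2,3)
    unfolding len by (auto simp: stack_table_def instr_ok_def)
  then have wf: "wf_tm M" unfolding M_def using NG len by (intro wf_table_tm) auto
  have "poly_bounded (\<lambda>n. 3 * n + 1 + b n + (2 * b n + 1))" by (intro poly_bounded_intros b)
  then obtain k where k: "\<And>n. 3 * n + 1 + b n + (2 * b n + 1) <= n ^ k + k"
    unfolding poly_bounded_iff by blast
  have "tm_output ((tm_step M ^^ (length x ^ k + k)) (tm_init M x)) (f x)" for x
  proof -
    obtain n s where ns: "exec c ((\<lambda>_. [])(2 := rev (bits x))) n s" "n <= b (length x)" "s 1 = bits (f x)"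
      using c by blast
    let ?z = "((\<lambda>_. 0), 0) :: tape"
    have "store_tapes N (\<lambda>_. []) = replicate N ?z"
      by (simp add: store_tapes_def stack_tape_Nil map_replicate_const)
    then have init: "tm_init M x = (0, [(input_tape x, 0), ?z] @ store_tapes N (\<lambda>_. []))"
      unfolding tm_init_def input_tape_def by (simp add: M_def table_tm_def)
    let ?s = "((\<lambda>_. []) :: store)(2 := rev (bits x))"
    have 1: "(tm_step M ^^ (3 * length x)) (tm_init M x) =
        (0, [(input_tape x, int (length x)), ?z] @ store_tapes N ?s)"
      unfolding M_def init[unfolded M_def] using stack_prologue[OF NG(2) le_refl, of x "N + 2" "Suc G" c ?z] by simp
    have 2: "tm_step M (0, [(input_tape x, int (length x)), ?z] @ store_tapes N ?s) =
        (8, [(input_tape x, int (length x)), ?z] @ store_tapes N ?s)"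
      unfolding M_def
      using table_tm_step[of 0 "stack_table c" 0 _ "[(input_tape x, int (length x)), ?z] @ store_tapes N ?s"
        "input_tape x" "int (length x)" 8 0 0 "N + 2" "Suc G"] stack_table_at(1)[of c]
      by (auto simp: code_at_Cons input_tape_def fun_upd_idem)
    have 3: "(tm_step M ^^ n) (8, [(input_tape x, int (length x)), ?z] @ store_tapes N ?s) =
        (8 + com_size c, [(input_tape x, int (length x)), ?z] @ store_tapes N s)"
      unfolding M_def using compile_correct[OF ns(1) NG(1) stack_table_at(5),
          of "[(input_tape x, int (length x)), ?z]" "N + 2" "Suc G"] by simp
    define m where "m = 2 * length (f x) + 1"
    obtain tps where 4: "(tm_step M ^^ m)
        (8 + com_size c, [(input_tape x, int (length x)), ?z] @ store_tapes N s) =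
        (1, [(input_tape x, int (length x)),
          (\<lambda>i. if 0 <= i & i < 0 + int (length (f x)) then bit_sym (f x ! nat (i - 0)) else 0,
        0 + int (length (f x)))] @ tps)" (is "_ = ?C")
      unfolding M_def m_def using stack_epilogue[where N = N and s = s and y = "f x" and K = "N + 2" and G = "Suc G"
          and c = c and tin = "(input_tape x, int (length x))" and t = "\<lambda>_. 0" and h = 0] ns(3) NG(2) by auto
    let ?t = "m + (n + Suc (3 * length x))"
    have C: "(tm_step M ^^ ?t) (tm_init M x) = ?C" by (simp only: funpow_add funpow.simps o_apply 1 2 3 4)
    have "length (f x) <= n"
      using exec_length[OF ns(1), of 1] ns(3) by simp
    then have "?t <= length x ^ k + k"
      using k[of "length x"] ns(2) unfolding m_def by linarith
    then obtain j where "length x ^ k + k = j + ?t" by (metis le_iff_add add.commute)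
    then have "(tm_step M ^^ (length x ^ k + k)) (tm_init M x) = ?C"
      using C tm_steps_halted[of ?C j M] by (simp only: funpow_add o_apply fst_conv)
    then show ?thesis by (simp add: tm_output_def)
  qed
  with wf show ?thesis unfolding polytime_def by blast
qed

subsection \<open>Programming with stacks\<close>

text \<open>Exact step counts were needed for the machine simulation; from here on upper bounds are
  enough and easier to compose.\<close>

definition runs :: "com => store => nat => store => bool" where
  "runs c s T s' \<longleftrightarrow> (\<exists>n\<le>T. exec c s n s')"

lemma runs_mono: "runs c s T s' ==> T <= T' ==> runs c s T' s'" by (auto simp: runs_def intro: order.trans)

lemma runs_Push: "s' = s(r := a # s r) ==> runs (Push r a) s 2 s'"
  unfolding runs_def using exec.Push by auto

lemma runs_Pop: "s' = s(r := tl (s r)) ==> runs (Pop r) s 1 s'"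
  unfolding runs_def using exec.Pop by auto

lemma runs_Seq: "runs c s T s' ==> runs d s' T' s'' ==> runs (c ;; d) s (T + T') s''"
  unfolding runs_def by (meson add_mono exec.Seq)

lemma runs_Cond: "runs (if P (topmost (s r)) then c else d) s T s' ==> runs (Cond r P c d) s (Suc T) s'"
  unfolding runs_def by (auto split: if_splits) (meson CondT CondF Suc_le_mono)+

lemma runs_LoopF: "~ P (topmost (s r)) ==> 1 <= T ==> runs (Loop r P c) s T s"
  unfolding runs_def using exec.LoopF by blast

lemma runs_LoopT: "P (topmost (s r)) ==> runs c s T s' ==> runs (Loop r P c) s' T' s'' ==>
    runs (Loop r P c) s (Suc (T + T')) s''"
  unfolding runs_def by (meson LoopT Suc_le_mono add_mono)

lemma runs_length: "runs c s T s' ==> length (s' r) <= length (s r) + T"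
  unfolding runs_def using exec_length by (meson add_left_mono order.trans)

lemma runs_Loop_iterate:
  assumes "\<And>i. i < k ==> P (topmost (S i r)) & runs c (S i) T (S (Suc i))"
    and "~ P (topmost (S k r))"
  shows "runs (Loop r P c) (S 0) (k * Suc T + 1) (S k)"
  using assms
proof (induction k arbitrary: S)
  case 0 then show ?case by (simp add: runs_LoopF)
next
  case (Suc k)
  have "runs (Loop r P c) (S (Suc 0)) (k * Suc T + 1) (S (Suc k))"
    by (rule Suc.IH[of "\<lambda>i. S (Suc i)"]) (use Suc.prems in auto)
  with Suc.prems(1)[of 0] have "runs (Loop r P c) (S 0) (Suc (T + (k * Suc T + 1))) (S (Suc k))"
    by (intro runs_LoopT) auto
  then show ?case by (rule runs_mono) simp
qed

definition skip :: com where
  "skip = Push 0 0 ;; Pop 0"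

lemma runs_skip: "runs skip s 3 s"
proof -
  have "runs (Push 0 0 ;; Pop 0) s (2 + 1) s" by (rule runs_Seq, rule runs_Push, rule refl, rule runs_Pop) simp
  then show ?thesis by (simp add: skip_def)
qed

definition nonempty :: "nat option => bool" where
  "nonempty t \<longleftrightarrow> t ~= None"

lemma nonempty_simps [simp]: "~ nonempty None" "nonempty (Some a)" by (simp_all add: nonempty_def)

lemma nonempty_topmost [simp]: "nonempty (topmost xs) \<longleftrightarrow> xs ~= []" by (cases xs) (auto simp: nonempty_def)

text \<open>A transfer between stacks reverses the word, which is why transfers come in pairs below
  and why waiting registers hold reversed words.\<close>

definition move_bits :: "nat => nat => com" where
  "move_bits r r' = Loop r nonempty
     (Cond r (\<lambda>t. t = Some 2) (Pop r ;; Push r' 2) (Pop r ;; Push r' 1))"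

lemma runs_move_bits:
  assumes "r ~= r'" "s r = bits x"
  shows "runs (move_bits r r') s (5 * length x + 1) (s(r := [], r' := rev (bits x) @ s r'))"
  using assms(2)
proof (induction x arbitrary: s)
  case Nil then have "s(r := [], r' := rev (bits []) @ s r') = s" by auto
  moreover have "runs (Loop r nonempty c) s (k * length ([]::bool list) + 1) s" for c k
    by (rule runs_LoopF) (use Nil in auto)
  ultimately show ?case unfolding move_bits_def by presburger
next
  case (Cons b x)
  let ?s = "s(r := bits x, r' := bit_sym b # s r')"
  have "runs (Pop r ;; Push r' a) s (1 + 2) (s(r := bits x, r' := a # s r'))" for a
    by (rule runs_Seq, rule runs_Pop, rule refl, rule runs_Push) (use Cons.prems assms(1) in auto)
  then have "runs (if (\<lambda>t. t = Some 2) (topmost (s r)) then Pop r ;; Push r' 2 else Pop r ;; Push r' 1)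
      s (1 + 2) ?s"
    using Cons.prems by (auto simp: bit_sym_def simp del: One_nat_def)
  from runs_Cond[of "\<lambda>t. t = Some 2", OF this]
  have 1: "runs (Cond r (\<lambda>t. t = Some 2) (Pop r ;; Push r' 2) (Pop r ;; Push r' 1)) s 4 ?s"
    by (rule runs_mono) simp
  have 2: "runs (move_bits r r') ?s (5 * length x + 1) (?s(r := [], r' := rev (bits x) @ ?s r'))"
    by (rule Cons.IH) (use assms in simp)
  have 3: "?s(r := [], r' := rev (bits x) @ ?s r') = s(r := [], r' := rev (bits (b # x)) @ s r')"
    using assms(1) by auto
  show ?case
    using runs_LoopT[of nonempty s r _ 4 ?s, OF _ 1 2[unfolded move_bits_def 3]] Cons.prems
    unfolding move_bits_def by (simp add: fun_upd_def)
qed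

definition copy_bits :: "nat => nat => nat => com" where
  "copy_bits r u v = Loop r nonempty
     (Cond r (\<lambda>t. t = Some 2) (Pop r ;; Push u 2 ;; Push v 2) (Pop r ;; Push u 1 ;; Push v 1))"

lemma runs_copy_bits:
  assumes "r ~= u" "r ~= v" "u ~= v" "s r = bits x"
  shows "runs (copy_bits r u v) s (7 * length x + 1)
    (s(r := [], u := rev (bits x) @ s u, v := rev (bits x) @ s v))"
  using assms(4)
proof (induction x arbitrary: s)
  case Nil then have "s(r := [], u := rev (bits []) @ s u, v := rev (bits []) @ s v) = s" by auto
  moreover have "runs (Loop r nonempty c) s (k * length ([]::bool list) + 1) s" for c k
    by (rule runs_LoopF) (use Nil in auto)
  ultimately show ?case unfolding copy_bits_def by presburger
next
  case (Cons b x)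
  let ?s = "s(r := bits x, u := bit_sym b # s u, v := bit_sym b # s v)"
  let ?c = "Pop r ;; Push u 2 ;; Push v 2" and ?d = "Pop r ;; Push u 1 ;; Push v 1"
  have "runs (Pop r ;; Push u a ;; Push v a) s (1 + (2 + 2)) (s(r := bits x, u := a # s u, v := a # s v))" for a
    by (rule runs_Seq, rule runs_Pop, rule refl, rule runs_Seq, rule runs_Push, rule refl, rule runs_Push)
      (use Cons.prems assms(1-3) in auto)
  then have "runs (if (\<lambda>t. t = Some 2) (topmost (s r)) then ?c else ?d) s (1 + (2 + 2)) ?s"
    using Cons.prems by (auto simp: bit_sym_def simp del: One_nat_def)
  from runs_Cond[of "\<lambda>t. t = Some 2", OF this]
  have 1: "runs (Cond r (\<lambda>t. t = Some 2) ?c ?d) s 6 ?s" by (rule runs_mono) simp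
  have 2: "runs (copy_bits r u v) ?s (7 * length x + 1)
      (?s(r := [], u := rev (bits x) @ ?s u, v := rev (bits x) @ ?s v))" by (rule Cons.IH) (use assms in simp)
  have 3: "?s(r := [], u := rev (bits x) @ ?s u, v := rev (bits x) @ ?s v) =
      s(r := [], u := rev (bits (b # x)) @ s u, v := rev (bits (b # x)) @ s v)"
    using assms(1-3) by auto
  show ?case
    using runs_LoopT[of nonempty s r _ 6 ?s, OF _ 1 2[unfolded copy_bits_def 3]] Cons.prems
    unfolding copy_bits_def by (simp add: fun_upd_def)
qed

definition clear :: "nat => com" where
  "clear r = Loop r nonempty (Pop r)"

lemma runs_clear: "runs (clear r) s (2 * length (s r) + 1) (s(r := []))"
proof (induction "s r" arbitrary: s)
  case Nil then have "s(r := []) = s" by auto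
  then show ?case unfolding clear_def using runs_LoopF[of nonempty s r "2 * length (s r) + 1" "Pop r"] Nil
    by (metis nonempty_topmost le_add2)
next
  case (Cons a xs)
  let ?s = "s(r := xs)"
  have 1: "runs (Pop r) s 1 ?s" by (rule runs_Pop) (use Cons(2) in \<open>simp flip: Cons(2)\<close>)
  have 2: "runs (clear r) ?s (2 * length xs + 1) (s(r := []))" using Cons(1)[of ?s] by simp
  show ?case
    using runs_LoopT[of nonempty s r _ 1 ?s, OF _ 1 2[unfolded clear_def]]
    unfolding clear_def by (simp flip: Cons(2))
qed

primrec clears :: "nat list => com" where
  "clears [] = skip"
| "clears (r # rs) = clear r ;; clears rs"

lemma runs_clears:
  assumes "\<And>r. length (s r) <= m"
  shows "runs (clears rs) s (length rs * (2 * m + 1) + 3) (\<lambda>r. if r \<in> set rs then [] else s r)"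
  using assms
proof (induction rs arbitrary: s)
  case Nil then show ?case using runs_skip by simp
next
  case (Cons r rs)
  have 1: "runs (clear r) s (2 * m + 1) (s(r := []))"
    using runs_clear[of r s] Cons.prems[of r] by (auto elim: runs_mono)
  have "runs (clears rs) (s(r := [])) (length rs * (2 * m + 1) + 3)
     (\<lambda>r'. if r' \<in> set rs then [] else (s(r := [])) r')" by (rule Cons.IH) (use Cons.prems in simp)
  note 2 = runs_Seq[OF 1 this]
  have "(\<lambda>r'. if r' \<in> set rs then [] else (s(r := [])) r') =
      (\<lambda>r'. if r' \<in> set (r # rs) then [] else s r')" by auto
  with 2 show ?case by (auto elim!: runs_mono)
qed

lemma exec_untouched: "exec c s n s' ==> bounded_com c N G ==> N <= r ==> s' r = s r"
  by (induction rule: exec.induct) auto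

text \<open>The basis for subroutines: a program that only touches registers below \<open>N\<close>
  behaves the same inside a larger store, so other data can wait in the registers from
  \<open>N\<close> on while it runs.\<close>

lemma exec_frame:
  assumes "exec c s n s'" "bounded_com c N G" "\<And>r. r < N ==> u r = s r"
  shows "exec c u n (\<lambda>r. if r < N then s' r else u r)"
  using assms
proof (induction arbitrary: u rule: exec.induct)
  case (Push r a s) then have "(\<lambda>r'. if r' < N then (s(r := a # s r)) r' else u r') = u(r := a # u r)" by auto
  then show ?case using exec.Push[of r a u] by simp
next
  case (Pop r s) then have "(\<lambda>r'. if r' < N then (s(r := tl (s r))) r' else u r') = u(r := tl (u r))" by auto
  then show ?case using exec.Pop[of r u] by simp
next
  case (Seq c s m s' d n s'')
  have "exec c u m (\<lambda>r. if r < N then s' r else u r)" using Seq by simp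
  moreover have "exec d (\<lambda>r. if r < N then s' r else u r) n
      (\<lambda>r. if r < N then s'' r else (if r < N then s' r else u r))" by (rule Seq.IH(2)) (use Seq in auto)
  ultimately have "exec (c ;; d) u (m + n) (\<lambda>r. if r < N then s'' r else (if r < N then s' r else u r))"
    by (rule exec.Seq)
  then show ?case by (simp cong: if_cong)
next
  case (LoopF P s r c) then have "(\<lambda>r. if r < N then s r else u r) = u" by auto
  then show ?case using LoopF exec.LoopF[of P u r c] by simp
next
  case (LoopT P s r c m s' n s'')
  have "exec c u m (\<lambda>r. if r < N then s' r else u r)" using LoopT by simp
  moreover have "exec (Loop r P c) (\<lambda>r. if r < N then s' r else u r) n
      (\<lambda>r. if r < N then s'' r else (if r < N then s' r else u r))" by (rule LoopT.IH(2)) (use LoopT in auto)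
  ultimately have "exec (Loop r P c) u (Suc (m + n)) (\<lambda>r. if r < N then s'' r else (if r < N then s' r else u r))"
    using LoopT by (intro exec.LoopT) auto
  then show ?case by (simp cong: if_cong)
qed (auto intro: exec.CondT exec.CondF)

definition reg :: "nat => bool list => store" where
  "reg r x = (\<lambda>_. [])(r := bits x)"

lemma reg_apply [simp]: "reg r x r' = (if r' = r then bits x else [])" by (simp add: reg_def)

definition stack_program :: "com => (bool list => bool list) => (nat => nat) => bool" where
  "stack_program c f b \<longleftrightarrow> poly_bounded b & mono b & (\<forall>x. runs c (reg 0 x) (b (length x)) (reg 1 (f x)))"

text \<open>Normal form of programs. By appended clearing loops all registers except 1 end up empty,
  so a program can be followed by another one or be called in every round of a loop. The registers
  from \<open>N\<close> on are empty because they were never touched, and the others are short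
  enough to be cleared in polynomial time.\<close>

lemma stack_programI:
  assumes b: "poly_bounded b"
    and c: "\<And>x. \<exists>s. runs c (reg 0 x) (b (length x)) s & s 1 = bits (f x)"
  shows "\<exists>c b. stack_program c f b"
proof -
  obtain b' where b': "poly_bounded b'" "mono b'" "\<And>n. b n <= b' n"
    using poly_bounded_ex_mono[OF b] by blast
  obtain N G where N: "bounded_com c N G" using ex_bounded_com by blast
  let ?rs = "0 # [2..<N]"
  let ?B = "\<lambda>n. b' n + (length ?rs * (2 * (n + b' n) + 1) + 3)"
  have "poly_bounded ?B" by (intro poly_bounded_intros b')
  moreover have "mono ?B"
    using b'(2) by (auto intro!: monoI add_mono mult_mono simp: monoD)
  moreover have "runs (c ;; clears ?rs) (reg 0 x) (?B (length x)) (reg 1 (f x))" for x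
  proof -
    obtain s where s: "runs c (reg 0 x) (b' (length x)) s" "s 1 = bits (f x)"
      using c[of x] b'(3)[of "length x"] runs_mono by blast
    have "length (s r) <= length x + b' (length x)" for r
      using runs_length[OF s(1), of r] by (cases "r = 0") auto
    note * = runs_Seq[OF s(1) runs_clears[OF this, of ?rs]]
    have "(\<lambda>r. if r \<in> set ?rs then [] else s r) = reg 1 (f x)"
    proof
      fix r
      have "N <= r ==> r ~= 0 ==> s r = []"
        using s(1) exec_untouched[OF _ N] unfolding runs_def by fastforce
      then show "(if r \<in> set ?rs then [] else s r) = reg 1 (f x) r"
        using s(2) by (cases "r = 1") auto
    qed
    with * show ?thesis by simp
  qed
  ultimately show ?thesis unfolding stack_program_def by blast
qed

lemma stack_program_polytime: "stack_program c f b ==> polytime f"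
proof -
  assume c: "stack_program c f b"
  then have c: "poly_bounded b" "\<And>x. runs c (reg 0 x) (b (length x)) (reg 1 (f x))"
    by (auto simp: stack_program_def)
  show ?thesis
  proof (rule stack_polytime[of "\<lambda>n. 5 * n + 1 + b n" "move_bits 2 0 ;; c"])
    show "poly_bounded (\<lambda>n. 5 * n + 1 + b n)" by (intro poly_bounded_intros c)
    fix x
    have "runs (move_bits 2 0) ((\<lambda>_. [])(2 := rev (bits x))) (5 * length x + 1)
       (((\<lambda>_. [])(2 := rev (bits x)))(2 := [], 0 := rev (rev (bits x)) @ []))"
      using runs_move_bits[of 2 0 "(\<lambda>_. [])(2 := rev (bits x))" "rev x"] by simp
    moreover have "((\<lambda>_. [])(2 := rev (bits x)))(2 := [], 0 := rev (rev (bits x)) @ []) = reg 0 x"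
      by (auto simp: reg_def)
    ultimately have "runs (move_bits 2 0 ;; c) ((\<lambda>_. [])(2 := rev (bits x))) (5 * length x + 1 + b (length x))
        (reg 1 (f x))" using c(2) runs_Seq by metis
    then show "\<exists>n s. exec (move_bits 2 0 ;; c) ((\<lambda>_. [])(2 := rev (bits x))) n s &
        n <= 5 * length x + 1 + b (length x) & s 1 = bits (f x)"
      unfolding runs_def by (metis reg_apply)
  qed
qed

lemma runs_call:
  assumes c: "stack_program c f b" and N: "bounded_com c N G" "2 <= N"
    and u: "u 0 = bits x" "\<And>r. 0 < r ==> r < N ==> u r = []"
  shows "runs c u (b (length x)) (u(0 := [], 1 := bits (f x)))"
proof -
  obtain n where n: "n <= b (length x)" "exec c (reg 0 x) n (reg 1 (f x))"
    using c by (auto simp: stack_program_def runs_def)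
  have "exec c u n (\<lambda>r. if r < N then reg 1 (f x) r else u r)"
    by (rule exec_frame[OF n(2) N(1)]) (use u in auto)
  moreover have "(\<lambda>r. if r < N then reg 1 (f x) r else u r) = u(0 := [], 1 := bits (f x))"
    using u N(2) by (auto simp: fun_eq_iff)
  ultimately show ?thesis using n(1) unfolding runs_def by auto
qed

lemma stack_program_length: "stack_program c f b ==> length (f x) <= length x + b (length x)"
  using runs_length[of c "reg 0 x" "b (length x)" "reg 1 (f x)" 1] by (auto simp: stack_program_def)

subsection \<open>Simulating Turing machines by stack programs\<close>

text \<open>Reading past the end yields the blank, so a finite stack represents half of a tape that
  is blank from some cell on.\<close>

definition sym_at :: "nat list => nat => nat" where
  "sym_at xs i = (if i < length xs then xs ! i else 0)"

lemma sym_at_Cons: "sym_at (a # xs) i = (case i of 0 => a | Suc j => sym_at xs j)"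
  by (auto simp: sym_at_def split: nat.split)

lemma sym_at_tl: "sym_at (tl xs) i = sym_at xs (Suc i)" by (cases xs) (auto simp: sym_at_def)

lemma sym_at_0: "sym_at xs 0 = (case topmost xs of None => 0 | Some a => a)"
  by (cases xs) (auto simp: sym_at_def)

text \<open>Branches on the top symbol, the empty stack counting as the blank.\<close>

primrec switch :: "nat => nat => (nat => com) => com" where
  "switch r 0 k = k 0"
| "switch r (Suc v) k = Cond r (\<lambda>t. t = Some (Suc v)) (k (Suc v)) (switch r v k)"

lemma runs_switch:
  assumes "runs (k (sym_at (s r) 0)) s T s'" "sym_at (s r) 0 <= m"
  shows "runs (switch r m k) s (T + m) s'"
  using assms(2)
proof (induction m)
  case 0 then show ?case using assms(1) by simp
next
  case (Suc v) show ?case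
  proof (cases "sym_at (s r) 0 = Suc v")
    case True then have "topmost (s r) = Some (Suc v)" by (auto simp: sym_at_0 split: option.splits)
    then have "runs (switch r (Suc v) k) s (Suc T) s'"
      using assms(1) True by (auto intro!: runs_Cond)
    then show ?thesis by (rule runs_mono) simp
  next
    case False then have "topmost (s r) ~= Some (Suc v)" by (auto simp: sym_at_0 split: option.splits)
    then show ?thesis using Suc False by (auto intro!: runs_Cond)
  qed
qed

primrec switch_all :: "nat => nat list => (nat list => com) => nat list => com" where
  "switch_all m [] k acc = k acc"
| "switch_all m (r # rs) k acc = switch r m (\<lambda>v. switch_all m rs k (acc @ [v]))"

lemma runs_switch_all:
  assumes "runs (k (acc @ map (\<lambda>r. sym_at (s r) 0) rs)) s T s'" "\<And>r. r \<in> set rs ==> sym_at (s r) 0 <= m"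
  shows "runs (switch_all m rs k acc) s (T + length rs * m) s'"
  using assms
proof (induction rs arbitrary: acc)
  case (Cons r rs)
  have "runs (switch_all m rs k (acc @ [sym_at (s r) 0])) s (T + length rs * m) s'"
    by (rule Cons.IH) (use Cons.prems in auto)
  then have "runs (switch r m (\<lambda>v. switch_all m rs k (acc @ [v]))) s (T + length rs * m + m) s'"
    by (rule runs_switch) (use Cons.prems in auto)
  then show ?case by (simp add: add_ac)
qed simp

text \<open>The symbol of cell 0 is marked by adding \<open>G\<close>, so that the head can find it again.\<close>

definition marked :: "nat => (int => nat) => int => nat" where
  "marked G t p = t p + (if p = 0 then G else 0)"

definition two_stacks :: "nat => tape => nat list => nat list => bool" where
  "two_stacks G tp l r \<longleftrightarrow> (\<forall>i. sym_at l i = marked G (fst tp) (snd tp - 1 - int i)) &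
     (\<forall>i. sym_at r i = marked G (fst tp) (snd tp + int i))"

definition left_reg :: "nat => nat" where "left_reg j = 4 + 2 * j"
definition right_reg :: "nat => nat" where "right_reg j = 5 + 2 * j"

lemma tape_reg_simps [simp]:
  "left_reg i = left_reg j \<longleftrightarrow> i = j" "right_reg i = right_reg j \<longleftrightarrow> i = j"
  "left_reg i ~= right_reg j" "right_reg j ~= left_reg i"
  "left_reg i ~= 0" "left_reg i ~= 1" "left_reg i ~= 2" "left_reg i ~= 3"
  "right_reg i ~= 0" "right_reg i ~= 1" "right_reg i ~= 2" "right_reg i ~= 3"
  "left_reg i ~= Suc 0" "right_reg i ~= Suc 0" "Suc 0 ~= left_reg i" "Suc 0 ~= right_reg i"
  unfolding left_reg_def right_reg_def by presburger+

text \<open>\<open>v\<close> is the scanned symbol with its possible mark, which the new symbol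
  inherits. A left move also transfers the top of the left stack, so that the cell under the head is
  on top of the right stack again.\<close>

definition tape_act :: "nat => nat => nat => nat \<times> int => com" where
  "tape_act G j v act = (let w = fst act + (if G <= v then G else 0) in
     Pop (right_reg j) ;;
     (if snd act = 1 then Push (left_reg j) w
      else if snd act = -1 then Push (right_reg j) w ;;
        switch (left_reg j) (2 * G) (\<lambda>u. Pop (left_reg j) ;; Push (right_reg j) u)
      else Push (right_reg j) w))"

lemma runs_tape_act:
  assumes st: "two_stacks G (t, h) (s (left_reg j)) (s (right_reg j))"
    and t: "\<And>i. t i < G" and d: "d \<in> {-1, 0, 1}"
  shows "\<exists>l r. two_stacks G (t(h := a), h + d) l r &
    runs (tape_act G j (sym_at (s (right_reg j)) 0) (a, d)) s (6 + 2 * G) (s(left_reg j := l, right_reg j := r))"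
proof -
  let ?l = "s (left_reg j)" and ?r = "s (right_reg j)"
  let ?v = "sym_at ?r 0"
  define w where "w = a + (if G <= ?v then G else 0)"
  have v: "?v = marked G t h" using st by (auto simp: two_stacks_def)
  have w: "w = marked G (t(h := a)) h"
    using t[of h] unfolding w_def v marked_def by auto
  have l: "sym_at ?l i = marked G t (h - 1 - int i)" and r: "sym_at ?r i = marked G t (h + int i)" for i
    using st by (auto simp: two_stacks_def)
  have pop: "runs (Pop (right_reg j)) s 1 (s(right_reg j := tl ?r))" by (rule runs_Pop) simp
  have w0: "Push i (fst (a, d) + (if G <= ?v then G else 0)) = Push i w" for i by (simp add: w_def)
  consider "d = 1" | "d = 0" | "d = -1" using d by auto
  then show ?thesis
  proof cases
    case 1
    have "runs (tape_act G j ?v (a, d)) s (1 + 2) (s(left_reg j := w # ?l, right_reg j := tl ?r))"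
      unfolding tape_act_def Let_def w0 using 1
      by (simp only: snd_conv if_True refl simp_thms, intro runs_Seq[OF pop] runs_Push) auto
    then have "runs (tape_act G j ?v (a, d)) s (6 + 2 * G) (s(left_reg j := w # ?l, right_reg j := tl ?r))"
      by (rule runs_mono) simp
    moreover have "two_stacks G (t(h := a), h + d) (w # ?l) (tl ?r)"
      using 1 w by (auto simp: two_stacks_def sym_at_Cons sym_at_tl l r marked_def algebra_simps split: nat.split)
    ultimately show ?thesis by blast
  next
    case 2
    have push: "runs (Push (right_reg j) w) (s(right_reg j := tl ?r)) 2 (s(right_reg j := w # tl ?r))"
      by (rule runs_Push) auto
    have "runs (tape_act G j ?v (a, d)) s (1 + 2) (s(left_reg j := ?l, right_reg j := w # tl ?r))"
      unfolding tape_act_def Let_def w0 using 2 runs_Seq[OF pop push] by simp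
    then have "runs (tape_act G j ?v (a, d)) s (6 + 2 * G) (s(left_reg j := ?l, right_reg j := w # tl ?r))"
      by (rule runs_mono) simp
    moreover have "two_stacks G (t(h := a), h + d) ?l (w # tl ?r)"
      using 2 w by (auto simp: two_stacks_def sym_at_Cons sym_at_tl l r marked_def algebra_simps split: nat.split)
    ultimately show ?thesis by blast
  next
    case 3
    define u where "u = sym_at ?l 0"
    have u: "u = marked G t (h - 1)" using l[of 0] by (simp add: u_def)
    have "u <= 2 * G" using t[of "h - 1"] by (auto simp: u marked_def)
    let ?s = "s(right_reg j := w # tl ?r)"
    let ?s' = "s(left_reg j := tl ?l, right_reg j := u # w # tl ?r)"
    have 1: "runs (Push (right_reg j) w) (s(right_reg j := tl ?r)) 2 ?s" by (rule runs_Push) auto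
    have "runs (Pop (left_reg j) ;; Push (right_reg j) u) ?s (1 + 2) ?s'"
      by (rule runs_Seq, rule runs_Pop, rule refl, rule runs_Push) auto
    then have 2: "runs (switch (left_reg j) (2 * G) (\<lambda>u. Pop (left_reg j) ;; Push (right_reg j) u)) ?s (1 + 2 + 2 * G) ?s'"
      by (intro runs_switch) (use \<open>u <= 2 * G\<close> in \<open>simp_all add: u_def\<close>)
    have "runs (tape_act G j ?v (a, d)) s (1 + (2 + (1 + 2 + 2 * G))) ?s'"
      unfolding tape_act_def Let_def w0 using 3 runs_Seq[OF pop runs_Seq[OF 1 2]] by simp
    then have "runs (tape_act G j ?v (a, d)) s (6 + 2 * G) ?s'" by (rule runs_mono) simp
    moreover have "two_stacks G (t(h := a), h + d) (tl ?l) (u # w # tl ?r)"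
    proof -
      have "sym_at (tl ?l) i = marked G (t(h := a)) (h + d - 1 - int i)" for i
        using 3 by (simp add: sym_at_tl l marked_def algebra_simps)
      moreover have "sym_at (u # w # tl ?r) i = marked G (t(h := a)) (h + d + int i)" for i
      proof (cases i)
        case 0 then show ?thesis using 3 u by (simp add: sym_at_Cons marked_def)
      next
        case (Suc k) show ?thesis
          using 3 w Suc by (cases k) (simp_all add: sym_at_Cons sym_at_tl r marked_def algebra_simps)
      qed
      ultimately show ?thesis by (simp add: two_stacks_def)
    qed
    ultimately show ?thesis by blast
  qed
qed

primrec tape_acts :: "nat => nat => nat list => (nat \<times> int) list => com" where
  "tape_acts G 0 vs acts = skip"
| "tape_acts G (Suc j) vs acts = tape_acts G j vs acts ;; tape_act G j (vs ! j) (acts ! j)"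

definition represents :: "nat => tape list => store => bool" where
  "represents G tps s \<longleftrightarrow>
     (\<forall>j < length tps. two_stacks G (tps ! j) (s (left_reg j)) (s (right_reg j)))"

lemma runs_tape_acts:
  assumes rep: "represents G tps s" and t: "\<forall>j < length tps. \<forall>i. fst (tps ! j) i < G"
    and acts: "length acts = length tps" "\<forall>(a, d) \<in> set acts. a < G & d \<in> {-1, 0, 1}"
    and k: "k <= length tps"
    and vs: "\<forall>j < length tps. vs ! j = sym_at (s (right_reg j)) 0"
  shows "\<exists>s'. runs (tape_acts G k vs acts) s (k * (6 + 2 * G) + 3) s' &
     (\<forall>j < k. two_stacks G (map2 (\<lambda>(t, h) (s, d). (t(h := s), h + d)) tps acts ! j)
        (s' (left_reg j)) (s' (right_reg j))) &
     (\<forall>r. (\<forall>j < k. r ~= left_reg j & r ~= right_reg j) --> s' r = s r)"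
  using k
proof (induction k)
  case 0 then show ?case using runs_skip by auto
next
  case (Suc k) then have "k <= length tps" by simp
  from Suc.IH[OF this] obtain s' where s': "runs (tape_acts G k vs acts) s (k * (6 + 2 * G) + 3) s'"
     "\<forall>j < k. two_stacks G (map2 (\<lambda>(t, h) (s, d). (t(h := s), h + d)) tps acts ! j)
        (s' (left_reg j)) (s' (right_reg j))"
     "\<forall>r. (\<forall>j < k. r ~= left_reg j & r ~= right_reg j) --> s' r = s r" by blast
  obtain t h where th: "tps ! k = (t, h)" by fastforce
  obtain a d where ad: "acts ! k = (a, d)" by fastforce
  have k: "k < length tps" using Suc by simp
  have "(a, d) \<in> set acts" using ad k acts(1) by (metis nth_mem)
  then have ad': "a < G" "d \<in> {-1, 0, 1}" using acts(2) by auto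
  have same: "s' (left_reg k) = s (left_reg k)" "s' (right_reg k) = s (right_reg k)"
    using s'(3) by auto
  have "two_stacks G (t, h) (s' (left_reg k)) (s' (right_reg k))"
    using rep k th same by (auto simp: represents_def)
  moreover have "\<And>i. t i < G" using t k th by force
  ultimately obtain l r where lr: "two_stacks G (t(h := a), h + d) l r"
    "runs (tape_act G k (sym_at (s' (right_reg k)) 0) (a, d)) s' (6 + 2 * G)
       (s'(left_reg k := l, right_reg k := r))"
    using runs_tape_act[of G t h s' k d a] ad' by blast
  have "vs ! k = sym_at (s' (right_reg k)) 0" using vs k same by simp
  then have "runs (tape_acts G (Suc k) vs acts) s (k * (6 + 2 * G) + 3 + (6 + 2 * G))
       (s'(left_reg k := l, right_reg k := r))"
    using runs_Seq[OF s'(1) lr(2)] ad by simp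
  then have "runs (tape_acts G (Suc k) vs acts) s (Suc k * (6 + 2 * G) + 3)
       (s'(left_reg k := l, right_reg k := r))" by (rule runs_mono) simp
  moreover have "two_stacks G (map2 (\<lambda>(t, h) (s, d). (t(h := s), h + d)) tps acts ! j)
        ((s'(left_reg k := l, right_reg k := r)) (left_reg j))
        ((s'(left_reg k := l, right_reg k := r)) (right_reg j))" if "j < Suc k" for j
    using that s'(2) lr(1) th ad k acts(1) by (cases "j = k") auto
  moreover have "(s'(left_reg k := l, right_reg k := r)) i = s i"
    if "\<forall>j < Suc k. i ~= left_reg j & i ~= right_reg j" for i
    using that s'(3) by auto
  ultimately show ?case by blast
qed

text \<open>The transition table is unfolded into a decision tree: first the state, kept in register
  2, then the symbol under each head. In a leaf all of these are constants, so the leaf is a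
  straight-line update of the stacks.\<close>

definition tm_step_com :: "tm => com" where
  "tm_step_com M = (let G = tm_symbols M; K = tm_tapes M in
     switch 2 (tm_states M) (\<lambda>q. switch_all (2 * G) (map right_reg [0..<K]) (\<lambda>vs.
       let (q', acts) = tm_delta M q (map (\<lambda>v. if G <= v then v - G else v) vs)
       in Pop 2 ;; Push 2 q' ;; tape_acts G K vs acts) []))"

definition tm_wf_config :: "tm => config => bool" where
  "tm_wf_config M c \<longleftrightarrow> fst c < tm_states M & length (snd c) = tm_tapes M &
     (\<forall>j < tm_tapes M. \<forall>i. fst (snd c ! j) i < tm_symbols M)"

lemma tm_wf_delta:
  assumes M: "wf_tm M" and c: "tm_wf_config M (q, tps)"
    and D: "tm_delta M q (map (\<lambda>(t, h). t h) tps) = (q', acts)"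
  shows "q' < tm_states M" "length acts = tm_tapes M"
    "\<forall>(a, d) \<in> set acts. a < tm_symbols M & d \<in> {-1, 0, 1}"
proof -
  have "\<forall>r \<in> set (map (\<lambda>(t, h). t h) tps). r < tm_symbols M"
    using c by (fastforce simp: tm_wf_config_def in_set_conv_nth)
  moreover have "q < tm_states M" "length tps = tm_tapes M" using c by (auto simp: tm_wf_config_def)
  ultimately have "case tm_delta M q (map (\<lambda>(t, h). t h) tps) of (q', acts) =>
       q' < tm_states M & length acts = tm_tapes M &
       (\<forall>(s, d)\<in>set acts. s < tm_symbols M & d \<in> {- 1, 0, 1})"
    using M unfolding wf_tm_def by (metis (no_types, lifting) length_map)
  then show "q' < tm_states M" "length acts = tm_tapes M"
    "\<forall>(a, d) \<in> set acts. a < tm_symbols M & d \<in> {-1, 0, 1}"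
    using D by auto
qed

lemma tm_wf_step:
  assumes M: "wf_tm M" and c: "tm_wf_config M c"
  shows "tm_wf_config M (tm_step M c)"
proof -
  obtain q tps where qt: "c = (q, tps)" by fastforce
  obtain q' acts where D: "tm_delta M q (map (\<lambda>(t, h). t h) tps) = (q', acts)" by fastforce
  note w = tm_wf_delta[OF M c[unfolded qt] D]
  have len: "length tps = tm_tapes M" using c qt by (simp add: tm_wf_config_def)
  show ?thesis
  proof (cases "q = 1")
    case False
    have "fst (map2 (\<lambda>(t, h) (s, d). (t(h := s), h + d)) tps acts ! j) i < tm_symbols M"
      if j: "j < tm_tapes M" for i j
    proof -
      obtain t h where th: "tps ! j = (t, h)" by fastforce
      obtain a d where ad: "acts ! j = (a, d)" by fastforce
      have "(a, d) \<in> set acts" using ad j w(2) by (metis nth_mem)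
      then have "a < tm_symbols M" using w(3) by auto
      moreover have "\<And>i. t i < tm_symbols M" using c qt j th by (force simp: tm_wf_config_def)
      ultimately show ?thesis using th ad j len w(2) by simp
    qed
    then show ?thesis using False qt D w len by (simp add: tm_wf_config_def tm_step_def)
  qed (use c qt in \<open>simp add: tm_step_def\<close>)
qed

lemma tm_wf_init: "wf_tm M ==> tm_wf_config M (tm_init M x)"
  unfolding tm_wf_config_def tm_init_def wf_tm_def by (auto simp: nth_Cons bit_sym_def split: nat.split)

lemma tm_wf_steps: "wf_tm M ==> tm_wf_config M c ==> tm_wf_config M ((tm_step M ^^ n) c)"
  by (induction n) (auto intro: tm_wf_step)

lemma runs_tm_step_com:
  assumes M: "wf_tm M" and c: "tm_wf_config M (q, tps)" "q ~= 1"
    and s: "s 2 = [q]" "represents (tm_symbols M) tps s"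
    and T: "T = 3 + tm_tapes M * (6 + 2 * tm_symbols M) + 3 + tm_tapes M * (2 * tm_symbols M) + tm_states M"
  shows "\<exists>s'. runs (tm_step_com M) s T s' & s' 2 = [fst (tm_step M (q, tps))] &
    represents (tm_symbols M) (snd (tm_step M (q, tps))) s' & s' 0 = s 0 & s' 1 = s 1 & s' 3 = s 3"
proof -
  let ?G = "tm_symbols M" and ?K = "tm_tapes M"
  obtain q' acts where D: "tm_delta M q (map (\<lambda>(t, h). t h) tps) = (q', acts)" by fastforce
  note w = tm_wf_delta[OF M c(1) D]
  have len: "length tps = ?K" and tG: "\<forall>j < length tps. \<forall>i. fst (tps ! j) i < ?G"
    and q: "q < tm_states M" using c by (auto simp: tm_wf_config_def)
  define vs where "vs = map (\<lambda>r. sym_at (s r) 0) (map right_reg [0..<?K])"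
  have vs: "vs ! j = marked ?G (fst (tps ! j)) (snd (tps ! j))" if "j < ?K" for j
    using s(2) that len by (auto simp: vs_def represents_def two_stacks_def)
  have rd: "map (\<lambda>v. if ?G <= v then v - ?G else v) vs = map (\<lambda>(t, h). t h) tps"
  proof (rule nth_equalityI)
    fix j assume "j < length (map (\<lambda>v. if ?G <= v then v - ?G else v) vs)"
    then have j: "j < ?K" by (simp add: vs_def)
    then have "fst (tps ! j) (snd (tps ! j)) < ?G" using tG len by simp
    then show "map (\<lambda>v. if ?G <= v then v - ?G else v) vs ! j = map (\<lambda>(t, h). t h) tps ! j"
      using j vs[OF j] len by (auto simp: vs_def marked_def split: prod.split)
  qed (simp add: vs_def len)
  let ?s = "s(2 := [q'])"
  have "represents ?G tps ?s" using s(2) by (simp add: represents_def)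
  moreover have "\<forall>j < length tps. vs ! j = sym_at (?s (right_reg j)) 0" using len by (simp add: vs_def)
  ultimately obtain s' where s': "runs (tape_acts ?G ?K vs acts) ?s (?K * (6 + 2 * ?G) + 3) s'"
     "\<forall>j < ?K. two_stacks ?G (map2 (\<lambda>(t, h) (s, d). (t(h := s), h + d)) tps acts ! j)
        (s' (left_reg j)) (s' (right_reg j))"
     "\<forall>r. (\<forall>j < ?K. r ~= left_reg j & r ~= right_reg j) --> s' r = ?s r"
    using runs_tape_acts[of ?G tps ?s acts ?K vs] tG w len by auto
  let ?k = "\<lambda>vs. let (q', acts) = tm_delta M q (map (\<lambda>v. if ?G <= v then v - ?G else v) vs)
       in Pop 2 ;; Push 2 q' ;; tape_acts ?G ?K vs acts"
  have "runs (Pop 2 ;; Push 2 q' ;; tape_acts ?G ?K vs acts) s (1 + (2 + (?K * (6 + 2 * ?G) + 3))) s'"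
    by (rule runs_Seq, rule runs_Pop, rule refl, rule runs_Seq, rule runs_Push, rule refl)
      (use s'(1) s(1) in simp)
  then have "runs (?k ([] @ vs)) s (1 + (2 + (?K * (6 + 2 * ?G) + 3))) s'" by (simp add: rd D)
  then have "runs (switch_all (2 * ?G) (map right_reg [0..<?K]) ?k []) s
      (1 + (2 + (?K * (6 + 2 * ?G) + 3)) + length (map right_reg [0..<?K]) * (2 * ?G)) s'"
  proof (intro runs_switch_all, simp only: vs_def)
    fix r assume "r \<in> set (map right_reg [0..<?K])"
    then obtain j where j: "j < ?K" "r = right_reg j" by auto
    then show "sym_at (s r) 0 <= 2 * ?G"
      using vs[OF j(1)] tG len by (simp add: vs_def marked_def) (metis less_imp_le mult_2 add_le_mono1 trans_le_add1)
  qed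
  then have "runs (switch_all (2 * ?G) (map right_reg [0..<?K]) ?k []) s
      (1 + (2 + (?K * (6 + 2 * ?G) + 3)) + ?K * (2 * ?G)) s'" by simp
  then have "runs (tm_step_com M) s (1 + (2 + (?K * (6 + 2 * ?G) + 3)) + ?K * (2 * ?G) + tm_states M) s'"
    unfolding tm_step_com_def Let_def by (intro runs_switch) (use s(1) q in \<open>simp_all add: sym_at_def\<close>)
  then have "runs (tm_step_com M) s T s'" by (rule runs_mono) (simp add: T)
  moreover have "tm_step M (q, tps) = (q', map2 (\<lambda>(t, h) (s, d). (t(h := s), h + d)) tps acts)"
    using c(2) D by (simp add: tm_step_def)
  ultimately show ?thesis
    using s'(2,3) w(2) len by (intro exI[of _ s']) (simp add: represents_def)
qed

text \<open>The loop may stop before round \<open>n\<close>, namely as soon as the state is 1; the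
  remaining machine steps leave a halted configuration as it is.\<close>

lemma runs_tm_loop:
  assumes M: "wf_tm M"
    and T: "T = 3 + tm_tapes M * (6 + 2 * tm_symbols M) + 3 + tm_tapes M * (2 * tm_symbols M) + tm_states M"
    and "tm_wf_config M c" "s 2 = [fst c]" "represents (tm_symbols M) (snd c) s"
    and "fst ((tm_step M ^^ n) c) = 1"
  shows "\<exists>s'. runs (Loop 2 (\<lambda>t. t ~= Some 1) (tm_step_com M)) s (n * Suc T + 1) s' &
    represents (tm_symbols M) (snd ((tm_step M ^^ n) c)) s' & s' 0 = s 0 & s' 1 = s 1"
  using assms(3-6)
proof (induction n arbitrary: c s)
  case 0 then show ?case using runs_LoopF[of "\<lambda>t. t ~= Some 1" s 2 1] by auto
next
  case (Suc n) show ?case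
  proof (cases "fst c = 1")
    case True then have "(tm_step M ^^ Suc n) c = c" by (rule tm_steps_halted)
    moreover have "runs (Loop 2 (\<lambda>t. t ~= Some 1) (tm_step_com M)) s (Suc n * Suc T + 1) s"
      by (rule runs_LoopF) (use True Suc.prems in auto)
    ultimately show ?thesis using Suc.prems by (intro exI[of _ s]) simp
  next
    case False
    obtain q tps where qt: "c = (q, tps)" by fastforce
    obtain s1 where s1: "runs (tm_step_com M) s T s1" "s1 2 = [fst (tm_step M c)]"
      "represents (tm_symbols M) (snd (tm_step M c)) s1" "s1 0 = s 0" "s1 1 = s 1"
      using runs_tm_step_com[OF M _ _ _ _ T, of q tps s] Suc.prems False unfolding qt by auto
    have "(tm_step M ^^ n) (tm_step M c) = (tm_step M ^^ Suc n) c" by (simp only: funpow_Suc_right o_apply)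
    then obtain s2 where s2: "runs (Loop 2 (\<lambda>t. t ~= Some 1) (tm_step_com M)) s1 (n * Suc T + 1) s2"
      "represents (tm_symbols M) (snd ((tm_step M ^^ Suc n) c)) s2" "s2 0 = s1 0" "s2 1 = s1 1"
      using Suc.IH[of "tm_step M c" s1] s1 tm_wf_step[OF M Suc.prems(1)] Suc.prems(4) by auto
    have "runs (Loop 2 (\<lambda>t. t ~= Some 1) (tm_step_com M)) s (Suc (T + (n * Suc T + 1))) s2"
      by (rule runs_LoopT[OF _ s1(1) s2(1)]) (use False Suc.prems in auto)
    then have "runs (Loop 2 (\<lambda>t. t ~= Some 1) (tm_step_com M)) s (Suc n * Suc T + 1) s2"
      by (rule runs_mono) simp
    then show ?thesis using s1 s2 by auto
  qed
qed

definition move_while :: "(nat option => bool) => nat => nat => nat => com" where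
  "move_while P r r' m = Loop r P (switch r m (\<lambda>v. Pop r ;; Push r' v))"

lemma runs_move_while:
  assumes "\<forall>a \<in> set (s r). a <= m" "~ P None" "r ~= r'"
  shows "runs (move_while P r r' m) s (length (s r) * (m + 4) + 1)
    (s(r := dropWhile (\<lambda>a. P (Some a)) (s r), r' := rev (takeWhile (\<lambda>a. P (Some a)) (s r)) @ s r'))"
  using assms(1)
proof (induction "s r" arbitrary: s)
  case Nil
  then have "s(r := dropWhile (\<lambda>a. P (Some a)) (s r), r' := rev (takeWhile (\<lambda>a. P (Some a)) (s r)) @ s r') = s"
    by (auto simp flip: Nil)
  moreover have "runs (move_while P r r' m) s (length (s r) * (m + 4) + 1) s"
    unfolding move_while_def by (rule runs_LoopF) (use assms(2) Nil in \<open>auto simp flip: Nil\<close>)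
  ultimately show ?case by presburger
next
  case (Cons a xs)
  let ?p = "\<lambda>a. P (Some a)"
  show ?case
  proof (cases "P (Some a)")
    case False then have "s(r := dropWhile ?p (s r), r' := rev (takeWhile ?p (s r)) @ s r') = s"
      by (auto simp flip: Cons(2))
    moreover have "runs (move_while P r r' m) s (length (s r) * (m + 4) + 1) s"
      unfolding move_while_def by (rule runs_LoopF) (use False in \<open>auto simp flip: Cons(2)\<close>)
    ultimately show ?thesis by presburger
  next
    case True
    let ?s = "s(r := xs, r' := a # s r')"
    have "runs (Pop r ;; Push r' a) s (1 + 2) ?s" by (rule runs_Seq, rule runs_Pop, rule refl, rule runs_Push)
        (use assms(3) in \<open>auto simp flip: Cons(2)\<close>)
    then have 1: "runs (switch r m (\<lambda>v. Pop r ;; Push r' v)) s (1 + 2 + m) ?s"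
      by (intro runs_switch) (use Cons.prems in \<open>auto simp: sym_at_0 simp flip: Cons(2)\<close>)
    have 2: "runs (move_while P r r' m) ?s (length xs * (m + 4) + 1)
        (?s(r := dropWhile ?p xs, r' := rev (takeWhile ?p xs) @ ?s r'))"
      using Cons(1)[of ?s] Cons.prems assms(3) by (simp flip: Cons(2))
    have 3: "?s(r := dropWhile ?p xs, r' := rev (takeWhile ?p xs) @ ?s r') =
        s(r := dropWhile ?p (s r), r' := rev (takeWhile ?p (s r)) @ s r')"
      using True assms(3) by (auto simp flip: Cons(2))
    have "runs (move_while P r r' m) s (Suc ((1 + 2 + m) + (length xs * (m + 4) + 1)))
      (s(r := dropWhile ?p (s r), r' := rev (takeWhile ?p (s r)) @ s r'))"
      unfolding move_while_def
      by (rule runs_LoopT[OF _ 1 2[unfolded move_while_def 3]]) (use True in \<open>simp flip: Cons(2)\<close>)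
    then show ?thesis by (rule runs_mono) (simp flip: Cons(2))
  qed
qed

text \<open>The output starts at cell 0, but the head may be anywhere. Everything is shifted to the
  left stack and then back until the marked symbol of cell 0 shows up. After its mark is removed,
  the right stack reads cells 0, 1, 2, ..., and its longest prefix of bits is the output.\<close>

definition tm_output_com :: "nat => com" where
  "tm_output_com G =
     move_while nonempty (right_reg 1) (left_reg 1) (2 * G) ;;
     move_while (\<lambda>t. case t of None => False | Some v => v < G) (left_reg 1) (right_reg 1) (2 * G) ;;
     switch (left_reg 1) (2 * G) (\<lambda>v. Pop (left_reg 1) ;; Push (right_reg 1) (v - G)) ;;
     move_while (\<lambda>t. t = Some 1 \<or> t = Some 2) (right_reg 1) 0 (2 * G) ;;
     move_bits 0 1"

lemma runs_tm_output_com: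
  assumes two: "two_stacks G (t, h) (s (left_reg 1)) (s (right_reg 1))"
    and t: "\<And>i. t i < G" and s: "s 0 = []" "s 1 = []"
    and y: "\<forall>i < length y. t (int i) = bit_sym (y ! i)" "t (int (length y)) = 0"
    and m: "length (s (left_reg 1)) + length (s (right_reg 1)) <= m"
  shows "\<exists>s'. runs (tm_output_com G) s (3 * (m * (2 * G + 4) + 1) + (3 + 2 * G) + (5 * m + 1)) s' & s' 1 = bits y"
proof -
  let ?L = "left_reg 1" and ?R = "right_reg 1"
  define l r where "l = s ?L" and "r = s ?R"
  have l: "sym_at l i = marked G t (h - 1 - int i)" and r: "sym_at r i = marked G t (h + int i)" for i
    using two by (auto simp: two_stacks_def l_def r_def)
  have G: "0 < G" using t[of 0] by simp
  define X where "X = rev r @ l"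
  have X: "X ! i = marked G t (h + int (length r) - 1 - int i)" if "i < length X" for i
  proof (cases "i < length r")
    case True then have "X ! i = sym_at r (length r - 1 - i)" by (simp add: X_def nth_append rev_nth sym_at_def)
    moreover have "int (length r - 1 - i) = int (length r) - 1 - int i" using True by linarith
    ultimately show ?thesis using r[of "length r - 1 - i"] by (simp add: algebra_simps)
  next
    case False then have "X ! i = sym_at l (i - length r)"
      using that by (simp add: X_def nth_append sym_at_def)
    moreover have "int (i - length r) = int i - int (length r)" using False by linarith
    ultimately show ?thesis using l[of "i - length r"] by (simp add: algebra_simps)
  qed
  \<comment> \<open>A marked symbol is nonzero even over a blank, so cell 0 is really stored in one
    of the two stacks; \<open>k\<close> below is its index in the concatenation
    \<open>X\<close>.\<close>
  have i0: "0 <= h + int (length r) - 1 & h + int (length r) - 1 < int (length X)"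
  proof (cases "h <= 0")
    case True then have "sym_at r (nat (- h)) = marked G t 0" using r[of "nat (- h)"] by simp
    then have "sym_at r (nat (- h)) ~= 0" using G by (simp add: marked_def)
    then have "nat (- h) < length r" by (auto simp: sym_at_def split: if_splits)
    then show ?thesis using True by (simp add: X_def)
  next
    case False then have "sym_at l (nat (h - 1)) = marked G t 0" using l[of "nat (h - 1)"] by simp
    then have "sym_at l (nat (h - 1)) ~= 0" using G by (simp add: marked_def)
    then have "nat (h - 1) < length l" by (auto simp: sym_at_def split: if_splits)
    then show ?thesis using False by (simp add: X_def)
  qed
  define k where "k = nat (h + int (length r) - 1)"
  have k: "k < length X" "int k = h + int (length r) - 1" using i0 by (auto simp: k_def)
  have Xk: "X ! i = marked G t (int k - int i)" if "i < length X" for i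
    using X[OF that] k(2) by simp
  have Xle: "\<forall>a \<in> set X. a <= 2 * G"
  proof
    fix a assume "a \<in> set X"
    then obtain i where "i < length X" "a = X ! i" by (auto simp: in_set_conv_nth)
    then show "a <= 2 * G" using Xk[of i] t[of "int k - int i"] by (auto simp: marked_def)
  qed
  have split: "X = take k X @ X ! k # drop (Suc k) X" using k(1) by (rule id_take_nth_drop)
  let ?p = "\<lambda>v. v < G"
  have small: "\<forall>a \<in> set (take k X). a < G"
  proof
    fix a assume "a \<in> set (take k X)"
    then obtain i where "i < k" "a = X ! i" using k(1) by (auto simp: in_set_conv_nth)
    then show "a < G" using Xk[of i] t[of "int k - int i"] k(1) by (auto simp: marked_def)
  qed
  have big: "X ! k = t 0 + G" using Xk[OF k(1)] by (simp add: marked_def)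
  have tw: "takeWhile ?p X = take k X" by (subst split) (use small big in \<open>simp add: takeWhile_append2\<close>)
  have dw: "dropWhile ?p X = X ! k # drop (Suc k) X"
    by (subst split) (use small big in \<open>simp add: dropWhile_append2\<close>)
  define Z where "Z = t 0 # rev (take k X)"
  have Z: "sym_at Z j = t (int j)" for j
  proof (cases j)
    case 0 then show ?thesis by (simp add: Z_def sym_at_Cons)
  next
    case (Suc i) show ?thesis
    proof (cases "i < k")
      case True then have "sym_at Z j = X ! (k - 1 - i)"
        using k(1) Suc by (simp add: Z_def sym_at_Cons sym_at_def rev_nth)
      also have "\<dots> = marked G t (int k - int (k - 1 - i))" using True k(1) by (intro Xk) simp
      also have "int k - int (k - 1 - i) = int j" using True Suc by linarith
      finally show ?thesis using Suc by (simp add: marked_def)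
    next
      case False then have "sym_at Z j = 0" using k(1) Suc by (simp add: Z_def sym_at_Cons sym_at_def)
      moreover have "sym_at r (nat (int j - h)) = 0"
        using False Suc k(2) by (simp add: sym_at_def)
      then have "marked G t (int j) = 0"
        using r[of "nat (int j - h)"] False Suc k(2) by simp
      ultimately show ?thesis using Suc by (simp add: marked_def)
    qed
  qed
  have lenZ: "length Z <= m" using k(1) m by (simp add: Z_def X_def l_def r_def)
  have lenX: "length X <= m" using m by (simp add: X_def l_def r_def)
  have Zle: "\<forall>a \<in> set Z. a <= 2 * G"
    using Z t by (auto simp: in_set_conv_nth sym_at_def) (metis add_leD1 less_imp_le mult_2 order.trans le_add1)
  \<comment> \<open>Cells beyond the stored part are blank while the symbols of \<open>y\<close> are
    not, so the whole output lies in \<open>Z\<close>.\<close>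
  have leny: "length y <= length Z"
  proof (rule ccontr)
    assume "~ length y <= length Z"
    then have "t (int (length Z)) ~= 0" using y(1) by (simp add: bit_sym_def)
    then show False using Z[of "length Z"] by (simp add: sym_at_def)
  qed
  have "take (length y) Z = bits y"
  proof (rule nth_equalityI)
    fix i assume "i < length (take (length y) Z)"
    then show "take (length y) Z ! i = bits y ! i"
      using Z[of i] y(1) by (auto simp: sym_at_def bits_def)
  qed (use leny in simp)
  then have Zy: "Z = bits y @ drop (length y) Z" by (metis append_take_drop_id)
  let ?q = "\<lambda>a. a = Suc 0 \<or> a = 2"
  have q1: "\<forall>a \<in> set (bits y). ?q a" by (auto simp: bits_def bit_sym_def)
  have q2: "takeWhile ?q (drop (length y) Z) = []"
  proof (cases "drop (length y) Z")
    case (Cons a zs) then have "length y < length Z" by (metis drop_all leI list.distinct(1))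
    then have "a = sym_at Z (length y)" using Cons by (simp add: sym_at_def) (metis hd_drop_conv_nth list.sel(1))
    then show ?thesis using Cons Z[of "length y"] y(2) by simp
  qed simp
  have twZ: "takeWhile ?q Z = bits y" by (subst Zy) (use q1 q2 in \<open>simp add: takeWhile_append2\<close>)
  let ?T = "m * (2 * G + 4) + 1"
  define s1 where "s1 = s(?R := [], ?L := X)"
  have le: "n * (2 * G + 4) + 1 <= ?T" if "n <= m" for n using that by simp
  have eq1: "s(?R := dropWhile (\<lambda>a. nonempty (Some a)) (s ?R),
      ?L := rev (takeWhile (\<lambda>a. nonempty (Some a)) (s ?R)) @ s ?L) = s1"
    by (simp add: s1_def X_def l_def r_def takeWhile_eq_all_conv[THEN iffD2] dropWhile_eq_Nil_conv[THEN iffD2])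
  have "\<forall>a \<in> set (s ?R). a <= 2 * G" using Xle by (simp add: X_def r_def)
  then have "runs (move_while nonempty ?R ?L (2 * G)) s (length (s ?R) * (2 * G + 4) + 1) s1"
    using runs_move_while[of s ?R "2 * G" nonempty ?L] eq1 by simp
  then have 1: "runs (move_while nonempty ?R ?L (2 * G)) s ?T s1" by (rule runs_mono) (rule le, use m in simp)
  define s2 where "s2 = s(?L := X ! k # drop (Suc k) X, ?R := rev (take k X))"
  let ?P = "\<lambda>t. case t of None => False | Some v => v < G"
  have "runs (move_while ?P ?L ?R (2 * G)) s1 (length (s1 ?L) * (2 * G + 4) + 1)
      (s1(?L := dropWhile (\<lambda>a. ?P (Some a)) (s1 ?L), ?R := rev (takeWhile (\<lambda>a. ?P (Some a)) (s1 ?L)) @ s1 ?R))"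
    by (rule runs_move_while) (use Xle in \<open>simp_all add: s1_def\<close>)
  moreover have "s1(?L := dropWhile (\<lambda>a. ?P (Some a)) (s1 ?L), ?R := rev (takeWhile (\<lambda>a. ?P (Some a)) (s1 ?L)) @ s1 ?R) = s2"
    by (auto simp: s1_def s2_def tw dw)
  ultimately have "runs (move_while ?P ?L ?R (2 * G)) s1 (length (s1 ?L) * (2 * G + 4) + 1) s2" by simp
  then have 2: "runs (move_while ?P ?L ?R (2 * G)) s1 ?T s2"
    by (rule runs_mono) (rule le, use lenX in \<open>simp add: s1_def\<close>)
  define s3 where "s3 = s(?L := drop (Suc k) X, ?R := Z)"
  have "runs (Pop ?L ;; Push ?R (X ! k - G)) s2 (1 + 2) s3"
    by (rule runs_Seq, rule runs_Pop, rule refl, rule runs_Push) (auto simp: s2_def s3_def Z_def big)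
  then have 3: "runs (switch ?L (2 * G) (\<lambda>v. Pop ?L ;; Push ?R (v - G))) s2 (1 + 2 + 2 * G) s3"
    by (intro runs_switch) (use Xle k(1) in \<open>simp_all add: s2_def sym_at_Cons\<close>)
  define s4 where "s4 = s(?L := drop (Suc k) X, ?R := dropWhile ?q Z, 0 := rev (bits y))"
  have "runs (move_while (\<lambda>t. t = Some 1 \<or> t = Some 2) ?R 0 (2 * G)) s3 (length (s3 ?R) * (2 * G + 4) + 1)
     (s3(?R := dropWhile ?q (s3 ?R), 0 := rev (takeWhile ?q (s3 ?R)) @ s3 0))"
    using runs_move_while[of s3 ?R "2 * G" "\<lambda>t. t = Some 1 \<or> t = Some 2" 0] Zle by (simp add: s3_def)
  moreover have "s3(?R := dropWhile ?q (s3 ?R), 0 := rev (takeWhile ?q (s3 ?R)) @ s3 0) = s4"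
    using s by (auto simp: s3_def s4_def twZ)
  ultimately have "runs (move_while (\<lambda>t. t = Some 1 \<or> t = Some 2) ?R 0 (2 * G)) s3 (length (s3 ?R) * (2 * G + 4) + 1) s4"
    by simp
  then have 4: "runs (move_while (\<lambda>t. t = Some 1 \<or> t = Some 2) ?R 0 (2 * G)) s3 ?T s4"
    by (rule runs_mono) (rule le, use lenZ in \<open>simp add: s3_def\<close>)
  have "runs (move_bits 0 1) s4 (5 * length (rev y) + 1) (s4(0 := [], 1 := rev (bits (rev y)) @ s4 1))"
    by (rule runs_move_bits) (simp_all add: s4_def)
  moreover have "rev (bits (rev y)) @ s4 1 = bits y" using s by (simp add: s4_def)
  ultimately have "runs (move_bits 0 1) s4 (5 * length (rev y) + 1) (s4(0 := [], 1 := bits y))" by simp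
  then have 5: "runs (move_bits 0 1) s4 (5 * m + 1) (s4(0 := [], 1 := bits y))"
    by (rule runs_mono) (use leny lenZ in simp)
  have "runs (tm_output_com G) s (?T + (?T + (1 + 2 + 2 * G + (?T + (5 * m + 1))))) (s4(0 := [], 1 := bits y))"
    unfolding tm_output_com_def by (intro runs_Seq[OF 1] runs_Seq[OF 2] runs_Seq[OF 3] runs_Seq[OF 4] 5)
  then have "runs (tm_output_com G) s (3 * ?T + (3 + 2 * G) + (5 * m + 1)) (s4(0 := [], 1 := bits y))"
    by (rule runs_mono) simp
  then show ?thesis by auto
qed

primrec mark_tapes :: "nat => nat list => com" where
  "mark_tapes G [] = skip"
| "mark_tapes G (j # js) = Push (right_reg j) G ;; mark_tapes G js"

lemma runs_mark_tapes:
  assumes "distinct js"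
  shows "\<exists>s'. runs (mark_tapes G js) s (2 * length js + 3) s' &
    (\<forall>j \<in> set js. s' (right_reg j) = G # s (right_reg j)) &
    (\<forall>r. (\<forall>j \<in> set js. r ~= right_reg j) --> s' r = s r)"
  using assms
proof (induction js arbitrary: s)
  case Nil then show ?case using runs_skip by auto
next
  case (Cons j js)
  let ?s = "s(right_reg j := G # s (right_reg j))"
  have "distinct js" using Cons.prems by simp
  from Cons.IH[OF this, of ?s] obtain s' where s': "runs (mark_tapes G js) ?s (2 * length js + 3) s'"
    "\<forall>j \<in> set js. s' (right_reg j) = G # ?s (right_reg j)"
    "\<forall>r. (\<forall>j \<in> set js. r ~= right_reg j) --> s' r = ?s r" by blast
  have "runs (mark_tapes G (j # js)) s (2 + (2 * length js + 3)) s'"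
    unfolding mark_tapes.simps by (rule runs_Seq[OF runs_Push[OF refl] s'(1)])
  then have "runs (mark_tapes G (j # js)) s (2 * length (j # js) + 3) s'" by simp
  moreover have "s' (right_reg j) = G # s (right_reg j)"
    using s'(3)[rule_format, of "right_reg j"] Cons.prems by auto
  moreover have "\<forall>i \<in> set js. s' (right_reg i) = G # s (right_reg i)"
    using s'(2) Cons.prems by auto
  moreover have "\<forall>r. (\<forall>i \<in> set (j # js). r ~= right_reg i) --> s' r = s r" using s'(3) by auto
  ultimately show ?case by auto
qed

text \<open>The simulation runs until the machine reaches its halting state, so the clock
  \<open>length x ^ k + k\<close> never has to be computed and only enters the time bound. All
  stacks stay short enough because a stack grows no faster than time passes.\<close>

theorem polytime_stack_program:
  assumes "polytime f"
  shows "\<exists>c b. stack_program c f b"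
proof -
  obtain M k where M: "wf_tm M"
    and out: "\<And>x. tm_output ((tm_step M ^^ (length x ^ k + k)) (tm_init M x)) (f x)"
    using assms unfolding polytime_def by blast
  define G K where "G = tm_symbols M" and "K = tm_tapes M"
  have K: "2 <= K" and G: "3 <= G" using M by (auto simp: wf_tm_def G_def K_def)
  define T where "T = 3 + K * (6 + 2 * G) + 3 + K * (2 * G) + tm_states M"
  define c1 where "c1 = move_bits 0 3 ;; move_bits 3 (right_reg 0) ;;
     switch (right_reg 0) 2 (\<lambda>v. Pop (right_reg 0) ;; Push (right_reg 0) (v + G)) ;;
     mark_tapes G [1..<K] ;; Push 2 0"
  define c2 where "c2 = Loop 2 (\<lambda>t. t ~= Some 1) (tm_step_com M)"
  define b1 b2 b3 where "b1 = (\<lambda>n::nat. (5 * n + 1) + ((5 * n + 1) + ((1 + 2 + 2) + ((2 * (K - 1) + 3) + 2))))"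
    and "b2 = (\<lambda>n::nat. (n ^ k + k) * Suc T + 1)"
    and "b3 = (\<lambda>n::nat. let m = 2 * (n + b1 n + b2 n) in
       3 * (m * (2 * G + 4) + 1) + (3 + 2 * G) + (5 * m + 1))"
  have "\<exists>s. runs (c1 ;; c2 ;; tm_output_com G) (reg 0 x) (b1 (length x) + (b2 (length x) + b3 (length x))) s & s 1 = bits (f x)" for x
  proof -
    let ?R = "right_reg 0"
    have 1: "runs (move_bits 0 3) (reg 0 x) (5 * length x + 1) (reg 3 (rev x))"
    proof -
      have "runs (move_bits 0 3) (reg 0 x) (5 * length x + 1) ((reg 0 x)(0 := [], 3 := rev (bits x) @ reg 0 x 3))"
        by (rule runs_move_bits) auto
      moreover have "(reg 0 x)(0 := [], 3 := rev (bits x) @ reg 0 x 3) = reg 3 (rev x)" by auto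
      ultimately show ?thesis by simp
    qed
    have 2: "runs (move_bits 3 ?R) (reg 3 (rev x)) (5 * length x + 1) (reg ?R x)"
    proof -
      have "runs (move_bits 3 ?R) (reg 3 (rev x)) (5 * length (rev x) + 1)
          ((reg 3 (rev x))(3 := [], ?R := rev (bits (rev x)) @ reg 3 (rev x) ?R))" by (rule runs_move_bits) auto
      moreover have "(reg 3 (rev x))(3 := [], ?R := rev (bits (rev x)) @ reg 3 (rev x) ?R) = reg ?R x" by auto
      ultimately show ?thesis by simp
    qed
    \<comment> \<open>On the empty input this still pushes \<open>G\<close>, the marked blank of
      cell 0.\<close>
    define s1 where "s1 = ((\<lambda>_. []) :: store)(?R := (sym_at (bits x) 0 + G) # tl (bits x))"
    have "runs (Pop ?R ;; Push ?R (sym_at (bits x) 0 + G)) (reg ?R x) (1 + 2) s1"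
      by (rule runs_Seq, rule runs_Pop, rule refl, rule runs_Push) (auto simp: s1_def reg_def)
    then have 3: "runs (switch ?R 2 (\<lambda>v. Pop ?R ;; Push ?R (v + G))) (reg ?R x) (1 + 2 + 2) s1"
      by (intro runs_switch) (auto simp: sym_at_def bits_def bit_sym_def)
    obtain s2 where s2: "runs (mark_tapes G [1..<K]) s1 (2 * length [1..<K] + 3) s2"
      "\<forall>j \<in> set [1..<K]. s2 (right_reg j) = G # s1 (right_reg j)"
      "\<forall>r. (\<forall>j \<in> set [1..<K]. r ~= right_reg j) --> s2 r = s1 r"
      using runs_mark_tapes[of "[1..<K]" G s1] by auto
    define s3 where "s3 = s2(2 := [0])"
    have 4: "runs (Push 2 0) s2 2 s3" by (rule runs_Push) (use s2(3) in \<open>auto simp: s3_def s1_def\<close>)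
    have c1: "runs c1 (reg 0 x) (b1 (length x)) s3"
      unfolding c1_def b1_def
      by (intro runs_Seq[OF 1] runs_Seq[OF 2] runs_Seq[OF 3] runs_Seq[OF s2(1)[simplified length_upt]] 4)
    have low: "s3 0 = []" "s3 1 = []" using s2(3) by (auto simp: s3_def s1_def)
    have "represents G (snd (tm_init M x)) s3"
      unfolding represents_def
    proof (intro allI impI)
      fix j assume j: "j < length (snd (tm_init M x))"
      then have j: "j < K" using K by (simp add: tm_init_def K_def)
      have left: "s3 (left_reg j) = []" using s2(3) by (auto simp: s3_def s1_def)
      show "two_stacks G (snd (tm_init M x) ! j) (s3 (left_reg j)) (s3 (right_reg j))"
      proof (cases "j = 0")
        case True
        have right: "s3 (right_reg j) = (sym_at (bits x) 0 + G) # tl (bits x)"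
          using s2(3) True by (auto simp: s3_def s1_def)
        have "sym_at (bits x) i = (if i < length x then bit_sym (x ! i) else 0)" for i
          by (auto simp: sym_at_def bits_def)
        then show ?thesis unfolding left right using True
          by (auto simp: two_stacks_def tm_init_def marked_def sym_at_Cons sym_at_tl split: nat.split)
             (auto simp: sym_at_def)
      next
        case False
        have right: "s3 (right_reg j) = [G]"
          using s2(2) False j by (simp add: s3_def s1_def)
        have "snd (tm_init M x) ! j = ((\<lambda>_. 0), 0)"
          using False j by (cases j) (auto simp: tm_init_def K_def)
        then show ?thesis unfolding left right by (auto simp: two_stacks_def marked_def sym_at_def)
      qed
    qed
    moreover have "s3 2 = [fst (tm_init M x)]" by (simp add: s3_def tm_init_def)
    moreover define cf where "cf = (tm_step M ^^ (length x ^ k + k)) (tm_init M x)"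
    moreover have cf: "fst cf = 1" "\<forall>i < length (f x). fst (snd cf ! 1) (int i) = bit_sym (f x ! i)"
      "fst (snd cf ! 1) (int (length (f x))) = 0"
      using out[of x] by (auto simp: tm_output_def cf_def)
    ultimately obtain s4 where s4: "runs c2 s3 (b2 (length x)) s4" "represents G (snd cf) s4"
      "s4 0 = s3 0" "s4 1 = s3 1"
      using runs_tm_loop[OF M T_def[unfolded G_def K_def], of "tm_init M x" s3 "length x ^ k + k"] tm_wf_init[OF M]
      unfolding c2_def b2_def G_def K_def by auto
    have wf: "tm_wf_config M cf" unfolding cf_def by (intro tm_wf_steps tm_wf_init M)
    define t h where "t = fst (snd cf ! 1)" and "h = snd (snd cf ! 1)"
    have two: "two_stacks G (t, h) (s4 (left_reg 1)) (s4 (right_reg 1))"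
      using s4(2) wf K by (auto simp: represents_def t_def h_def tm_wf_config_def K_def)
    have t: "\<And>i. t i < G" using wf K by (auto simp: tm_wf_config_def t_def G_def K_def)
    have "length (s4 r) <= length x + b1 (length x) + b2 (length x)" for r
      using runs_length[OF c1, of r] runs_length[OF s4(1), of r] by (auto split: if_splits)
    then have "length (s4 (left_reg 1)) + length (s4 (right_reg 1)) <= 2 * (length x + b1 (length x) + b2 (length x))"
      by (metis add_mono mult_2)
    then obtain s5 where s5: "runs (tm_output_com G) s4 (b3 (length x)) s5" "s5 1 = bits (f x)"
      using runs_tm_output_com[OF two t, of "f x"] cf low s4 unfolding b3_def Let_def t_def by metis
    show ?thesis using runs_Seq[OF c1 runs_Seq[OF s4(1) s5(1)]] s5(2) by blast
  qed
  moreover have "poly_bounded (\<lambda>n. b1 n + (b2 n + b3 n))"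
    unfolding b1_def b2_def b3_def Let_def by (intro poly_bounded_intros)
  ultimately show ?thesis by (intro stack_programI[of "\<lambda>n. b1 n + (b2 n + b3 n)"]) auto
qed

subsection \<open>Closure properties of polynomial time\<close>

definition regs2 :: "nat => bool list => nat => bool list => store" where
  "regs2 p x q y = (\<lambda>_. [])(p := bits x, q := bits y)"

lemma regs2_apply: "regs2 p x q y r = (if r = q then bits y else if r = p then bits x else [])"
  by (simp add: regs2_def)

lemma regs2_commute: "p ~= q ==> regs2 p x q y = regs2 q y p x" by (auto simp: regs2_def)

lemma regs2_Nil: "p ~= q ==> regs2 p x q [] = reg p x" by (auto simp: regs2_def reg_def)

lemma runs_move_regs2:
  assumes "p ~= q" "p ~= r" "q ~= r"
  shows "runs (move_bits p r) (regs2 p x q y) (5 * length x + 1) (regs2 r (rev x) q y)"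
proof -
  have "runs (move_bits p r) (regs2 p x q y) (5 * length x + 1)
      ((regs2 p x q y)(p := [], r := rev (bits x) @ regs2 p x q y r))"
    by (rule runs_move_bits) (use assms in \<open>simp_all add: regs2_apply\<close>)
  moreover have "(regs2 p x q y)(p := [], r := rev (bits x) @ regs2 p x q y r) = regs2 r (rev x) q y"
    using assms by (auto simp: regs2_apply)
  ultimately show ?thesis by simp
qed

lemma runs_move_onto:
  assumes "p ~= q"
  shows "runs (move_bits p q) (regs2 p x q y) (5 * length x + 1) (reg q (rev x @ y))"
proof -
  have "runs (move_bits p q) (regs2 p x q y) (5 * length x + 1)
      ((regs2 p x q y)(p := [], q := rev (bits x) @ regs2 p x q y q))"
    by (rule runs_move_bits) (use assms in \<open>simp_all add: regs2_apply\<close>)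
  moreover have "(regs2 p x q y)(p := [], q := rev (bits x) @ regs2 p x q y q) = reg q (rev x @ y)"
    using assms by (auto simp: regs2_apply)
  ultimately show ?thesis by simp
qed

lemma runs_move_reg: "p ~= q ==> runs (move_bits p q) (reg p x) (5 * length x + 1) (reg q (rev x))"
  using runs_move_onto[of p q x "[]"] by (simp add: regs2_Nil)

lemma runs_copy_reg:
  assumes "p ~= q" "r ~= p" "r ~= q"
  shows "runs (copy_bits r p q) (reg r x) (7 * length x + 1) (regs2 p (rev x) q (rev x))"
proof -
  have "runs (copy_bits r p q) (reg r x) (7 * length x + 1)
      ((reg r x)(r := [], p := rev (bits x) @ reg r x p, q := rev (bits x) @ reg r x q))"
    by (rule runs_copy_bits) (use assms in simp_all)
  moreover have "(reg r x)(r := [], p := rev (bits x) @ reg r x p, q := rev (bits x) @ reg r x q) =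
      regs2 p (rev x) q (rev x)"
    using assms by (auto simp: regs2_apply)
  ultimately show ?thesis by simp
qed

lemma runs_clear_regs2:
  assumes "p ~= q"
  shows "runs (clear p) (regs2 p x q y) (2 * length x + 1) (reg q y)"
proof -
  have "(regs2 p x q y)(p := []) = reg q y" using assms by (auto simp: regs2_apply)
  then show ?thesis using runs_clear[of p "regs2 p x q y"] assms by (simp add: regs2_apply)
qed

lemma runs_call_regs2:
  assumes "stack_program c f b" "bounded_com c N G" "2 <= N" "N <= q"
  shows "runs c (regs2 0 x q y) (b (length x)) (regs2 1 (f x) q y)"
proof -
  have "runs c (regs2 0 x q y) (b (length x)) ((regs2 0 x q y)(0 := [], 1 := bits (f x)))"
    by (rule runs_call[OF assms(1-3)]) (use assms(3,4) in \<open>auto simp: regs2_apply\<close>)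
  moreover have "(regs2 0 x q y)(0 := [], 1 := bits (f x)) = regs2 1 (f x) q y"
    using assms(3,4) by (auto simp: regs2_apply)
  ultimately show ?thesis by simp
qed

lemma polytime_program:
  assumes "polytime f"
  obtains c b N G where "stack_program c f b" "poly_bounded b" "mono b" "bounded_com c N G"
    "\<And>x. length (f x) <= length x + b (length x)"
proof -
  obtain c b where c: "stack_program c f b" using polytime_stack_program[OF assms] by blast
  then have "poly_bounded b" "mono b" by (auto simp: stack_program_def)
  moreover obtain N G where "bounded_com c N G" using ex_bounded_com by blast
  ultimately show ?thesis using that c stack_program_length by blast
qed

lemma polytime_length_bound:
  assumes "polytime f"
  obtains b where "poly_bounded b" "mono b" "\<And>x. length (f x) <= b (length x)"
proof -
  obtain c b where "poly_bounded b" "mono b" "\<And>x. length (f x) <= length x + b (length x)"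
    using polytime_program[OF assms] by metis
  then show ?thesis
    by (intro that[of "\<lambda>n. n + b n"]) (auto intro!: poly_bounded_intros monoI add_mono dest: monoD)
qed

lemma polytime_progI:
  assumes "poly_bounded b" "\<And>x. runs c (reg 0 x) (b (length x)) (reg 1 (f x))"
  shows "polytime f"
  using stack_programI[of b c f] assms stack_program_polytime by (metis reg_apply)

theorem polytime_comp:
  assumes "polytime f" "polytime g"
  shows "polytime (\<lambda>x. f (g x))"
proof -
  obtain c b where f: "stack_program c f b" "poly_bounded b" "mono b"
    using polytime_program[OF assms(1)] by metis
  obtain d e where g: "stack_program d g e" "poly_bounded e" "\<And>x. length (g x) <= length x + e (length x)"
    using polytime_program[OF assms(2)] by metis
  let ?m = "\<lambda>n. n + e n"
  let ?B = "\<lambda>n. e n + ((5 * ?m n + 1) + ((5 * ?m n + 1) + b (?m n)))"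
  show ?thesis
  proof (rule polytime_progI[of ?B "d ;; move_bits 1 2 ;; move_bits 2 0 ;; c"])
    show "poly_bounded ?B" by (intro poly_bounded_intros g poly_bounded_comp[OF f(2)])
    fix x
    have 1: "runs d (reg 0 x) (e (length x)) (reg 1 (g x))" using g(1) by (simp add: stack_program_def)
    have 2: "runs (move_bits 1 2) (reg 1 (g x)) (5 * ?m (length x) + 1) (reg 2 (rev (g x)))"
      using runs_move_reg[of 1 2 "g x"] g(3)[of x] by (auto elim!: runs_mono)
    have 3: "runs (move_bits 2 0) (reg 2 (rev (g x))) (5 * ?m (length x) + 1) (reg 0 (g x))"
      using runs_move_reg[of 2 0 "rev (g x)"] g(3)[of x] by (auto elim!: runs_mono)
    have "runs c (reg 0 (g x)) (b (length (g x))) (reg 1 (f (g x)))"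
      using f(1) by (simp add: stack_program_def)
    then have 4: "runs c (reg 0 (g x)) (b (?m (length x))) (reg 1 (f (g x)))"
      by (rule runs_mono) (rule monoD[OF f(3) g(3)])
    show "runs (d ;; move_bits 1 2 ;; move_bits 2 0 ;; c) (reg 0 x) (?B (length x)) (reg 1 (f (g x)))"
      by (intro runs_Seq[OF 1] runs_Seq[OF 2] runs_Seq[OF 3] 4)
  qed
qed

definition with_copy :: "nat => com => com" where
  "with_copy N c = copy_bits 0 N (Suc N) ;; move_bits N 0 ;; c"

lemma runs_with_copy:
  assumes "stack_program c f b" "bounded_com c N G" "2 <= N"
  shows "runs (with_copy N c) (reg 0 x) ((7 * length x + 1) + ((5 * length x + 1) + b (length x)))
    (regs2 1 (f x) (Suc N) (rev x))"
proof -
  have 1: "runs (copy_bits 0 N (Suc N)) (reg 0 x) (7 * length x + 1) (regs2 N (rev x) (Suc N) (rev x))"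
    using assms(3) by (intro runs_copy_reg) auto
  have 2: "runs (move_bits N 0) (regs2 N (rev x) (Suc N) (rev x)) (5 * length x + 1) (regs2 0 x (Suc N) (rev x))"
    using runs_move_regs2[of N "Suc N" 0 "rev x" "rev x"] assms(3) by simp
  have 3: "runs c (regs2 0 x (Suc N) (rev x)) (b (length x)) (regs2 1 (f x) (Suc N) (rev x))"
    using assms by (intro runs_call_regs2) auto
  show ?thesis unfolding with_copy_def by (intro runs_Seq[OF 1] runs_Seq[OF 2] 3)
qed

text \<open>The second program runs while the result of the first one waits, reversed, in register
  \<open>N\<close>; transferring it back later also restores its order.\<close>

definition both :: "nat => com => com => com" where
  "both N c d = with_copy N c ;; move_bits 1 N ;; move_bits (Suc N) 0 ;; d"

lemma runs_both:
  assumes f: "stack_program c f b" "bounded_com c N G" "2 <= N" "length (f x) <= length x + b (length x)"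
    and g: "stack_program d g e" "bounded_com d N G'"
  shows "runs (both N c d) (reg 0 x) ((7 * length x + 1) + ((5 * length x + 1) + b (length x)) +
      ((5 * (length x + b (length x)) + 1) + ((5 * length x + 1) + e (length x))))
    (regs2 1 (g x) N (rev (f x)))"
proof -
  note 1 = runs_with_copy[OF f(1-3), of x]
  have "runs (move_bits 1 N) (regs2 1 (f x) (Suc N) (rev x)) (5 * length (f x) + 1)
      (regs2 N (rev (f x)) (Suc N) (rev x))" by (rule runs_move_regs2) (use f(3) in auto)
  then have 2: "runs (move_bits 1 N) (regs2 1 (f x) (Suc N) (rev x)) (5 * (length x + b (length x)) + 1)
      (regs2 (Suc N) (rev x) N (rev (f x)))"
    using f(4) regs2_commute[of N "Suc N"] by (auto elim!: runs_mono)
  have 3: "runs (move_bits (Suc N) 0) (regs2 (Suc N) (rev x) N (rev (f x))) (5 * length x + 1)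
      (regs2 0 x N (rev (f x)))"
    using runs_move_regs2[of "Suc N" N 0 "rev x"] f(3) by simp
  have 4: "runs d (regs2 0 x N (rev (f x))) (e (length x)) (regs2 1 (g x) N (rev (f x)))"
    by (rule runs_call_regs2[OF g f(3)]) simp
  show ?thesis unfolding both_def by (intro runs_Seq[OF 1] runs_Seq[OF 2] runs_Seq[OF 3] 4)
qed

theorem polytime_append:
  assumes "polytime f" "polytime g"
  shows "polytime (\<lambda>x. f x @ g x)"
proof -
  obtain c b N1 G1 where f: "stack_program c f b" "poly_bounded b" "bounded_com c N1 G1"
      "\<And>x. length (f x) <= length x + b (length x)"
    using polytime_program[OF assms(1)] by metis
  obtain d e N2 G2 where g: "stack_program d g e" "poly_bounded e" "bounded_com d N2 G2"
    using polytime_program[OF assms(2)] by metis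
  define N where "N = N1 + N2 + 2"
  have N: "bounded_com c N G1" "bounded_com d N G2" "2 <= N"
    using bounded_com_mono[OF f(3), of N G1] bounded_com_mono[OF g(3), of N G2] by (auto simp: N_def)
  let ?B = "\<lambda>n. (7 * n + 1) + ((5 * n + 1) + b n) + ((5 * (n + b n) + 1) + ((5 * n + 1) + e n)) + (5 * (n + b n) + 1)"
  show ?thesis
  proof (rule polytime_progI[of ?B "both N c d ;; move_bits N 1"])
    show "poly_bounded ?B" by (intro poly_bounded_intros f g)
    fix x
    note 1 = runs_both[OF f(1) N(1,3) f(4) g(1) N(2), of x]
    have "runs (move_bits N 1) (regs2 N (rev (f x)) 1 (g x)) (5 * length (rev (f x)) + 1)
        (reg 1 (rev (rev (f x)) @ g x))" by (rule runs_move_onto) (use N in auto)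
    then have 2: "runs (move_bits N 1) (regs2 1 (g x) N (rev (f x))) (5 * (length x + b (length x)) + 1)
        (reg 1 (f x @ g x))"
      using f(4)[of x] regs2_commute[of N 1] N(3) by (auto elim!: runs_mono)
    show "runs (both N c d ;; move_bits N 1) (reg 0 x) (?B (length x)) (reg 1 (f x @ g x))"
      by (rule runs_Seq[OF 1 2])
  qed
qed

lemma polytime_test:
  assumes "polytime f" "polytime g" "polytime h"
  shows "polytime (\<lambda>x. if P (topmost (bits (f x))) then g x else h x)"
proof -
  obtain c b N1 G1 where f: "stack_program c f b" "poly_bounded b" "bounded_com c N1 G1"
      "\<And>x. length (f x) <= length x + b (length x)"
    using polytime_program[OF assms(1)] by metis
  obtain d e where g: "stack_program d g e" "poly_bounded e"
    using polytime_program[OF assms(2)] by metis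
  obtain d' e' where h: "stack_program d' h e'" "poly_bounded e'"
    using polytime_program[OF assms(3)] by metis
  define N where "N = N1 + 2"
  have N: "bounded_com c N G1" "2 <= N"
    using bounded_com_mono[OF f(3), of N G1] by (auto simp: N_def)
  let ?c = "\<lambda>d. clear 1 ;; move_bits (Suc N) 0 ;; d"
  let ?B = "\<lambda>n. (7 * n + 1) + ((5 * n + 1) + b n) + Suc ((2 * (n + b n) + 1) + ((5 * n + 1) + (e n + e' n)))"
  show ?thesis
  proof (rule polytime_progI[of ?B "with_copy N c ;; Cond 1 P (?c d) (?c d')"])
    show "poly_bounded ?B" unfolding Suc_eq_plus1 by (intro poly_bounded_intros f g h)
    fix x
    note 1 = runs_with_copy[OF f(1) N, of x]
    have "runs (clear 1) (regs2 1 (f x) (Suc N) (rev x)) (2 * length (f x) + 1) (reg (Suc N) (rev x))"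
      by (rule runs_clear_regs2) (use N in auto)
    then have 2: "runs (clear 1) (regs2 1 (f x) (Suc N) (rev x)) (2 * (length x + b (length x)) + 1) (reg (Suc N) (rev x))"
      by (rule runs_mono) (use f(4)[of x] in auto)
    have 3: "runs (move_bits (Suc N) 0) (reg (Suc N) (rev x)) (5 * length x + 1) (reg 0 x)"
      using runs_move_reg[of "Suc N" 0 "rev x"] by simp
    have 4: "runs d (reg 0 x) (e (length x) + e' (length x)) (reg 1 (g x))"
      "runs d' (reg 0 x) (e (length x) + e' (length x)) (reg 1 (h x))"
      using g(1) h(1) runs_mono[OF _ le_add1] runs_mono[OF _ le_add2] unfolding stack_program_def by blast+
    have "topmost (regs2 1 (f x) (Suc N) (rev x) 1) = topmost (bits (f x))"
      using N(2) by (simp add: regs2_apply)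
    then have "runs (if P (topmost (regs2 1 (f x) (Suc N) (rev x) 1)) then ?c d else ?c d')
        (regs2 1 (f x) (Suc N) (rev x))
        ((2 * (length x + b (length x)) + 1) + ((5 * length x + 1) + (e (length x) + e' (length x))))
        (reg 1 (if P (topmost (bits (f x))) then g x else h x))"
      using runs_Seq[OF 2 runs_Seq[OF 3 4(1)]] runs_Seq[OF 2 runs_Seq[OF 3 4(2)]] by simp
    from runs_Seq[OF 1 runs_Cond[of P, OF this]]
    show "runs (with_copy N c ;; Cond 1 P (?c d) (?c d')) (reg 0 x) (?B (length x))
        (reg 1 (if P (topmost (bits (f x))) then g x else h x))" .
  qed
qed

definition first_true :: "bool list => bool" where
  "first_true x \<longleftrightarrow> x ~= [] & hd x"

lemma first_true_simps [simp]: "~ first_true []" "first_true (b # x) \<longleftrightarrow> b" by (simp_all add: first_true_def)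

theorem polytime_if:
  assumes "polytime f" "polytime g" "polytime h"
  shows "polytime (\<lambda>x. if first_true (f x) then g x else h x)"
proof -
  have "topmost (bits y) = Some 2 \<longleftrightarrow> first_true y" for y by (cases y) (auto simp: bit_sym_def)
  then show ?thesis using polytime_test[OF assms, of "\<lambda>t. t = Some 2"] by simp
qed

theorem polytime_if_Nil:
  assumes "polytime f" "polytime g" "polytime h"
  shows "polytime (\<lambda>x. if f x = [] then g x else h x)"
proof -
  have "topmost (bits y) = None \<longleftrightarrow> y = []" for y by (cases y) auto
  then show ?thesis using polytime_test[OF assms, of "\<lambda>t. t = None"] by simp
qed

text \<open>The word \<open>u x\<close> itself is the loop counter: it waits in register
  \<open>N\<close> and loses one symbol per round. The bound \<open>q\<close> on all intermediate
  words is what keeps the total time polynomial, since a polynomial-time step may well double its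
  argument each time.\<close>

theorem polytime_iterate:
  assumes "polytime u" "polytime v" "polytime step" "poly_bounded q"
    and q: "\<And>x i. i <= length (u x) ==> length ((step ^^ i) (v x)) <= q (length x)"
  shows "polytime (\<lambda>x. (step ^^ length (u x)) (v x))"
proof -
  obtain c b N1 G1 where u: "stack_program c u b" "poly_bounded b" "bounded_com c N1 G1"
      "\<And>x. length (u x) <= length x + b (length x)"
    using polytime_program[OF assms(1)] by metis
  obtain d e N2 G2 where v: "stack_program d v e" "poly_bounded e" "bounded_com d N2 G2"
    using polytime_program[OF assms(2)] by metis
  obtain d' e' N3 G3 where s: "stack_program d' step e'" "poly_bounded e'" "mono e'" "bounded_com d' N3 G3"
      "\<And>x. length (step x) <= length x + e' (length x)"
    using polytime_program[OF assms(3)] by metis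
  define N where "N = N1 + N2 + N3 + 3"
  have N: "bounded_com c N G1" "bounded_com d N G2" "bounded_com d' N G3" "2 <= N"
    using bounded_com_mono[OF u(3), of N G1] bounded_com_mono[OF v(3), of N G2]
      bounded_com_mono[OF s(4), of N G3] by (auto simp: N_def)
  let ?body = "Pop N ;; d' ;; move_bits 1 (Suc N) ;; move_bits (Suc N) 0"
  let ?T = "\<lambda>n. 1 + (e' (q n) + ((5 * (q n + e' (q n)) + 1) + (5 * (q n + e' (q n)) + 1)))"
  let ?B = "\<lambda>n. ((7 * n + 1) + ((5 * n + 1) + b n) + ((5 * (n + b n) + 1) + ((5 * n + 1) + e n))) +
     ((5 * q n + 1) + ((5 * q n + 1) + (((n + b n) * (?T n + 1) + 1) + ((5 * q n + 1) + (5 * q n + 1)))))"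
  show ?thesis
  proof (rule polytime_progI[of ?B "both N c d ;; move_bits 1 (Suc N) ;; move_bits (Suc N) 0 ;;
      Loop N nonempty ?body ;; move_bits 0 2 ;; move_bits 2 1"])
    show "poly_bounded ?B" by (intro poly_bounded_intros u v poly_bounded_comp[OF s(2)] assms(4))
    fix x :: "bool list"
    let ?n = "length x"
    note 1 = runs_both[OF u(1) N(1,4) u(4) v(1) N(2), of x]
    let ?S = "\<lambda>i. regs2 0 ((step ^^ i) (v x)) N (drop i (rev (u x)))"
    have le: "5 * m + 1 <= 5 * q ?n + 1" if "m <= q ?n" for m using that by simp
    have v0: "length (v x) <= q ?n" using q[of 0 x] by simp
    have "runs (move_bits 1 (Suc N)) (regs2 1 (v x) N (rev (u x))) (5 * length (v x) + 1)
       (regs2 (Suc N) (rev (v x)) N (rev (u x)))" by (rule runs_move_regs2) (use N in auto)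
    then have 2: "runs (move_bits 1 (Suc N)) (regs2 1 (v x) N (rev (u x))) (5 * q ?n + 1)
       (regs2 (Suc N) (rev (v x)) N (rev (u x)))" by (rule runs_mono) (rule le[OF v0])
    have "runs (move_bits (Suc N) 0) (regs2 (Suc N) (rev (v x)) N (rev (u x))) (5 * length (rev (v x)) + 1)
       (regs2 0 (rev (rev (v x))) N (rev (u x)))" by (rule runs_move_regs2) (use N in auto)
    then have 3: "runs (move_bits (Suc N) 0) (regs2 (Suc N) (rev (v x)) N (rev (u x))) (5 * q ?n + 1) (?S 0)"
      using v0 by (auto elim!: runs_mono)
    have 4: "runs (Loop N nonempty ?body) (?S 0) (length (u x) * Suc (?T ?n) + 1) (?S (length (u x)))"
    proof (rule runs_Loop_iterate)
      fix i assume i: "i < length (u x)"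
      define y where "y = (step ^^ i) (v x)"
      define z where "z = drop (Suc i) (rev (u x))"
      have y: "length y <= q ?n" using q[of i x] i by (simp add: y_def)
      have dr: "drop i (rev (u x)) = (rev (u x) ! i) # z"
        using i by (simp add: z_def Cons_nth_drop_Suc)
      have a: "runs (Pop N) (?S i) 1 (regs2 0 y N z)"
        by (rule runs_Pop) (use dr N in \<open>auto simp: regs2_def y_def\<close>)
      have "runs d' (regs2 0 y N z) (e' (length y)) (regs2 1 (step y) N z)"
        by (rule runs_call_regs2[OF s(1) N(3,4)]) simp
      then have b: "runs d' (regs2 0 y N z) (e' (q ?n)) (regs2 1 (step y) N z)"
        by (rule runs_mono) (rule monoD[OF s(3) y])
      have len: "length (step y) <= q ?n + e' (q ?n)"
        using s(5)[of y] y monoD[OF s(3) y] by linarith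
      have "runs (move_bits 1 (Suc N)) (regs2 1 (step y) N z) (5 * length (step y) + 1)
          (regs2 (Suc N) (rev (step y)) N z)" by (rule runs_move_regs2) (use N in auto)
      then have c: "runs (move_bits 1 (Suc N)) (regs2 1 (step y) N z) (5 * (q ?n + e' (q ?n)) + 1)
          (regs2 (Suc N) (rev (step y)) N z)" by (rule runs_mono) (use len in simp)
      have "runs (move_bits (Suc N) 0) (regs2 (Suc N) (rev (step y)) N z) (5 * length (rev (step y)) + 1)
          (regs2 0 (rev (rev (step y))) N z)" by (rule runs_move_regs2) (use N in auto)
      then have d: "runs (move_bits (Suc N) 0) (regs2 (Suc N) (rev (step y)) N z) (5 * (q ?n + e' (q ?n)) + 1)
          (regs2 0 (rev (rev (step y))) N z)" by (rule runs_mono) (use len in simp)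
      have "regs2 0 (rev (rev (step y))) N z = ?S (Suc i)" by (simp add: y_def z_def)
      then have "runs ?body (?S i) (?T ?n) (?S (Suc i))"
        using runs_Seq[OF a runs_Seq[OF b runs_Seq[OF c d]]] by simp
      moreover have "nonempty (topmost (?S i N))" using dr by (simp add: regs2_apply)
      ultimately show "nonempty (topmost (?S i N)) & runs ?body (?S i) (?T ?n) (?S (Suc i))" by blast
    qed (simp add: regs2_apply)
    define y where "y = (step ^^ length (u x)) (v x)"
    have y: "length y <= q ?n" using q[of "length (u x)" x] by (simp add: y_def)
    have Sy: "?S (length (u x)) = reg 0 y" using N(4) by (simp add: regs2_Nil y_def)
    have "length (u x) * Suc (?T ?n) + 1 <= (?n + b ?n) * (?T ?n + 1) + 1"
      using u(4)[of x] by (intro add_mono mult_mono) auto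
    with 4 have 4: "runs (Loop N nonempty ?body) (?S 0) ((?n + b ?n) * (?T ?n + 1) + 1) (reg 0 y)"
      unfolding Sy by (rule runs_mono)
    have 5: "runs (move_bits 0 2) (reg 0 y) (5 * q ?n + 1) (reg 2 (rev y))"
      using runs_move_reg[of 0 2 y] y by (auto elim!: runs_mono)
    have 6: "runs (move_bits 2 1) (reg 2 (rev y)) (5 * q ?n + 1) (reg 1 y)"
      using runs_move_reg[of 2 1 "rev y"] y by (auto elim!: runs_mono)
    show "runs (both N c d ;; move_bits 1 (Suc N) ;; move_bits (Suc N) 0 ;;
        Loop N nonempty ?body ;; move_bits 0 2 ;; move_bits 2 1) (reg 0 x) (?B ?n)
        (reg 1 ((step ^^ length (u x)) (v x)))"
      unfolding y_def[symmetric]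
      by (intro runs_Seq[OF 1] runs_Seq[OF 2] runs_Seq[OF 3] runs_Seq[OF 4] runs_Seq[OF 5] 6)
  qed
qed

subsection \<open>Finite-state transducers\<close>

primrec transduce :: "(nat => bool => nat \<times> bool list) => (nat => bool list) => bool list => nat => bool list" where
  "transduce D F [] q = F q"
| "transduce D F (b # x) q = snd (D q b) @ transduce D F x (fst (D q b))"

primrec push_bits :: "nat => bool list => com" where
  "push_bits r [] = skip"
| "push_bits r (b # x) = Push r (bit_sym b) ;; push_bits r x"

lemma runs_push_bits: "runs (push_bits r x) s (2 * length x + 3) (s(r := rev (bits x) @ s r))"
proof (induction x arbitrary: s)
  case Nil then show ?case using runs_skip by simp
next
  case (Cons b x)
  let ?s = "s(r := bit_sym b # s r)"
  have "runs (push_bits r (b # x)) s (2 + (2 * length x + 3)) (?s(r := rev (bits x) @ ?s r))"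
    unfolding push_bits.simps by (rule runs_Seq[OF runs_Push[OF refl] Cons.IH])
  moreover have "?s(r := rev (bits x) @ ?s r) = s(r := rev (bits (b # x)) @ s r)" by simp
  ultimately have "runs (push_bits r (b # x)) s (2 + (2 * length x + 3)) (s(r := rev (bits (b # x)) @ s r))"
    by metis
  then show ?case by (rule runs_mono) simp
qed

text \<open>The common origin of the elementary functions below. The state is one symbol of register
  3 bounded by \<open>n\<close>, so a switch can select the constant output word; \<open>L\<close>
  bounds the length of all these words.\<close>

theorem polytime_transduce:
  assumes D: "\<And>q b. q <= n ==> fst (D q b) <= n" and q0: "q0 <= n"
  shows "polytime (\<lambda>x. transduce D F x q0)"
proof -
  define L where "L = (\<Sum>q\<le>n. length (snd (D q True)) + length (snd (D q False)) + length (F q))"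
  have L: "length (snd (D q b)) <= L" "length (F q) <= L" if "q <= n" for q b
  proof -
    have "length (snd (D q True)) + length (snd (D q False)) + length (F q) <= L"
      unfolding L_def using that
      by (intro member_le_sum[of q "{..n}" "\<lambda>q. length (snd (D q True)) + length (snd (D q False)) + length (F q)"]) auto
    then show "length (snd (D q b)) <= L" "length (F q) <= L" by (cases b; simp)+
  qed
  define act where "act q b = Pop 0 ;; Pop 3 ;; Push 3 (fst (D q b)) ;; push_bits 2 (snd (D q b))" for q b
  define body where "body = switch 3 n (\<lambda>q. Cond 0 (\<lambda>t. t = Some 2) (act q True) (act q False))"
  define fin where "fin = switch 3 n (\<lambda>q. push_bits 2 (F q))"
  define S where "S x q out = ((\<lambda>_. []) :: store)(0 := bits x, 3 := [q], 2 := rev (bits out))" for x q out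
  let ?T = "Suc (1 + (1 + (2 + (2 * L + 3)))) + n"
  have body: "runs body (S (b # x) q out) ?T (S x (fst (D q b)) (out @ snd (D q b)))" if "q <= n" for b x q out
  proof -
    have 1: "runs (Pop 0) (S (b # x) q out) 1 (S x q out)" by (rule runs_Pop) (auto simp: S_def)
    have 2: "runs (Pop 3) (S x q out) 1 ((S x q out)(3 := []))" by (rule runs_Pop) (auto simp: S_def)
    have 3: "runs (Push 3 (fst (D q b))) ((S x q out)(3 := [])) 2 (S x (fst (D q b)) out)"
      by (rule runs_Push) (auto simp: S_def)
    have "(S x (fst (D q b)) out)(2 := rev (bits (snd (D q b))) @ S x (fst (D q b)) out 2) =
        S x (fst (D q b)) (out @ snd (D q b))" by (auto simp: S_def)
    then have 4: "runs (push_bits 2 (snd (D q b))) (S x (fst (D q b)) out) (2 * L + 3) (S x (fst (D q b)) (out @ snd (D q b)))"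
      using runs_push_bits[of 2 "snd (D q b)" "S x (fst (D q b)) out"] L(1)[OF that, of b] by (auto elim!: runs_mono)
    have a: "runs (act q b) (S (b # x) q out) (1 + (1 + (2 + (2 * L + 3)))) (S x (fst (D q b)) (out @ snd (D q b)))"
      unfolding act_def by (intro runs_Seq[OF 1] runs_Seq[OF 2] runs_Seq[OF 3] 4)
    have "runs (Cond 0 (\<lambda>t. t = Some 2) (act q True) (act q False)) (S (b # x) q out)
        (Suc (1 + (1 + (2 + (2 * L + 3))))) (S x (fst (D q b)) (out @ snd (D q b)))"
      by (rule runs_Cond) (use a in \<open>cases b; simp add: S_def bit_sym_def\<close>)
    then show ?thesis
      unfolding body_def by (intro runs_switch) (use that in \<open>simp_all add: S_def sym_at_Cons\<close>)
  qed
  have loop: "\<exists>q' out'. q' <= n & runs (Loop 0 nonempty body) (S x q out) (length x * Suc ?T + 1) (S [] q' out') &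
      out @ transduce D F x q = out' @ F q'" if "q <= n" for x q out
    using that
  proof (induction x arbitrary: q out)
    case Nil
    have "runs (Loop 0 nonempty body) (S [] q out) (length ([]::bool list) * Suc ?T + 1) (S [] q out)"
      by (rule runs_LoopF) (simp_all add: S_def)
    then show ?case using Nil by (intro exI[of _ q] exI[of _ out]) simp
  next
    case (Cons b x)
    obtain q' out' where IH: "q' <= n"
      "runs (Loop 0 nonempty body) (S x (fst (D q b)) (out @ snd (D q b))) (length x * Suc ?T + 1) (S [] q' out')"
      "(out @ snd (D q b)) @ transduce D F x (fst (D q b)) = out' @ F q'"
      using Cons.IH[OF D[OF Cons.prems, of b], of "out @ snd (D q b)"] by blast
    have "runs (Loop 0 nonempty body) (S (b # x) q out) (Suc (?T + (length x * Suc ?T + 1))) (S [] q' out')"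
      by (rule runs_LoopT[OF _ body[OF Cons.prems] IH(2)]) (simp add: S_def)
    then have "runs (Loop 0 nonempty body) (S (b # x) q out) (length (b # x) * Suc ?T + 1) (S [] q' out')"
      by (rule runs_mono) simp
    then show ?case using IH by auto
  qed
  let ?M = "\<lambda>m. m * Suc ?T + (2 * L + 3)"
  let ?B = "\<lambda>m. 2 + ((m * Suc ?T + 1) + ((2 * L + 3 + n) + (5 * (2 + (m * Suc ?T + 1) + (2 * L + 3 + n)) + 1)))"
  show ?thesis
  proof -
    have "\<exists>s. runs (Push 3 q0 ;; Loop 0 nonempty body ;; fin ;; move_bits 2 1) (reg 0 x) (?B (length x)) s &
        s 1 = bits (transduce D F x q0)" for x
    proof -
      let ?m = "length x"
      have 1: "runs (Push 3 q0) (reg 0 x) 2 (S x q0 [])" by (rule runs_Push) (auto simp: S_def reg_def)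
      obtain q out where q: "q <= n" "runs (Loop 0 nonempty body) (S x q0 []) (?m * Suc ?T + 1) (S [] q out)"
        "transduce D F x q0 = out @ F q"
        using loop[OF q0, of x "[]"] by auto
      have "(S [] q out)(2 := rev (bits (F q)) @ S [] q out 2) = S [] q (out @ F q)" by (auto simp: S_def)
      then have "runs (push_bits 2 (F q)) (S [] q out) (2 * L + 3) (S [] q (out @ F q))"
        using runs_push_bits[of 2 "F q" "S [] q out"] L(2)[OF q(1)] by (auto elim!: runs_mono)
      then have 3: "runs fin (S [] q out) (2 * L + 3 + n) (S [] q (out @ F q))"
        unfolding fin_def by (intro runs_switch) (use q(1) in \<open>simp_all add: S_def sym_at_Cons\<close>)
      have len: "length (out @ F q) <= 2 + (?m * Suc ?T + 1) + (2 * L + 3 + n)"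
        using runs_length[OF runs_Seq[OF 1 runs_Seq[OF q(2) 3]], of 2] by (simp add: S_def)
      let ?s = "(S [] q (out @ F q))(2 := [], 1 := rev (bits (rev (out @ F q))) @ S [] q (out @ F q) 1)"
      have "runs (move_bits 2 1) (S [] q (out @ F q)) (5 * length (rev (out @ F q)) + 1) ?s"
        by (rule runs_move_bits) (simp_all add: S_def)
      then have 4: "runs (move_bits 2 1) (S [] q (out @ F q)) (5 * (2 + (?m * Suc ?T + 1) + (2 * L + 3 + n)) + 1) ?s"
        by (rule runs_mono) (use len in simp)
      show ?thesis by (rule exI[of _ ?s], rule conjI, intro runs_Seq[OF 1] runs_Seq[OF q(2)] runs_Seq[OF 3] 4)
          (simp add: S_def q(3))
    qed
    moreover have "poly_bounded ?B" unfolding Suc_eq_plus1 by (intro poly_bounded_intros)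
    ultimately have "\<exists>c b. stack_program c (\<lambda>x. transduce D F x q0) b" by (rule stack_programI[rotated])
    then show ?thesis using stack_program_polytime by blast
  qed
qed

subsection \<open>A toolbox of polynomial-time functions\<close>

lemma polytime_id: "polytime (\<lambda>x. x)"
proof -
  have "transduce (\<lambda>q b. (0, [b])) (\<lambda>_. []) x 0 = x" for x by (induction x) auto
  then show ?thesis using polytime_transduce[of 0 "\<lambda>q b. (0, [b])" 0 "\<lambda>_. []"] by simp
qed

lemma polytime_const: "polytime (\<lambda>_. c)"
proof -
  have "transduce (\<lambda>q b. (0, [])) (\<lambda>_. c) x 0 = c" for x by (induction x) auto
  then show ?thesis using polytime_transduce[of 0 "\<lambda>q b. (0, [])" 0 "\<lambda>_. c"] by simp
qed

lemma polytime_Cons: "polytime f ==> polytime (\<lambda>x. b # f x)"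
  using polytime_append[OF polytime_const[of "[b]"], of f] by simp

lemma polytime_tl:
  assumes "polytime f"
  shows "polytime (\<lambda>x. tl (f x))"
proof -
  let ?D = "\<lambda>q b. (1, if q = 0 then [] else [b]) :: nat \<times> bool list"
  have "transduce ?D (\<lambda>_. []) x 1 = x" for x by (induction x) auto
  then have "transduce ?D (\<lambda>_. []) x 0 = tl x" for x by (cases x) auto
  then have "polytime tl" using polytime_transduce[of 1 ?D 0 "\<lambda>_. []"] by simp
  then show ?thesis using assms by (rule polytime_comp)
qed

lemma polytime_delimited:
  assumes "polytime f"
  shows "polytime (\<lambda>x. delimited (f x))"
proof -
  have "transduce (\<lambda>q b. (0, [True, b])) (\<lambda>_. [False]) x 0 = delimited x" for x
    by (induction x) (auto simp: delimited_def)
  then have "polytime delimited"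
    using polytime_transduce[of 0 "\<lambda>q b. (0, [True, b])" 0 "\<lambda>_. [False]"] by simp
  then show ?thesis using assms by (rule polytime_comp)
qed

lemma polytime_pair_code: "polytime f ==> polytime g ==> polytime (\<lambda>x. pair_code (f x) (g x))"
  unfolding pair_code_def by (intro polytime_append polytime_delimited)

lemma delimited_simps: "delimited [] = [False]" "delimited (b # x) = True # b # delimited x"
  by (simp_all add: delimited_def)

lemma length_delimited: "length (delimited x) = 2 * length x + 1" by (induction x) (auto simp: delimited_simps)

lemma length_pair_code: "length (pair_code x y) = 2 * length x + 1 + length y"
  by (simp add: pair_code_def length_delimited)

text \<open>The automaton recognises, as the first prefix leading to state 4, vertex codes from state 0,
  integer codes from state 1 and delimited strings from state 2.\<close>

definition code_next :: "nat => bool => nat" where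
  "code_next q b = (if q = 0 then (if b then 2 else 1) else if q = 1 then 2
     else if q = 2 then (if b then 3 else 4) else if q = 3 then 2 else 4)"

lemma code_next_simps: "code_next 2 True = 3" "code_next 2 False = 4" "code_next 3 b = 2"
  by (simp_all add: code_next_def)

definition code_take :: "nat => bool list => bool list" where
  "code_take q x = transduce (\<lambda>q b. (code_next q b, if q = 4 then [] else [b])) (\<lambda>_. []) x q"

definition code_drop :: "nat => bool list => bool list" where
  "code_drop q x = transduce (\<lambda>q b. (code_next q b, if q = 4 then [b] else [])) (\<lambda>_. []) x q"

text \<open>State 3 is entered after each marker \<open>True\<close> of a delimited word, so the bit
  read in this state is payload.\<close>

definition unpair1 :: "bool list => bool list" where
  "unpair1 x = transduce (\<lambda>q b. (code_next q b, if q = 3 then [b] else [])) (\<lambda>_. []) x 2"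

definition unpair2 :: "bool list => bool list" where
  "unpair2 = code_drop 2"

lemma polytime_code_take:
  assumes "q <= 4" "polytime f"
  shows "polytime (\<lambda>x. code_take q (f x))"
proof -
  have "polytime (code_take q)"
    using assms(1) polytime_transduce[of 4 "\<lambda>q b. (code_next q b, if q = 4 then [] else [b])" q "\<lambda>_. []"]
    by (simp add: code_take_def[abs_def] code_next_def)
  then show ?thesis using assms(2) by (rule polytime_comp)
qed

lemma polytime_code_drop:
  assumes "q <= 4" "polytime f"
  shows "polytime (\<lambda>x. code_drop q (f x))"
proof -
  have "polytime (code_drop q)"
    using assms(1) polytime_transduce[of 4 "\<lambda>q b. (code_next q b, if q = 4 then [b] else [])" q "\<lambda>_. []"]
    by (simp add: code_drop_def[abs_def] code_next_def)
  then show ?thesis using assms(2) by (rule polytime_comp)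
qed

lemma polytime_unpair1:
  assumes "polytime f"
  shows "polytime (\<lambda>x. unpair1 (f x))"
proof -
  have "polytime unpair1"
    using polytime_transduce[of 4 "\<lambda>q b. (code_next q b, if q = 3 then [b] else [])" 2 "\<lambda>_. []"]
    by (simp add: unpair1_def[abs_def] code_next_def)
  then show ?thesis using assms by (rule polytime_comp)
qed

lemma polytime_unpair2: "polytime f ==> polytime (\<lambda>x. unpair2 (f x))"
  unfolding unpair2_def by (rule polytime_code_drop) simp_all

lemma code_take_4: "code_take 4 x = []" and code_drop_4: "code_drop 4 x = x"
  by (induction x) (auto simp: code_take_def code_drop_def code_next_def)

lemma code_Cons:
  "q ~= 4 ==> code_take q (b # x) = b # code_take (code_next q b) x"
  "q ~= 4 ==> code_drop q (b # x) = code_drop (code_next q b) x" by (simp_all add: code_take_def code_drop_def)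

lemma code_delimited:
  "code_take 2 (delimited x @ y) = delimited x" "code_drop 2 (delimited x @ y) = y"
  by (induction x) (simp_all add: delimited_simps code_Cons code_next_def code_take_4 code_drop_4)

lemma code_int: "code_drop 1 (int_code i @ y) = y"
  by (simp add: int_code_def nat_code_def code_Cons code_next_def code_delimited[simplified])

lemma code_vertex:
  "code_take 0 (vertex_code v @ y) = vertex_code v" "code_drop 0 (vertex_code v @ y) = y"
  by (cases v; simp add: nat_code_def code_Cons code_next_def code_delimited[simplified])+

lemma unpair1_pair [simp]: "unpair1 (pair_code x y) = x"
proof -
  have 4: "transduce (\<lambda>q b. (code_next q b, if q = 3 then [b] else [])) (\<lambda>_. []) y 4 = []" for y
    by (induction y) (auto simp: code_next_def)
  show ?thesis unfolding unpair1_def pair_code_def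
    by (induction x) (simp_all add: delimited_simps code_next_simps 4)
qed

lemma unpair2_pair [simp]: "unpair2 (pair_code x y) = y" by (simp add: unpair2_def pair_code_def code_delimited)

lemmas polytime_basic = polytime_id polytime_const polytime_append polytime_Cons polytime_tl
  polytime_delimited polytime_pair_code polytime_unpair1 polytime_unpair2 polytime_if polytime_if_Nil

lemma polytime_drop:
  assumes "polytime u" "polytime v"
  shows "polytime (\<lambda>x. drop (length (u x)) (v x))"
proof -
  have tl: "(tl ^^ n) xs = drop n xs" for n and xs :: "bool list"
    by (induction n) (simp_all add: tl_drop drop_Suc)
  obtain b where b: "poly_bounded b" "\<And>x. length (v x) <= b (length x)"
    using polytime_length_bound[OF assms(2)] by blast
  have "polytime (\<lambda>x. (tl ^^ length (u x)) (v x))"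
    by (rule polytime_iterate[OF assms polytime_tl[OF polytime_id] b(1)])
      (use b(2) in \<open>auto simp: tl intro: diff_le_self order.trans\<close>)
  then show ?thesis by (simp add: tl)
qed

text \<open>One round strips a common first bit and otherwise does nothing. After as many rounds as
  the first word has bits, both words are empty exactly if they were equal.\<close>

definition eq_step :: "bool list => bool list" where
  "eq_step z = (if unpair1 z = [] then z else if unpair2 z = [] then z
     else if first_true (unpair1 z)
       then (if first_true (unpair2 z) then pair_code (tl (unpair1 z)) (tl (unpair2 z)) else z)
       else (if first_true (unpair2 z) then z else pair_code (tl (unpair1 z)) (tl (unpair2 z))))"

lemma polytime_eq_step: "polytime eq_step"
  unfolding eq_step_def[abs_def] by (intro polytime_basic)

lemma eq_steps:
  "\<exists>a' b'. (eq_step ^^ i) (pair_code a b) = pair_code a' b' & length a' <= length a & length b' <= length b"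
proof (induction i)
  case (Suc i)
  then obtain a' b' where *: "(eq_step ^^ i) (pair_code a b) = pair_code a' b'" "length a' <= length a" "length b' <= length b"
    by blast
  show ?case
  proof (cases "eq_step (pair_code a' b') = pair_code a' b'")
    case True then show ?thesis using * by auto
  next
    case False then have "eq_step (pair_code a' b') = pair_code (tl a') (tl b')"
      unfolding eq_step_def by (auto split: if_splits)
    then show ?thesis using * by (intro exI[of _ "tl a'"] exI[of _ "tl b'"]) auto
  qed
qed auto

lemma eq_steps_fix: "eq_step z = z ==> (eq_step ^^ i) z = z" by (induction i) auto

lemma eq_steps_result:
  "unpair1 ((eq_step ^^ length a) (pair_code a b)) = [] & unpair2 ((eq_step ^^ length a) (pair_code a b)) = []
   \<longleftrightarrow> a = b"
proof (induction a arbitrary: b)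
  case (Cons x a) show ?case
  proof (cases "\<exists>b'. b = x # b'")
    case True
    then obtain b' where b': "b = x # b'" by blast
    then have "eq_step (pair_code (x # a) b) = pair_code a b'" by (cases x) (simp_all add: eq_step_def)
    then show ?thesis using Cons b' by (simp only: list.size(4) add.commute[of _ "Suc 0"] plus_1_eq_Suc funpow_Suc_right o_apply)
        (simp add: funpow_Suc_right del: funpow.simps)
  next
    case False then have "eq_step (pair_code (x # a) b) = pair_code (x # a) b"
      by (cases b) (auto simp: eq_step_def)
    then have "(eq_step ^^ length (x # a)) (pair_code (x # a) b) = pair_code (x # a) b" by (rule eq_steps_fix)
    then show ?thesis using False by (simp only: unpair1_pair) auto
  qed
qed auto

lemma polytime_if_eq:
  assumes "polytime f" "polytime g" "polytime h" "polytime k"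
  shows "polytime (\<lambda>x. if f x = g x then h x else k x)"
proof -
  let ?z = "\<lambda>x. pair_code (f x) (g x)"
  have z: "polytime ?z" by (intro polytime_basic assms)
  obtain b where b: "poly_bounded b" "\<And>x. length (?z x) <= b (length x)"
    using polytime_length_bound[OF z] by blast
  have "length ((eq_step ^^ i) (?z x)) <= b (length x)" for i x
    using eq_steps[of i "f x" "g x"] b(2)[of x] by (auto simp: length_pair_code)
  then have "polytime (\<lambda>x. (eq_step ^^ length (f x)) (?z x))"
    by (intro polytime_iterate[OF assms(1) z polytime_eq_step b(1)])
  then have "polytime (\<lambda>x. if unpair1 ((eq_step ^^ length (f x)) (?z x)) = []
      then (if unpair2 ((eq_step ^^ length (f x)) (?z x)) = [] then h x else k x) else k x)"
    by (intro polytime_basic assms)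
  moreover have "(if unpair1 ((eq_step ^^ length (f x)) (?z x)) = []
      then (if unpair2 ((eq_step ^^ length (f x)) (?z x)) = [] then h x else k x) else k x) =
      (if f x = g x then h x else k x)" for x
    using eq_steps_result[of "f x" "g x"] by auto
  ultimately show ?thesis by simp
qed

text \<open>A counting loop, run as an iteration on the triple of the index in unary, the parameter
  \<open>x\<close> and the output produced so far. All calls of \<open>g\<close> have arguments of
  polynomial length, which bounds the accumulated output.\<close>

lemma polytime_concat_map:
  assumes "polytime n" "polytime g"
  shows "polytime (\<lambda>x. concat (map (\<lambda>i. g (pair_code (replicate i True) x)) [0..<length (n x)]))"
proof -
  let ?step = "\<lambda>z. pair_code (True # unpair1 z) (pair_code (unpair1 (unpair2 z))
     (unpair2 (unpair2 z) @ g (pair_code (unpair1 z) (unpair1 (unpair2 z)))))"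
  let ?v = "\<lambda>x. pair_code [] (pair_code x [])"
  let ?c = "\<lambda>i x. concat (map (\<lambda>i. g (pair_code (replicate i True) x)) [0..<i])"
  have step: "polytime ?step" by (intro polytime_basic polytime_comp[OF assms(2)])
  have v: "polytime ?v" by (intro polytime_basic)
  have it: "(?step ^^ i) (?v x) = pair_code (replicate i True) (pair_code x (?c i x))" for i x
    by (induction i) simp_all
  obtain b where b: "poly_bounded b" "mono b" "\<And>x. length (g x) <= b (length x)"
    using polytime_length_bound[OF assms(2)] by blast
  obtain m where m: "poly_bounded m" "\<And>x. length (n x) <= m (length x)"
    using polytime_length_bound[OF assms(1)] by blast
  let ?q = "\<lambda>k. 2 * m k + 1 + (2 * k + 1 + m k * b (2 * m k + 1 + k))"
  have q: "poly_bounded ?q" by (intro poly_bounded_intros m poly_bounded_comp[OF b(1)])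
  have len: "length ((?step ^^ i) (?v x)) <= ?q (length x)" if "i <= length (n x)" for i x
  proof -
    have i: "i <= m (length x)" using that m(2)[of x] by simp
    have "length (?c i x) = (\<Sum>j\<leftarrow>[0..<i]. length (g (pair_code (replicate j True) x)))"
      by (simp add: length_concat o_def)
    also have "\<dots> <= (\<Sum>j\<leftarrow>[0..<i]. b (2 * m (length x) + 1 + length x))"
    proof (rule sum_list_mono)
      fix j assume "j \<in> set [0..<i]"
      then have "length (pair_code (replicate j True) x) <= 2 * m (length x) + 1 + length x"
        using i by (simp add: length_pair_code)
      then show "length (g (pair_code (replicate j True) x)) <= b (2 * m (length x) + 1 + length x)"
        using b(3) monoD[OF b(2)] order.trans by blast
    qed
    also have "\<dots> = i * b (2 * m (length x) + 1 + length x)" by (simp add: sum_list_triv)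
    also have "\<dots> <= m (length x) * b (2 * m (length x) + 1 + length x)" using i by (intro mult_right_mono) auto
    finally show ?thesis unfolding it length_pair_code length_replicate using i by linarith
  qed
  have "polytime (\<lambda>x. (?step ^^ length (n x)) (?v x))" by (rule polytime_iterate[OF assms(1) v step q len])
  then have "polytime (\<lambda>x. unpair2 (unpair2 ((?step ^^ length (n x)) (?v x))))" by (intro polytime_basic)
  then show ?thesis by (simp add: it)
qed

lemma polytime_ones: "polytime f ==> polytime (\<lambda>x. replicate (length (f x)) True)"
proof -
  have "transduce (\<lambda>q b. (0, [True])) (\<lambda>_. []) x 0 = replicate (length x) True" for x by (induction x) auto
  then have "polytime (\<lambda>x. replicate (length x) True)"
    using polytime_transduce[of 0 "\<lambda>q b. (0, [True])" 0 "\<lambda>_. []"] by simp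
  then show "polytime f ==> ?thesis" using polytime_comp[of "\<lambda>x. replicate (length x) True" f] by simp
qed

lemma concat_map_replicate_const:
  "concat (map (\<lambda>_. replicate k a) [0..<n]) = replicate (n * k) a"
  by (induction n) (simp_all add: replicate_add[symmetric] add.commute)

lemma polytime_mult:
  assumes "polytime f" "polytime g"
  shows "polytime (\<lambda>x. replicate (length (f x) * length (g x)) True)"
proof -
  have "polytime (\<lambda>z. replicate (length (g (unpair2 z))) True)"
    by (intro polytime_ones polytime_comp[OF assms(2)] polytime_basic)
  from polytime_concat_map[OF assms(1) this] show ?thesis by (simp add: concat_map_replicate_const)
qed

lemma polytime_power: "polytime f ==> polytime (\<lambda>x. replicate (length (f x) ^ k) True)"
proof (induction k)
  case (Suc k)
  from polytime_mult[OF Suc.prems Suc.IH[OF Suc.prems]] show ?case by simp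
qed (simp add: polytime_const)

text \<open>The least significant bit comes first, so the carry travels in reading direction: state
  0 carries, state 1 copies, and a carry that survives the last bit appends a new one. Iterating
  this increment converts unary to binary.\<close>

lemma nat_bits_Suc_transduce:
  "transduce (\<lambda>q b. if q = 0 then (if b then (0, [False]) else (1, [True])) else (1, [b]))
     (\<lambda>q. if q = 0 then [True] else []) (nat_bits n) 0 = nat_bits (Suc n)"
proof (induction n rule: less_induct)
  case (less n)
  let ?D = "\<lambda>q b. if q = 0 then (if b then (0, [False]) else (1, [True])) else (1::nat, [b])"
  have 1: "transduce ?D (\<lambda>q. if q = 0 then [True] else []) x 1 = x" for x by (induction x) auto
  show ?case
  proof (cases "n = 0")
    case True then show ?thesis by (simp add: nat_bits_0 nat_bits_pos)
  next
    case False show ?thesis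
    proof (cases "odd n")
      case True then have "Suc n div 2 = Suc (n div 2)" by presburger
      then show ?thesis using less.IH[of "n div 2"] False True by (simp add: nat_bits_pos)
    next
      case even: False then have "Suc n div 2 = n div 2" by presburger
      then show ?thesis using False even 1 by (simp add: nat_bits_pos)
    qed
  qed
qed

lemma length_nat_bits: "length (nat_bits n) <= n"
proof (induction n rule: less_induct)
  case (less n) show ?case
  proof (cases "n = 0")
    case False then have "length (nat_bits (n div 2)) <= n div 2" by (intro less) simp
    then show ?thesis using False by (simp add: nat_bits_pos)
  qed (simp add: nat_bits_0)
qed

lemma polytime_nat_bits:
  assumes "polytime f"
  shows "polytime (\<lambda>x. nat_bits (length (f x)))"
proof -
  define inc where "inc x = transduce (\<lambda>q b. if q = 0 then (if b then (0, [False]) else (1, [True])) else (1, [b]))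
     (\<lambda>q. if q = 0 then [True] else []) x (0::nat)" for x
  have inc: "polytime inc" unfolding inc_def[abs_def] by (rule polytime_transduce[of 1]) auto
  have it: "(inc ^^ i) [] = nat_bits i" for i
    by (induction i) (simp_all add: nat_bits_0 inc_def nat_bits_Suc_transduce)
  obtain b where b: "poly_bounded b" "\<And>x. length (f x) <= b (length x)"
    using polytime_length_bound[OF assms] by blast
  have "polytime (\<lambda>x. (inc ^^ length (f x)) [])" by (rule polytime_iterate[OF assms polytime_const inc b(1)])
      (unfold it, meson b(2) length_nat_bits order.trans)
  then show ?thesis by (simp add: it)
qed

lemma polytime_concat_list:
  "(\<And>a. a \<in> set as ==> polytime (F a)) ==> polytime (\<lambda>x. concat (map (\<lambda>a. F a x) as))"
  by (induction as) (auto intro!: polytime_const polytime_append)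

section \<open>Cost geometry: layouts with one intermediate layer and the price of splitting a
  group\<close>

section \<open>Layouts of height two\<close>

lemma ex_layer:
  assumes "is_rooted_forest L" "v \<in> verts L"
  shows "\<exists>k. \<exists>r \<in> roots L. (v, r) \<in> edges L ^^ k"
proof -
  have fin: "finite (edges L)"
    using assms(1) by (auto simp: is_rooted_forest_def intro: finite_subset[OF _ finite_cartesian_product])
  have "wf ((edges L)\<inverse>)"
    using assms(1) fin by (intro finite_acyclic_wf_converse) (auto simp: is_rooted_forest_def)
  then show ?thesis using assms(2)
  proof (induction v rule: wf_induct_rule)
    case (less v) show ?case
    proof (cases "v \<in> Domain (edges L)")
      case True
      then obtain u where u: "(v, u) \<in> edges L" by blast
      then have "u \<in> verts L" using assms(1) by (auto simp: is_rooted_forest_def)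
      with less.IH[of u] u obtain k r where "r \<in> roots L" "(u, r) \<in> edges L ^^ k" by auto
      then show ?thesis using u by (intro exI[of _ "Suc k"] bexI[of _ r]) (metis relpow_Suc_I2)+
    next
      case False then have "v \<in> roots L" using less.prems by (simp add: roots_def)
      then show ?thesis by (intro exI[of _ 0]) auto
    qed
  qed
qed

lemma layer_unique:
  assumes "single_valued (edges L)" "(v, r) \<in> edges L ^^ k" "(v, r') \<in> edges L ^^ k'"
    "r \<in> roots L" "r' \<in> roots L"
  shows "k = k' & r = r'"
  using assms(2,3)
proof (induction k arbitrary: v k')
  case 0 show ?case
  proof (cases k')
    case (Suc k'')
    from relpow_Suc_D2[OF 0(2)[unfolded Suc]] show ?thesis using 0(1) assms(4) by (auto simp: roots_def)
  qed (use 0 in simp)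
next
  case (Suc k)
  from relpow_Suc_D2[OF Suc.prems(1)] obtain u where u: "(v, u) \<in> edges L" "(u, r) \<in> edges L ^^ k" by blast
  then obtain k'' where k'': "k' = Suc k''"
    using Suc.prems(2) assms(5) by (cases k') (auto simp: roots_def)
  from relpow_Suc_D2[OF Suc.prems(2)[unfolded k'']] obtain u' where
    u': "(v, u') \<in> edges L" "(u', r') \<in> edges L ^^ k''" by blast
  have "u = u'" using assms(1) u(1) u'(1) by (meson single_valuedD)
  with Suc.IH[OF u(2)] u'(2) k'' show ?case by auto
qed

lemma layer_eq:
  assumes "is_rooted_forest L" "r \<in> roots L" "(v, r) \<in> edges L ^^ k"
  shows "layer L v = k"
  unfolding layer_def
proof (rule the_equality)
  show "\<exists>r\<in>roots L. (v, r) \<in> edges L ^^ k" using assms by blast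
  fix k' assume "\<exists>r\<in>roots L. (v, r) \<in> edges L ^^ k'"
  then show "k' = k" using assms layer_unique by (auto simp: is_rooted_forest_def dest: layer_unique)
qed

lemma layer_0_root: "is_rooted_forest L ==> v \<in> verts L ==> layer L v = 0 ==> v \<in> roots L"
  using ex_layer[of L v] layer_eq[of L _ v] by fastforce

lemma layer_edge:
  assumes "is_rooted_forest L" "(u, v) \<in> edges L"
  shows "layer L u = Suc (layer L v)"
proof -
  have "v \<in> verts L" using assms by (auto simp: is_rooted_forest_def)
  then obtain k r where "r \<in> roots L" "(v, r) \<in> edges L ^^ k" using ex_layer[OF assms(1)] by blast
  moreover from this have "(u, r) \<in> edges L ^^ Suc k" using assms(2) by (rule_tac relpow_Suc_I2)
  ultimately show ?thesis using layer_eq[OF assms(1)] by metis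
qed

text \<open>A Steiner vertex is not a leaf and therefore has a child. That child is two layers above
  the parent of the Steiner vertex and in layer at most 2, so the parent is a root. Hence no two
  Steiner vertices are adjacent.\<close>

lemma edge_cases:
  assumes top: "is_topology I L" and one: "intermediate_layers I = 1" and e: "(u, v) \<in> edges L"
  shows "(\<exists>s \<in> sources I. u = Source s & (\<exists>t \<in> sinks I. v = Sink t & v \<in> roots L)) \<or>
    (\<exists>s \<in> sources I. u = Source s & (\<exists>z. v = Steiner z)) \<or>
    (\<exists>z. u = Steiner z & (\<exists>t \<in> sinks I. v = Sink t & v \<in> roots L))"
proof -
  have f: "is_rooted_forest L" and lay: "\<And>v. v \<in> verts L ==> layer L v <= 2"
    and lv: "leaves L = Source ` sources I" and rt: "roots L \<subseteq> Sink ` sinks I"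
    and st: "verts L - leaves L - roots L \<subseteq> range Steiner"
    using top one by (auto simp: is_topology_def)
  have uv: "u \<in> verts L" "v \<in> verts L" using f e by (auto simp: is_rooted_forest_def)
  have "u \<notin> roots L" "v \<notin> leaves L" using e by (auto simp: roots_def leaves_def)
  then consider (A) s where "s \<in> sources I" "u = Source s" | (B) z where "u = Steiner z"
    using uv lv st by blast
  then show ?thesis
  proof cases
    case A then show ?thesis using uv st rt \<open>v \<notin> leaves L\<close> by blast
  next
    case B then have "u \<notin> leaves L" using lv by auto
    then obtain w where w: "(w, u) \<in> edges L" using uv by (auto simp: leaves_def)
    then have "w \<in> verts L" using f by (auto simp: is_rooted_forest_def)
    then have "layer L v = 0" using layer_edge[OF f w] layer_edge[OF f e] lay by fastforce
    then have "v \<in> roots L" using layer_0_root[OF f uv(2)] by simp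
    then show ?thesis using B rt by blast
  qed
qed

text \<open>The sink of a source, in a form that a decoder can follow through the edge list in at
  most two lookups.\<close>

definition connects :: "('s, 't) layout => 's => 't => bool" where
  "connects L s t \<longleftrightarrow> (Source s, Sink t) \<in> edges L \<or>
     (\<exists>z. (Source s, Steiner z) \<in> edges L & (Steiner z, Sink t) \<in> edges L)"

locale two_level =
  fixes I :: "('s, 't) flamecast" and L :: "('s, 't) layout"
  assumes inst: "is_instance I" and one: "intermediate_layers I = 1"
    and valid: "L \<in> valid_layouts I"
begin

definition par :: "('s, 't) vertex => ('s, 't) vertex" where
  "par u = (THE v. (u, v) \<in> edges L)"

lemma top: "is_topology I L" "is_rooted_forest L" and emb: "is_embedding I L"
  and fin: "finite (sources I)" "finite (verts L)"
  using valid inst by (auto simp: valid_layouts_def is_valid_topology_def is_topology_def is_instance_def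
      is_rooted_forest_def)

lemma sv: "(u, v) \<in> edges L ==> (u, v') \<in> edges L ==> v = v'"
  using top(2) by (auto simp: is_rooted_forest_def dest: single_valuedD)

lemma par_eq: "(u, v) \<in> edges L ==> par u = v"
  unfolding par_def using sv by blast

lemma source_vert: "s \<in> sources I ==> Source s \<in> verts L"
  using top(1) by (auto simp: is_topology_def leaves_def)

lemma par_source: "s \<in> sources I ==> (Source s, par (Source s)) \<in> edges L"
proof -
  assume s: "s \<in> sources I"
  have "Source s \<notin> roots L" using top(1) by (auto simp: is_topology_def)
  then obtain v where "(Source s, v) \<in> edges L" using source_vert[OF s] by (auto simp: roots_def)
  then show ?thesis using par_eq by simp
qed

lemma par_steiner: "Steiner z \<in> verts L ==> (Steiner z, par (Steiner z)) \<in> edges L"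
proof -
  assume z: "Steiner z \<in> verts L"
  have "Steiner z \<notin> roots L" using top(1) by (auto simp: is_topology_def)
  then obtain v where "(Steiner z, v) \<in> edges L" using z by (auto simp: roots_def)
  then show ?thesis using par_eq by simp
qed

definition steiners :: "nat set" where
  "steiners = {z. Steiner z \<in> verts L}"

lemma finite_steiners: "finite steiners"
proof -
  have "Steiner ` steiners \<subseteq> verts L" by (auto simp: steiners_def)
  then have "finite (Steiner ` steiners :: ('s, 't) vertex set)" using fin(2) finite_subset by blast
  then show ?thesis by (rule finite_imageD) (auto simp: inj_on_def)
qed

lemma edges_eq: "edges L = (\<lambda>s. (Source s, par (Source s))) ` sources I \<union>
    (\<lambda>z. (Steiner z, par (Steiner z))) ` steiners"
proof (intro equalityI subsetI)
  fix e assume e: "e \<in> edges L"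
  obtain u v where uv: "e = (u, v)" by fastforce
  have "u \<in> verts L" using e uv top(2) by (auto simp: is_rooted_forest_def)
  with edge_cases[OF top(1) one e[unfolded uv]] par_eq[OF e[unfolded uv]] uv
  show "e \<in> (\<lambda>s. (Source s, par (Source s))) ` sources I \<union>
    (\<lambda>z. (Steiner z, par (Steiner z))) ` steiners" by (auto simp: steiners_def)
next
  fix e :: "('s, 't) vertex \<times> ('s, 't) vertex"
  assume "e \<in> (\<lambda>s. (Source s, par (Source s))) ` sources I \<union>
    (\<lambda>z. (Steiner z, par (Steiner z))) ` steiners"
  then show "e \<in> edges L" using par_source par_steiner by (auto simp: steiners_def)
qed

lemma par_steiner_sink: "z \<in> steiners ==> \<exists>t \<in> sinks I. par (Steiner z) = Sink t & Sink t \<in> roots L"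
  using edge_cases[OF top(1) one par_steiner, of z] by (fastforce simp: steiners_def)

lemma par_source_cases: "s \<in> sources I ==>
    (\<exists>t \<in> sinks I. par (Source s) = Sink t & Sink t \<in> roots L) \<or>
    (\<exists>z \<in> steiners. par (Source s) = Steiner z)"
proof -
  assume s: "s \<in> sources I"
  have "par (Source s) \<in> verts L" using par_source[OF s] top(2) by (auto simp: is_rooted_forest_def)
  then show ?thesis using edge_cases[OF top(1) one par_source[OF s]] by (auto simp: steiners_def)
qed

lemma source_not_range: "(u, Source s) \<notin> edges L"
  using edge_cases[OF top(1) one, of u "Source s"] by auto

lemma rtrancl_source: "(u, Source s) \<in> (edges L)\<^sup>* \<longleftrightarrow> u = Source s"
  using source_not_range by (auto elim: rtranclE)

lemma load_source: "s \<in> sources I ==> load I L (Source s) = 1"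
proof -
  assume "s \<in> sources I"
  then have "{s' \<in> sources I. (Source s', Source s) \<in> (edges L)\<^sup>*} = {s}" by (auto simp: rtrancl_source)
  then show ?thesis by (simp add: load_def)
qed

lemma rtrancl_steiner: "(Source s, Steiner z) \<in> (edges L)\<^sup>* \<longleftrightarrow> (Source s, Steiner z) \<in> edges L"
proof
  assume "(Source s, Steiner z) \<in> (edges L)\<^sup>*"
  then obtain u where u: "(Source s, u) \<in> (edges L)\<^sup>*" "(u, Steiner z) \<in> edges L" by (auto elim: rtranclE)
  then have "\<exists>s'. u = Source s'" using edge_cases[OF top(1) one u(2)] by auto
  then have "u = Source s" using u(1) rtrancl_source by auto
  then show "(Source s, Steiner z) \<in> edges L" using u by simp
qed auto

lemma load_steiner: "load I L (Steiner z) = card {s \<in> sources I. par (Source s) = Steiner z}"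
proof -
  have "{s \<in> sources I. (Source s, Steiner z) \<in> (edges L)\<^sup>*} = {s \<in> sources I. par (Source s) = Steiner z}"
    by (rule Collect_cong) (metis par_source par_eq rtrancl_steiner)
  then show ?thesis by (simp add: load_def)
qed

lemma connects_unique: "connects L s t ==> connects L s t' ==> t = t'"
  unfolding connects_def using sv by (metis vertex.distinct(6) vertex.inject(2) vertex.inject(3))

lemma ex_connects: "s \<in> sources I ==> \<exists>t \<in> sinks I. connects L s t"
proof -
  assume s: "s \<in> sources I"
  note e = par_source[OF s]
  from par_source_cases[OF s] show ?thesis
  proof
    assume "\<exists>t \<in> sinks I. par (Source s) = Sink t & Sink t \<in> roots L"
    then show ?thesis using e by (auto simp: connects_def)
  next
    assume "\<exists>z \<in> steiners. par (Source s) = Steiner z"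
    then obtain z where z: "z \<in> steiners" "par (Source s) = Steiner z" by blast
    from par_steiner_sink[OF z(1)] obtain t where "t \<in> sinks I" "par (Steiner z) = Sink t" by blast
    with z par_steiner[of z] e show ?thesis
      unfolding connects_def steiners_def by (intro bexI[of _ t]) auto
  qed
qed

lemma connects_capacity:
  shows "card {s \<in> sources I. connects L s t} <= capacities I ! 0"
proof (cases "\<exists>s \<in> sources I. connects L s t")
  case True
  then obtain u where u: "(u, Sink t) \<in> edges L" by (auto simp: connects_def)
  then have r: "Sink t \<in> roots L" using edge_cases[OF top(1) one u] by auto
  then have "layer L (Sink t) = 0" using layer_eq[OF top(2) r, of "Sink t" 0] by simp
  moreover have "Sink t \<in> verts L" using r by (simp add: roots_def)
  ultimately have "load I L (Sink t) <= capacities I ! 0"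
    using valid by (auto simp: valid_layouts_def is_valid_topology_def)
  moreover have "card {s \<in> sources I. connects L s t} <= load I L (Sink t)"
    unfolding load_def using fin(1) by (intro card_mono) (auto simp: connects_def intro: rtrancl_trans)
  ultimately show ?thesis by simp
next
  case False then have "{s \<in> sources I. connects L s t} = {}" by auto
  then show ?thesis by (metis card.empty zero_le)
qed

text \<open>Edges leaving a source have load 1 and cost their plain length; only the edges out of
  Steiner vertices profit from the exponent.\<close>

lemma layout_cost_eq: "layout_cost I L =
    (\<Sum>s \<in> sources I. norm (source_pos I s - pos L (par (Source s)))) +
    (\<Sum>z \<in> steiners. norm (pos L (Steiner z) - pos L (par (Steiner z))) *
       real (card {s \<in> sources I. par (Source s) = Steiner z}) powr alpha I)"
proof -
  let ?f = "\<lambda>(u, v). norm (pos L u - pos L v) * real (load I L u) powr alpha I"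
  have "layout_cost I L = sum ?f ((\<lambda>s. (Source s, par (Source s))) ` sources I) +
     sum ?f ((\<lambda>z. (Steiner z, par (Steiner z))) ` steiners)"
    unfolding layout_cost_def edges_eq by (rule sum.union_disjoint) (use fin finite_steiners in auto)
  also have "sum ?f ((\<lambda>s. (Source s, par (Source s))) ` sources I) =
      (\<Sum>s \<in> sources I. norm (source_pos I s - pos L (par (Source s))))"
    by (subst sum.reindex) (use emb source_vert load_source in \<open>auto simp: inj_on_def is_embedding_def intro!: sum.cong\<close>)
  also have "sum ?f ((\<lambda>z. (Steiner z, par (Steiner z))) ` steiners) =
      (\<Sum>z \<in> steiners. norm (pos L (Steiner z) - pos L (par (Steiner z))) *
       real (card {s \<in> sources I. par (Source s) = Steiner z}) powr alpha I)"
    by (subst sum.reindex) (auto simp: inj_on_def load_steiner intro!: sum.cong)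
  finally show ?thesis .
qed

end

section \<open>Near-optimal layouts do not split groups\<close>

text \<open>The smaller of two losses: \<open>1 / 4\<close> is paid for a foreign source in a bundle
  or for a sink that is farther than the nearest one by \<open>1 / 4\<close>, and
  \<open>1 - 2 powr (\<alpha> - 1)\<close> for a bundle with at most half of a group whose nearest
  sink has distance at least 1.\<close>

definition split_gap :: "real => real" where
  "split_gap \<alpha> = min (1 / 4) (1 - 2 powr (\<alpha> - 1))"

lemma split_gap_pos: "\<alpha> < 1 ==> 0 < split_gap \<alpha>"
  using powr_less_mono[of "\<alpha> - 1" 0 2] by (simp add: split_gap_def)

definition group_size :: "('s, 't) flamecast => point => nat" where
  "group_size I p = card {s \<in> sources I. source_pos I s = p}"

text \<open>A bundle is a set of sources sharing a Steiner vertex at \<open>z\<close>; its nominal cost charges every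
  source of the group at \<open>p\<close> an equal part of \<open>d p * group_size p powr \<alpha>\<close>.\<close>

locale separated =
  fixes I :: "('s, 't) flamecast" and d :: "point => real"
  assumes inst: "is_instance I" and alpha: "alpha I < 1"
    and sep: "\<And>s s'. s \<in> sources I ==> s' \<in> sources I ==> source_pos I s ~= source_pos I s' ==>
      1 <= norm (source_pos I s - source_pos I s')"
    and d_nonneg: "\<And>p. 0 <= d p"
    and d_min: "\<And>s t. s \<in> sources I ==> t \<in> sinks I ==> d (source_pos I s) <= norm (source_pos I s - sink_pos I t)"
    and small: "\<And>s. s \<in> sources I ==>
      d (source_pos I s) * real (group_size I (source_pos I s)) powr (alpha I - 1) <= 1 / 4"
begin

abbreviation "\<alpha> \<equiv> alpha I"
abbreviation "sp \<equiv> source_pos I"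

definition nominal :: "point => real" where
  "nominal p = d p * real (group_size I p) powr (\<alpha> - 1)"

lemma alpha_nonneg: "0 <= \<alpha>" and finS: "finite (sources I)"
  using inst by (auto simp: is_instance_def)

text \<open>Let \<open>p\<close> be the position of a source of \<open>X\<close> nearest to
  \<open>z\<close>. A source elsewhere has distance at least 1 from \<open>p\<close>, hence at least
  \<open>1 / 2\<close> from \<open>z\<close>, against a nominal share of at most
  \<open>1 / 4\<close>: each of these \<open>l\<close> sources adds \<open>1 / 4\<close> to
  \<open>E\<close>. For the \<open>k\<close> sources at \<open>p\<close>, the triangle inequality
  together with \<open>real k powr \<alpha> \<le> real k\<close> and \<open>k \<le> card X\<close>
  shows that the route through \<open>z\<close> is no cheaper than a bundle of \<open>k\<close>
  going straight from \<open>p\<close> to the sink. What remains is the detour beyond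
  \<open>d p\<close> and \<open>d p * q\<close>, where \<open>q\<close> compares \<open>k\<close>
  sources travelling alone with \<open>k\<close> shares of the whole group; \<open>q\<close> is
  nonnegative because \<open>x powr (\<alpha> - 1)\<close> decreases.\<close>

lemma bundle_excess:
  fixes z :: point and t :: 't
  assumes X: "X \<subseteq> sources I" "X ~= {}" and t: "t \<in> sinks I"
  defines "E \<equiv> (\<Sum>s\<in>X. norm (sp s - z)) + norm (z - sink_pos I t) * real (card X) powr \<alpha> - (\<Sum>s\<in>X. nominal (sp s))"
  shows "0 <= E" and "E < split_gap \<alpha> ==> \<exists>p. (\<forall>s\<in>X. sp s = p) &
    norm (p - sink_pos I t) < d p + 1 / 4 & (1 <= d p --> group_size I p < 2 * card X)"
proof -
  have finX: "finite X" using X(1) finS finite_subset by blast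
  obtain s0 where s0: "s0 \<in> X" "\<And>s. s \<in> X ==> norm (sp s0 - z) <= norm (sp s - z)"
  proof -
    have "Min ((\<lambda>s. norm (sp s - z)) ` X) \<in> (\<lambda>s. norm (sp s - z)) ` X"
      using finX X(2) by (intro Min_in) auto
    then obtain s0 where "s0 \<in> X" "norm (sp s0 - z) = Min ((\<lambda>s. norm (sp s - z)) ` X)" by force
    then show ?thesis using that[of s0] finX by auto
  qed
  define p where "p = sp s0"
  define Y where "Y = {s \<in> X. sp s = p}"
  define k a l where "k = card Y" and "a = group_size I p" and "l = card (X - Y)"
  have Y: "Y \<subseteq> X" "s0 \<in> Y" "finite Y" using s0 finX by (auto simp: Y_def p_def)
  have k1: "1 <= k" using Y by (metis k_def card_0_eq empty_iff less_one not_le)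
  have ka: "k <= a" unfolding k_def a_def group_size_def using X(1) finS by (intro card_mono) (auto simp: Y_def)
  have cX: "card X = k + l" unfolding k_def l_def using Y finX
    by (metis card_Diff_subset card_mono le_add_diff_inverse)
  have far: "1 / 2 <= norm (sp s - z)" if "s \<in> X - Y" for s
  proof -
    have "1 <= norm (sp s0 - sp s)" using that s0 X(1) by (intro sep) (auto simp: Y_def p_def)
    also have "\<dots> <= norm (sp s0 - z) + norm (sp s - z)"
      using norm_triangle_sub[of "sp s0 - z" "sp s - z"] norm_triangle_ineq4[of "sp s0 - z" "sp s - z"] by simp
    also have "\<dots> <= 2 * norm (sp s - z)" using s0(2)[of s] that by simp
    finally show ?thesis by simp
  qed
  have nom: "nominal (sp s) <= 1 / 4" if "s \<in> X" for s
    using small[of s] that X(1) by (auto simp: nominal_def)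
  have split: "sum f X = sum f Y + sum f (X - Y)" for f :: "'s => real"
    using Y finX by (metis add.commute sum.subset_diff)
  have "real l * (1 / 2) <= (\<Sum>s\<in>X - Y. norm (sp s - z))"
    unfolding l_def by (rule sum_bounded_below[of "X - Y" "1/2"]) (rule far)
  moreover have "(\<Sum>s\<in>Y. norm (sp s - z)) = real k * norm (p - z)" by (simp add: Y_def k_def)
  moreover have "(\<Sum>s\<in>X - Y. nominal (sp s)) <= real l * (1 / 4)"
    unfolding l_def by (rule sum_bounded_above[of "X - Y" _ "1/4"]) (use nom in auto)
  moreover have "(\<Sum>s\<in>Y. nominal (sp s)) = real k * nominal p" by (simp add: Y_def k_def)
  ultimately have E1: "real l / 4 + real k * norm (p - z) + norm (z - sink_pos I t) * real (card X) powr \<alpha>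
      - real k * nominal p <= E"
    unfolding E_def split by linarith
  have kk: "real k powr \<alpha> <= real (card X) powr \<alpha>"
    using alpha_nonneg by (intro powr_mono2) (auto simp: cX)
  have kp: "real k powr \<alpha> <= real k" "1 <= real k powr \<alpha>"
    using powr_mono[of \<alpha> 1 "real k"] alpha k1 ge_one_powr_ge_zero[of "real k" \<alpha>] alpha_nonneg by auto
  have "real k powr \<alpha> * norm (p - sink_pos I t) <= real k powr \<alpha> * (norm (p - z) + norm (z - sink_pos I t))"
    using norm_triangle_ineq[of "p - z" "z - sink_pos I t"] by (intro mult_left_mono) simp_all
  also have "\<dots> <= real k * norm (p - z) + norm (z - sink_pos I t) * real (card X) powr \<alpha>"
    using mult_right_mono[OF kp(1), of "norm (p - z)"] mult_right_mono[OF kk, of "norm (z - sink_pos I t)"]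
    by (simp add: algebra_simps)
  finally have E2: "real l / 4 + real k powr \<alpha> * norm (p - sink_pos I t) - real k * nominal p <= E"
    using E1 by linarith
  have pos: "0 < real k" "0 < real a" using k1 ka by auto
  define q where "q = real k powr \<alpha> - real k * real a powr (\<alpha> - 1)"
  have E3: "real l / 4 + real k powr \<alpha> * (norm (p - sink_pos I t) - d p) + d p * q <= E"
    using E2 by (simp add: nominal_def q_def a_def algebra_simps)
  have kal: "real k * real k powr (\<alpha> - 1) = real k powr \<alpha>"
    using pos by (simp add: powr_diff)
  have q0: "0 <= q"
  proof -
    have "real a powr (\<alpha> - 1) <= real k powr (\<alpha> - 1)"
      using ka pos alpha by (intro powr_mono2') auto
    then have "real k * real a powr (\<alpha> - 1) <= real k * real k powr (\<alpha> - 1)" by (intro mult_left_mono) auto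
    then show ?thesis unfolding q_def kal by simp
  qed
  have dm: "d p <= norm (p - sink_pos I t)" using d_min[of s0 t] s0(1) X(1) t by (auto simp: p_def)
  have t1: "0 <= real k powr \<alpha> * (norm (p - sink_pos I t) - d p)" using dm by simp
  have t2: "0 <= d p * q" using d_nonneg q0 by simp
  show "0 <= E" using E3 t1 t2 by linarith
  assume E: "E < split_gap \<alpha>"
  then have E': "E < 1 / 4" "E < 1 - 2 powr (\<alpha> - 1)" by (auto simp: split_gap_def)
  have "l = 0" using E3 t1 t2 E'(1) by linarith
  then have "X = Y" using Y finX by (auto simp: l_def)
  then have same: "\<forall>s\<in>X. sp s = p" by (auto simp: Y_def)
  have "real k powr \<alpha> * (norm (p - sink_pos I t) - d p) < 1 / 4" using E3 t2 E'(1) by linarith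
  moreover have "norm (p - sink_pos I t) - d p <= real k powr \<alpha> * (norm (p - sink_pos I t) - d p)"
    using mult_right_mono[OF kp(2), of "norm (p - sink_pos I t) - d p"] dm by simp
  ultimately have near: "norm (p - sink_pos I t) < d p + 1 / 4" by linarith
  \<comment> \<open>If the group is at least twice as large as the bundle, then each share is
    smaller by the factor \<open>2 powr (\<alpha> - 1)\<close>, so \<open>q\<close> and with it
    \<open>E\<close> reaches the second term of \<open>split_gap\<close>.\<close>
  have "a < 2 * card X" if "1 <= d p"
  proof (rule ccontr)
    assume "~ a < 2 * card X"
    then have a: "2 * real k <= real a" using cX \<open>l = 0\<close> by simp
    have "real a powr (\<alpha> - 1) <= (2 * real k) powr (\<alpha> - 1)"
      using a pos alpha by (intro powr_mono2') auto
    also have "\<dots> = 2 powr (\<alpha> - 1) * real k powr (\<alpha> - 1)" by (simp add: powr_mult)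
    finally have "real k * real a powr (\<alpha> - 1) <= real k * (2 powr (\<alpha> - 1) * real k powr (\<alpha> - 1))"
      by (intro mult_left_mono) auto
    also have "\<dots> = 2 powr (\<alpha> - 1) * real k powr \<alpha>" using kal by (simp add: algebra_simps)
    finally have "(1 - 2 powr (\<alpha> - 1)) * real k powr \<alpha> <= q" unfolding q_def by (simp add: algebra_simps)
    moreover have "0 <= 1 - 2 powr (\<alpha> - 1)" using split_gap_pos[OF alpha] by (simp add: split_gap_def)
    then have "1 - 2 powr (\<alpha> - 1) <= (1 - 2 powr (\<alpha> - 1)) * real k powr \<alpha>"
      using mult_left_mono[OF kp(2), of "1 - 2 powr (\<alpha> - 1)"] by simp
    moreover have "q <= d p * q" using mult_right_mono[OF that q0] by simp
    ultimately show False using E3 t1 E'(2) by linarith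
  qed
  then show "\<exists>p. (\<forall>s\<in>X. sp s = p) &
    norm (p - sink_pos I t) < d p + 1 / 4 & (1 <= d p --> group_size I p < 2 * card X)"
    using same near a_def by blast
qed

end


locale near_optimal = separated I d + two_level I L
  for I :: "('s, 't) flamecast" and d and L :: "('s, 't) layout"
begin

definition "direct = {s \<in> sources I. \<exists>t \<in> sinks I. par (Source s) = Sink t}"
definition "at_steiner z = {s \<in> sources I. par (Source s) = Steiner z}"
definition "excess1 s = norm (sp s - pos L (par (Source s))) - nominal (sp s)"
definition "excess2 z = (\<Sum>s\<in>at_steiner z. norm (sp s - pos L (Steiner z))) +
   norm (pos L (Steiner z) - pos L (par (Steiner z))) * real (card (at_steiner z)) powr \<alpha> -
   (\<Sum>s\<in>at_steiner z. nominal (sp s))"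

lemma sum_sources: "(\<Sum>s\<in>sources I. f s) = (\<Sum>s\<in>direct. f s) + (\<Sum>z\<in>steiners. \<Sum>s\<in>at_steiner z. f s)"
  for f :: "'s => real"
proof -
  have "sources I = direct \<union> (\<Union>z\<in>steiners. at_steiner z)"
    using par_source_cases by (fastforce simp: direct_def at_steiner_def)
  moreover have "direct \<inter> (\<Union>z\<in>steiners. at_steiner z) = {}" by (auto simp: direct_def at_steiner_def)
  moreover have "finite direct" "\<And>z. finite (at_steiner z)" using finS by (auto simp: direct_def at_steiner_def)
  ultimately have "sum f (sources I) = sum f direct + sum f (\<Union>z\<in>steiners. at_steiner z)"
    using finite_steiners by (simp add: sum.union_disjoint)
  also have "sum f (\<Union>z\<in>steiners. at_steiner z) = (\<Sum>z\<in>steiners. sum f (at_steiner z))"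
    using finite_steiners \<open>\<And>z. finite (at_steiner z)\<close> by (intro sum.UNION_disjoint) (auto simp: at_steiner_def)
  finally show ?thesis .
qed

lemma cost_excess: "layout_cost I L = (\<Sum>s\<in>sources I. nominal (sp s)) +
    ((\<Sum>s\<in>direct. excess1 s) + (\<Sum>z\<in>steiners. excess2 z))"
proof -
  have eq: "norm (sp s - pos L (par (Source s))) = norm (sp s - pos L (Steiner z))" if "s \<in> at_steiner z" for s z
    using that by (simp add: at_steiner_def)
  show ?thesis
    unfolding layout_cost_eq sum_sources excess1_def excess2_def at_steiner_def[symmetric]
    by (simp add: sum.distrib sum_subtractf eq cong: sum.cong)
qed

lemma sink_pos_root: "Sink t \<in> roots L ==> pos L (Sink t) = sink_pos I t"
  using emb by (auto simp: is_embedding_def roots_def)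

text \<open>A source joined directly to a sink is treated as a bundle of one whose Steiner vertex
  lies on the sink.\<close>

lemma direct_bundle:
  assumes "s \<in> direct"
  shows "0 <= excess1 s" "excess1 s < split_gap \<alpha> ==> \<exists>t \<in> sinks I. connects L s t &
    norm (sp s - sink_pos I t) < d (sp s) + 1 / 4 & (1 <= d (sp s) --> group_size I (sp s) < 2 * card {s})"
proof -
  have s: "s \<in> sources I" using assms by (simp add: direct_def)
  then obtain t where t: "t \<in> sinks I" "par (Source s) = Sink t" "Sink t \<in> roots L"
    using par_source_cases[OF s] assms by (auto simp: direct_def)
  note b = bundle_excess[of "{s}" t "sink_pos I t"]
  have e: "excess1 s = (\<Sum>s\<in>{s}. norm (sp s - sink_pos I t)) +
      norm (sink_pos I t - sink_pos I t) * real (card {s}) powr \<alpha> - (\<Sum>s\<in>{s}. nominal (sp s))"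
    using t sink_pos_root by (simp add: excess1_def)
  show "0 <= excess1 s" unfolding e using b(1) s t by simp
  assume "excess1 s < split_gap \<alpha>"
  then obtain p where p: "\<forall>s'\<in>{s}. sp s' = p" "norm (p - sink_pos I t) < d p + 1 / 4"
    "1 <= d p --> group_size I p < 2 * card {s}"
    using b(2) s t(1) unfolding e by blast
  moreover have "connects L s t" using par_source[OF s] t by (simp add: connects_def)
  ultimately show "\<exists>t \<in> sinks I. connects L s t &
    norm (sp s - sink_pos I t) < d (sp s) + 1 / 4 & (1 <= d (sp s) --> group_size I (sp s) < 2 * card {s})"
    using t(1) by auto
qed

lemma steiner_bundle:
  assumes "z \<in> steiners"
  shows "0 <= excess2 z" "excess2 z < split_gap \<alpha> ==> \<exists>p. \<exists>t \<in> sinks I.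
    (\<forall>s \<in> at_steiner z. connects L s t & sp s = p) &
    norm (p - sink_pos I t) < d p + 1 / 4 & (1 <= d p --> group_size I p < 2 * card (at_steiner z))"
proof -
  obtain t where t: "t \<in> sinks I" "par (Steiner z) = Sink t" "Sink t \<in> roots L"
    using par_steiner_sink[OF assms] by blast
  have zv: "Steiner z \<in> verts L" using assms by (simp add: steiners_def)
  have "Steiner z \<notin> leaves L" using top(1) by (auto simp: is_topology_def)
  then obtain w where w: "(w, Steiner z) \<in> edges L" using zv by (auto simp: leaves_def)
  then obtain s where "s \<in> sources I" "w = Source s" using edge_cases[OF top(1) one w] by auto
  then have ne: "at_steiner z ~= {}" using w par_eq by (auto simp: at_steiner_def)
  have sub: "at_steiner z \<subseteq> sources I" by (auto simp: at_steiner_def)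
  note b = bundle_excess[OF sub ne t(1), of "pos L (Steiner z)"]
  have e: "excess2 z = (\<Sum>s\<in>at_steiner z. norm (sp s - pos L (Steiner z))) +
   norm (pos L (Steiner z) - sink_pos I t) * real (card (at_steiner z)) powr \<alpha> -
   (\<Sum>s\<in>at_steiner z. nominal (sp s))"
    using t sink_pos_root by (simp add: excess2_def)
  show "0 <= excess2 z" unfolding e by (rule b(1))
  assume "excess2 z < split_gap \<alpha>"
  then obtain p where p: "\<forall>s\<in>at_steiner z. sp s = p" "norm (p - sink_pos I t) < d p + 1 / 4"
    "1 <= d p --> group_size I p < 2 * card (at_steiner z)"
    using b(2) unfolding e by blast
  moreover have "connects L s t" if "s \<in> at_steiner z" for s
    using that par_source[of s] par_steiner[OF zv] t by (auto simp: connects_def at_steiner_def)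
  ultimately show "\<exists>p. \<exists>t \<in> sinks I.
    (\<forall>s \<in> at_steiner z. connects L s t & sp s = p) &
    norm (p - sink_pos I t) < d p + 1 / 4 & (1 <= d p --> group_size I p < 2 * card (at_steiner z))"
    using t(1) by blast
qed

lemma cost_lower_bound: "(\<Sum>s\<in>sources I. nominal (sp s)) <= layout_cost I L"
  unfolding cost_excess using direct_bundle(1) steiner_bundle(1) by (simp add: add_nonneg_nonneg sum_nonneg)

text \<open>All excesses are nonnegative and their sum is below the gap, so each single one is;
  \<open>X\<close> is the bundle that contains \<open>s\<close>.\<close>

lemma ex_bundle:
  assumes near: "layout_cost I L < (\<Sum>s\<in>sources I. nominal (sp s)) + split_gap \<alpha>" and s: "s \<in> sources I"
  shows "\<exists>X t. s \<in> X & X \<subseteq> sources I & t \<in> sinks I & (\<forall>x\<in>X. connects L x t & sp x = sp s) &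
    norm (sp s - sink_pos I t) < d (sp s) + 1 / 4 & (1 <= d (sp s) --> group_size I (sp s) < 2 * card X)"
proof -
  have lt: "(\<Sum>s\<in>direct. excess1 s) + (\<Sum>z\<in>steiners. excess2 z) < split_gap \<alpha>"
    using near by (simp add: cost_excess)
  have fin: "finite direct" using finS by (simp add: direct_def)
  have nn: "0 <= (\<Sum>s\<in>direct. excess1 s)" "0 <= (\<Sum>z\<in>steiners. excess2 z)"
    using direct_bundle(1) steiner_bundle(1) by (auto intro: sum_nonneg)
  consider (A) "s \<in> direct" | (B) z where "z \<in> steiners" "s \<in> at_steiner z"
    using par_source_cases[OF s] s by (auto simp: direct_def at_steiner_def)
  then show ?thesis
  proof cases
    case A
    have "excess1 s <= (\<Sum>s\<in>direct. excess1 s)"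
      using A fin direct_bundle(1) by (intro member_le_sum) auto
    then have "excess1 s < split_gap \<alpha>" using lt nn by linarith
    then show ?thesis using direct_bundle(2)[OF A] s by (intro exI[of _ "{s}"]) auto
  next
    case B
    have "excess2 z <= (\<Sum>z\<in>steiners. excess2 z)"
      using B finite_steiners steiner_bundle(1) by (intro member_le_sum) auto
    then have "excess2 z < split_gap \<alpha>" using lt nn by linarith
    then obtain p t where "t \<in> sinks I" "\<forall>s \<in> at_steiner z. connects L s t & sp s = p"
        "norm (p - sink_pos I t) < d p + 1 / 4" "1 <= d p --> group_size I p < 2 * card (at_steiner z)"
      using steiner_bundle(2)[OF B(1)] by blast
    then show ?thesis using B(2) by (intro exI[of _ "at_steiner z"] exI[of _ t]) (auto simp: at_steiner_def)
  qed
qed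

theorem near_optimal_close:
  assumes "layout_cost I L < (\<Sum>s\<in>sources I. nominal (sp s)) + split_gap \<alpha>"
    and "s \<in> sources I" "connects L s t"
  shows "t \<in> sinks I & norm (sp s - sink_pos I t) < d (sp s) + 1 / 4"
  using ex_bundle[OF assms(1,2)] connects_unique[OF assms(3)] by blast

text \<open>The bundles of \<open>s\<close> and \<open>s'\<close> each contain more than half of the
  same group, so they share a source, and a source has only one sink.\<close>

theorem near_optimal_unsplit:
  assumes near: "layout_cost I L < (\<Sum>s\<in>sources I. nominal (sp s)) + split_gap \<alpha>"
    and s: "s \<in> sources I" "s' \<in> sources I" "sp s = sp s'" "1 <= d (sp s)"
    and c: "connects L s t" "connects L s' t'"
  shows "t = t'"
proof -
  obtain X u where X: "s \<in> X" "X \<subseteq> sources I" "\<forall>x\<in>X. connects L x u & sp x = sp s"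
      "group_size I (sp s) < 2 * card X"
    using ex_bundle[OF near s(1)] s(4) by blast
  obtain X' u' where X': "s' \<in> X'" "X' \<subseteq> sources I" "\<forall>x\<in>X'. connects L x u' & sp x = sp s"
      "group_size I (sp s) < 2 * card X'"
    using ex_bundle[OF near s(2), unfolded s(3)[symmetric]] s(4) by blast
  have "X \<inter> X' ~= {}"
  proof
    assume disj: "X \<inter> X' = {}"
    have "card X + card X' = card (X \<union> X')"
      using disj finite_subset[OF X(2) finS] finite_subset[OF X'(2) finS] by (simp add: card_Un_disjoint)
    also have "\<dots> <= group_size I (sp s)"
      unfolding group_size_def
    proof (rule card_mono)
      show "X \<union> X' \<subseteq> {s' \<in> sources I. sp s' = sp s}" using X(2,3) X'(2,3) by blast
    qed (use finS in simp)
    finally show False using X(4) X'(4) by simp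
  qed
  then obtain x where "x \<in> X" "x \<in> X'" by blast
  then have "u = u'" using X(3) X'(3) connects_unique by blast
  moreover have "connects L s u" "connects L s' u'" using X(1,3) X'(1,3) by blast+
  ultimately show ?thesis using c connects_unique by blast
qed

end

section \<open>Building layouts\<close>

definition bundle_layout ::
  "('s, 't) flamecast => ('s => nat) => (nat => 't) => (nat => point) => ('s, 't) layout" where
  "bundle_layout I b \<psi> q = \<lparr>
     verts = Source ` sources I \<union> Steiner ` b ` sources I \<union> Sink ` \<psi> ` b ` sources I,
     edges = (\<lambda>s. (Source s, Steiner (b s))) ` sources I \<union> (\<lambda>n. (Steiner n, Sink (\<psi> n))) ` b ` sources I,
     pos = (\<lambda>v. case v of Source s => source_pos I s | Sink t => sink_pos I t | Steiner n => q n) \<rparr>"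

lemma bundle_layout_valid:
  fixes I :: "('s, 't) flamecast"
  assumes inst: "is_instance I" and one: "intermediate_layers I = 1"
    and \<psi>: "\<And>s. s \<in> sources I ==> \<psi> (b s) \<in> sinks I"
    and cap1: "\<And>n. card {s \<in> sources I. b s = n} <= capacities I ! 1"
    and cap0: "\<And>t. card {s \<in> sources I. \<psi> (b s) = t} <= capacities I ! 0"
  shows "bundle_layout I b \<psi> q \<in> valid_layouts I"
proof -
  let ?L = "bundle_layout I b \<psi> q"
  let ?S = "sources I" and ?E = "edges ?L"
  have fin: "finite ?S" using inst by (simp add: is_instance_def)
  have len: "length (capacities I) = 3" using inst one by (auto simp: is_instance_def intermediate_layers_def)
  have E: "(u, v) \<in> ?E \<longleftrightarrow> (\<exists>s \<in> ?S. u = Source s & v = Steiner (b s)) \<or>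
      (\<exists>s \<in> ?S. u = Steiner (b s) & v = Sink (\<psi> (b s)))" for u v by (auto simp: bundle_layout_def)
  have acyc: "acyclic ?E"
  proof -
    define rank where "rank v = (case v of Source _ => 2 | Steiner _ => 1 | Sink _ => (0::nat))" for v :: "('s, 't) vertex"
    have "?E\<inverse> \<subseteq> inv_image less_than rank" by (auto simp: E rank_def)
    then have "wf (?E\<inverse>)" using wf_subset[OF wf_inv_image[OF wf_less_than]] by blast
    then show ?thesis using wf_acyclic acyclic_converse by blast
  qed
  have forest: "is_rooted_forest ?L"
    using fin acyc by (auto simp: is_rooted_forest_def single_valued_def E) (auto simp: bundle_layout_def)
  have lv: "leaves ?L = Source ` ?S" by (force simp: leaves_def bundle_layout_def)
  have rt: "roots ?L = Sink ` \<psi> ` b ` ?S" by (force simp: roots_def bundle_layout_def)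
  have lay0: "layer ?L (Sink (\<psi> (b s))) = 0" if "s \<in> ?S" for s
    using layer_eq[OF forest, of "Sink (\<psi> (b s))" "Sink (\<psi> (b s))" 0] that rt by auto
  have lay1: "layer ?L (Steiner (b s)) = 1" if "s \<in> ?S" for s
    using layer_edge[OF forest, of "Steiner (b s)" "Sink (\<psi> (b s))"] lay0[OF that] that E by auto
  have lay2: "layer ?L (Source s) = 2" if "s \<in> ?S" for s
    using layer_edge[OF forest, of "Source s" "Steiner (b s)"] lay1[OF that] that E by auto
  have top: "is_topology I ?L"
    unfolding is_topology_def lv rt
    using forest one \<psi> lay0 lay1 lay2 by (auto simp: bundle_layout_def)
  have star: "(Source s, v) \<in> ?E\<^sup>* ==> v = Source s \<or> v = Steiner (b s) \<or> v = Sink (\<psi> (b s))" for s v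
    by (induction rule: rtrancl_induct) (auto simp: E)
  have caps: "1 <= capacities I ! 2"
    using inst len by (auto simp: is_instance_def)
  have fin': "finite {s \<in> ?S. P s}" for P using fin by simp
  have "load I ?L v <= capacities I ! layer ?L v" if v: "v \<in> verts ?L" for v
  proof -
    consider (A) s where "s \<in> ?S" "v = Source s" | (B) s where "s \<in> ?S" "v = Steiner (b s)"
      | (C) s where "s \<in> ?S" "v = Sink (\<psi> (b s))"
      using v by (auto simp: bundle_layout_def)
    then show ?thesis
    proof cases
      case A
      have "load I ?L v <= card {s}" unfolding load_def A by (intro card_mono) (auto dest: star)
      then show ?thesis using lay2 A caps by simp
    next
      case B
      have "load I ?L v <= card {s' \<in> ?S. b s' = b s}"
        unfolding load_def B by (intro card_mono fin') (auto dest: star)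
      then show ?thesis using lay1 B cap1[of "b s"] by simp
    next
      case C
      have "load I ?L v <= card {s' \<in> ?S. \<psi> (b s') = \<psi> (b s)}"
        unfolding load_def C by (intro card_mono fin') (auto dest: star)
      then show ?thesis using lay0 C cap0[of "\<psi> (b s)"] by simp
    qed
  qed
  moreover have "is_embedding I ?L" by (simp add: is_embedding_def bundle_layout_def)
  ultimately show ?thesis using top by (simp add: valid_layouts_def is_valid_topology_def)
qed

lemma bundle_layout_cost:
  assumes inst: "is_instance I" and one: "intermediate_layers I = 1"
    and valid: "bundle_layout I b \<psi> q \<in> valid_layouts I"
  shows "layout_cost I (bundle_layout I b \<psi> q) = (\<Sum>s\<in>sources I. norm (source_pos I s - q (b s))) +
    (\<Sum>n\<in>b ` sources I. norm (q n - sink_pos I (\<psi> n)) * real (card {s \<in> sources I. b s = n}) powr alpha I)"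
proof -
  let ?L = "bundle_layout I b \<psi> q"
  interpret two_level I ?L by unfold_locales (use assms in auto)
  have p1: "par (Source s) = Steiner (b s)" if "s \<in> sources I" for s
    using that by (intro par_eq) (simp add: bundle_layout_def)
  have p2: "par (Steiner n) = Sink (\<psi> n)" if "n \<in> b ` sources I" for n
    using that by (intro par_eq) (simp add: bundle_layout_def)
  have st: "steiners = b ` sources I" unfolding steiners_def by (auto simp: bundle_layout_def)
  have 1: "(\<Sum>s\<in>sources I. norm (source_pos I s - pos ?L (par (Source s)))) =
      (\<Sum>s\<in>sources I. norm (source_pos I s - q (b s)))"
    by (intro sum.cong) (simp_all add: p1, simp add: bundle_layout_def)
  have "{s \<in> sources I. par (Source s) = Steiner n} = {s \<in> sources I. b s = n}" for n
    using p1 by auto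
  then have 2: "(\<Sum>z\<in>steiners. norm (pos ?L (Steiner z) - pos ?L (par (Steiner z))) *
       real (card {s \<in> sources I. par (Source s) = Steiner z}) powr alpha I) =
      (\<Sum>n\<in>b ` sources I. norm (q n - sink_pos I (\<psi> n)) * real (card {s \<in> sources I. b s = n}) powr alpha I)"
    unfolding st by (intro sum.cong) (simp_all add: p2, simp add: bundle_layout_def)
  show ?thesis unfolding layout_cost_eq 1 2 ..
qed

text \<open>Each group gets one Steiner vertex at its own position, so the edges of the sources have
  length 0. Positions are numbered by \<open>i\<close> because Steiner vertices are named by natural
  numbers.\<close>

lemma ex_unsplit_layout:
  assumes inst: "is_instance I" and one: "intermediate_layers I = 1"
    and \<phi>: "\<And>s. s \<in> sources I ==> \<phi> (source_pos I s) \<in> sinks I"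
    and cap1: "\<And>p. group_size I p <= capacities I ! 1"
    and cap0: "\<And>t. card {s \<in> sources I. \<phi> (source_pos I s) = t} <= capacities I ! 0"
  shows "\<exists>L \<in> valid_layouts I. layout_cost I L =
    (\<Sum>p \<in> source_pos I ` sources I. norm (p - sink_pos I (\<phi> p)) * real (group_size I p) powr alpha I)"
proof -
  let ?S = "sources I" and ?sp = "source_pos I"
  have "finite (?sp ` ?S)" using inst by (simp add: is_instance_def)
  from finite_imp_inj_to_nat_seg[OF this] obtain i :: "point => nat" where i: "inj_on i (?sp ` ?S)" by blast
  define b q where "b s = i (?sp s)" and "q = the_inv_into (?sp ` ?S) i" for s
  have q: "q (i p) = p" if "p \<in> ?sp ` ?S" for p
    unfolding q_def using i that by (rule the_inv_into_f_f)
  define \<psi> where "\<psi> n = \<phi> (q n)" for n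
  have \<psi>: "\<psi> (b s) = \<phi> (?sp s)" if "s \<in> ?S" for s using that q by (simp add: \<psi>_def b_def)
  have grp: "{s \<in> ?S. b s = i p} = {s \<in> ?S. ?sp s = p}" if "p \<in> ?sp ` ?S" for p
    using that i by (auto simp: b_def inj_on_def)
  let ?L = "bundle_layout I b \<psi> q"
  have valid: "?L \<in> valid_layouts I"
  proof (rule bundle_layout_valid[OF inst one])
    fix n
    show "card {s \<in> ?S. b s = n} <= capacities I ! 1"
    proof (cases "n \<in> i ` ?sp ` ?S")
      case True
      then obtain p where p: "p \<in> ?sp ` ?S" "n = i p" by blast
      show ?thesis using cap1[of p] grp[OF p(1)] p(2) by (simp add: group_size_def)
    next
      case False then have "{s \<in> ?S. b s = n} = {}" by (auto simp: b_def)
      then show ?thesis by (metis card.empty zero_le)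
    qed
  next
    fix t
    have "{s \<in> ?S. \<psi> (b s) = t} = {s \<in> ?S. \<phi> (?sp s) = t}" using \<psi> by auto
    then show "card {s \<in> ?S. \<psi> (b s) = t} <= capacities I ! 0" using cap0 by simp
  qed (use \<psi> \<phi> in auto)
  have "layout_cost I ?L = (\<Sum>n\<in>i ` ?sp ` ?S. norm (q n - sink_pos I (\<psi> n)) * real (card {s \<in> ?S. b s = n}) powr alpha I)"
    unfolding bundle_layout_cost[OF inst one valid] using q by (simp add: b_def image_image)
  also have "\<dots> = (\<Sum>p\<in>?sp ` ?S. norm (p - sink_pos I (\<phi> p)) * real (group_size I p) powr alpha I)"
    by (subst sum.reindex[OF i]) (auto intro!: sum.cong simp: q \<psi>_def group_size_def grp)
  finally show ?thesis using valid by blast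
qed

text \<open>If every source has a sink for itself, all loads are 1 and fit into any capacities. This
  is the purpose of the spare sinks.\<close>

lemma ex_valid_layout:
  assumes inst: "is_instance I" and one: "intermediate_layers I = 1"
    and \<phi>: "inj_on \<phi> (sources I)" "\<phi> ` sources I \<subseteq> sinks I"
  shows "valid_layouts I ~= {}"
proof -
  have fin: "finite (sources I)" using inst by (simp add: is_instance_def)
  from finite_imp_inj_to_nat_seg[OF this] obtain i :: "'a => nat" where i: "inj_on i (sources I)" by blast
  have len: "length (capacities I) = 3" using inst one by (auto simp: is_instance_def intermediate_layers_def)
  have caps: "1 <= capacities I ! 0" "1 <= capacities I ! 1"
    using inst len by (auto simp: is_instance_def)
  define \<psi> where "\<psi> n = \<phi> (the_inv_into (sources I) i n)" for n
  have \<psi>: "\<psi> (i s) = \<phi> s" if "s \<in> sources I" for s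
    using that i by (simp add: \<psi>_def the_inv_into_f_f)
  have le1: "card A <= 1" if "\<And>x y. x \<in> A ==> y \<in> A ==> x = y" for A :: "'a set"
    using that by (cases "finite A") (auto simp: card_le_Suc0_iff_eq)
  have "bundle_layout I i \<psi> (\<lambda>_. 0) \<in> valid_layouts I"
  proof (rule bundle_layout_valid[OF inst one])
    show "\<psi> (i s) \<in> sinks I" if "s \<in> sources I" for s using \<psi> \<phi>(2) that by auto
    show "card {s \<in> sources I. i s = n} <= capacities I ! 1" for n
      by (rule order.trans[OF le1 caps(2)]) (use i in \<open>auto simp: inj_on_def\<close>)
    show "card {s \<in> sources I. \<psi> (i s) = t} <= capacities I ! 0" for t
      by (rule order.trans[OF le1 caps(1)]) (use \<psi> \<phi>(1) in \<open>auto simp: inj_on_def\<close>)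
  qed
  then show ?thesis by blast
qed

section \<open>Rational layouts\<close>

lemma rational_point_near:
  fixes p :: point
  assumes "0 < e"
  shows "\<exists>r. norm (real_point r - p) <= e"
proof -
  obtain a where a: "fst p < of_rat a" "of_rat a < fst p + e / 2"
    using of_rat_dense[of "fst p" "fst p + e / 2"] assms by auto
  obtain b where b: "snd p < of_rat b" "of_rat b < snd p + e / 2"
    using of_rat_dense[of "snd p" "snd p + e / 2"] assms by auto
  have "norm (real_point (a, b) - p) <= norm (of_rat a - fst p) + norm (of_rat b - snd p)"
    using norm_Pair_le[of "of_rat a - fst p" "of_rat b - snd p"] by (simp add: real_point_def minus_prod_def)
  then show ?thesis using a b by (intro exI[of _ "(a, b)"]) auto
qed

lemma layout_cost_nonneg: "0 <= layout_cost I L"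
  unfolding layout_cost_def by (intro sum_nonneg) auto

text \<open>The infimum in \<open>min_cost\<close> need not be attained, but being positive it
  leaves room below \<open>\<rho> * min_cost I\<close>. Some real layout fits there strictly, and
  only its Steiner vertices have to be moved: given sources and sinks are rational already.\<close>

lemma ex_rational_approximation:
  fixes ss ts cs \<alpha>
  defines "I \<equiv> the_instance \<alpha> ss ts cs"
  assumes ne: "valid_layouts I ~= {}" and pos: "0 < min_cost I" and \<rho>: "1 < \<rho>"
  shows "\<exists>vs es. is_approximation \<rho> I (the_layout vs es)"
proof -
  have bdd: "bdd_below (layout_cost I ` valid_layouts I)"
    by (rule bdd_belowI[of _ 0]) (auto simp: layout_cost_nonneg)
  have "(INF L \<in> valid_layouts I. layout_cost I L) < \<rho> * min_cost I"
    using pos \<rho> by (simp add: min_cost_def[symmetric])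
  then obtain L where L: "L \<in> valid_layouts I" "layout_cost I L < \<rho> * min_cost I"
    using cINF_less_iff[OF ne bdd] by auto
  have top: "is_valid_topology I L" and emb: "is_embedding I L" using L(1) by (auto simp: valid_layouts_def)
  then have fin: "finite (verts L)" "edges L \<subseteq> verts L \<times> verts L"
    by (auto simp: is_valid_topology_def is_topology_def is_rooted_forest_def)
  then have finE: "finite (edges L)" by (auto intro: finite_subset)
  define W where "W = (\<Sum>(u, v) \<in> edges L. real (load I L u) powr alpha I)"
  have W: "0 <= W" unfolding W_def by (intro sum_nonneg) auto
  \<comment> \<open>Moving both ends of each edge by at most \<open>e\<close> costs at most
    \<open>2 * e * W\<close>, which is to stay within the slack; \<open>W + 1\<close> in place of
    \<open>W\<close> avoids a division by zero.\<close>
  define e where "e = (\<rho> * min_cost I - layout_cost I L) / (2 * (W + 1))"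
  have e: "0 < e" using L(2) W by (simp add: e_def)
  define r where "r v = (case v of Source s => ss ! s | Sink t => ts ! t
      | Steiner z => SOME q. norm (real_point q - pos L v) <= e)" for v
  have near: "norm (real_point (r v) - pos L v) <= e" if "v \<in> verts L" for v
  proof (cases v)
    case (Source s)
    then show ?thesis using that emb e by (simp add: r_def is_embedding_def I_def the_instance_def)
  next
    case (Sink t)
    then show ?thesis using that emb e by (simp add: r_def is_embedding_def I_def the_instance_def)
  next
    case (Steiner z)
    then show ?thesis using someI_ex[OF rational_point_near[OF e, of "pos L v"]] by (simp add: r_def)
  qed
  obtain vl where vl: "set vl = verts L" using finite_list[OF fin(1)] by blast
  obtain es where es: "set es = edges L" using finite_list[OF finE] by blast
  define vs where "vs = map (\<lambda>v. (v, r v)) vl"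
  define L' where "L' = the_layout vs es"
  have v': "verts L' = verts L" and e': "edges L' = edges L"
    by (auto simp: L'_def the_layout_def vs_def vl es image_image)
  have p': "pos L' v = real_point (r v)" if "v \<in> verts L" for v
  proof -
    have "map_of vs v = Some (r v)" unfolding vs_def using that vl by (simp add: map_of_map_restrict)
    then show ?thesis by (simp add: L'_def the_layout_def)
  qed
  have L'_eq: "L' = L\<lparr>pos := pos L'\<rparr>" using v' e' by simp
  have "is_valid_topology I (L\<lparr>pos := p\<rparr>)" for p
  proof -
    have 1: "roots (L\<lparr>pos := p\<rparr>) = roots L" "leaves (L\<lparr>pos := p\<rparr>) = leaves L"
      by (simp_all add: roots_def leaves_def)
    moreover have "layer (L\<lparr>pos := p\<rparr>) = layer L" "load I (L\<lparr>pos := p\<rparr>) = load I L"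
      by (simp_all add: layer_def load_def 1 fun_eq_iff)
    ultimately show ?thesis using top by (auto simp: is_valid_topology_def is_topology_def is_rooted_forest_def)
  qed
  then have "is_valid_topology I L'" using L'_eq by metis
  moreover have "is_embedding I L'"
    unfolding is_embedding_def v' using p' by (simp add: r_def I_def the_instance_def)
  ultimately have valid': "L' \<in> valid_layouts I" by (simp add: valid_layouts_def)
  have load': "load I L' u = load I L u" for u by (simp add: load_def e')
  have "layout_cost I L' <= (\<Sum>(u, v) \<in> edges L. norm (pos L u - pos L v) * real (load I L u) powr alpha I +
      2 * e * real (load I L u) powr alpha I)"
    unfolding layout_cost_def e' load'
  proof (rule sum_mono)
    fix x assume x: "x \<in> edges L"
    obtain u v where uv: "x = (u, v)" by fastforce
    have in_v: "u \<in> verts L" "v \<in> verts L" using x uv fin(2) by auto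
    have "norm (pos L' u - pos L' v) <= norm (pos L u - pos L v) + 2 * e"
      using near[OF in_v(1)] near[OF in_v(2)] norm_triangle_ineq[of "pos L' u - pos L u" "pos L u - pos L v"]
        norm_triangle_ineq4[of "pos L' u - pos L v" "pos L' v - pos L v"] p'[OF in_v(1)] p'[OF in_v(2)] by simp
    from mult_right_mono[OF this, of "real (load I L u) powr alpha I"]
    show "(case x of (u, v) => norm (pos L' u - pos L' v) * real (load I L u) powr alpha I) <=
      (case x of (u, v) => norm (pos L u - pos L v) * real (load I L u) powr alpha I +
        2 * e * real (load I L u) powr alpha I)" by (simp add: uv algebra_simps)
  qed
  also have "\<dots> = layout_cost I L + 2 * e * W"
    by (simp add: layout_cost_def W_def case_prod_unfold sum.distrib sum_distrib_left)
  also have "2 * e * W <= 2 * e * (W + 1)" using e by simp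
  also have "2 * e * (W + 1) = \<rho> * min_cost I - layout_cost I L" using W by (simp add: e_def field_simps)
  finally have "layout_cost I L' <= \<rho> * min_cost I" by simp
  then show ?thesis using valid' unfolding is_approximation_def L'_def by blast
qed

section \<open>Combinatorial core: perfect packings, exact covers, and tilings that encode
  computations\<close>

section \<open>Exact covers as tight packings\<close>

text \<open>Positional notation without carries: as long as all digits are at most \<open>M\<close>,
  the number determines the digits.\<close>

definition unique_weights :: "nat => 'd set => ('d => nat) => bool" where
  "unique_weights M D wt \<longleftrightarrow> (\<forall>x y. (\<forall>i\<in>D. x i <= M & y i <= M) -->
    (\<Sum>i\<in>D. x i * wt i) = (\<Sum>i\<in>D. y i * wt i) --> (\<forall>i\<in>D. x i = y i))"

text \<open>The weight \<open>W\<close> of a new digit exceeds every value that the earlier digits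
  can add up to, so quotient and remainder by \<open>W\<close> separate the new digit from the
  others.\<close>

lemma ex_unique_weights:
  assumes "finite D"
  shows "\<exists>wt :: 'd => nat. (\<forall>i. 1 <= wt i) & unique_weights M D wt"
  unfolding unique_weights_def
  using assms
proof (induction D)
  case empty show ?case by (intro exI[of _ "\<lambda>_. 1"]) auto
next
  case (insert d D)
  then obtain wt where wt: "\<forall>i. 1 <= wt i" "\<And>x y. (\<forall>i\<in>D. x i <= M & y i <= M) ==>
    (\<Sum>i\<in>D. x i * wt i) = (\<Sum>i\<in>D. y i * wt i) ==> (\<forall>i\<in>D. x i = y i)" by blast
  define W where "W = Suc (\<Sum>i\<in>D. M * wt i)"
  have lt: "(\<Sum>i\<in>D. x i * wt i) < W" if "\<forall>i\<in>D. x i <= M" for x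
    unfolding W_def using that by (intro le_imp_less_Suc sum_mono mult_right_mono) auto
  have sum: "(\<Sum>i\<in>insert d D. x i * (wt(d := W)) i) = x d * W + (\<Sum>i\<in>D. x i * wt i)" for x
    using insert by (simp, intro sum.cong) auto
  have "\<forall>i\<in>insert d D. x i = y i" if xy: "\<forall>i\<in>insert d D. x i <= M & y i <= M"
    "(\<Sum>i\<in>insert d D. x i * (wt(d := W)) i) = (\<Sum>i\<in>insert d D. y i * (wt(d := W)) i)" for x y
  proof -
    have eq: "x d * W + (\<Sum>i\<in>D. x i * wt i) = y d * W + (\<Sum>i\<in>D. y i * wt i)" using xy(2) by (simp only: sum)
    have l: "(\<Sum>i\<in>D. x i * wt i) < W" "(\<Sum>i\<in>D. y i * wt i) < W" using xy(1) by (auto intro!: lt)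
    have "x d = (x d * W + (\<Sum>i\<in>D. x i * wt i)) div W" using l by simp
    also have "\<dots> = y d" unfolding eq using l by simp
    finally have "x d = y d" .
    moreover from this eq have "(\<Sum>i\<in>D. x i * wt i) = (\<Sum>i\<in>D. y i * wt i)" by simp
    ultimately show ?thesis using wt(2)[of x y] xy(1) by blast
  qed
  moreover have "\<forall>i. 1 <= (wt(d := W)) i" using wt(1) by (auto simp: W_def)
  ultimately show ?case by (intro exI[of _ "wt(d := W)"]) blast
qed

text \<open>A transposition moves \<open>a\<close> to index 0. This gives the distinguished copies,
  those with number 0, to the bin of the selected tile.\<close>

lemma ex_bij_start:
  assumes "finite A" "a \<in> A"
  shows "\<exists>f. bij_betw f {..<card A} A & f 0 = a"
proof -
  obtain f where f: "bij_betw f {..<card A} A"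
    using ex_bij_betw_nat_finite[OF assms(1)] atLeast0LessThan by metis
  then have "a \<in> f ` {..<card A}" using assms(2) by (simp add: bij_betw_def)
  then obtain j where j: "j < card A" "f j = a" by blast
  define g where "g n = (if n = 0 then a else if n = j then f 0 else f n)" for n
  have inj: "inj_on f {..<card A}" and img: "f ` {..<card A} = A" using f by (auto simp: bij_betw_def)
  have 0: "0 < card A" using j by simp
  have "inj_on g {..<card A}"
    using j 0 by (intro inj_onI) (auto simp: g_def inj_on_eq_iff[OF inj] split: if_splits)
  moreover have "g ` {..<card A} \<subseteq> A" using img assms(2) 0 by (auto simp: g_def)
  ultimately have "bij_betw g {..<card A} A"
    unfolding bij_betw_def using card_subset_eq[OF assms(1), of "g ` {..<card A}"] by (simp add: card_image)
  then show ?thesis by (intro exI[of _ g]) (simp add: g_def)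
qed

datatype ('v, 'th, 'e) item = TileItem 'v 'th | CellItem 'v nat | ElemItem 'e nat
datatype 'k digit = Top | Flag | Cell | Side 'k

text \<open>Every cell has one bin per tile. The bin that holds the tile item of \<open>\<theta>\<close> also takes one item
  per element needed by \<open>\<theta>\<close>; the flags force these items to be all actual (copy number 0 of an
  active element) in the bin of the selected tile, which holds \<open>CellItem v 0\<close>, and all dummies in
  the other bins.\<close>

locale cover =
  fixes cells :: "'v set" and tiles :: "'th set" and elems :: "'e set"
    and locs :: "'e => 'v set" and kap :: "'e => 'k" and act :: "'e => bool"
    and need :: "'v => 'th => 'k set" and sides :: "'k set" and K :: nat
    and wt :: "'k digit => nat"
  assumes fin: "finite cells" "finite tiles" "finite elems" "finite sides"
    and locs: "\<And>e. e \<in> elems ==> locs e \<subseteq> cells" and kap: "\<And>e. e \<in> elems ==> kap e \<in> sides"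
    and need: "\<And>v \<theta>. v \<in> cells ==> \<theta> \<in> tiles ==> need v \<theta> \<subseteq> sides & card (need v \<theta>) = K"
    and elem_unique: "\<And>e e' v. e \<in> elems ==> e' \<in> elems ==> v \<in> locs e ==> v \<in> locs e' ==> kap e = kap e' ==> e = e'"
    and elem_ex: "\<And>v \<theta> \<kappa>. v \<in> cells ==> \<theta> \<in> tiles ==> \<kappa> \<in> need v \<theta> ==> \<exists>e\<in>elems. v \<in> locs e & kap e = \<kappa>"
begin

text \<open>The number of pairs of a cell and a tile that ask for \<open>e\<close>, and so the
  number of bins that need a copy of it.\<close>

definition deg :: "'e => nat" where
  "deg e = (\<Sum>v\<in>locs e. card {\<theta> \<in> tiles. kap e \<in> need v \<theta>})"

text \<open>A tile item fills the \<open>Side\<close> digits that its tile does not need. As the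
  target of every side is 1, each needed side is left to exactly one element item.
  \<open>Top\<close> and \<open>Cell\<close> count the tile items and the cell items of a
  bin.\<close>

fun vec :: "('v, 'th, 'e) item => 'k digit => nat" where
  "vec (TileItem v \<theta>) D = (case D of Top => 1 | Side \<kappa> => (if \<kappa> \<in> need v \<theta> then 0 else 1) | _ => 0)"
| "vec (CellItem v k) D = (case D of Cell => 1 | Flag => (if k = 0 then K else 0) | _ => 0)"
| "vec (ElemItem e k) D = (case D of Side \<kappa> => (if \<kappa> = kap e then 1 else 0)
     | Flag => (if k = 0 & act e then 0 else 1) | _ => 0)"

definition digits :: "'k digit set" where
  "digits = {Top, Flag, Cell} \<union> Side ` sides"

definition target :: "'k digit => nat" where
  "target D = (if D = Flag then K else 1)"

definition item_size :: "('v, 'th, 'e) item => nat" where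
  "item_size i = (\<Sum>D\<in>digits. vec i D * wt D)"

definition bin_size :: nat where
  "bin_size = (\<Sum>D\<in>digits. target D * wt D)"

definition items :: "('v, 'th, 'e) item set" where
  "items = (\<lambda>(v, \<theta>). TileItem v \<theta>) ` (cells \<times> tiles) \<union> (\<lambda>(v, k). CellItem v k) ` (cells \<times> {..<card tiles}) \<union>
     (\<lambda>(e, k). ElemItem e k) ` (SIGMA e:elems. {..<deg e})"

fun acc :: "('v, 'th, 'e) item => 'v set" where
  "acc (TileItem v \<theta>) = {v}" | "acc (CellItem v k) = {v}" | "acc (ElemItem e k) = locs e"

definition selection :: "('v => 'th) => bool" where
  "selection sel \<longleftrightarrow> (\<forall>v\<in>cells. sel v \<in> tiles) &
     (\<forall>e\<in>elems. card {v \<in> locs e. kap e \<in> need v (sel v)} = (if act e then 1 else 0))"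

lemma fin_digits: "finite digits" using fin by (simp add: digits_def)
lemma fin_items: "finite items" using fin by (auto simp: items_def)
lemma fin_locs: "e \<in> elems ==> finite (locs e)" using locs fin(1) finite_subset by blast

lemma items_simps:
  "TileItem v \<theta> \<in> items \<longleftrightarrow> v \<in> cells & \<theta> \<in> tiles"
  "CellItem v k \<in> items \<longleftrightarrow> v \<in> cells & k < card tiles"
  "ElemItem e k \<in> items \<longleftrightarrow> e \<in> elems & k < deg e" by (auto simp: items_def)

lemma sum_item_size:
  assumes "finite X"
  shows "(\<Sum>i\<in>X. item_size i) = (\<Sum>D\<in>digits. (\<Sum>i\<in>X. vec i D) * wt D)"
  unfolding item_size_def by (subst sum.swap) (simp add: sum_distrib_right)

text \<open>The map \<open>\<beta> v\<close> assigns the bins of \<open>v\<close> to the tiles, and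
  \<open>c v\<close> is the bin of the selected one. The copies of \<open>e\<close> are spread
  bijectively over \<open>NB e\<close>, the bins whose tile needs \<open>e\<close>; if
  \<open>e\<close> is active, copy 0 goes to the bin \<open>c v\<close> of the one cell whose
  selected tile covers \<open>e\<close>. Copy 0 of the cell item also goes to \<open>c v\<close>, so
  that the flags come out right in every bin.\<close>

lemma selection_packing:
  assumes sel: "selection sel"
    and bins: "\<And>v. v \<in> cells ==> finite (bins v) & card (bins v) = card tiles"
    and disj: "\<And>v v' b. v \<in> cells ==> v' \<in> cells ==> b \<in> bins v ==> b \<in> bins v' ==> v = v'"
  shows "\<exists>\<phi>. (\<forall>i\<in>items. \<exists>v\<in>acc i. \<phi> i \<in> bins v) &
    (\<forall>v\<in>cells. \<forall>b\<in>bins v. (\<Sum>i | i \<in> items & \<phi> i = b. item_size i) = bin_size)"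
proof -
  have selt: "sel v \<in> tiles" if "v \<in> cells" for v using sel that by (simp add: selection_def)
  have "\<forall>v. \<exists>\<beta>. v \<in> cells --> bij_betw \<beta> tiles (bins v)"
    using bins fin(2) by (auto intro!: finite_same_card_bij)
  then obtain \<beta> where \<beta>: "\<And>v. v \<in> cells ==> bij_betw (\<beta> v) tiles (bins v)" by metis
  have \<beta>in: "\<beta> v \<theta> \<in> bins v" if "v \<in> cells" "\<theta> \<in> tiles" for v \<theta>
    using \<beta> that by (auto simp: bij_betw_def)
  have \<beta>inj: "v = v' & \<theta> = \<theta>'" if "v \<in> cells" "v' \<in> cells" "\<theta> \<in> tiles" "\<theta>' \<in> tiles" "\<beta> v \<theta> = \<beta> v' \<theta>'" for v v' \<theta> \<theta>'
  proof -
    have "v = v'" using disj[of v v' "\<beta> v \<theta>"] \<beta>in that by metis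
    then show ?thesis using \<beta>[of v] that by (auto simp: bij_betw_def dest: inj_onD)
  qed
  define c where "c v = \<beta> v (sel v)" for v
  have "\<forall>v. \<exists>h. v \<in> cells --> bij_betw h {..<card tiles} (bins v) & h 0 = c v"
    using ex_bij_start[of "bins v" "c v" for v] bins \<beta>in selt unfolding c_def by metis
  then obtain h where h: "\<And>v. v \<in> cells ==> bij_betw (h v) {..<card tiles} (bins v) & h v 0 = c v" by metis
  define NB where "NB e = (\<lambda>(v, \<theta>). \<beta> v \<theta>) ` (SIGMA v:locs e. {\<theta> \<in> tiles. kap e \<in> need v \<theta>})" for e
  have NBcard: "finite (NB e) & card (NB e) = deg e" if "e \<in> elems" for e
  proof -
    have "inj_on (\<lambda>(v, \<theta>). \<beta> v \<theta>) (SIGMA v:locs e. {\<theta> \<in> tiles. kap e \<in> need v \<theta>})"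
    proof (rule inj_onI)
      fix x y
      assume *: "x \<in> (SIGMA v:locs e. {\<theta> \<in> tiles. kap e \<in> need v \<theta>})"
        "y \<in> (SIGMA v:locs e. {\<theta> \<in> tiles. kap e \<in> need v \<theta>})"
        "(case x of (v, \<theta>) => \<beta> v \<theta>) = (case y of (v, \<theta>) => \<beta> v \<theta>)"
      then show "x = y"
        using \<beta>inj[of "fst x" "fst y" "snd x" "snd y"] locs[OF that] by (cases x; cases y) auto
    qed
    then show ?thesis unfolding NB_def deg_def using fin_locs[OF that] fin(2) by (simp add: card_image)
  qed
  have act_sel: "act e & (\<forall>v'\<in>locs e. kap e \<in> need v' (sel v') --> v' = v)"
    if "e \<in> elems" "v \<in> locs e" "kap e \<in> need v (sel v)" for e v
  proof -
    let ?A = "{v \<in> locs e. kap e \<in> need v (sel v)}"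
    have "finite ?A" using fin_locs[OF that(1)] by simp
    moreover have "v \<in> ?A" using that by simp
    moreover have "card ?A = (if act e then 1 else 0)" using sel that(1) by (simp add: selection_def)
    ultimately show ?thesis by (auto simp: card_1_singleton_iff split: if_splits) (metis (mono_tags, lifting) card_1_singletonE mem_Collect_eq singletonD)
  qed
  have "\<forall>e. \<exists>g. e \<in> elems --> bij_betw g {..<deg e} (NB e) &
      (act e --> (\<exists>v\<in>locs e. kap e \<in> need v (sel v) & g 0 = c v))"
  proof (intro allI)
    fix e
    show "\<exists>g. e \<in> elems --> bij_betw g {..<deg e} (NB e) &
      (act e --> (\<exists>v\<in>locs e. kap e \<in> need v (sel v) & g 0 = c v))"
    proof (cases "e \<in> elems & act e")
      case True then have "card {v \<in> locs e. kap e \<in> need v (sel v)} = 1" using sel by (simp add: selection_def)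
      then obtain v where v: "v \<in> locs e" "kap e \<in> need v (sel v)"
        by (metis (mono_tags, lifting) card_1_singletonE mem_Collect_eq singletonI)
      have "c v \<in> NB e" using v selt locs True by (force simp: NB_def c_def)
      then show ?thesis using ex_bij_start[of "NB e" "c v"] NBcard True v by metis
    next
      case False then show ?thesis
        using NBcard[of e] ex_bij_betw_nat_finite[of "NB e"] by (auto simp: atLeast0LessThan)
    qed
  qed
  then obtain g where g: "\<And>e. e \<in> elems ==> bij_betw (g e) {..<deg e} (NB e)"
    "\<And>e. e \<in> elems ==> act e ==> \<exists>v\<in>locs e. kap e \<in> need v (sel v) & g e 0 = c v" by metis
  define \<phi> where "\<phi> i = (case i of TileItem v \<theta> => \<beta> v \<theta> | CellItem v k => h v k | ElemItem e k => g e k)" for i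
  have "\<exists>v\<in>acc i. \<phi> i \<in> bins v" if i: "i \<in> items" for i
  proof (cases i)
    case (ElemItem e k) then have e: "e \<in> elems" "k < deg e" using i by (auto simp: items_simps)
    then have "g e k \<in> NB e" using g(1)[of e] by (auto simp: bij_betw_def)
    then show ?thesis using ElemItem \<beta>in locs[OF e(1)] by (fastforce simp: \<phi>_def NB_def)
  next
    case (CellItem v k) then have "v \<in> cells" "k < card tiles" using i by (auto simp: items_simps)
    then show ?thesis using h[of v] CellItem by (auto simp: \<phi>_def bij_betw_def)
  qed (use i \<beta>in in \<open>auto simp: \<phi>_def items_simps\<close>)
  moreover have "(\<Sum>i | i \<in> items & \<phi> i = b. item_size i) = bin_size" if v: "v \<in> cells" and b: "b \<in> bins v" for v b
  proof -
    obtain \<theta> where \<theta>: "\<theta> \<in> tiles" "b = \<beta> v \<theta>" using \<beta>[OF v] b by (auto simp: bij_betw_def)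
    have "b \<in> h v ` {..<card tiles}" using h[OF v] b by (simp add: bij_betw_def)
    then obtain k0 where k0: "k0 < card tiles" "h v k0 = b" by blast
    have k0_iff: "k0 = 0 \<longleftrightarrow> \<theta> = sel v"
    proof
      assume "k0 = 0"
      then have "\<beta> v \<theta> = \<beta> v (sel v)" using h[OF v] k0 \<theta> by (simp add: c_def)
      then show "\<theta> = sel v" using \<beta>inj v \<theta>(1) selt by blast
    next
      assume "\<theta> = sel v"
      then have "h v k0 = h v 0" using k0 \<theta> h[OF v] by (simp add: c_def)
      moreover have "0 < card tiles" using k0 by simp
      ultimately show "k0 = 0" using h[OF v] k0 by (auto simp: bij_betw_def inj_on_def)
    qed
    define EB where "EB = {(e, k). e \<in> elems & k < deg e & g e k = b}"
    have EBin: "v \<in> locs e & kap e \<in> need v \<theta>" if "(e, k) \<in> EB" for e k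
    proof -
      have e: "e \<in> elems" "k < deg e" "g e k = b" using that by (auto simp: EB_def)
      then have "b \<in> NB e" using g(1)[of e] by (auto simp: bij_betw_def)
      then obtain v' \<theta>' where "v' \<in> locs e" "\<theta>' \<in> tiles" "kap e \<in> need v' \<theta>'" "b = \<beta> v' \<theta>'"
        by (auto simp: NB_def)
      then show ?thesis using \<beta>inj[of v v' \<theta> \<theta>'] v \<theta> locs[OF e(1)] by auto
    qed
    have EBinj: "inj_on (kap \<circ> fst) EB"
    proof (rule inj_onI)
      fix x y assume xy: "x \<in> EB" "y \<in> EB" "(kap \<circ> fst) x = (kap \<circ> fst) y"
      obtain e k e' k' where [simp]: "x = (e, k)" "y = (e', k')" by fastforce
      have el: "e \<in> elems" "e' \<in> elems" "k < deg e" "k' < deg e'" "g e k = b" "g e' k' = b"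
        using xy by (auto simp: EB_def)
      have "e = e'" using elem_unique[OF el(1,2)] EBin xy by auto
      moreover from this have "k = k'" using g(1)[OF el(1)] el by (auto simp: bij_betw_def inj_on_def)
      ultimately show "x = y" by simp
    qed
    have EBimg: "(kap \<circ> fst) ` EB = need v \<theta>"
    proof (intro equalityI subsetI)
      fix \<kappa> assume \<kappa>: "\<kappa> \<in> need v \<theta>"
      then obtain e where e: "e \<in> elems" "v \<in> locs e" "kap e = \<kappa>" using elem_ex[OF v \<theta>(1)] by blast
      then have "b \<in> NB e" using \<theta> \<kappa> by (force simp: NB_def)
      then have "b \<in> g e ` {..<deg e}" using g(1)[OF e(1)] by (simp add: bij_betw_def)
      then obtain k where "k < deg e" "g e k = b" by blast
      then show "\<kappa> \<in> (kap \<circ> fst) ` EB" using e by (force simp: EB_def)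
    qed (use EBin in auto)
    have finEB: "finite EB"
      by (rule finite_subset[of _ "SIGMA e:elems. {..<deg e}"]) (use fin in \<open>auto simp: EB_def\<close>)
    have cardEB: "card EB = K"
      using card_image[OF EBinj] EBimg need[OF v \<theta>(1)] by simp
    let ?X = "{i. i \<in> items & \<phi> i = b}"
    have X: "?X = {TileItem v \<theta>, CellItem v k0} \<union> (\<lambda>(e, k). ElemItem e k) ` EB"
    proof (intro equalityI subsetI)
      fix i assume i: "i \<in> ?X"
      show "i \<in> {TileItem v \<theta>, CellItem v k0} \<union> (\<lambda>(e, k). ElemItem e k) ` EB"
      proof (cases i)
        case (TileItem v' \<theta>') then show ?thesis using i \<beta>inj[of v' v \<theta>' \<theta>] v \<theta> by (auto simp: \<phi>_def items_simps)
      next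
        case (CellItem v' k)
        then have vk: "v' \<in> cells" "k < card tiles" "h v' k = b" using i by (auto simp: \<phi>_def items_simps)
        then have "b \<in> bins v'" using h[OF vk(1)] by (auto simp: bij_betw_def)
        then have "v' = v" using disj[OF vk(1) v] b by blast
        then have "k = k0" using vk k0 h[OF v] by (auto simp: bij_betw_def inj_on_def)
        then show ?thesis using CellItem \<open>v' = v\<close> by simp
      next
        case (ElemItem e k) then show ?thesis using i by (force simp: \<phi>_def items_simps EB_def)
      qed
    next
      fix i assume "i \<in> {TileItem v \<theta>, CellItem v k0} \<union> (\<lambda>(e, k). ElemItem e k) ` EB"
      then show "i \<in> ?X" using v \<theta> k0 by (auto simp: \<phi>_def items_simps EB_def)
    qed
    have injE: "inj_on (\<lambda>(e, k). ElemItem e k) EB" by (auto simp: inj_on_def)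
    have sumX: "(\<Sum>i\<in>?X. f i) = f (TileItem v \<theta>) + f (CellItem v k0) + (\<Sum>(e, k)\<in>EB. f (ElemItem e k))"
      for f :: "('v, 'th, 'e) item => nat"
    proof -
      have "(\<Sum>i\<in>?X. f i) = sum f {TileItem v \<theta>, CellItem v k0} + sum f ((\<lambda>(e, k). ElemItem e k) ` EB)"
        unfolding X by (rule sum.union_disjoint) (use finEB in auto)
      moreover have "sum f ((\<lambda>(e, k). ElemItem e k) ` EB) = (\<Sum>(e, k)\<in>EB. f (ElemItem e k))"
        by (subst sum.reindex[OF injE]) (auto intro!: sum.cong)
      ultimately show ?thesis by simp
    qed
    have dig: "(\<Sum>i\<in>?X. vec i D) = target D" if D: "D \<in> digits" for D
    proof (cases D)
      case (Side \<kappa>)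
      have "(\<Sum>(e, k)\<in>EB. vec (ElemItem e k) D) = (\<Sum>x\<in>EB. if \<kappa> = (kap \<circ> fst) x then 1 else 0)"
        by (intro sum.cong) (auto simp: Side)
      also have "\<dots> = (\<Sum>\<kappa>'\<in>need v \<theta>. if \<kappa> = \<kappa>' then 1 else 0)"
        unfolding EBimg[symmetric] by (subst sum.reindex[OF EBinj]) (simp only: o_def)
      also have "\<dots> = (if \<kappa> \<in> need v \<theta> then 1 else 0)"
        using finite_subset[of "need v \<theta>" sides] need[OF v \<theta>(1)] fin(4) by (simp add: sum.delta')
      finally show ?thesis unfolding sumX by (simp add: Side target_def)
    next
      case Flag show ?thesis
      proof (cases "\<theta> = sel v")
        case True
        have "k = 0 & act e" if ek: "(e, k) \<in> EB" for e k
        proof -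
          have e: "e \<in> elems" "k < deg e" "g e k = b" using ek by (auto simp: EB_def)
          have a: "act e" "\<And>v'. v'\<in>locs e ==> kap e \<in> need v' (sel v') ==> v' = v"
            using act_sel[OF e(1)] EBin[OF ek] True by auto
          then have "g e 0 = c v" using g(2)[OF e(1) a(1)] by blast
          then have "g e 0 = g e k" using e \<theta> True by (simp add: c_def)
          then show ?thesis using a g(1)[OF e(1)] e by (auto simp: bij_betw_def inj_on_def)
        qed
        then have "(\<Sum>(e, k)\<in>EB. vec (ElemItem e k) D) = 0" using finEB by (force simp: Flag)
        then show ?thesis unfolding sumX using True k0_iff by (simp add: Flag target_def)
      next
        case False
        have "~ (k = 0 & act e)" if ek: "(e, k) \<in> EB" for e k
        proof
          assume a: "k = 0 & act e"
          have e: "e \<in> elems" "g e k = b" using ek by (auto simp: EB_def)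
          then obtain v' where "v' \<in> locs e" "b = \<beta> v' (sel v')" using g(2)[of e] a by (auto simp: c_def)
          then show False using \<beta>inj[of v v' \<theta> "sel v'"] v \<theta> selt locs[OF e(1)] False by auto
        qed
        then have "(\<Sum>(e, k)\<in>EB. vec (ElemItem e k) D) = (\<Sum>x\<in>EB. 1)" by (intro sum.cong) (auto simp: Flag)
        then show ?thesis unfolding sumX using False k0_iff cardEB by (simp add: Flag target_def)
      qed
    qed (simp_all add: sumX target_def case_prod_unfold)
    have "finite ?X" using fin_items by simp
    then show ?thesis unfolding bin_size_def by (simp add: sum_item_size dig cong: sum.cong)
  qed
  ultimately show ?thesis by blast
qed

text \<open>The weighted sum of a full bin determines its digit sums, because \<open>M\<close>
  bounds the digit sums of whatever can be in the bin. The digits are then evaluated one by one: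
  \<open>Top\<close> and \<open>Cell\<close> give one tile and one cell item, the sides exactly the
  needed elements, and \<open>Flag\<close> decides whether these are all actual or all dummies. The
  selected tile is the one that shares its bin with \<open>CellItem v 0\<close>. A positive degree
  of active elements guarantees that their copy 0 exists.\<close>

lemma packing_selection:
  fixes bins :: "'v => 'b set" and \<phi> :: "('v, 'th, 'e) item => 'b" and M :: nat
  assumes wt: "unique_weights M digits wt"
    and M: "\<And>v. v \<in> cells ==> card {i \<in> items. v \<in> acc i} * (K + 1) <= M" "K + 1 <= M"
    and disj: "\<And>v v' b. v \<in> cells ==> v' \<in> cells ==> b \<in> bins v ==> b \<in> bins v' ==> v = v'"
    and \<phi>: "\<And>i. i \<in> items ==> \<exists>v\<in>acc i. \<phi> i \<in> bins v"
    and full: "\<And>v b. v \<in> cells ==> b \<in> bins v ==> (\<Sum>i | i \<in> items & \<phi> i = b. item_size i) = bin_size"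
    and deg: "\<And>e. e \<in> elems ==> act e ==> 0 < deg e"
    and tiles: "tiles ~= {}"
  shows "\<exists>sel. selection sel &
    (\<forall>v\<in>cells. \<forall>\<theta>\<in>tiles. \<phi> (TileItem v \<theta>) = \<phi> (CellItem v 0) \<longleftrightarrow> \<theta> = sel v)"
proof -
  let ?X = "\<lambda>b. {i. i \<in> items & \<phi> i = b}"
  have finX: "finite (?X b)" for b using fin_items by simp
  have acc_cells: "acc i \<subseteq> cells" if "i \<in> items" for i
    using that locs by (cases i) (auto simp: items_simps)
  have loc: "v \<in> acc i" if "i \<in> ?X b" "b \<in> bins v" "v \<in> cells" for i b v
    using \<phi>[of i] that disj acc_cells[of i] by blast
  have dig: "(\<Sum>i\<in>?X b. vec i D) = target D" if b: "b \<in> bins v" "v \<in> cells" and D: "D \<in> digits" for b v D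
  proof -
    \<comment> \<open>A single digit is at most \<open>K\<close>, attained by the flag of a cell
      item with number 0, or 1; \<open>K + 1\<close> bounds both.\<close>
    have vle: "vec i D <= K + 1" for i D by (cases i) (auto split: digit.split)
    have "(\<Sum>i\<in>?X b. vec i D) <= M" for D
    proof -
      have "(\<Sum>i\<in>?X b. vec i D) <= card (?X b) * (K + 1)"
        using sum_bounded_above[of "?X b" "\<lambda>i. vec i D" "K + 1"] vle by simp
      also have "card (?X b) <= card {i \<in> items. v \<in> acc i}"
        using fin_items loc[OF _ b] by (intro card_mono) auto
      finally show ?thesis using M(1)[OF b(2)] by (meson le_trans mult_le_mono1)
    qed
    moreover have "target D <= M" for D using M(2) by (simp add: target_def)
    moreover have "(\<Sum>D\<in>digits. (\<Sum>i\<in>?X b. vec i D) * wt D) = (\<Sum>D\<in>digits. target D * wt D)"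
      using full[OF b(2,1)] sum_item_size[OF finX[of b]] by (simp add: bin_size_def)
    ultimately show ?thesis
      using wt[unfolded unique_weights_def, rule_format, of "\<lambda>D. \<Sum>i\<in>?X b. vec i D" target] D by blast
  qed
  define tiI ceI elI where "tiI b = {i \<in> ?X b. \<exists>v \<theta>. i = TileItem v \<theta>}"
    and "ceI b = {i \<in> ?X b. \<exists>v k. i = CellItem v k}" and "elI b = {i \<in> ?X b. \<exists>e k. i = ElemItem e k}" for b
  have part: "(\<Sum>i\<in>?X b. f i) = (\<Sum>i\<in>tiI b. f i) + (\<Sum>i\<in>ceI b. f i) + (\<Sum>i\<in>elI b. f i)"
    for b and f :: "('v, 'th, 'e) item => nat"
  proof -
    have "?X b = (tiI b \<union> ceI b) \<union> elI b"
    proof (rule set_eqI)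
      fix i show "i \<in> ?X b \<longleftrightarrow> i \<in> (tiI b \<union> ceI b) \<union> elI b" by (cases i) (auto simp: tiI_def ceI_def elI_def)
    qed
    moreover have "finite (tiI b)" "finite (ceI b)" "finite (elI b)"
      using fin_items by (auto simp: tiI_def ceI_def elI_def intro: finite_subset[rotated])
    moreover have "tiI b \<inter> ceI b = {}" "(tiI b \<union> ceI b) \<inter> elI b = {}" by (auto simp: tiI_def ceI_def elI_def)
    ultimately show ?thesis by (simp add: sum.union_disjoint)
  qed
  have fin3: "finite (tiI b)" "finite (ceI b)" "finite (elI b)" for b
    using fin_items by (auto simp: tiI_def ceI_def elI_def intro: finite_subset[rotated])
  have top: "\<exists>\<theta>\<in>tiles. tiI b = {TileItem v \<theta>}" if b: "b \<in> bins v" "v \<in> cells" for b v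
  proof -
    have "(\<Sum>i\<in>tiI b. vec i Top) = (\<Sum>i\<in>tiI b. 1)" by (intro sum.cong) (auto simp: tiI_def)
    moreover have "(\<Sum>i\<in>ceI b. vec i Top) = 0" "(\<Sum>i\<in>elI b. vec i Top) = 0"
      by (rule sum.neutral; auto simp: ceI_def elI_def)+
    ultimately have "card (tiI b) = 1" using dig[OF b, of Top] part[of "\<lambda>i. vec i Top" b] by (simp add: digits_def target_def)
    then obtain i where i: "tiI b = {i}" by (auto simp: card_1_singleton_iff)
    then have "i \<in> tiI b" by simp
    then obtain v' \<theta> where "i = TileItem v' \<theta>" "i \<in> ?X b" by (auto simp: tiI_def)
    moreover from this have "v \<in> acc i" using loc[OF _ b] by blast
    ultimately show ?thesis using i by (auto simp: items_simps)
  qed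
  define tl where "tl v b = (THE \<theta>. tiI b = {TileItem v \<theta>})" for v b
  have tl: "tl v b \<in> tiles" "tiI b = {TileItem v (tl v b)}" if b: "b \<in> bins v" "v \<in> cells" for b v
  proof -
    obtain \<theta> where \<theta>: "\<theta> \<in> tiles" "tiI b = {TileItem v \<theta>}" using top[OF b] by blast
    then have "tl v b = \<theta>" unfolding tl_def by auto
    then show "tl v b \<in> tiles" "tiI b = {TileItem v (tl v b)}" using \<theta> by simp_all
  qed
  have side: "card {i \<in> elI b. \<exists>e k. i = ElemItem e k & kap e = \<kappa>} = (if \<kappa> \<in> need v (tl v b) then 1 else 0)"
    if b: "b \<in> bins v" "v \<in> cells" and \<kappa>: "\<kappa> \<in> sides" for b v \<kappa>
  proof -
    have "(\<Sum>i\<in>tiI b. vec i (Side \<kappa>)) = (if \<kappa> \<in> need v (tl v b) then 0 else 1)"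
      using tl(2)[OF b] by simp
    moreover have "(\<Sum>i\<in>ceI b. vec i (Side \<kappa>)) = 0" by (rule sum.neutral) (auto simp: ceI_def)
    moreover have "(\<Sum>i\<in>elI b. vec i (Side \<kappa>)) = (\<Sum>i\<in>elI b. if (\<exists>e k. i = ElemItem e k & kap e = \<kappa>) then 1 else 0)"
      by (intro sum.cong) (auto simp: elI_def)
    moreover have "\<dots> = card {i \<in> elI b. \<exists>e k. i = ElemItem e k & kap e = \<kappa>}"
      using fin3 by (simp add: sum.If_cases Int_def)
    ultimately show ?thesis
      using dig[OF b, of "Side \<kappa>"] part[of "\<lambda>i. vec i (Side \<kappa>)" b] \<kappa> by (simp add: digits_def target_def split: if_splits)
  qed
  have cell: "\<exists>k. ceI b = {CellItem v k}" if b: "b \<in> bins v" "v \<in> cells" for b v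
  proof -
    have "(\<Sum>i\<in>ceI b. vec i Cell) = (\<Sum>i\<in>ceI b. 1)" by (intro sum.cong) (auto simp: ceI_def)
    moreover have "(\<Sum>i\<in>tiI b. vec i Cell) = 0" "(\<Sum>i\<in>elI b. vec i Cell) = 0"
      by (rule sum.neutral; auto simp: tiI_def elI_def)+
    ultimately have "card (ceI b) = 1" using dig[OF b, of Cell] part[of "\<lambda>i. vec i Cell" b] by (simp add: digits_def target_def)
    then obtain i where i: "ceI b = {i}" by (auto simp: card_1_singleton_iff)
    then have "i \<in> ceI b" by simp
    then obtain v' k where "i = CellItem v' k" "i \<in> ?X b" by (auto simp: ceI_def)
    moreover from this have "v \<in> acc i" using loc[OF _ b] by blast
    ultimately show ?thesis using i by (auto simp: items_simps)
  qed
  define actual where "actual i \<longleftrightarrow> (\<exists>e. i = ElemItem e 0 & act e)" for i :: "('v, 'th, 'e) item"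
  have elcard: "card (elI b) = K" if b: "b \<in> bins v" "v \<in> cells" for b v
  proof -
    have eq: "elI b = (\<Union>\<kappa>\<in>sides. {i \<in> elI b. \<exists>e k. i = ElemItem e k & kap e = \<kappa>})"
      using kap by (auto simp: elI_def items_simps)
    then have "card (elI b) = (\<Sum>\<kappa>\<in>sides. card {i \<in> elI b. \<exists>e k. i = ElemItem e k & kap e = \<kappa>})"
      using fin3 fin(4) by (subst eq, intro card_UN_disjoint) auto
    also have "\<dots> = (\<Sum>\<kappa>\<in>sides. if \<kappa> \<in> need v (tl v b) then 1 else 0)"
      using side[OF b] by (intro sum.cong) auto
    also have "\<dots> = card (need v (tl v b))"
      using need[OF b(2) tl(1)[OF b]] fin(4) by (simp add: sum.If_cases Int_absorb1)
    finally show ?thesis using need[OF b(2) tl(1)[OF b]] by simp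
  qed
  have flag: "(if CellItem v 0 \<in> ceI b then K else 0) + card {i \<in> elI b. ~ actual i} = K"
    if b: "b \<in> bins v" "v \<in> cells" for b v
  proof -
    obtain k where k: "ceI b = {CellItem v k}" using cell[OF b] by blast
    have "(\<Sum>i\<in>tiI b. vec i Flag) = 0" by (rule sum.neutral) (auto simp: tiI_def)
    moreover have "(\<Sum>i\<in>ceI b. vec i Flag) = (if CellItem v 0 \<in> ceI b then K else 0)" using k by simp
    moreover have "(\<Sum>i\<in>elI b. vec i Flag) = (\<Sum>i\<in>elI b. if ~ actual i then 1 else 0)"
      by (intro sum.cong) (auto simp: elI_def actual_def)
    moreover have "\<dots> = card {i \<in> elI b. ~ actual i}"
      using fin3 by (simp add: sum.If_cases Int_def Collect_neg_eq[symmetric])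
    ultimately show ?thesis using dig[OF b, of Flag] part[of "\<lambda>i. vec i Flag" b] by (simp add: digits_def target_def)
  qed
  have chosen: "actual i" if b: "b \<in> bins v" "v \<in> cells" "CellItem v 0 \<in> ceI b" "i \<in> elI b" for b v i
  proof -
    have "card {i \<in> elI b. ~ actual i} = 0" using flag[OF b(1,2)] b(3) by simp
    then show ?thesis using fin3(3)[of b] b(4) by auto
  qed
  have unchosen: "~ actual i" if b: "b \<in> bins v" "v \<in> cells" "CellItem v 0 \<notin> ceI b" "i \<in> elI b" for b v i
  proof -
    have "card {i \<in> elI b. ~ actual i} = card (elI b)" using flag[OF b(1,2)] b(3) elcard[OF b(1,2)] by simp
    then have "{i \<in> elI b. ~ actual i} = elI b" using fin3(3)[of b] by (intro card_subset_eq) auto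
    then show ?thesis using b(4) by blast
  qed
  have t0: "0 < card tiles" using tiles fin(2) by (simp add: card_gt_0_iff)
  define sb where "sb v = \<phi> (CellItem v 0)" for v
  have sb: "sb v \<in> bins v" "CellItem v 0 \<in> ceI (sb v)" if "v \<in> cells" for v
    using \<phi>[of "CellItem v 0"] that t0 by (auto simp: items_simps sb_def ceI_def)
  define sel where "sel v = tl v (sb v)" for v
  have "selection sel" unfolding selection_def
  proof (intro conjI ballI)
    fix v assume "v \<in> cells"
    then show "sel v \<in> tiles" using tl(1) sb by (simp add: sel_def)
  next
    fix e assume e: "e \<in> elems"
    let ?A = "{v \<in> locs e. kap e \<in> need v (sel v)}"
    have A: "act e & \<phi> (ElemItem e 0) = sb v" if v: "v \<in> ?A" for v
    proof -
      have vc: "v \<in> cells" using v locs[OF e] by auto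
      note b = sb[OF vc]
      have "card {i \<in> elI (sb v). \<exists>e' k. i = ElemItem e' k & kap e' = kap e} = 1"
        using side[OF b(1) vc kap[OF e]] v by (simp add: sel_def)
      then have "{i \<in> elI (sb v). \<exists>e' k. i = ElemItem e' k & kap e' = kap e} ~= {}"
        by (metis card.empty zero_neq_one)
      then obtain e' k where i: "ElemItem e' k \<in> elI (sb v)" "kap e' = kap e" by blast
      then have "ElemItem e' k \<in> ?X (sb v)" by (simp add: elI_def)
      from loc[OF this b(1) vc] have "v \<in> locs e'" by simp
      moreover have "e' \<in> elems" using i by (simp add: elI_def items_simps)
      ultimately have "e' = e" using elem_unique[of e' e v] e v i(2) by auto
      moreover have "actual (ElemItem e' k)" using chosen[OF b(1) vc b(2) i(1)] .
      ultimately show ?thesis using i(1) unfolding actual_def elI_def by blast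
    qed
    have A1: "v = v'" if v: "v \<in> ?A" "v' \<in> ?A" for v v'
    proof -
      have vc: "v \<in> cells" "v' \<in> cells" using v locs[OF e] by auto
      have "sb v = sb v'" using A[OF v(1)] A[OF v(2)] by simp
      then show ?thesis using disj[OF vc, of "sb v"] sb(1)[OF vc(1)] sb(1)[OF vc(2)] by simp
    qed
    show "card ?A = (if act e then 1 else 0)"
    proof (cases "act e")
      case False then have "?A = {}" using A by blast
      then have "card ?A = card ({} :: 'v set)" by (rule arg_cong)
      then show ?thesis using False by simp
    next
      case True
      \<comment> \<open>Copy 0 lies in some bin of some cell of \<open>e\<close>. Being actual it
        cannot be in an unselected bin, so the selected tile of that cell covers
        \<open>e\<close>.\<close>
      have i: "ElemItem e 0 \<in> items" using e deg[OF e True] by (simp add: items_simps)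
      then obtain v where v: "v \<in> locs e" "\<phi> (ElemItem e 0) \<in> bins v" using \<phi>[OF i] by auto
      define b where "b = \<phi> (ElemItem e 0)"
      have vc: "v \<in> cells" using v locs[OF e] by auto
      have eb: "ElemItem e 0 \<in> elI b" using i by (simp add: elI_def b_def)
      have bv: "b \<in> bins v" using v by (simp add: b_def)
      have "CellItem v 0 \<in> ceI b"
        using unchosen[OF bv vc _ eb] True by (auto simp: actual_def)
      then have "b = sb v" by (simp add: ceI_def sb_def)
      moreover have "kap e \<in> need v (tl v b)"
      proof (rule ccontr)
        assume "kap e \<notin> need v (tl v b)"
        then have "card {i \<in> elI b. \<exists>e' k. i = ElemItem e' k & kap e' = kap e} = 0"
          using side[OF bv vc kap[OF e]] by simp
        then have "{i \<in> elI b. \<exists>e' k. i = ElemItem e' k & kap e' = kap e} = {}" using fin3(3)[of b] by simp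
        then show False using eb by blast
      qed
      ultimately have "v \<in> ?A" using v by (simp add: sel_def)
      then have "?A = {v}" using A1 by blast
      then have "card ?A = card {v}" by (rule arg_cong)
      then show ?thesis using True by simp
    qed
  qed
  moreover have "\<phi> (TileItem v \<theta>) = \<phi> (CellItem v 0) \<longleftrightarrow> \<theta> = sel v" if v: "v \<in> cells" "\<theta> \<in> tiles" for v \<theta>
  proof -
    have "\<phi> (TileItem v \<theta>) = sb v \<longleftrightarrow> TileItem v \<theta> \<in> tiI (sb v)"
      using v by (auto simp: tiI_def items_simps)
    also have "\<dots> \<longleftrightarrow> \<theta> = sel v" using tl(2)[OF sb(1)[OF v(1)] v(1)] by (auto simp: sel_def)
    finally show ?thesis by (simp add: sb_def)
  qed
  ultimately show ?thesis by blast
qed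

lemma selection_deg_pos: "selection sel ==> e \<in> elems ==> act e ==> 0 < deg e"
proof -
  assume sel: "selection sel" and e: "e \<in> elems" "act e"
  then have "card {v \<in> locs e. kap e \<in> need v (sel v)} = 1" by (simp add: selection_def)
  then obtain v where v: "v \<in> locs e" "kap e \<in> need v (sel v)"
    by (metis (mono_tags, lifting) card_1_singletonE mem_Collect_eq singletonI)
  have "sel v \<in> {\<theta> \<in> tiles. kap e \<in> need v \<theta>}"
    using sel v locs[OF e(1)] by (auto simp: selection_def)
  then have "0 < card {\<theta> \<in> tiles. kap e \<in> need v \<theta>}" using fin(2) by (auto simp: card_gt_0_iff)
  then show ?thesis unfolding deg_def using v(1) fin_locs[OF e(1)]
    by (metis (no_types, lifting) gr0I less_irrefl sum_eq_0_iff)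
qed

end

section \<open>Computations as tilings\<close>

text \<open>\<open>HRun\<close> broadcasts the state and the symbols read on all tapes along a whole
  row, because a transition of a multi-tape machine depends on cells that may be far apart; its two
  bit lists are the heads that cross a border to the right and to the left. \<open>HInput\<close>
  passes on whether the witness may still continue.\<close>

datatype hcol = HEdge | HRun nat "nat list" "bool list" "bool list" | HInput bool
datatype vcol = VEdge | VInput nat | VCell nat "nat list" "bool list" | VTest nat

type_synonym ('h, 'v) tile = "'h \<times> 'h \<times> 'v \<times> 'v"

definition tile_l :: "('h, 'v) tile => 'h" where "tile_l \<theta> = fst \<theta>"
definition tile_r :: "('h, 'v) tile => 'h" where "tile_r \<theta> = fst (snd \<theta>)"
definition tile_d :: "('h, 'v) tile => 'v" where "tile_d \<theta> = fst (snd (snd \<theta>))"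
definition tile_u :: "('h, 'v) tile => 'v" where "tile_u \<theta> = snd (snd (snd \<theta>))"

lemmas tile_sel_defs = tile_l_def tile_r_def tile_d_def tile_u_def

lemma tile_sel_simps [simp]:
  "tile_l (l, r, d, u) = l" "tile_r (l, r, d, u) = r" "tile_d (l, r, d, u) = d" "tile_u (l, r, d, u) = u"
  by (simp_all add: tile_sel_defs)

definition tiling :: "('h, 'v) tile set => 'h => nat => nat => (nat => 'v) => (nat => 'v) =>
    (nat \<times> nat => ('h, 'v) tile) => bool" where
  "tiling \<Theta> h0 H W bc tc sel \<longleftrightarrow>
     (\<forall>t\<in>{1..H}. \<forall>c\<in>{1..W}. sel (t, c) \<in> \<Theta>) &
     (\<forall>t\<in>{1..H}. tile_l (sel (t, 1)) = h0 & tile_r (sel (t, W)) = h0) &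
     (\<forall>t\<in>{1..H}. \<forall>c\<in>{1..<W}. tile_r (sel (t, c)) = tile_l (sel (t, Suc c))) &
     (\<forall>c\<in>{1..W}. tile_d (sel (1, c)) = bc c & tile_u (sel (H, c)) = tc c) &
     (\<forall>t\<in>{1..<H}. \<forall>c\<in>{1..W}. tile_u (sel (t, c)) = tile_d (sel (Suc t, c)))"

locale machine =
  fixes M :: tm
  assumes wf: "wf_tm M"
begin

abbreviation "K \<equiv> tm_tapes M"

definition reads :: "config => nat list" where
  "reads cf = map (\<lambda>(t, h). t h) (snd cf)"

definition new_state :: "nat => nat list => nat" where
  "new_state q rs = (if q = 1 then 1 else fst (tm_delta M q rs))"

definition writes :: "nat => nat list => nat => nat" where
  "writes q rs k = (if q = 1 then rs ! k else fst (snd (tm_delta M q rs) ! k))"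

definition moves :: "nat => nat list => nat => int" where
  "moves q rs k = (if q = 1 then 0 else snd (snd (tm_delta M q rs) ! k))"

definition content :: "config => nat => int => nat" where
  "content cf k = fst (snd cf ! k)"

definition head :: "config => nat => int" where
  "head cf k = snd (snd cf ! k)"

lemma wf_length: "tm_wf_config M cf ==> length (snd cf) = K" by (simp add: tm_wf_config_def)

lemma reads_nth: "tm_wf_config M cf ==> k < K ==> reads cf ! k = content cf k (head cf k)"
  by (simp add: reads_def wf_length content_def head_def case_prod_unfold)

lemma length_reads: "tm_wf_config M cf ==> length (reads cf) = K" by (simp add: reads_def wf_length)

lemma step_facts:
  assumes cf: "tm_wf_config M cf"
  shows "fst (tm_step M cf) = new_state (fst cf) (reads cf)"
    and "k < K ==> content (tm_step M cf) k = (content cf k)(head cf k := writes (fst cf) (reads cf) k)"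
    and "k < K ==> head (tm_step M cf) k = head cf k + moves (fst cf) (reads cf) k"
    and "k < K ==> moves (fst cf) (reads cf) k \<in> {-1, 0, 1}"
proof -
  obtain q tps where cf': "cf = (q, tps)" by fastforce
  obtain q' acts where D: "tm_delta M q (map (\<lambda>(t, h). t h) tps) = (q', acts)" by fastforce
  note w = tm_wf_delta[OF wf cf[unfolded cf'] D]
  have len: "length tps = K" using wf_length[OF cf] cf' by simp
  show "fst (tm_step M cf) = new_state (fst cf) (reads cf)"
    using D by (simp add: cf' tm_step_def new_state_def reads_def)
  show "content (tm_step M cf) k = (content cf k)(head cf k := writes (fst cf) (reads cf) k)" if "k < K"
    using D that len w(2) reads_nth[OF cf that]
    by (simp add: cf' tm_step_def writes_def reads_def content_def head_def case_prod_unfold)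
  show "head (tm_step M cf) k = head cf k + moves (fst cf) (reads cf) k" if "k < K"
    using D that len w(2) by (simp add: cf' tm_step_def moves_def reads_def head_def case_prod_unfold)
  show "moves (fst cf) (reads cf) k \<in> {-1, 0, 1}" if "k < K"
  proof -
    have "acts ! k \<in> set acts" using that w(2) by simp
    then have "snd (acts ! k) \<in> {-1, 0, 1}" using w(3) by (auto simp: case_prod_unfold)
    then show ?thesis using D by (simp add: moves_def cf' reads_def)
  qed
qed

text \<open>The local view of a configuration at cell \<open>c\<close>, and what crosses the border between the
  cells \<open>c - 1\<close> and \<open>c\<close>: the scanned symbols and the heads moving right and left.\<close>

definition vc_at :: "config => int => vcol" where
  "vc_at cf c = VCell (fst cf) (map (\<lambda>k. content cf k c) [0..<K]) (map (\<lambda>k. head cf k = c) [0..<K])"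

definition hc_at :: "config => int => hcol" where
  "hc_at cf c = HRun (fst cf) (reads cf)
     (map (\<lambda>k. head cf k = c - 1 & moves (fst cf) (reads cf) k = 1) [0..<K])
     (map (\<lambda>k. head cf k = c & moves (fst cf) (reads cf) k = -1) [0..<K])"

text \<open>The colour of a border that no head crosses. It is required at both ends of a row, so
  that heads neither appear from nor vanish into the side columns.\<close>

definition still :: "nat => nat list => hcol" where
  "still q rs = HRun q rs (replicate K False) (replicate K False)"

definition start_cell :: "nat => bool => vcol" where
  "start_cell s st = VCell 0 (s # replicate (K - 1) 0) (replicate K st)"

text \<open>The tiles are cut out of arbitrary well-formed configurations, and neighbours in a
  tiling may stem from different ones; \<open>row_step\<close> shows that matching borders make them
  agree wherever it matters. There are finitely many because all colours belong to
  \<open>hcols\<close> and \<open>vcols\<close>.\<close>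

definition "run_tiles = {(hc_at cf c, hc_at cf (c + 1), vc_at cf c, vc_at (tm_step M cf) c) | cf c. tm_wf_config M cf}"
definition "side_tiles = {(HEdge, still q (reads cf), VEdge, VEdge) | q cf. q < tm_states M & tm_wf_config M cf} \<union>
  {(still q (reads cf), HEdge, VEdge, VEdge) | q cf. q < tm_states M & tm_wf_config M cf} \<union>
  {(HEdge, HInput b, VEdge, VEdge) | b. True} \<union> {(HInput b, HEdge, VEdge, VEdge) | b. True} \<union>
  {(HEdge, HEdge, VEdge, VEdge)}"

text \<open>The input codes 0 to 4 stand for a blank, the two bits, and the two bits at the initial head
  position; code 5 stands for a cell of the witness, whose symbols must not continue after a blank.\<close>

definition "input_tiles = {(HInput b, HInput b', VInput a, start_cell s st) | b b' a s st.
   (a <= 2 & s = a & ~ st) \<or> (a \<in> {3, 4} & s = a - 2 & st) \<or>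
   (a = 5 & ~ st & (s = 0 & ~ b' \<or> s \<in> {1, 2} & b & b'))}"
text \<open>Test 3 accepts any symbol, tests 0 and 2 demand this symbol on the output tape. The
  output \<open>[True]\<close> is recognised as the bit symbol 2 in cell 0 followed by a
  blank.\<close>

definition "final_tiles = {(HEdge, HEdge, vc_at cf c, VTest a) | cf c a. tm_wf_config M cf & fst cf = 1 &
   (a = 3 \<or> a \<in> {0, 2} & content cf 1 c = a)}"
definition "machine_tiles = run_tiles \<union> side_tiles \<union> input_tiles \<union> final_tiles"

lemma K2: "2 <= K" and G3: "3 <= tm_symbols M" and Q2: "2 <= tm_states M"
  using wf by (auto simp: wf_tm_def)

definition "hcols = {HEdge, HInput True, HInput False} \<union>
  (\<lambda>(q, rs, a, b). HRun q rs a b) ` ({..<tm_states M} \<times> {rs. set rs \<subseteq> {..<tm_symbols M} & length rs = K} \<times>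
     {a. set a \<subseteq> UNIV & length a = K} \<times> {a. set a \<subseteq> UNIV & length a = K})"
definition "vcols = {VEdge} \<union> VInput ` {..5} \<union> VTest ` {..3} \<union>
  (\<lambda>(q, rs, a). VCell q rs a) ` ({..<tm_states M} \<times> {rs. set rs \<subseteq> {..<tm_symbols M} & length rs = K} \<times>
     {a. set a \<subseteq> UNIV & length a = K})"

lemma finite_hcols: "finite hcols" and finite_vcols: "finite vcols"
  unfolding hcols_def vcols_def
  by (intro finite_UnI finite_imageI finite_cartesian_product finite_lists_length_eq; simp)+

lemma content_less: "tm_wf_config M cf ==> k < K ==> content cf k c < tm_symbols M"
  by (simp add: tm_wf_config_def content_def)

lemma reads_in: "tm_wf_config M cf ==> set (reads cf) \<subseteq> {..<tm_symbols M} & length (reads cf) = K"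
proof -
  assume cf: "tm_wf_config M cf"
  then have "reads cf ! k < tm_symbols M" if "k < K" for k
    using reads_nth[OF cf that] content_less[OF cf that] by simp
  then show ?thesis using length_reads[OF cf] by (auto simp: in_set_conv_nth)
qed

lemma hc_at_in: "tm_wf_config M cf ==> hc_at cf c \<in> hcols"
  using reads_in[of cf] unfolding hcols_def hc_at_def
  by (intro UnI2 image_eqI[where x = "(_, _, _, _)"]) (auto simp: tm_wf_config_def)

lemma vc_at_in: "tm_wf_config M cf ==> vc_at cf c \<in> vcols"
proof -
  assume cf: "tm_wf_config M cf"
  then have "set (map (\<lambda>k. content cf k c) [0..<K]) \<subseteq> {..<tm_symbols M}"
    using content_less[OF cf] by auto
  moreover have "fst cf < tm_states M" using cf by (simp add: tm_wf_config_def)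
  ultimately show ?thesis using content_less[OF cf] unfolding vcols_def vc_at_def
    by (intro UnI2 image_eqI[where x = "(_, _, _)"]) auto
qed

lemma still_in: "q < tm_states M ==> tm_wf_config M cf ==> still q (reads cf) \<in> hcols"
  using reads_in[of cf] unfolding hcols_def still_def by (intro UnI2 image_eqI[where x = "(_, _, _, _)"]) auto

lemma start_cell_in: "s <= 2 ==> start_cell s st \<in> vcols"
proof -
  assume "s <= 2"
  then have "set (s # replicate (K - 1) 0) \<subseteq> {..<tm_symbols M}" using G3 by auto
  moreover have "length (s # replicate (K - 1) 0) = K" using K2 by simp
  ultimately show ?thesis unfolding vcols_def start_cell_def using Q2
    by (intro UnI2 image_eqI[where x = "(_, _, _)"]) auto
qed

lemma machine_tiles_in: "machine_tiles \<subseteq> hcols \<times> hcols \<times> vcols \<times> vcols"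
proof
  fix \<theta> assume "\<theta> \<in> machine_tiles"
  then consider "\<theta> \<in> run_tiles" | "\<theta> \<in> side_tiles" | "\<theta> \<in> input_tiles" | "\<theta> \<in> final_tiles"
    unfolding machine_tiles_def by blast
  then show "\<theta> \<in> hcols \<times> hcols \<times> vcols \<times> vcols"
  proof cases
    case 1
    then obtain cf c where "tm_wf_config M cf"
      "\<theta> = (hc_at cf c, hc_at cf (c + 1), vc_at cf c, vc_at (tm_step M cf) c)"
      unfolding run_tiles_def by blast
    then show ?thesis using hc_at_in[of cf] vc_at_in[of cf] vc_at_in[OF tm_wf_step[OF wf], of cf] by simp
  next
    case 2 then show ?thesis using still_in by (auto simp: side_tiles_def) (auto simp: hcols_def vcols_def)
  next
    case 3
    have H: "HInput b \<in> hcols" for b by (cases b) (auto simp: hcols_def)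
    have V: "VInput a \<in> vcols" if "a <= 5" for a using that by (simp add: vcols_def)
    from 3 H V start_cell_in show ?thesis by (auto simp: input_tiles_def)
  next
    case 4 then show ?thesis using vc_at_in by (auto simp: final_tiles_def) (auto simp: hcols_def vcols_def)
  qed
qed

lemma vc_at_eq:
  assumes "vc_at cf c = vc_at cf' c'"
  shows "fst cf = fst cf'" "k < K ==> content cf k c = content cf' k c'"
    "k < K ==> head cf k = c \<longleftrightarrow> head cf' k = c'"
  using assms by (auto simp: vc_at_def)

text \<open>Each tile belongs to its own configuration \<open>C c\<close> and position
  \<open>p c\<close>. Matching colours make the broadcast list of read symbols constant along the
  row, and its entry for tape \<open>k\<close> is correct at the cell where the head of tape
  \<open>k\<close> stands; so it equals \<open>reads cf\<close> everywhere. With the transition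
  known, the arrival flags at a border equal the departures in the neighbouring cell, and at the two
  ends \<open>still\<close> rules out arrivals. Thus symbol and head presence after the step are
  right in every cell.\<close>

lemma row_step:
  assumes cf: "tm_wf_config M cf"
    and tile: "\<And>c. lo <= c ==> c <= hi ==> \<theta> c \<in> run_tiles & tile_d (\<theta> c) = vc_at cf c"
    and match: "\<And>c. lo <= c ==> c < hi ==> tile_r (\<theta> c) = tile_l (\<theta> (c + 1))"
    and left: "\<exists>q rs. tile_l (\<theta> lo) = still q rs" and right: "\<exists>q rs. tile_r (\<theta> hi) = still q rs"
    and heads: "\<And>k. k < K ==> lo <= head cf k & head cf k <= hi"
    and c: "lo <= c" "c <= hi"
  shows "tile_u (\<theta> c) = vc_at (tm_step M cf) (c :: int)"
proof -
  have "\<forall>c. \<exists>cf' p. lo <= c & c <= hi --> tm_wf_config M cf' &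
      \<theta> c = (hc_at cf' p, hc_at cf' (p + 1), vc_at cf' p, vc_at (tm_step M cf') p)"
    using tile unfolding run_tiles_def by blast
  then obtain C p where C: "\<And>c. lo <= c ==> c <= hi ==> tm_wf_config M (C c) &
      \<theta> c = (hc_at (C c) (p c), hc_at (C c) (p c + 1), vc_at (C c) (p c), vc_at (tm_step M (C c)) (p c))"
    by metis
  have wfC: "tm_wf_config M (C c)" if "lo <= c" "c <= hi" for c using C[OF that] by simp
  have d: "vc_at (C c) (p c) = vc_at cf c" if "lo <= c" "c <= hi" for c
    using C[OF that] tile[OF that] by simp
  note v = vc_at_eq[OF d]
  have next_reads: "hc_at (C c) (p c + 1) = hc_at (C (c + 1)) (p (c + 1))" if "lo <= c" "c < hi" for c
    using match[OF that] C[of c] C[of "c + 1"] that by simp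
  have same: "reads (C c) = reads (C lo)" if "lo <= c" "c <= hi" for c
    using that
  proof (induction c rule: int_ge_induct)
    case (step c) then have "reads (C (c + 1)) = reads (C c)" using next_reads[of c] by (simp add: hc_at_def)
    then show ?case using step by simp
  qed simp
  have lohi: "lo <= hi" using c by simp
  have rs: "reads (C c) = reads cf" if c: "lo <= c" "c <= hi" for c
  proof (rule nth_equalityI)
    show "length (reads (C c)) = length (reads cf)" using length_reads wfC[OF c] cf by simp
    fix k assume "k < length (reads (C c))"
    then have k: "k < K" using length_reads[OF wfC[OF c]] by simp
    let ?h = "head cf k"
    have h: "lo <= ?h" "?h <= hi" using heads[OF k] by auto
    have "reads (C c) ! k = reads (C ?h) ! k" using same[OF c] same[OF h] by simp
    also have "\<dots> = content (C ?h) k (head (C ?h) k)" using reads_nth[OF wfC[OF h] k] .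
    also have "head (C ?h) k = p ?h" using v(3)[OF h k] by simp
    also have "content (C ?h) k (p ?h) = content cf k ?h" using v(2)[OF h k] .
    also have "\<dots> = reads cf ! k" using reads_nth[OF cf k] by simp
    finally show "reads (C c) ! k = reads cf ! k" .
  qed
  let ?m = "moves (fst cf) (reads cf)"
  have fromleft: "head (C c) k = p c - 1 & ?m k = 1 \<longleftrightarrow> head cf k = c - 1 & ?m k = 1" if k: "k < K" for k
  proof (cases "c = lo")
    case True
    obtain q r where "hc_at (C lo) (p lo) = still q r" using left C[of lo] lohi by auto
    then have "map (\<lambda>k. head (C lo) k = p lo - 1 & moves (fst (C lo)) (reads (C lo)) k = 1) [0..<K] = replicate K False"
      unfolding hc_at_def still_def hcol.inject by (elim conjE)
    then have "map (\<lambda>k. head (C lo) k = p lo - 1 & moves (fst (C lo)) (reads (C lo)) k = 1) [0..<K] ! k = replicate K False ! k"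
      by simp
    then have "~ (head (C lo) k = p lo - 1 & ?m k = 1)"
      using k v(1)[of lo] rs[of lo] lohi by simp
    moreover have "head cf k ~= c - 1" using heads[OF k] True by auto
    ultimately show ?thesis using True by simp
  next
    case False then have c': "lo <= c - 1" "c - 1 <= hi" "c - 1 < hi" using c by auto
    have "hc_at (C (c - 1)) (p (c - 1) + 1) = hc_at (C c) (p c)" using next_reads[OF c'(1,3)] by simp
    then have "(head (C (c - 1)) k = p (c - 1) & ?m k = 1) = (head (C c) k = p c - 1 & ?m k = 1)"
      using k rs[OF c] rs[OF c'(1,2)] v(1)[OF c] v(1)[OF c'(1,2)] by (simp add: hc_at_def)
    then show ?thesis using v(3)[OF c'(1,2) k] by simp
  qed
  have fromright: "head (C c) k = p c + 1 & ?m k = -1 \<longleftrightarrow> head cf k = c + 1 & ?m k = -1" if k: "k < K" for k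
  proof (cases "c = hi")
    case True
    obtain q r where "hc_at (C hi) (p hi + 1) = still q r" using right C[of hi] lohi by auto
    then have "map (\<lambda>k. head (C hi) k = p hi + 1 & moves (fst (C hi)) (reads (C hi)) k = -1) [0..<K] = replicate K False"
      unfolding hc_at_def still_def hcol.inject by (elim conjE)
    then have "map (\<lambda>k. head (C hi) k = p hi + 1 & moves (fst (C hi)) (reads (C hi)) k = -1) [0..<K] ! k = replicate K False ! k"
      by simp
    then have "~ (head (C hi) k = p hi + 1 & ?m k = -1)"
      using k v(1)[of hi] rs[of hi] lohi by simp
    moreover have "head cf k ~= c + 1" using heads[OF k] True by auto
    ultimately show ?thesis using True by simp
  next
    case False then have c': "lo <= c + 1" "c + 1 <= hi" "c < hi" using c by auto
    have "hc_at (C c) (p c + 1) = hc_at (C (c + 1)) (p (c + 1))" using next_reads[OF c(1) c'(3)] .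
    then have "(head (C c) k = p c + 1 & ?m k = -1) = (head (C (c + 1)) k = p (c + 1) & ?m k = -1)"
      using k rs[OF c] rs[OF c'(1,2)] v(1)[OF c] v(1)[OF c'(1,2)] by (simp add: hc_at_def)
    then show ?thesis using v(3)[OF c'(1,2) k] by simp
  qed
  note sC = step_facts[OF wfC[OF c]] and sc = step_facts[OF cf]
  have "fst (tm_step M (C c)) = fst (tm_step M cf)" using sC(1) sc(1) v(1)[OF c] rs[OF c] by simp
  moreover have "content (tm_step M (C c)) k (p c) = content (tm_step M cf) k c" if k: "k < K" for k
    using sC(2)[OF k] sc(2)[OF k] v(1)[OF c] v(2,3)[OF c k] rs[OF c] by (cases "head cf k = c") simp_all
  moreover have "head (tm_step M (C c)) k = p c \<longleftrightarrow> head (tm_step M cf) k = c" if k: "k < K" for k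
  proof -
    have e: "head (tm_step M (C c)) k = head (C c) k + ?m k" "head (tm_step M cf) k = head cf k + ?m k"
      using sC(3)[OF k] sc(3)[OF k] v(1)[OF c] rs[OF c] by simp_all
    consider "?m k = 0" | "?m k = 1" | "?m k = -1" using sc(4)[OF k] by auto
    then show ?thesis
    proof cases
      case 1 then show ?thesis unfolding e using v(3)[OF c k] by simp
    next
      case 2 then show ?thesis unfolding e using fromleft[OF k] by auto
    next
      case 3 then show ?thesis unfolding e using fromright[OF k] by auto
    qed
  qed
  ultimately show ?thesis using C[OF c] by (simp add: vc_at_def)
qed

definition input_code :: "bool list => nat => int => nat" where
  "input_code X p i = (if i < 0 then 0 else if i < int (length X) then bit_sym (X ! nat i) + (if i = 0 then 2 else 0)
     else if i < int (length X + p) then 5 else 0)"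

text \<open>Column \<open>c\<close> shows tape cell \<open>c - T - 2\<close>, and columns 1 and
  \<open>W\<close> are the sides. For the width used below the visible cells range from
  \<open>- T\<close> to \<open>T + length X + p\<close>, so heads that start in cell 0 stay visible
  for \<open>T\<close> steps.\<close>

definition bottom_colour :: "bool list => nat => nat => nat => nat => vcol" where
  "bottom_colour X p T W c = (if c <= 1 \<or> W <= c then VEdge else VInput (input_code X p (int c - int T - 2)))"

definition top_colour :: "nat => nat => nat => vcol" where
  "top_colour T W c = (if c <= 1 \<or> W <= c then VEdge
     else VTest (if c = T + 2 then 2 else if c = T + 3 then 0 else 3))"

lemma init_facts:
  "fst (tm_init M x) = 0"
  "k < K ==> content (tm_init M x) k = (if k = 0 then input_tape x else (\<lambda>_. 0))"
  "k < K ==> head (tm_init M x) k = 0"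
  by (auto simp: tm_init_def content_def head_def nth_Cons input_tape_def split: nat.split)

lemma vc_at_init: "vc_at (tm_init M x) c = start_cell (input_tape x c) (c = 0)"
proof -
  have "map (\<lambda>k. content (tm_init M x) k c) [0..<K] = input_tape x c # replicate (K - 1) 0"
    using K2 by (intro nth_equalityI) (auto simp: init_facts nth_Cons split: nat.split)
  moreover have "map (\<lambda>k. head (tm_init M x) k = c) [0..<K] = replicate K (c = 0)"
    by (intro nth_equalityI) (auto simp: init_facts)
  ultimately show ?thesis by (simp add: vc_at_def start_cell_def init_facts)
qed

lemma head_bound:
  assumes "k < K"
  shows "\<bar>head ((tm_step M ^^ i) (tm_init M x)) k\<bar> <= int i"
proof (induction i)
  case 0 then show ?case using assms by (simp add: init_facts)
next
  case (Suc i)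
  show ?case using Suc step_facts(3,4)[OF tm_wf_steps[OF wf tm_wf_init[OF wf, of x], of i] assms] by auto
qed

lemma input_tape_append:
  "input_tape (X @ w) i = (if i < 0 then 0 else if i < int (length X) then bit_sym (X ! nat i)
     else if i < int (length X + length w) then bit_sym (w ! nat (i - int (length X))) else 0)"
  by (auto simp: input_tape_def nth_append nat_diff_distrib nat_less_iff)

text \<open>Row 1 turns the input codes into the start configuration, row \<open>i + 2\<close>
  performs step \<open>i\<close>, and row \<open>T + 2\<close> tests the output.\<close>

theorem run_tiling:
  assumes W: "W = 2 * T + length X + p + 3" and X: "X ~= []" and w: "length w <= p"
    and out: "tm_output ((tm_step M ^^ T) (tm_init M (X @ w))) [True]"
  shows "\<exists>sel. tiling machine_tiles HEdge (T + 2) W (bottom_colour X p T W) (top_colour T W) sel"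
proof -
  define C where "C i = (tm_step M ^^ i) (tm_init M (X @ w))" for i
  have wfC: "tm_wf_config M (C i)" for i unfolding C_def by (intro tm_wf_steps tm_wf_init wf)
  have X1: "1 <= length X" using X by (cases X) auto
  define P where "P c = int c - int T - 2" for c :: nat
  \<comment> \<open>The bit on the left border of column \<open>c\<close>. It is still true at the
    first blank after the witness and false from the next border on, as the tiles for code 5
    demand.\<close>
  define B where "B c \<longleftrightarrow> P c <= int (length X + length w)" for c
  let ?inp = "input_code X p"
  define row1 where "row1 c = (if c = 1 then (HEdge, HInput (B 2), VEdge, VEdge)
    else if c = W then (HInput (B W), HEdge, VEdge, VEdge)
    else (HInput (B c), HInput (B (Suc c)), VInput (?inp (P c)), vc_at (C 0) (P c)))" for c
  define rowF where "rowF c = (if c = 1 \<or> c = W then (HEdge, HEdge, VEdge, VEdge)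
    else (HEdge, HEdge, vc_at (C T) (P c), top_colour T W c))" for c
  define run where "run i c = (if c = 1 then (HEdge, still (fst (C i)) (reads (C i)), VEdge, VEdge)
    else if c = W then (still (fst (C i)) (reads (C i)), HEdge, VEdge, VEdge)
    else (hc_at (C i) (P c), hc_at (C i) (P c + 1), vc_at (C i) (P c), vc_at (C (Suc i)) (P c)))" for i c
  define sel where "sel = (\<lambda>(t, c). if t = 1 then row1 c else if t = T + 2 then rowF c else run (t - 2) c)"
  have PS: "P (Suc c) = P c + 1" for c by (simp add: P_def)
  have W4: "4 <= W" using W X1 by simp
  have row1_in: "row1 c \<in> machine_tiles" if c: "1 <= c" "c <= W" for c
  proof -
    consider "c = 1 \<or> c = W" | "1 < c" "c < W" using c by linarith
    then show ?thesis
    proof cases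
      case 1 then show ?thesis using W4 by (auto simp: row1_def machine_tiles_def side_tiles_def)
    next
      case 2
      define a s st where "a = ?inp (P c)" and "s = input_tape (X @ w) (P c)" and "st \<longleftrightarrow> P c = 0"
      let ?L = "int (length X)"
      have "(a <= 2 & s = a & ~ st) \<or> (a \<in> {3, 4} & s = a - 2 & st) \<or>
         (a = 5 & ~ st & (s = 0 & ~ B (Suc c) \<or> s \<in> {1, 2} & B c & B (Suc c)))"
      proof -
        consider (A) "P c < 0" | (B) "0 <= P c" "P c < ?L" | (C) "?L <= P c" "P c < ?L + int p" | (D) "?L + int p <= P c"
          by linarith
        then show ?thesis
        proof cases
          case A then show ?thesis by (simp add: a_def s_def st_def input_code_def input_tape_append)
        next
          case B
          then show ?thesis by (auto simp: a_def s_def st_def input_code_def input_tape_append bit_sym_def)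
        next
          case C then have "a = 5" "~ st" using X1 by (auto simp: a_def st_def input_code_def)
          then show ?thesis using C by (auto simp: s_def input_tape_append B_def PS bit_sym_def)
        next
          case D
          then show ?thesis using X1 w by (auto simp: a_def s_def st_def input_code_def input_tape_append)
        qed
      qed
      moreover have "row1 c = (HInput (B c), HInput (B (Suc c)), VInput a, start_cell s st)"
        using 2 by (simp add: row1_def a_def s_def st_def C_def vc_at_init)
      ultimately have "row1 c \<in> input_tiles" unfolding input_tiles_def by blast
      then show ?thesis by (simp add: machine_tiles_def)
    qed
  qed
  have out': "fst (C T) = 1" "content (C T) 1 0 = 2" "content (C T) 1 1 = 0"
    using out by (auto simp: tm_output_def C_def content_def bit_sym_def)
  have rowF_in: "rowF c \<in> machine_tiles" if c: "1 <= c" "c <= W" for c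
  proof -
    consider "c = 1 \<or> c = W" | "1 < c" "c < W" using c by linarith
    then show ?thesis
    proof cases
      case 1 then show ?thesis by (auto simp: rowF_def machine_tiles_def side_tiles_def)
    next
      case 2
      define a where "a = (if c = T + 2 then 2 else if c = T + 3 then 0 else 3 :: nat)"
      have "a = 3 \<or> a \<in> {0, 2} & content (C T) 1 (P c) = a"
        using out' by (auto simp: a_def P_def)
      moreover have "rowF c = (HEdge, HEdge, vc_at (C T) (P c), VTest a)"
        using 2 by (simp add: rowF_def top_colour_def a_def)
      ultimately have "rowF c \<in> final_tiles" unfolding final_tiles_def using wfC[of T] out'(1) by blast
      then show ?thesis by (simp add: machine_tiles_def)
    qed
  qed
  have run_in: "run i c \<in> machine_tiles" if c: "1 <= c" "c <= W" for i c
  proof -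
    have q: "fst (C i) < tm_states M" using wfC[of i] by (simp add: tm_wf_config_def)
    consider "c = 1" | "c = W" "c ~= 1" | "1 < c" "c < W" using c by linarith
    then show ?thesis
    proof cases
      case 1 then have "run i c = (HEdge, still (fst (C i)) (reads (C i)), VEdge, VEdge)" by (simp add: run_def)
      then have "run i c \<in> side_tiles" using q wfC[of i] unfolding side_tiles_def by blast
      then show ?thesis by (simp add: machine_tiles_def)
    next
      case 2 then have "run i c = (still (fst (C i)) (reads (C i)), HEdge, VEdge, VEdge)" by (simp add: run_def)
      then have "run i c \<in> side_tiles" using q wfC[of i] unfolding side_tiles_def by blast
      then show ?thesis by (simp add: machine_tiles_def)
    next
      case 3
      have "C (Suc i) = tm_step M (C i)" by (simp add: C_def)
      then have "run i c = (hc_at (C i) (P c), hc_at (C i) (P c + 1), vc_at (C i) (P c), vc_at (tm_step M (C i)) (P c))"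
        using 3 by (simp add: run_def)
      then have "run i c \<in> run_tiles" using wfC[of i] unfolding run_tiles_def by blast
      then show ?thesis by (simp add: machine_tiles_def)
    qed
  qed
  have edge: "hc_at (C i) (P 2) = still (fst (C i)) (reads (C i))" "hc_at (C i) (P W) = still (fst (C i)) (reads (C i))"
    if "i < T" for i
  proof -
    have h: "- int T < head (C i) k & head (C i) k < int T" if "k < K" for k
      using head_bound[OF that, of i "X @ w"] \<open>i < T\<close> by (auto simp: C_def)
    have "map (\<lambda>k. head (C i) k = P 2 - 1 & moves (fst (C i)) (reads (C i)) k = 1) [0..<K] = replicate K False"
      "map (\<lambda>k. head (C i) k = P 2 & moves (fst (C i)) (reads (C i)) k = -1) [0..<K] = replicate K False"
      "map (\<lambda>k. head (C i) k = P W - 1 & moves (fst (C i)) (reads (C i)) k = 1) [0..<K] = replicate K False"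
      "map (\<lambda>k. head (C i) k = P W & moves (fst (C i)) (reads (C i)) k = -1) [0..<K] = replicate K False"
      by (intro nth_equalityI; use h X1 in \<open>force simp: P_def W\<close>)+
    then show "hc_at (C i) (P 2) = still (fst (C i)) (reads (C i))" "hc_at (C i) (P W) = still (fst (C i)) (reads (C i))"
      by (simp_all add: hc_at_def still_def)
  qed
  have match_run: "tile_r (run i c) = tile_l (run i (Suc c))" if "1 <= c" "c < W" "i < T" for i c
    using that edge[OF that(3)] W4 by (auto simp: run_def PS numeral_2_eq_2)
  have "tile_r (sel (t, c)) = tile_l (sel (t, Suc c))" if tc: "1 <= t" "t <= T + 2" "1 <= c" "c < W" for t c
  proof -
    consider "t = 1" | "t = T + 2" | "2 <= t" "t < T + 2" using tc by linarith
    then show ?thesis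
    proof cases
      case 1 then show ?thesis using tc W4 by (auto simp: sel_def row1_def numeral_2_eq_2)
    next
      case 2 then show ?thesis by (auto simp: sel_def rowF_def)
    next
      case 3 then show ?thesis using match_run[of c "t - 2"] tc by (auto simp: sel_def)
    qed
  qed
  moreover have "tile_l (sel (t, 1)) = HEdge & tile_r (sel (t, W)) = HEdge" for t
    using W4 by (simp add: sel_def row1_def rowF_def run_def)
  moreover have "tile_d (sel (1, c)) = bottom_colour X p T W c" if "1 <= c" "c <= W" for c
    using that by (auto simp: sel_def row1_def bottom_colour_def P_def)
  moreover have "tile_u (sel (T + 2, c)) = top_colour T W c" if "1 <= c" "c <= W" for c
    using that by (auto simp: sel_def rowF_def top_colour_def)
  moreover have "tile_u (sel (t, c)) = tile_d (sel (Suc t, c))" if tc: "1 <= t" "t < T + 2" "1 <= c" "c <= W" for t c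
  proof -
    consider "t = 1" "T = 0" | "t = 1" "0 < T" | "2 <= t" "t = T + 1" | "2 <= t" "t < T + 1" using tc by linarith
    then show ?thesis
    proof cases
      case 3 then have "Suc (t - 2) = T" by linarith
      then show ?thesis using 3 by (auto simp: sel_def run_def rowF_def)
    next
      case 4 then have "Suc (t - 2) = Suc t - 2" by linarith
      then show ?thesis using 4 by (auto simp: sel_def run_def)
    qed (auto simp: sel_def row1_def run_def rowF_def)
  qed
  moreover have "sel (t, c) \<in> machine_tiles" if "1 <= c" "c <= W" for t c
    using row1_in[OF that] rowF_in[OF that] run_in[OF that] by (simp add: sel_def)
  ultimately show ?thesis unfolding tiling_def by (intro exI[of _ sel]) auto
qed

definition witness_bit :: "(hcol, vcol) tile => bool list" where
  "witness_bit \<theta> = (if (\<exists>st. tile_u \<theta> = start_cell 1 st) then [False]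
     else if (\<exists>st. tile_u \<theta> = start_cell 2 st) then [True] else [])"

lemma start_cell_inj: "start_cell s st = start_cell s' st' \<longleftrightarrow> s = s' & st = st'"
  using K2 by (auto simp: start_cell_def)

text \<open>The constructor of the lower colour separates the families of tiles, so the side
  columns, the input row and the rows above it can only be tiled in the intended way.\<close>

lemma tile_kinds:
  assumes "\<theta> \<in> machine_tiles"
  shows "tile_d \<theta> = VEdge ==> tile_u \<theta> = VEdge"
    and "tile_d \<theta> = VInput a ==> \<theta> \<in> input_tiles"
    and "tile_d \<theta> = VCell q s h ==> \<theta> \<in> run_tiles \<or> \<theta> \<in> final_tiles"
    and "tile_d \<theta> ~= VTest a" and "tile_u \<theta> = VTest a ==> \<theta> \<in> final_tiles"
    and "tile_l \<theta> = HRun q s e f ==> tile_d \<theta> = VEdge ==> \<exists>q rs. tile_l \<theta> = still q rs"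
    and "tile_r \<theta> = HRun q s e f ==> tile_d \<theta> = VEdge ==> \<exists>q rs. tile_r \<theta> = still q rs"
  using assms unfolding machine_tiles_def run_tiles_def side_tiles_def input_tiles_def final_tiles_def
  by (auto simp: vc_at_def still_def start_cell_def)

text \<open>The input row may choose the symbols of the witness cells, but the bits passed along
  force blanks after the first blank; so these cells hold a word \<open>w\<close> followed by blanks
  and the row shows the start configuration for \<open>X @ w\<close>. Induction with
  \<open>row_step\<close> then shows that the lower colours of row \<open>i + 2\<close> are
  configuration \<open>i\<close>, and the last row certifies its output.\<close>

theorem tiling_run:
  assumes W: "W = 2 * T + length X + p + 3" and X: "X ~= []"
    and til: "tiling machine_tiles HEdge (T + 2) W (bottom_colour X p T W) (top_colour T W) sel"
  defines "w \<equiv> concat (map (\<lambda>i. witness_bit (sel (1, T + 2 + length X + i))) [0..<p])"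
  shows "length w <= p" "tm_output ((tm_step M ^^ T) (tm_init M (X @ w))) [True]"
proof -
  define P where "P c = int c - int T - 2" for c :: nat
  define cl where "cl i = nat (i + int T + 2)" for i :: int
  have Pcl: "P (cl i) = i" if "- int T <= i" for i using that by (simp add: P_def cl_def)
  let ?lo = "- int T" and ?hi = "int (T + length X + p)"
  have X1: "1 <= length X" using X by (cases X) auto
  have cl_in: "1 < cl i" "cl i < W" "1 <= cl i" "cl i <= W" if "?lo <= i" "i <= ?hi" for i
    using that by (auto simp: cl_def W)
  have cl_Suc: "cl (i + 1) = Suc (cl i)" if "?lo <= i" for i using that by (simp add: cl_def)
  have sel: "sel (t, c) \<in> machine_tiles" if "1 <= t" "t <= T + 2" "1 <= c" "c <= W" for t c
    using til that by (simp add: tiling_def)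
  have match: "tile_r (sel (t, c)) = tile_l (sel (t, Suc c))" if "1 <= t" "t <= T + 2" "1 <= c" "c < W" for t c
    using til that by (simp add: tiling_def)
  have up: "tile_u (sel (t, c)) = tile_d (sel (Suc t, c))" if "1 <= t" "t < T + 2" "1 <= c" "c <= W" for t c
    using til that by (simp add: tiling_def)
  have bot: "tile_d (sel (1, c)) = bottom_colour X p T W c" if "1 <= c" "c <= W" for c
    using til that by (simp add: tiling_def)
  have topc: "tile_u (sel (T + 2, c)) = top_colour T W c" if "1 <= c" "c <= W" for c
    using til that by (simp add: tiling_def)
  have edge: "tile_d (sel (t, c)) = VEdge" if "1 <= t" "t <= T + 2" "c = 1 \<or> c = W" for t c
    using that(1,2)
  proof (induction t rule: nat_induct_at_least)
    case base then show ?case using bot[of c] that(3) W by (auto simp: bottom_colour_def)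
  next
    case (Suc t) then show ?case using up[of t c] tile_kinds(1)[OF sel[of t c]] that(3) W by auto
  qed
  have inp: "\<exists>b b' s st. sel (1, cl i) = (HInput b, HInput b', VInput (input_code X p i), start_cell s st) &
     ((input_code X p i <= 2 & s = input_code X p i & ~ st) \<or>
      (input_code X p i \<in> {3, 4} & s = input_code X p i - 2 & st) \<or>
      (input_code X p i = 5 & ~ st & (s = 0 & ~ b' \<or> s \<in> {1, 2} & b & b')))"
    if i: "?lo <= i" "i <= ?hi" for i
  proof -
    have "tile_d (sel (1, cl i)) = VInput (input_code X p i)"
      using bot[of "cl i"] cl_in[OF i] Pcl[OF i(1)] by (simp add: bottom_colour_def P_def)
    moreover from this have "sel (1, cl i) \<in> input_tiles"
      using tile_kinds(2)[OF sel[of 1 "cl i"]] cl_in[OF i] by simp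
    ultimately show ?thesis unfolding input_tiles_def by clarsimp metis
  qed
  define sy where "sy i = (THE s. \<exists>st. tile_u (sel (1, cl i)) = start_cell s st)" for i
  have sy: "sy i = s" if "tile_u (sel (1, cl i)) = start_cell s st" for i s st
    unfolding sy_def using that by (auto simp: start_cell_inj)
  define L where "L = int (length X)"
  have code5: "input_code X p (L + int j) = 5" if "j < p" for j using that by (simp add: input_code_def L_def)
  have in_range: "?lo <= L + int j" "L + int j <= ?hi" if "j <= p" for j using that by (auto simp: L_def)
  have wit: "sy (L + int j) <= 2" if "j < p" for j
    using inp[of "L + int j"] in_range[of j] code5[OF that] that sy[of "L + int j"] by auto
  have stop: "sy (L + int (Suc j)) = 0" if j: "Suc j < p" "sy (L + int j) = 0" for j
  proof -
    obtain b b' st s where 1: "sel (1, cl (L + int j)) = (HInput b, HInput b', VInput 5, start_cell s st)"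
      "s = 0 & ~ b' \<or> s \<in> {1, 2} & b & b'"
      using inp[of "L + int j"] in_range[of j] code5[of j] j by auto
    then have "s = 0" using sy[of "L + int j" s st] j by simp
    then have "~ b'" using 1(2) by simp
    obtain c c' st' s' where 2: "sel (1, cl (L + int (Suc j))) = (HInput c, HInput c', VInput 5, start_cell s' st')"
      "s' = 0 & ~ c' \<or> s' \<in> {1, 2} & c & c'"
      using inp[of "L + int (Suc j)"] in_range[of "Suc j"] code5[of "Suc j"] j by auto
    have "cl (L + int (Suc j)) = Suc (cl (L + int j))" by (simp add: cl_def L_def)
    then have "c = b'" using match[of 1 "cl (L + int j)"] cl_in[of "L + int j"] in_range[of j] j 1(1) 2(1) by auto
    then have "s' = 0" using 2(2) \<open>~ b'\<close> by simp
    then show ?thesis using sy[of "L + int (Suc j)" s' st'] 2(1) by simp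
  qed
  have stops: "sy (L + int k) = 0" if "j <= k" "k < p" "sy (L + int j) = 0" for j k
    using that(1,2)
  proof (induction k rule: nat_induct_at_least)
    case base then show ?case using that(3) by simp
  next
    case (Suc k) then show ?case using stop[of k] by simp
  qed
  have cw: "cl (L + int i) = T + 2 + length X + i" for i by (simp add: cl_def L_def)
  have wb: "witness_bit (sel (1, T + 2 + length X + j)) =
      (if sy (L + int j) = 1 then [False] else if sy (L + int j) = 2 then [True] else [])" if j: "j < p" for j
  proof -
    obtain b b' s st where "sel (1, cl (L + int j)) = (HInput b, HInput b', VInput 5, start_cell s st)"
      using inp[of "L + int j"] in_range[of j] code5[of j] j by auto
    then show ?thesis using sy[of "L + int j" s st] unfolding cw by (auto simp: witness_bit_def start_cell_inj)
  qed
  \<comment> \<open>The first blank among the \<open>p\<close> witness cells, or \<open>p\<close> if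
    there is none; this is the length of \<open>w\<close>.\<close>
  define m where "m = (LEAST m. m = p \<or> m < p & sy (L + int m) = 0)"
  have m: "m = p \<or> m < p & sy (L + int m) = 0"
    unfolding m_def by (rule LeastI[of _ p]) simp
  have lm: "sy (L + int j) ~= 0" if "j < m" for j
    using not_less_Least[of j "\<lambda>m. m = p \<or> m < p & sy (L + int m) = 0"] that m by (auto simp: m_def[symmetric])
  have mp: "m <= p" using m by auto
  have weq: "w = map (\<lambda>j. sy (L + int j) = 2) [0..<m]"
  proof -
    have "[0..<p] = [0..<m] @ [m..<p]" using mp by (metis le0 upt_add_eq_append le_add_diff_inverse)
    moreover have "concat (map (\<lambda>i. witness_bit (sel (1, T + 2 + length X + i))) [m..<p]) = []"
      using wb stops[of m] m by auto
    moreover have "concat (map (\<lambda>i. witness_bit (sel (1, T + 2 + length X + i))) [0..<m]) =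
        concat (map (\<lambda>j. [sy (L + int j) = 2]) [0..<m])"
    proof (intro arg_cong[where f = concat] map_cong refl)
      fix j assume "j \<in> set [0..<m]"
      then have j: "j < m" "j < p" using mp by auto
      then have "sy (L + int j) = 1 \<or> sy (L + int j) = 2" using lm[OF j(1)] wit[OF j(2)] by linarith
      then show "witness_bit (sel (1, T + 2 + length X + j)) = [sy (L + int j) = 2]" using wb[OF j(2)] by auto
    qed
    ultimately show ?thesis unfolding w_def by (simp add: concat_map_singleton)
  qed
  have lw: "length w = m" by (simp add: weq)
  show "length w <= p" using lw mp by simp
  define C where "C i = (tm_step M ^^ i) (tm_init M (X @ w))" for i
  have wfC: "tm_wf_config M (C i)" for i unfolding C_def by (intro tm_wf_steps tm_wf_init wf)
  have "tile_d (sel (i + 2, cl c)) = vc_at (C i) c" if "i <= T" "?lo <= c" "c <= ?hi" for i c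
    using that
  proof (induction i arbitrary: c)
    case 0
    obtain b b' s st where t: "sel (1, cl c) = (HInput b, HInput b', VInput (input_code X p c), start_cell s st)"
      and cs: "(input_code X p c <= 2 & s = input_code X p c & ~ st) \<or>
      (input_code X p c \<in> {3, 4} & s = input_code X p c - 2 & st) \<or>
      (input_code X p c = 5 & ~ st & (s = 0 & ~ b' \<or> s \<in> {1, 2} & b & b'))"
      using inp[OF 0(2,3)] by blast
    have ss: "sy c = s" using sy[of c s st] t by simp
    have "s = input_tape (X @ w) c & st = (c = 0)"
    proof (cases "L <= c & c < L + int p")
      case True
      then obtain j where j: "c = L + int j" "j < p" by (metis zle_iff_zadd of_nat_less_iff add_less_cancel_left)
      have "~ st" using cs code5[OF j(2)] j(1) by auto
      moreover have "c ~= 0" using True X1 by (simp add: L_def)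
      moreover have "s = input_tape (X @ w) c"
      proof (cases "j < m")
        case True then have "s = 1 \<or> s = 2" using lm[OF True] wit[OF j(2)] ss j by auto
        moreover have "w ! j = (s = 2)" using True ss j(1) by (simp add: weq)
        ultimately show ?thesis using True lw j(1) by (auto simp: input_tape_append L_def bit_sym_def)
      next
        case False then have "s = 0" using stops[of m j] m j ss by auto
        then show ?thesis using False lw j(1) by (simp add: input_tape_append L_def)
      qed
      ultimately show ?thesis by simp
    next
      case False
      then consider "c < 0" | "0 <= c" "c < L" | "L + int p <= c" by linarith
      then show ?thesis
      proof cases
        case 1 then show ?thesis using cs by (auto simp: input_code_def input_tape_append)
      next
        case 2
        then show ?thesis using cs by (auto simp: input_code_def input_tape_append L_def bit_sym_def split: if_splits)
      next
        case 3 then show ?thesis using cs lw mp X1 by (auto simp: input_code_def input_tape_append L_def)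
      qed
    qed
    then have "tile_u (sel (1, cl c)) = vc_at (C 0) c" using t by (simp add: C_def vc_at_init)
    then show ?case using up[of 1 "cl c"] cl_in[OF 0(2,3)] by (simp add: numeral_2_eq_2)
  next
    case (Suc i)
    let ?\<theta> = "\<lambda>c. sel (i + 2, cl c)"
    have d: "tile_d (?\<theta> c) = vc_at (C i) c" if "?lo <= c" "c <= ?hi" for c using Suc that by simp
    \<comment> \<open>A final tile has a test colour on its upper side, and no tile has one on its
      lower side; hence final tiles occur in the last row only.\<close>
    have ti: "?\<theta> c \<in> run_tiles" if c: "?lo <= c" "c <= ?hi" for c
    proof -
      have s1: "?\<theta> c \<in> machine_tiles" using sel[of "i + 2" "cl c"] cl_in[OF c] Suc.prems by simp
      have s2: "sel (Suc (i + 2), cl c) \<in> machine_tiles" using sel[of "Suc (i + 2)" "cl c"] cl_in[OF c] Suc.prems by simp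
      have "tile_u (?\<theta> c) = tile_d (sel (Suc (i + 2), cl c))"
        using up[of "i + 2" "cl c"] cl_in[OF c] Suc.prems by simp
      then have "~ (\<exists>a. tile_u (?\<theta> c) = VTest a)" using tile_kinds(4)[OF s2] by simp
      then have "?\<theta> c \<notin> final_tiles" by (auto simp: final_tiles_def)
      then show ?thesis using tile_kinds(3)[OF s1] d[OF c] by (auto simp: vc_at_def)
    qed
    have lohi: "?lo <= ?hi" by simp
    have "tile_u (?\<theta> c) = vc_at (tm_step M (C i)) c"
    proof (rule row_step[OF wfC, of ?lo ?hi ?\<theta>])
      show "?\<theta> c \<in> run_tiles & tile_d (?\<theta> c) = vc_at (C i) c" if "?lo <= c" "c <= ?hi" for c
        using ti[OF that] d[OF that] by simp
      show "tile_r (?\<theta> c) = tile_l (?\<theta> (c + 1))" if "?lo <= c" "c < ?hi" for c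
        using match[of "i + 2" "cl c"] cl_in[of c] that Suc.prems cl_Suc[OF that(1)] by simp
      have 1: "sel (i + 2, 1) \<in> machine_tiles" "tile_d (sel (i + 2, 1)) = VEdge"
        "sel (i + 2, W) \<in> machine_tiles" "tile_d (sel (i + 2, W)) = VEdge"
        using sel[of "i + 2"] edge[of "i + 2"] Suc.prems W by auto
      have "\<exists>q s e f. tile_l (?\<theta> ?lo) = HRun q s e f"
        using ti[OF order.refl lohi] by (auto simp: run_tiles_def hc_at_def)
      moreover have "cl ?lo = Suc 1" by (simp add: cl_def)
      then have l: "tile_r (sel (i + 2, 1)) = tile_l (?\<theta> ?lo)"
        using match[of "i + 2" 1] Suc.prems W by simp
      ultimately show "\<exists>q rs. tile_l (?\<theta> ?lo) = still q rs" using tile_kinds(7)[OF 1(1)] 1(2) by metis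
      have "\<exists>q s e f. tile_r (?\<theta> ?hi) = HRun q s e f"
        using ti[OF lohi order.refl] by (auto simp: run_tiles_def hc_at_def)
      moreover have "Suc (cl ?hi) = W" by (simp add: cl_def W)
      then have "tile_r (?\<theta> ?hi) = tile_l (sel (i + 2, W))"
        using match[of "i + 2" "cl ?hi"] Suc.prems cl_in[OF lohi order.refl] by simp
      ultimately show "\<exists>q rs. tile_r (?\<theta> ?hi) = still q rs" using tile_kinds(6)[OF 1(3)] 1(4) by metis
      show "?lo <= head (C i) k & head (C i) k <= ?hi" if "k < K" for k
        using head_bound[OF that, of i "X @ w"] Suc.prems by (auto simp: C_def)
    qed (use Suc.prems in auto)
    then show ?case using up[of "i + 2" "cl c"] cl_in[OF Suc.prems(2,3)] Suc.prems by (simp add: C_def)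
  qed
  then have dT: "tile_d (sel (T + 2, cl c)) = vc_at (C T) c" if "?lo <= c" "c <= ?hi" for c using that by simp
  have fin: "fst (C T) = 1 & (a \<in> {0, 2} --> content (C T) 1 c = a)"
    if c: "?lo <= c" "c <= ?hi" and a: "top_colour T W (cl c) = VTest a" for c a
  proof -
    have s: "sel (T + 2, cl c) \<in> machine_tiles" using sel[of "T + 2" "cl c"] cl_in[OF c] by simp
    have "tile_u (sel (T + 2, cl c)) = VTest a" using topc[of "cl c"] cl_in[OF c] a by simp
    moreover from this have "sel (T + 2, cl c) \<in> final_tiles" using tile_kinds(5)[OF s] by blast
    ultimately obtain cf c' where cf: "vc_at cf c' = vc_at (C T) c" "fst cf = 1"
      "a = 3 \<or> a \<in> {0, 2} & content cf 1 c' = a"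
      using dT[OF c] unfolding final_tiles_def by force
    then show ?thesis using vc_at_eq[OF cf(1)] K2 by auto
  qed
  have "fst (C T) = 1 & content (C T) 1 0 = 2"
    using fin[of 0 2] cl_in[of 0] by (auto simp: top_colour_def cl_def W)
  moreover have "content (C T) 1 1 = 0"
    using fin[of 1 0] cl_in[of 1] X1 by (auto simp: top_colour_def cl_def W)
  ultimately show "tm_output ((tm_step M ^^ T) (tm_init M (X @ w))) [True]"
    by (simp add: tm_output_def C_def content_def bit_sym_def)
qed

end

section \<open>Tilings as exact covers\<close>

text \<open>The horizontal edge \<open>EdgeH t c\<close> lies to the right of cell \<open>(t, c)\<close> and the vertical edge
  \<open>EdgeV t c\<close> above it; a tile covers its own colour on its right and upper edge and all the
  other colours on its left and lower edge. The parity in a side keeps opposite edges of a cell apart.\<close>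

datatype ('h, 'v) elem = EdgeH nat nat 'h | EdgeV nat nat 'v
datatype ('h, 'v) side = SideH bool 'h | SideV bool 'v

locale wang =
  fixes \<Theta> :: "('h, 'v) tile set" and Hs :: "'h set" and Vs :: "'v set" and h0 :: 'h
    and H W :: nat and bc tc :: "nat => 'v" and wt :: "('h, 'v) side digit => nat"
  assumes finite_colours: "finite Hs" "finite Vs" and tiles_sub: "\<Theta> \<subseteq> Hs \<times> Hs \<times> Vs \<times> Vs"
    and h0: "h0 \<in> Hs" and bc: "\<And>c. bc c \<in> Vs" and tc: "\<And>c. tc c \<in> Vs"
    and HW: "1 <= H" "1 <= W" and tiles_ne: "\<Theta> ~= {}"
begin

definition cells :: "(nat \<times> nat) set" where
  "cells = {1..H} \<times> {1..W}"

definition elems :: "('h, 'v) elem set" where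
  "elems = (\<lambda>(t, c, h). EdgeH t c h) ` ({1..H} \<times> {0..W} \<times> Hs) \<union>
     (\<lambda>(t, c, v). EdgeV t c v) ` ({0..H} \<times> {1..W} \<times> Vs)"

fun locs :: "('h, 'v) elem => (nat \<times> nat) set" where
  "locs (EdgeH t c h) = {(t, c), (t, Suc c)} \<inter> cells"
| "locs (EdgeV t c v) = {(t, c), (Suc t, c)} \<inter> cells"

fun kap :: "('h, 'v) elem => ('h, 'v) side" where
  "kap (EdgeH t c h) = SideH (odd c) h" | "kap (EdgeV t c v) = SideV (odd t) v"

text \<open>On an inner edge every colour is covered exactly once precisely if the two adjacent
  cells show the same colour there. On the left and lower border only the complement of a colour is
  covered, so all colours but the prescribed one are active; on the right and upper border only the
  prescribed one is.\<close>

fun act :: "('h, 'v) elem => bool" where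
  "act (EdgeH t c h) \<longleftrightarrow> (c = 0 --> h ~= h0) & (c = W --> h = h0)"
| "act (EdgeV t c v) \<longleftrightarrow> (t = 0 --> v ~= bc c) & (t = H --> v = tc c)"

definition need :: "nat \<times> nat => ('h, 'v) tile => ('h, 'v) side set" where
  "need v \<theta> = {SideH (odd (snd v)) (tile_r \<theta>), SideV (odd (fst v)) (tile_u \<theta>)} \<union>
     SideH (even (snd v)) ` (Hs - {tile_l \<theta>}) \<union> SideV (even (fst v)) ` (Vs - {tile_d \<theta>})"

definition sides :: "('h, 'v) side set" where
  "sides = (\<lambda>(b, h). SideH b h) ` (UNIV \<times> Hs) \<union> (\<lambda>(b, v). SideV b v) ` (UNIV \<times> Vs)"

text \<open>One colour on the right, one above, and all but one on the left and below: every tile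
  covers the same number of elements, as the target of the flag digit requires.\<close>

definition K :: nat where "K = card Hs + card Vs"

lemma finite_tiles: "finite \<Theta>"
  using finite_subset[OF tiles_sub] finite_colours by simp

lemma tile_in: "\<theta> \<in> \<Theta> ==> tile_l \<theta> \<in> Hs & tile_r \<theta> \<in> Hs & tile_d \<theta> \<in> Vs & tile_u \<theta> \<in> Vs"
  using tiles_sub by (auto simp: tile_sel_defs)

lemma need_iff:
  "SideH b h \<in> need v \<theta> \<longleftrightarrow> (b = odd (snd v) & h = tile_r \<theta>) \<or> (b = even (snd v) & h \<in> Hs & h ~= tile_l \<theta>)"
  "SideV b w \<in> need v \<theta> \<longleftrightarrow> (b = odd (fst v) & w = tile_u \<theta>) \<or> (b = even (fst v) & w \<in> Vs & w ~= tile_d \<theta>)"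
  by (auto simp: need_def)

lemma need_card: "\<theta> \<in> \<Theta> ==> need v \<theta> \<subseteq> sides & card (need v \<theta>) = K"
proof -
  assume t: "\<theta> \<in> \<Theta>"
  note ti = tile_in[OF t]
  let ?A = "{SideH (odd (snd v)) (tile_r \<theta>), SideV (odd (fst v)) (tile_u \<theta>)}"
  let ?B = "SideH (even (snd v)) ` (Hs - {tile_l \<theta>}) :: ('h, 'v) side set"
    and ?C = "SideV (even (fst v)) ` (Vs - {tile_d \<theta>}) :: ('h, 'v) side set"
  have "card (need v \<theta>) = card (?A \<union> ?B) + card ?C"
    unfolding need_def by (subst card_Un_disjoint) (use finite_colours in auto)
  also have "card (?A \<union> ?B) = card ?A + card ?B" by (subst card_Un_disjoint) (use finite_colours in auto)
  also have "card ?B = card Hs - 1" using ti by (subst card_image) (auto simp: inj_on_def)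
  also have "card ?C = card Vs - 1" using ti by (subst card_image) (auto simp: inj_on_def)
  finally have "card (need v \<theta>) = 2 + (card Hs - 1) + (card Vs - 1)" by simp
  moreover have "1 <= card Hs" "1 <= card Vs" using ti finite_colours by (auto simp: Suc_le_eq card_gt_0_iff)
  ultimately have "card (need v \<theta>) = K" by (simp add: K_def)
  moreover have "need v \<theta> \<subseteq> sides" using ti by (auto simp: need_def sides_def image_iff)
  ultimately show ?thesis by simp
qed

lemma elems_simps:
  "EdgeH t c h \<in> elems \<longleftrightarrow> 1 <= t & t <= H & c <= W & h \<in> Hs"
  "EdgeV t c v \<in> elems \<longleftrightarrow> t <= H & 1 <= c & c <= W & v \<in> Vs" by (force simp: elems_def)+

lemma cells_simps: "(t, c) \<in> cells \<longleftrightarrow> 1 <= t & t <= H & 1 <= c & c <= W" by (auto simp: cells_def)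

sublocale cover cells \<Theta> elems locs kap act need sides K wt
proof
  show "finite cells" "finite \<Theta>" "finite elems" "finite sides"
    using finite_colours finite_tiles by (simp_all add: cells_def elems_def sides_def)
  show "locs e \<subseteq> cells" for e by (cases e) auto
  show "kap e \<in> sides" if "e \<in> elems" for e
    using that by (cases e) (auto simp: elems_simps sides_def)
  show "need v \<theta> \<subseteq> sides & card (need v \<theta>) = K" if "\<theta> \<in> \<Theta>" for v \<theta> using need_card[OF that] .
  show "e = e'" if "e \<in> elems" "e' \<in> elems" "v \<in> locs e" "v \<in> locs e'" "kap e = kap e'" for e e' v
    using that by (cases e; cases e') auto
  show "\<exists>e\<in>elems. v \<in> locs e & kap e = \<kappa>" if v: "v \<in> cells" and t: "\<theta> \<in> \<Theta>" and k: "\<kappa> \<in> need v \<theta>" for v \<theta> \<kappa>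
  proof -
    obtain t c where tc: "v = (t, c)" by fastforce
    have vc: "1 <= t" "t <= H" "1 <= c" "c <= W" using v tc by (auto simp: cells_simps)
    note ti = tile_in[OF t]
    show ?thesis
    proof (cases \<kappa>)
      case (SideH b h)
      then have "(b = odd c & h = tile_r \<theta>) \<or> (b = even c & h \<in> Hs)" using k tc by (auto simp: need_iff)
      then show ?thesis
      proof
        assume "b = odd c & h = tile_r \<theta>"
        then show ?thesis using ti vc SideH tc v by (intro bexI[of _ "EdgeH t c h"]) (auto simp: elems_simps)
      next
        assume "b = even c & h \<in> Hs"
        then show ?thesis using vc SideH tc v by (intro bexI[of _ "EdgeH t (c - 1) h"]) (auto simp: elems_simps)
      qed
    next
      case (SideV b w)
      then have "(b = odd t & w = tile_u \<theta>) \<or> (b = even t & w \<in> Vs)" using k tc by (auto simp: need_iff)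
      then show ?thesis
      proof
        assume "b = odd t & w = tile_u \<theta>"
        then show ?thesis using ti vc SideV tc v by (intro bexI[of _ "EdgeV t c w"]) (auto simp: elems_simps)
      next
        assume "b = even t & w \<in> Vs"
        then show ?thesis using vc SideV tc v by (intro bexI[of _ "EdgeV (t - 1) c w"]) (auto simp: elems_simps)
      qed
    qed
  qed
qed

lemma card_two: "a ~= b ==> card {x \<in> {a, b}. P x} = (if P a then 1 else 0) + (if P b then 1 else 0)"
proof -
  assume "a ~= b"
  moreover have "{x \<in> {a, b}. P x} = (if P a then {a} else {}) \<union> (if P b then {b} else {})" by auto
  ultimately show ?thesis by simp
qed

lemma card_one: "card {x \<in> {a}. P x} = (if P a then 1 else 0)"
proof -
  have "{x \<in> {a}. P x} = (if P a then {a} else {})" by auto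
  then show ?thesis by simp
qed

lemma cover_H:
  assumes "1 <= t" "t <= H" "h \<in> Hs" "c <= W"
  shows "card {v \<in> locs (EdgeH t c h). kap (EdgeH t c h) \<in> need v (sel v)} =
    (if 1 <= c & tile_r (sel (t, c)) = h then 1 else 0) + (if c < W & tile_l (sel (t, Suc c)) ~= h then 1 else 0)"
proof -
  consider "c = 0" | "c = W" "c ~= 0" | "1 <= c" "c < W" using assms by linarith
  then show ?thesis
  proof cases
    case 1 then have "locs (EdgeH t c h) = {(t, Suc c)}" using assms HW by (auto simp: cells_simps)
    then show ?thesis unfolding \<open>locs _ = _\<close> card_one using 1 assms HW by (auto simp: need_iff)
  next
    case 2 then have "locs (EdgeH t c h) = {(t, c)}" using assms HW by (auto simp: cells_simps)
    then show ?thesis unfolding \<open>locs _ = _\<close> card_one using 2 assms by (auto simp: need_iff)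
  next
    case 3 then have "locs (EdgeH t c h) = {(t, c), (t, Suc c)}" using assms by (auto simp: cells_simps)
    then have "card {v \<in> locs (EdgeH t c h). kap (EdgeH t c h) \<in> need v (sel v)} =
        card {v \<in> {(t, c), (t, Suc c)}. kap (EdgeH t c h) \<in> need v (sel v)}" by simp
    also have "\<dots> = (if kap (EdgeH t c h) \<in> need (t, c) (sel (t, c)) then 1 else 0) +
        (if kap (EdgeH t c h) \<in> need (t, Suc c) (sel (t, Suc c)) then 1 else 0)" by (rule card_two) simp
    finally show ?thesis using 3 assms by (auto simp: need_iff)
  qed
qed

lemma cover_V:
  assumes "1 <= c" "c <= W" "v \<in> Vs" "t <= H"
  shows "card {x \<in> locs (EdgeV t c v). kap (EdgeV t c v) \<in> need x (sel x)} =
    (if 1 <= t & tile_u (sel (t, c)) = v then 1 else 0) + (if t < H & tile_d (sel (Suc t, c)) ~= v then 1 else 0)"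
proof -
  consider "t = 0" | "t = H" "t ~= 0" | "1 <= t" "t < H" using assms by linarith
  then show ?thesis
  proof cases
    case 1 then have "locs (EdgeV t c v) = {(Suc t, c)}" using assms HW by (auto simp: cells_simps)
    then show ?thesis unfolding \<open>locs _ = _\<close> card_one using 1 assms HW by (auto simp: need_iff)
  next
    case 2 then have "locs (EdgeV t c v) = {(t, c)}" using assms HW by (auto simp: cells_simps)
    then show ?thesis unfolding \<open>locs _ = _\<close> card_one using 2 assms by (auto simp: need_iff)
  next
    case 3 then have "locs (EdgeV t c v) = {(t, c), (Suc t, c)}" using assms by (auto simp: cells_simps)
    then have "card {x \<in> locs (EdgeV t c v). kap (EdgeV t c v) \<in> need x (sel x)} =
        card {x \<in> {(t, c), (Suc t, c)}. kap (EdgeV t c v) \<in> need x (sel x)}" by simp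
    also have "\<dots> = (if kap (EdgeV t c v) \<in> need (t, c) (sel (t, c)) then 1 else 0) +
        (if kap (EdgeV t c v) \<in> need (Suc t, c) (sel (Suc t, c)) then 1 else 0)" by (rule card_two) simp
    finally show ?thesis using 3 assms by (auto simp: need_iff)
  qed
qed

text \<open>Per edge and colour, exact covering is an equation between two indicators. To get
  matching colours, it is enough to evaluate it at the colour shown by the left or lower cell: that
  colour is covered already, so the other cell must leave it out, which means that it shows it too.
  On the border the prescribed colour is used.\<close>

theorem selection_iff_tiling: "selection sel \<longleftrightarrow> tiling \<Theta> h0 H W bc tc sel"
proof
  assume s: "selection sel"
  then have selT: "sel (t, c) \<in> \<Theta>" if "1 <= t" "t <= H" "1 <= c" "c <= W" for t c
    using that by (auto simp: selection_def cells_simps)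
  have EH: "(if 1 <= c & tile_r (sel (t, c)) = h then 1 else 0) + (if c < W & tile_l (sel (t, Suc c)) ~= h then 1 else 0) =
      (if act (EdgeH t c h) then 1 else (0::nat))" if b: "1 <= t" "t <= H" "h \<in> Hs" "c <= W" for t c h
  proof -
    have "EdgeH t c h \<in> elems" using b by (simp add: elems_simps)
    then show ?thesis using s unfolding selection_def cover_H[OF b, of sel, symmetric] by blast
  qed
  have EV: "(if 1 <= t & tile_u (sel (t, c)) = v then 1 else 0) + (if t < H & tile_d (sel (Suc t, c)) ~= v then 1 else 0) =
      (if act (EdgeV t c v) then 1 else (0::nat))" if b: "1 <= c" "c <= W" "v \<in> Vs" "t <= H" for t c v
  proof -
    have "EdgeV t c v \<in> elems" using b by (simp add: elems_simps)
    then show ?thesis using s unfolding selection_def cover_V[OF b, of sel, symmetric] by blast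
  qed
  show "tiling \<Theta> h0 H W bc tc sel"
    unfolding tiling_def
  proof (intro conjI ballI)
    show "sel (t, c) \<in> \<Theta>" if "t \<in> {1..H}" "c \<in> {1..W}" for t c using selT that by simp
    show "tile_l (sel (t, 1)) = h0" if "t \<in> {1..H}" for t
      using EH[of t h0 0] that h0 HW by (cases "tile_l (sel (t, 1)) = h0") auto
    show "tile_r (sel (t, W)) = h0" if "t \<in> {1..H}" for t
      using EH[of t h0 W] that h0 HW by (cases "tile_r (sel (t, W)) = h0") auto
    show "tile_r (sel (t, c)) = tile_l (sel (t, Suc c))" if "t \<in> {1..H}" "c \<in> {1..<W}" for t c
      using EH[of t "tile_r (sel (t, c))" c] that tile_in[OF selT[of t c]]
      by (cases "tile_r (sel (t, c)) = tile_l (sel (t, Suc c))") auto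
    show "tile_d (sel (1, c)) = bc c" if "c \<in> {1..W}" for c
      using EV[of c "bc c" 0] that bc HW by (cases "tile_d (sel (1, c)) = bc c") auto
    show "tile_u (sel (H, c)) = tc c" if "c \<in> {1..W}" for c
      using EV[of c "tc c" H] that tc HW by (cases "tile_u (sel (H, c)) = tc c") auto
    show "tile_u (sel (t, c)) = tile_d (sel (Suc t, c))" if "t \<in> {1..<H}" "c \<in> {1..W}" for t c
      using EV[of c "tile_u (sel (t, c))" t] that tile_in[OF selT[of t c]]
      by (cases "tile_u (sel (t, c)) = tile_d (sel (Suc t, c))") auto
  qed
next
  assume til: "tiling \<Theta> h0 H W bc tc sel"
  show "selection sel"
    unfolding selection_def
  proof (intro conjI ballI)
    show "sel v \<in> \<Theta>" if "v \<in> cells" for v using til that by (auto simp: tiling_def cells_def)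
    show "card {v \<in> locs e. kap e \<in> need v (sel v)} = (if act e then 1 else 0)" if e: "e \<in> elems" for e
    proof (cases e)
      case (EdgeH t c h) then have b: "1 <= t" "t <= H" "h \<in> Hs" "c <= W" using e by (auto simp: elems_simps)
      have "c = 0 ==> tile_l (sel (t, Suc c)) = h0" "c = W ==> tile_r (sel (t, c)) = h0"
        "1 <= c ==> c < W ==> tile_r (sel (t, c)) = tile_l (sel (t, Suc c))"
        using til b by (auto simp: tiling_def)
      then show ?thesis unfolding EdgeH cover_H[OF b] using HW b by (cases "c = 0"; cases "c = W") auto
    next
      case (EdgeV t c v) then have b: "1 <= c" "c <= W" "v \<in> Vs" "t <= H" using e by (auto simp: elems_simps)
      have "t = 0 ==> tile_d (sel (Suc t, c)) = bc c" "t = H ==> tile_u (sel (t, c)) = tc c"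
        "1 <= t ==> t < H ==> tile_u (sel (t, c)) = tile_d (sel (Suc t, c))"
        using til b by (auto simp: tiling_def)
      then show ?thesis unfolding EdgeV cover_V[OF b] using HW b by (cases "t = 0"; cases "t = H") auto
    qed
  qed
qed

end

section \<open>Embedding of the tiling problem in the plane as a FLaMECaST instance\<close>

section \<open>The geometric gadget\<close>

text \<open>A part describes an item relative to the cell that owns it: tile items, cell items, and the
  copies of the elements on its right and upper edge; cells on the left or lower border also own the
  elements of that border edge.\<close>

datatype ('h, 'v) part = PTile "('h, 'v) tile" | PCell nat | PR 'h nat | PU 'v nat | PL 'h nat | PD 'v nat

text \<open>The components are the parities of row and column, membership in the first and last row
  and in the first and last column, and the prescribed colours of the column at the bottom and at
  the top. Parts, their sizes and their relative places depend on nothing else, so a reduction can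
  treat a cell by a constant program for its kind.\<close>

type_synonym 'v kind = "bool \<times> bool \<times> bool \<times> bool \<times> bool \<times> bool \<times> 'v \<times> 'v"

locale gadget =
  fixes \<Theta> :: "('h, 'v) tile set" and Hs :: "'h set" and Vs :: "'v set" and h0 :: 'h
    and wt :: "('h, 'v) side digit => nat" and S :: nat and num :: "('h, 'v) part => nat"
  assumes finite_Hs: "finite Hs" and finite_Vs: "finite Vs" and sub: "\<Theta> \<subseteq> Hs \<times> Hs \<times> Vs \<times> Vs"
    and h0_in: "h0 \<in> Hs" and ne: "\<Theta> ~= {}" and wt_pos: "\<And>D. 1 <= wt D"
    and S2: "even S" "2 <= S"
begin

text \<open>The shares of \<open>deg\<close> coming from the two cells at an edge: \<open>dr\<close>
  and \<open>du\<close> from the cell to the left or below, \<open>dl\<close> and \<open>dd\<close>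
  from the cell to the right or above.\<close>

definition "dr h = card {\<theta> \<in> \<Theta>. tile_r \<theta> = h}"
definition "dl h = card {\<theta> \<in> \<Theta>. tile_l \<theta> ~= h}"
definition "du v = card {\<theta> \<in> \<Theta>. tile_u \<theta> = v}"
definition "dd v = card {\<theta> \<in> \<Theta>. tile_d \<theta> ~= v}"

definition base_parts :: "('h, 'v) part set" where
  "base_parts = PTile ` \<Theta> \<union> PCell ` {..<card \<Theta>}"

fun edge_parts :: "'v kind => ('h, 'v) part set" where
  "edge_parts (ot, oc, b1, bH, c1, cW, vb, vt) =
     (\<lambda>(h, k). PR h k) ` (SIGMA h:Hs. {..<dr h + (if cW then 0 else dl h)}) \<union>
     (\<lambda>(v, k). PU v k) ` (SIGMA v:Vs. {..<du v + (if bH then 0 else dd v)}) \<union>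
     (if c1 then (\<lambda>(h, k). PL h k) ` (SIGMA h:Hs. {..<dl h}) else {}) \<union>
     (if b1 then (\<lambda>(v, k). PD v k) ` (SIGMA v:Vs. {..<dd v}) else {})"

definition "parts kd = base_parts \<union> edge_parts kd"

definition elem_vec :: "('h, 'v) side => bool => ('h, 'v) side digit => nat" where
  "elem_vec \<kappa>' a D = (case D of Side \<kappa> => (if \<kappa> = \<kappa>' then 1 else 0) | Flag => (if a then 0 else 1) | _ => 0)"

fun part_vec :: "'v kind => ('h, 'v) part => ('h, 'v) side digit => nat" where
  "part_vec (ot, oc, b1, bH, c1, cW, vb, vt) p D = (case p of
     PTile \<theta> => (case D of Top => 1
       | Side \<kappa> => (if \<kappa> \<in> wang.need Hs Vs (of_bool ot, of_bool oc) \<theta> then 0 else 1) | _ => 0)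
   | PCell k => (case D of Cell => 1 | Flag => (if k = 0 then wang.K Hs Vs else 0) | _ => 0)
   | PR h k => elem_vec (SideH oc h) (k = 0 & (cW --> h = h0)) D
   | PU v k => elem_vec (SideV ot v) (k = 0 & (bH --> v = vt)) D
   | PL h k => elem_vec (SideH False h) (k = 0 & h ~= h0) D
   | PD v k => elem_vec (SideV False v) (k = 0 & v ~= vb) D)"

definition part_size :: "'v kind => ('h, 'v) part => nat" where
  "part_size kd p = (\<Sum>D\<in>{Top, Flag, Cell} \<union> Side ` wang.sides Hs Vs. part_vec kd p D * wt D)"

definition bin_weight :: nat where
  "bin_weight = (\<Sum>D\<in>{Top, Flag, Cell} \<union> Side ` wang.sides Hs Vs.
     (if D = Flag then wang.K Hs Vs else 1) * wt D)"

text \<open>An item bound to one cell sits on the diagonal next to the lattice point of this cell.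
  An item of an inner edge sits beside the midpoint of two neighbouring lattice points, shifted by
  \<open>num p\<close> at right angles to their connection, and is therefore equally far from
  both.\<close>

fun offset :: "'v kind => ('h, 'v) part => nat \<times> nat" where
  "offset (ot, oc, b1, bH, c1, cW, vb, vt) p = (case p of
     PR h k => if cW then (num p, num p) else (num p, S div 2)
   | PU v k => if bH then (num p, num p) else (S div 2, num p)
   | _ => (num p, num p))"

definition place :: "'v kind => nat \<times> nat => ('h, 'v) part => nat \<times> nat" where
  "place kd v p = (S * fst v + fst (offset kd p), S * snd v + snd (offset kd p))"

lemma finite_Theta: "finite \<Theta>" using finite_subset[OF sub] finite_Hs finite_Vs by simp

lemma finite_parts: "finite (parts kd)" "finite base_parts" "finite (edge_parts kd)"
  using finite_Hs finite_Vs finite_Theta by (cases kd, auto simp: parts_def base_parts_def)+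

text \<open>Independent of the kind, so that one numbering serves all cells;
  \<open>2 * card \<Theta>\<close> bounds the copies of an element, which come from two
  cells.\<close>

definition all_parts :: "('h, 'v) part set" where
  "all_parts = base_parts \<union> (\<lambda>(h, k). PR h k) ` (Hs \<times> {..<2 * card \<Theta>}) \<union> (\<lambda>(v, k). PU v k) ` (Vs \<times> {..<2 * card \<Theta>}) \<union>
     (\<lambda>(h, k). PL h k) ` (Hs \<times> {..<2 * card \<Theta>}) \<union> (\<lambda>(v, k). PD v k) ` (Vs \<times> {..<2 * card \<Theta>})"

lemma deg_bounds: "dr h <= card \<Theta>" "dl h <= card \<Theta>" "du v <= card \<Theta>" "dd v <= card \<Theta>"
  unfolding dr_def dl_def du_def dd_def by (intro card_mono finite_Theta; auto)+

lemma parts_all: "parts kd \<subseteq> all_parts"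
proof -
  have bounds: "\<And>x h. x < dr h ==> x < 2 * card \<Theta>" "\<And>x h. x < dr h + dl h ==> x < 2 * card \<Theta>"
    "\<And>x v. x < du v ==> x < 2 * card \<Theta>" "\<And>x v. x < du v + dd v ==> x < 2 * card \<Theta>"
    "\<And>x h. x < dl h ==> x < 2 * card \<Theta>" "\<And>x v. x < dd v ==> x < 2 * card \<Theta>"
    using deg_bounds(1,2) deg_bounds(3,4) by (smt (verit) add_mono less_le_trans mult_2 trans_le_add1)+
  obtain ot oc b1 bH c1 cW vb vt where kd: "kd = (ot, oc, b1, bH, c1, cW, vb, vt)" by (metis prod.collapse)
  show ?thesis
  proof
    fix p assume "p \<in> parts kd"
    then show "p \<in> all_parts"
      unfolding kd parts_def all_parts_def using bounds
      by (cases p) (auto simp: base_parts_def image_iff split: if_splits)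
  qed
qed

lemma finite_all_parts: "finite all_parts"
  unfolding all_parts_def using finite_parts finite_Hs finite_Vs by simp

end

text \<open>A number is at least 1 to keep each item at distance at least 1 from its sinks, as the
  argument against split groups requires. The factor 8 keeps shifts small: own sinks are then within
  \<open>5 / 8\<close> of the spacing, all others at least \<open>7 / 8\<close> of it away.\<close>

locale numbered_gadget = gadget +
  assumes num_inj: "inj_on num all_parts"
    and num_range: "\<And>p. p \<in> all_parts ==> 1 <= num p & 8 * num p <= S"

locale placed = numbered_gadget \<Theta> Hs Vs h0 wt S num + wang \<Theta> Hs Vs h0 H W bc tc wt
  for \<Theta> :: "('h, 'v) tile set" and Hs Vs h0 wt S num H W bc tc
begin

definition kd :: "nat \<times> nat => 'v kind" where
  "kd v = (odd (fst v), odd (snd v), fst v = 1, fst v = H, snd v = 1, snd v = W, bc (snd v), tc (snd v))"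

fun part_item :: "nat \<times> nat => ('h, 'v) part => (nat \<times> nat, ('h, 'v) tile, ('h, 'v) elem) item" where
  "part_item v (PTile \<theta>) = TileItem v \<theta>"
| "part_item v (PCell k) = CellItem v k"
| "part_item v (PR h k) = ElemItem (EdgeH (fst v) (snd v) h) k"
| "part_item v (PU x k) = ElemItem (EdgeV (fst v) (snd v) x) k"
| "part_item v (PL h k) = ElemItem (EdgeH (fst v) 0 h) k"
| "part_item v (PD x k) = ElemItem (EdgeV 0 (snd v) x) k"

definition slots :: "((nat \<times> nat) \<times> ('h, 'v) part) set" where
  "slots = (SIGMA v:cells. parts (kd v))"

abbreviation "site v p \<equiv> place (kd v) v p"

lemma need_parity: "need v \<theta> = need (of_bool (odd (fst v)), of_bool (odd (snd v))) \<theta>" by (simp add: need_def)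

lemma part_size_eq:
  assumes "(v, p) \<in> slots"
  shows "part_size (kd v) p = item_size (part_item v p)"
proof -
  have "part_vec (kd v) p D = vec (part_item v p) D" for D
    using assms HW need_parity[of v]
    by (cases p) (auto simp: kd_def elem_vec_def slots_def cells_def parts_def base_parts_def
        split: digit.split if_splits)
  then show ?thesis by (simp add: part_size_def item_size_def digits_def)
qed

lemma bin_weight_eq: "bin_weight = bin_size" by (simp add: bin_weight_def bin_size_def target_def digits_def)

lemma deg_H:
  assumes "1 <= t" "t <= H" "c <= W" "h \<in> Hs"
  shows "deg (EdgeH t c h) = (if c = 0 then 0 else dr h) + (if c = W then 0 else dl h)"
proof -
  have 1: "{\<theta> \<in> \<Theta>. kap (EdgeH t c h) \<in> need (t, c) \<theta>} = {\<theta> \<in> \<Theta>. tile_r \<theta> = h}"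
    using assms by (auto simp: need_iff)
  have 2: "{\<theta> \<in> \<Theta>. kap (EdgeH t c h) \<in> need (t, Suc c) \<theta>} = {\<theta> \<in> \<Theta>. tile_l \<theta> ~= h}"
    using assms by (auto simp: need_iff)
  have "locs (EdgeH t c h) = (if c = 0 then {} else {(t, c)}) \<union> (if c = W then {} else {(t, Suc c)})"
    using assms HW by (auto simp: cells_simps)
  then show ?thesis unfolding deg_def using 1 2 by (auto simp: dr_def dl_def)
qed

lemma deg_V:
  assumes "1 <= c" "c <= W" "t <= H" "v \<in> Vs"
  shows "deg (EdgeV t c v) = (if t = 0 then 0 else du v) + (if t = H then 0 else dd v)"
proof -
  have 1: "{\<theta> \<in> \<Theta>. kap (EdgeV t c v) \<in> need (t, c) \<theta>} = {\<theta> \<in> \<Theta>. tile_u \<theta> = v}"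
    using assms by (auto simp: need_iff)
  have 2: "{\<theta> \<in> \<Theta>. kap (EdgeV t c v) \<in> need (Suc t, c) \<theta>} = {\<theta> \<in> \<Theta>. tile_d \<theta> ~= v}"
    using assms by (auto simp: need_iff)
  have "locs (EdgeV t c v) = (if t = 0 then {} else {(t, c)}) \<union> (if t = H then {} else {(Suc t, c)})"
    using assms HW by (auto simp: cells_simps)
  then show ?thesis unfolding deg_def using 1 2 by (auto simp: du_def dd_def)
qed

lemma slots_simps:
  "((t, c), PTile \<theta>) \<in> slots \<longleftrightarrow> (t, c) \<in> cells & \<theta> \<in> \<Theta>"
  "((t, c), PCell k) \<in> slots \<longleftrightarrow> (t, c) \<in> cells & k < card \<Theta>"
  "((t, c), PR h k) \<in> slots \<longleftrightarrow> (t, c) \<in> cells & h \<in> Hs & k < dr h + (if c = W then 0 else dl h)"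
  "((t, c), PU x k) \<in> slots \<longleftrightarrow> (t, c) \<in> cells & x \<in> Vs & k < du x + (if t = H then 0 else dd x)"
  "((t, c), PL h k) \<in> slots \<longleftrightarrow> (t, c) \<in> cells & c = 1 & h \<in> Hs & k < dl h"
  "((t, c), PD x k) \<in> slots \<longleftrightarrow> (t, c) \<in> cells & t = 1 & x \<in> Vs & k < dd x"
  by (auto simp: slots_def parts_def base_parts_def kd_def split: if_splits)

lemma part_item_bij: "bij_betw (\<lambda>(v, p). part_item v p) slots items"
  unfolding bij_betw_def
proof
  show "inj_on (\<lambda>(v, p). part_item v p) slots"
  proof (rule inj_onI)
    fix x y assume x: "x \<in> slots" and y: "y \<in> slots"
      and eq: "(case x of (v, p) => part_item v p) = (case y of (v, p) => part_item v p)"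
    obtain t c p t' c' p' where [simp]: "x = ((t, c), p)" "y = ((t', c'), p')" by (metis prod.collapse)
    show "x = y" using x y eq by (cases p; cases p') (auto simp: slots_simps cells_simps)
  qed
  show "(\<lambda>(v, p). part_item v p) ` slots = items"
  proof (intro equalityI subsetI)
    fix i assume "i \<in> (\<lambda>(v, p). part_item v p) ` slots"
    then obtain t c p where s: "((t, c), p) \<in> slots" and [simp]: "i = part_item (t, c) p" by auto
    show "i \<in> items"
      using s HW by (cases p) (auto simp: slots_simps items_simps elems_simps cells_simps deg_H deg_V split: if_splits)
  next
    fix i assume i: "i \<in> items"
    show "i \<in> (\<lambda>(v, p). part_item v p) ` slots"
    proof (cases i)
      case (TileItem v \<theta>) then show ?thesis using i
        by (cases v, intro image_eqI[of _ _ "(v, PTile \<theta>)"]) (auto simp: slots_simps items_simps)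
    next
      case (CellItem v k) then show ?thesis using i
        by (cases v, intro image_eqI[of _ _ "(v, PCell k)"]) (auto simp: slots_simps items_simps)
    next
      case (ElemItem e k) show ?thesis
      proof (cases e)
        case (EdgeH t c h) then have b: "1 <= t" "t <= H" "c <= W" "h \<in> Hs" and k: "k < deg (EdgeH t c h)"
          using i ElemItem by (auto simp: items_simps elems_simps)
        show ?thesis
        proof (cases "c = 0")
          case True then show ?thesis using b k HW ElemItem EdgeH deg_H[OF b]
            by (intro image_eqI[of _ _ "((t, 1), PL h k)"]) (auto simp: slots_simps cells_simps)
        next
          case False then show ?thesis using b k ElemItem EdgeH deg_H[OF b]
            by (intro image_eqI[of _ _ "((t, c), PR h k)"]) (auto simp: slots_simps cells_simps)
        qed
      next
        case (EdgeV t c x) then have b: "1 <= c" "c <= W" "t <= H" "x \<in> Vs" and k: "k < deg (EdgeV t c x)"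
          using i ElemItem by (auto simp: items_simps elems_simps)
        show ?thesis
        proof (cases "t = 0")
          case True then show ?thesis using b k HW ElemItem EdgeV deg_V[OF b]
            by (intro image_eqI[of _ _ "((1, c), PD x k)"]) (auto simp: slots_simps cells_simps)
        next
          case False then show ?thesis using b k ElemItem EdgeV deg_V[OF b]
            by (intro image_eqI[of _ _ "((t, c), PU x k)"]) (auto simp: slots_simps cells_simps)
        qed
      qed
    qed
  qed
qed

lemma slot_num: "(v, p) \<in> slots ==> 1 <= num p & 8 * num p <= S"
  using num_range[of p] parts_all[of "kd v"] by (auto simp: slots_def)

lemma offset_less: "(v, p) \<in> slots ==> fst (offset (kd v) p) < S & snd (offset (kd v) p) < S &
    1 <= fst (offset (kd v) p)"
  using slot_num[of v p] S2 by (cases p) (auto simp: kd_def)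

lemma at_inj: "inj_on (\<lambda>(v, p). site v p) slots"
proof (rule inj_onI)
  fix x y assume x: "x \<in> slots" and y: "y \<in> slots"
    and eq: "(case x of (v, p) => site v p) = (case y of (v, p) => site v p)"
  obtain v p v' p' where [simp]: "x = (v, p)" "y = (v', p')" by (metis prod.collapse)
  note ol = offset_less[OF x[simplified]] offset_less[OF y[simplified]]
  have dm: "a = a' & r = r'" if "S * a + r = S * a' + r'" "r < S" "r' < S" for a r a' r' :: nat
  proof -
    have "a = (S * a + r) div S" using that(2) by simp
    also have "\<dots> = a'" unfolding that(1) using that(3) by simp
    finally show ?thesis using that(1) by simp
  qed
  have e: "fst v = fst v'" "snd v = snd v'" "fst (offset (kd v) p) = fst (offset (kd v') p')"
    "snd (offset (kd v) p) = snd (offset (kd v') p')"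
    using dm[of "fst v" "fst (offset (kd v) p)" "fst v'" "fst (offset (kd v') p')"]
      dm[of "snd v" "snd (offset (kd v) p)" "snd v'" "snd (offset (kd v') p')"] eq ol
    by (simp_all add: place_def)
  then have v: "v = v'" by (simp add: prod_eq_iff)
  have off: "offset (kd v) p = offset (kd v) p'" using e(3,4) unfolding v by (rule prod_eqI)
  \<comment> \<open>Part numbers are at most \<open>S / 8\<close>, so a coordinate
    \<open>S div 2\<close> cannot be mistaken for one and the offset reveals the number.\<close>
  have n: "num p ~= S div 2" "num p' ~= S div 2" using slot_num[of v p] slot_num[of v' p'] x y by auto
  have "num p = num p'"
    using off n by (cases p; cases p') (auto simp: kd_def split: if_splits)
  moreover have "p \<in> all_parts" "p' \<in> all_parts"
    using x y parts_all[of "kd v"] parts_all[of "kd v'"] by (auto simp: slots_def)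
  ultimately have "p = p'" using num_inj by (simp add: inj_on_eq_iff)
  then show "x = y" using v by simp
qed

definition lattice :: "nat \<times> nat => point" where
  "lattice v = (real (S * fst v), real (S * snd v))"

definition real_place :: "nat \<times> nat => point" where
  "real_place q = (real (fst q), real (snd q))"

lemma far_coord:
  assumes "a ~= b" "8 * n <= S"
  shows "7 / 8 * real S <= \<bar>real (S * a + n) - real (S * b)\<bar>"
proof -
  have n: "real n <= real S / 8" using assms(2) by linarith
  show ?thesis
  proof (cases "a < b")
    case True then have "S * a + S <= S * b" by (metis Suc_leI mult_Suc_right add.commute mult_le_mono2)
    then have "real (S * a) + real S <= real (S * b)" by linarith
    then show ?thesis using n by simp
  next
    case False
    then have "S * b + S <= S * a" using assms(1) by (metis Suc_leI mult_Suc_right add.commute mult_le_mono2 nat_neq_iff)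
    then have "real (S * b) + real S <= real (S * a)" by linarith
    then show ?thesis by simp
  qed
qed

lemma half_coord:
  assumes "b ~= a" "b ~= Suc a"
  shows "real S <= \<bar>real (S * a + S div 2) - real (S * b)\<bar>"
proof (cases "b < a")
  case True then have "S * b + S <= S * a" by (metis Suc_leI mult_Suc_right add.commute mult_le_mono2)
  then have "real (S * b) + real S <= real (S * a)" by linarith
  then show ?thesis by simp
next
  case False then have "Suc (Suc a) <= b" using assms by simp
  then have "S * Suc (Suc a) <= S * b" by (rule mult_le_mono2)
  then have "S * a + S + S <= S * b" by (simp add: algebra_simps)
  then have "real (S * a) + real S + real S <= real (S * b)" by linarith
  moreover have "real (S div 2) <= real S" by simp
  ultimately show ?thesis by simp
qed

lemma norm_pair_bounds: "\<bar>x\<bar> <= norm (x, y)" "\<bar>y\<bar> <= norm (x, y)" "norm (x, y) <= \<bar>x\<bar> + \<bar>y\<bar>"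
  for x y :: real
  using norm_fst_le[of x y] norm_snd_le[of y x] norm_Pair_le[of x y] by simp_all

text \<open>Accessible lattice points have the same distance, at most \<open>5 / 8\<close> of
  \<open>S\<close>, while any other one differs by \<open>7 / 8\<close> of \<open>S\<close> or more
  in some coordinate. Since \<open>S\<close> is at least 8, the difference exceeds
  \<open>1 / 4\<close>. The point \<open>(0, 0)\<close> is included as the place of the spare
  sinks.\<close>

lemma place_distance:
  assumes s: "(v, p) \<in> slots"
  shows "\<exists>\<delta>. 1 <= \<delta> & \<delta> <= real S & acc (part_item v p) ~= {} &
    (\<forall>u \<in> acc (part_item v p). norm (real_place (site v p) - lattice u) = \<delta>) &
    (\<forall>u. u \<notin> acc (part_item v p) --> u \<in> insert (0, 0) cells --> \<delta> + 1 / 4 <= norm (real_place (site v p) - lattice u))"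
proof -
  obtain t c where v: "v = (t, c)" by fastforce
  have vc: "1 <= t" "t <= H" "1 <= c" "c <= W" using s v by (auto simp: slots_def cells_simps)
  define n where "n = num p"
  have n: "1 <= n" "8 * n <= S" using slot_num[OF s] by (auto simp: n_def)
  have nr: "1 <= real n" "real n <= real S / 8" using n by linarith+
  have S2r: "2 <= real S" using S2(2) by linarith
  have S8: "8 <= real S" using nr by linarith
  have half: "real (S div 2) = real S / 2" using S2(1) by (auto elim: evenE)
  have near: ?thesis if off: "offset (kd v) p = (a, b)" and acc: "acc (part_item v p) = N" "N ~= {}"
    and \<delta>: "1 <= \<delta>" "\<delta> <= 5 / 8 * real S"
    and close: "\<And>u. u \<in> N ==> norm (real (S * t + a) - real (S * fst u), real (S * c + b) - real (S * snd u)) = \<delta>"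
    and far: "\<And>u. u \<notin> N ==> 7 / 8 * real S <= \<bar>real (S * t + a) - real (S * fst u)\<bar> \<or>
      7 / 8 * real S <= \<bar>real (S * c + b) - real (S * snd u)\<bar>" for a b N \<delta>
  proof -
    have d: "real_place (site v p) - lattice u = (real (S * t + a) - real (S * fst u), real (S * c + b) - real (S * snd u))" for u
      by (simp add: real_place_def lattice_def place_def off[unfolded v] v)
    have "\<delta> + 1 / 4 <= norm (real_place (site v p) - lattice u)" if "u \<notin> N" for u
      using far[OF that] norm_pair_bounds(1)[of "real (S * t + a) - real (S * fst u)" "real (S * c + b) - real (S * snd u)"]
        norm_pair_bounds(2)[of "real (S * c + b) - real (S * snd u)" "real (S * t + a) - real (S * fst u)"] \<delta> S8
      unfolding d by argo
    then show ?thesis using close \<delta> S8 unfolding acc(1) d by (intro exI[of _ \<delta>] conjI acc(2)) simp_all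
  qed
  have local: ?thesis if off: "offset (kd v) p = (n, n)" and a: "acc (part_item v p) = {v}"
  proof (rule near[OF off a])
    show "1 <= norm (real n, real n)" "norm (real n, real n) <= 5 / 8 * real S"
      using norm_pair_bounds[of "real n" "real n"] nr by auto
    fix u show "7 / 8 * real S <= \<bar>real (S * t + n) - real (S * fst u)\<bar> \<or>
      7 / 8 * real S <= \<bar>real (S * c + n) - real (S * snd u)\<bar>" if "u \<notin> {v}"
      using that v far_coord[OF _ n(2), of t "fst u"] far_coord[OF _ n(2), of c "snd u"] by (cases u) auto
  qed (simp_all add: v)
  have horizontal: ?thesis if off: "offset (kd v) p = (n, S div 2)" and a: "acc (part_item v p) = {(t, c), (t, Suc c)}"
  proof (rule near[OF off a])
    show "1 <= norm (real n, real S / 2)" "norm (real n, real S / 2) <= 5 / 8 * real S"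
      using norm_pair_bounds[of "real n" "real S / 2"] nr S8 by auto
    fix u show "7 / 8 * real S <= \<bar>real (S * t + n) - real (S * fst u)\<bar> \<or>
      7 / 8 * real S <= \<bar>real (S * c + S div 2) - real (S * snd u)\<bar>" if "u \<notin> {(t, c), (t, Suc c)}"
      using that far_coord[OF _ n(2), of t "fst u"] half_coord[of "snd u" c] S8 by (cases u) fastforce
  qed (auto simp: half norm_Pair power2_eq_square algebra_simps)
  have vertical: ?thesis if off: "offset (kd v) p = (S div 2, n)" and a: "acc (part_item v p) = {(t, c), (Suc t, c)}"
  proof (rule near[OF off a])
    show "1 <= norm (real S / 2, real n)" "norm (real S / 2, real n) <= 5 / 8 * real S"
      using norm_pair_bounds[of "real S / 2" "real n"] nr S8 by auto
    fix u show "7 / 8 * real S <= \<bar>real (S * t + S div 2) - real (S * fst u)\<bar> \<or>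
      7 / 8 * real S <= \<bar>real (S * c + n) - real (S * snd u)\<bar>" if "u \<notin> {(t, c), (Suc t, c)}"
      using that far_coord[OF _ n(2), of c "snd u"] half_coord[of "fst u" t] S8 by (cases u) fastforce
  qed (auto simp: half norm_Pair power2_eq_square algebra_simps)
  show ?thesis
  proof (cases p)
    case (PTile \<theta>) then show ?thesis by (intro local) (auto simp: kd_def n_def)
  next
    case (PCell k) then show ?thesis by (intro local) (auto simp: kd_def n_def)
  next
    case (PR h k) show ?thesis
    proof (cases "c = W")
      case True then show ?thesis using PR v vc by (intro local) (auto simp: kd_def n_def cells_simps)
    next
      case False then show ?thesis using PR v vc by (intro horizontal) (auto simp: kd_def n_def cells_simps)
    qed
  next
    case (PU x k) show ?thesis
    proof (cases "t = H")
      case True then show ?thesis using PU v vc by (intro local) (auto simp: kd_def n_def cells_simps)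
    next
      case False then show ?thesis using PU v vc by (intro vertical) (auto simp: kd_def n_def cells_simps)
    qed
  next
    case (PL h k) then have "c = 1" using s v by (simp add: slots_simps)
    then show ?thesis using PL v vc by (intro local) (auto simp: kd_def n_def cells_simps)
  next
    case (PD x k) then have "t = 1" using s v by (simp add: slots_simps)
    then show ?thesis using PD v vc by (intro local) (auto simp: kd_def n_def cells_simps)
  qed
qed

end

section \<open>Exact covers as FLaMECaST instances\<close>

lemma sum_over_groups:
  fixes F :: "point => 'a::semiring_1"
  assumes "finite (sources I)"
  shows "(\<Sum>s\<in>{s \<in> sources I. P (source_pos I s)}. F (source_pos I s)) =
    (\<Sum>p\<in>{p \<in> source_pos I ` sources I. P p}. of_nat (group_size I p) * F p)"
proof -
  let ?T = "{s \<in> sources I. P (source_pos I s)}"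
  have "(\<Sum>s\<in>?T. F (source_pos I s)) = (\<Sum>p\<in>source_pos I ` ?T. \<Sum>s\<in>{s \<in> ?T. source_pos I s = p}. F (source_pos I s))"
    using assms by (intro sum.image_gen) simp
  also have "\<dots> = (\<Sum>p\<in>source_pos I ` ?T. of_nat (group_size I p) * F p)"
  proof (intro sum.cong refl)
    fix p assume "p \<in> source_pos I ` ?T"
    then have "{s \<in> ?T. source_pos I s = p} = {s \<in> sources I. source_pos I s = p}" by auto
    then show "(\<Sum>s\<in>{s \<in> ?T. source_pos I s = p}. F (source_pos I s)) = of_nat (group_size I p) * F p"
      by (simp add: group_size_def)
  qed
  also have "source_pos I ` ?T = {p \<in> source_pos I ` sources I. P p}" by auto
  finally show ?thesis .
qed

lemma (in cover) item_size_pos: "i \<in> items ==> (\<And>D. 1 <= wt D) ==> 1 <= item_size i"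
proof -
  assume i: "i \<in> items" and w: "\<And>D. 1 <= wt D"
  obtain D where D: "D \<in> digits" "1 <= vec i D"
  proof (cases i)
    case (TileItem v \<theta>) then show ?thesis using that[of Top] by (simp add: digits_def)
  next
    case (CellItem v k) then show ?thesis using that[of Cell] by (simp add: digits_def)
  next
    case (ElemItem e k)
    then show ?thesis using that[of "Side (kap e)"] i kap by (simp add: digits_def items_simps)
  qed
  have "1 <= vec i D * wt D" using D(2) w[of D] by (metis mult_le_mono nat_mult_1)
  also have "\<dots> <= item_size i" unfolding item_size_def using D(1) fin_digits by (intro member_le_sum) auto
  finally show ?thesis .
qed

text \<open>The interface between packing and geometry: coordinates are used only through these
  assumptions. Sinks at \<open>home v\<close> are the bins of \<open>v\<close>, and the capacity of
  layer 0 makes a sink a bin of size \<open>A * bin_size\<close>. The same capacity in the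
  intermediate layer never obstructs a single item, because an item in a full bin is not larger than
  the bin.\<close>

locale cover_instance = cover cells tiles elems locs kap act need sides K wt
  for cells :: "'v set" and tiles :: "'th set" and elems :: "'e set" and locs
    and kap :: "'e => 'k" and act need sides K wt +
  fixes I :: "('s, 't) flamecast" and spot :: "('v, 'th, 'e) item => point" and home :: "'v => point"
    and A g :: nat and S :: real
  assumes inst: "is_instance I" and one: "intermediate_layers I = 1" and alpha: "alpha I < 1"
    and caps: "capacities I = [A * bin_size, A * bin_size, A * bin_size]"
    and image: "source_pos I ` sources I = insert 0 (spot ` items)"
    and spot_inj: "inj_on spot items" and spot_nz: "\<And>i. i \<in> items ==> spot i ~= 0"
    and size: "\<And>i. i \<in> items ==> group_size I (spot i) = A * item_size i" and size0: "group_size I 0 = g"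
    and apart: "\<And>p q. p \<in> insert 0 (spot ` items) ==> q \<in> insert 0 (spot ` items) ==> p ~= q ==> 1 <= norm (p - q)"
    and sink_image: "\<And>t. t \<in> sinks I ==> sink_pos I t \<in> insert 0 (home ` cells)"
    and home_inj: "inj_on home cells" and home_nz: "\<And>v. v \<in> cells ==> home v ~= 0"
    and card_bins: "\<And>v. v \<in> cells ==> card {t \<in> sinks I. sink_pos I t = home v} = card tiles"
    and spare: "card (sources I) <= card {t \<in> sinks I. sink_pos I t = 0}"
    and dist: "\<And>i. i \<in> items ==> \<exists>\<delta>. 1 <= \<delta> & \<delta> <= S & acc i ~= {} & (\<forall>u\<in>acc i. norm (spot i - home u) = \<delta>) &
      (\<forall>u\<in>cells - acc i. \<delta> + 1 / 4 <= norm (spot i - home u)) & \<delta> + 1 / 4 <= norm (spot i)"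
    and wt1: "\<And>D. 1 <= wt D"
    and Ag: "1 <= g" "g <= A" and gap: "S * real A powr (alpha I - 1) < split_gap (alpha I)"
    and cells_ne: "cells ~= {}" and tiles_ne': "tiles ~= {}"
begin

definition "bins v = {t \<in> sinks I. sink_pos I t = home v}"

definition "d p = Min ((\<lambda>t. norm (p - sink_pos I t)) ` sinks I)"

lemma finI: "finite (sources I)" "finite (sinks I)" using inst by (auto simp: is_instance_def)

lemma acc_cells: "i \<in> items ==> acc i \<subseteq> cells"
  using locs by (cases i) (auto simp: items_simps)

lemma bins: "v \<in> cells ==> finite (bins v) & card (bins v) = card tiles" "v \<in> cells ==> bins v ~= {}"
proof -
  assume v: "v \<in> cells"
  show "finite (bins v) & card (bins v) = card tiles" using finI card_bins[OF v] by (simp add: bins_def)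
  moreover have "0 < card tiles" using fin(2) tiles_ne' by (simp add: card_gt_0_iff)
  ultimately show "bins v ~= {}" by auto
qed

lemma bins_disj: "v \<in> cells ==> v' \<in> cells ==> b \<in> bins v ==> b \<in> bins v' ==> v = v'"
  using home_inj by (auto simp: bins_def inj_on_def)

lemma zero_sink: "\<exists>t\<in>sinks I. sink_pos I t = 0"
proof -
  have "sources I ~= {}" using image by blast
  then have "0 < card (sources I)" using finI by (simp add: card_gt_0_iff)
  then have "0 < card {t \<in> sinks I. sink_pos I t = 0}" using spare by linarith
  then show ?thesis by (auto simp: card_gt_0_iff)
qed

lemma d_le: "t \<in> sinks I ==> d p <= norm (p - sink_pos I t)"
  unfolding d_def using finI by (intro Min_le) auto

lemma d_nonneg': "0 <= d p"
  unfolding d_def using finI zero_sink by (subst Min_ge_iff) auto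

lemma d_0: "d 0 = 0"
  using zero_sink d_le[of _ 0] d_nonneg'[of 0] by fastforce

lemma d_spot:
  assumes i: "i \<in> items"
  shows "1 <= d (spot i)" "d (spot i) <= S"
    "t \<in> sinks I ==> norm (spot i - sink_pos I t) < d (spot i) + 1 / 4 ==> \<exists>v\<in>acc i. t \<in> bins v"
    "v \<in> acc i ==> t \<in> bins v ==> norm (spot i - sink_pos I t) = d (spot i)"
proof -
  obtain \<delta> where \<delta>: "1 <= \<delta>" "\<delta> <= S" "acc i ~= {}" "\<And>u. u \<in> acc i ==> norm (spot i - home u) = \<delta>"
      "\<And>u. u \<in> cells - acc i ==> \<delta> + 1 / 4 <= norm (spot i - home u)" "\<delta> + 1 / 4 <= norm (spot i)"
    using dist[OF i] by metis
  have far: "\<exists>v\<in>acc i. t \<in> bins v" if t: "t \<in> sinks I" "norm (spot i - sink_pos I t) < \<delta> + 1 / 4" for t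
  proof -
    consider "sink_pos I t = 0" | v where "v \<in> cells" "sink_pos I t = home v" using sink_image[OF t(1)] by auto
    then show ?thesis
    proof cases
      case 1 then show ?thesis using t \<delta>(6) by simp
    next
      case (2 v) then have "v \<in> acc i" using \<delta>(5)[of v] t by auto
      then show ?thesis using 2 t(1) by (auto simp: bins_def)
    qed
  qed
  have eq: "norm (spot i - sink_pos I t) = \<delta>" if "v \<in> acc i" "t \<in> bins v" for v t
    using that \<delta>(4) by (auto simp: bins_def)
  have d: "d (spot i) = \<delta>"
    unfolding d_def
  proof (rule Min_eqI)
    show "finite ((\<lambda>t. norm (spot i - sink_pos I t)) ` sinks I)" using finI by simp
    show "\<delta> <= y" if "y \<in> (\<lambda>t. norm (spot i - sink_pos I t)) ` sinks I" for y
      using that far eq by (cases "y < \<delta> + 1 / 4") force+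
    obtain v where "v \<in> acc i" using \<delta>(3) by blast
    moreover obtain t where "t \<in> bins v" using bins(2)[of v] acc_cells[OF i] \<open>v \<in> acc i\<close> by blast
    ultimately show "\<delta> \<in> (\<lambda>t. norm (spot i - sink_pos I t)) ` sinks I"
      using eq[of v t] by (intro image_eqI[of _ _ t]) (auto simp: bins_def)
  qed
  show "1 <= d (spot i)" "d (spot i) <= S" using \<delta> d by auto
  show "\<exists>v\<in>acc i. t \<in> bins v" if "t \<in> sinks I" "norm (spot i - sink_pos I t) < d (spot i) + 1 / 4"
    using far[of t] that d by simp
  show "norm (spot i - sink_pos I t) = d (spot i)" if "v \<in> acc i" "t \<in> bins v" using eq[OF that] d by simp
qed

lemma size_ge: "i \<in> items ==> A <= group_size I (spot i)"
  using size item_size_pos[OF _ wt1, of i] by simp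

lemma source_cases:
  assumes "s \<in> sources I"
  obtains "source_pos I s = 0" | i where "i \<in> items" "source_pos I s = spot i"
proof -
  have "source_pos I s \<in> insert 0 (spot ` items)" using image assms by blast
  then show ?thesis using that by blast
qed

lemma nominal_bound:
  assumes s: "s \<in> sources I"
  shows "d (source_pos I s) * real (group_size I (source_pos I s)) powr (alpha I - 1) <= S * real A powr (alpha I - 1)"
proof (cases rule: source_cases[OF s])
  case 1
  obtain v \<theta> where "v \<in> cells" "\<theta> \<in> tiles" using cells_ne tiles_ne' by blast
  then have "TileItem v \<theta> \<in> items" by (simp add: items_simps)
  from d_spot(1,2)[OF this] have "0 <= S" by linarith
  then show ?thesis using 1 d_0 by simp
next
  case (2 i)
  have "real (group_size I (spot i)) powr (alpha I - 1) <= real A powr (alpha I - 1)"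
    using size_ge[OF 2(1)] Ag alpha by (intro powr_mono2') auto
  then show ?thesis using d_spot(1,2)[OF 2(1)] 2(2) by (auto intro!: mult_mono)
qed

sublocale separated I d
proof
  show "is_instance I" "alpha I < 1" by (fact inst, fact alpha)
  show "1 <= norm (source_pos I s - source_pos I s')"
    if "s \<in> sources I" "s' \<in> sources I" "source_pos I s ~= source_pos I s'" for s s'
    using apart[of "source_pos I s" "source_pos I s'"] that image by blast
  show "0 <= d p" for p by (fact d_nonneg')
  show "d (source_pos I s) <= norm (source_pos I s - sink_pos I t)" if "t \<in> sinks I" for s t using d_le[OF that] .
  show "d (source_pos I s) * real (group_size I (source_pos I s)) powr (alpha I - 1) <= 1 / 4" if "s \<in> sources I" for s
    using nominal_bound[OF that] gap by (simp add: split_gap_def)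
qed

lemma min_group_size: "has_min_group_size g I"
proof -
  have "card ` groups I = group_size I ` insert 0 (spot ` items)"
    unfolding groups_def image image_image by (simp add: group_size_def)
  moreover have "Min (group_size I ` insert 0 (spot ` items)) = g"
    using fin_items size0 size_ge Ag by (intro Min_eqI) (auto intro: order_trans)
  moreover have "sources I ~= {}" using image by blast
  ultimately show ?thesis by (simp add: has_min_group_size_def)
qed

lemma valid_ne: "valid_layouts I ~= {}"
proof -
  obtain \<phi> where "\<phi> ` sources I \<subseteq> {t \<in> sinks I. sink_pos I t = 0}" "inj_on \<phi> (sources I)"
    using card_le_inj[OF _ _ spare] finI by auto
  then show ?thesis by (intro ex_valid_layout[OF inst one, of \<phi>]) auto
qed

lemma bdd_cost: "bdd_below (layout_cost I ` valid_layouts I)"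
  by (rule bdd_belowI[of _ 0]) (auto simp: layout_cost_nonneg)

abbreviation "base_cost \<equiv> \<Sum>s\<in>sources I. nominal (sp s)"

lemma near_optimalI: "L \<in> valid_layouts I ==> near_optimal I d L" by unfold_locales (simp_all add: inst one)

lemma min_cost_pos: "0 < min_cost I"
proof -
  obtain v \<theta> where "v \<in> cells" "\<theta> \<in> tiles" using cells_ne tiles_ne' by blast
  then have i: "TileItem v \<theta> \<in> items" by (simp add: items_simps)
  then obtain s where s: "s \<in> sources I" "sp s = spot (TileItem v \<theta>)" using image by (metis imageE image_eqI insertCI)
  have nn: "0 <= nominal (sp s)" for s using d_nonneg' by (simp add: nominal_def)
  have "0 < nominal (sp s)" using d_spot(1)[OF i] s(2) size_ge[OF i] Ag by (simp add: nominal_def)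
  also have "\<dots> <= base_cost" using s(1) nn finI by (intro member_le_sum[of s _ "\<lambda>s. nominal (sp s)"]) auto
  also have "\<dots> <= min_cost I" unfolding min_cost_def
    using near_optimal.cost_lower_bound[OF near_optimalI] valid_ne by (intro cINF_greatest) auto
  finally show ?thesis .
qed

lemma card_sources_if: "card {s \<in> sources I. P (sp s)} = (\<Sum>p\<in>{p \<in> insert 0 (spot ` items). P p}. group_size I p)"
  using sum_over_groups[OF finI(1), where P = P and F = "\<lambda>_. 1::nat"] image by simp

lemma bin_size_pos: "1 <= bin_size"
proof -
  have "1 <= target Top * wt Top" using wt1 by (simp add: target_def)
  also have "\<dots> <= bin_size" unfolding bin_size_def using fin_digits by (intro member_le_sum) (auto simp: digits_def)
  finally show ?thesis .
qed

lemma g_le: "g <= A * bin_size"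
  using Ag bin_size_pos by (metis le_trans mult.right_neutral mult_le_mono2)

context
  fixes \<phi> :: "('v, 'th, 'e) item => 't"
  assumes \<phi>: "\<And>i. i \<in> items ==> \<exists>v\<in>acc i. \<phi> i \<in> bins v"
    and full: "\<And>v b. v \<in> cells ==> b \<in> bins v ==> (\<Sum>i | i \<in> items & \<phi> i = b. item_size i) = bin_size"
begin

lemma \<phi>_cells: "i \<in> items ==> \<exists>v\<in>cells. \<phi> i \<in> bins v" using \<phi> acc_cells by blast

text \<open>A perfect packing sends each group as a whole to one of its nearest sinks, which costs
  exactly its nominal amount. The group at the origin uses a spare sink there and costs
  nothing.\<close>

lemma packing_cost: "min_cost I <= base_cost"
proof -
  obtain t0 where t0: "t0 \<in> sinks I" "sink_pos I t0 = 0" using zero_sink by blast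
  define \<Phi> where "\<Phi> p = (if p = 0 then t0 else \<phi> (inv_into items spot p))" for p
  have \<Phi>s: "\<Phi> (spot i) = \<phi> i" if "i \<in> items" for i using that spot_nz[OF that] spot_inj by (simp add: \<Phi>_def)
  have \<Phi>0: "\<Phi> 0 = t0" by (simp add: \<Phi>_def)
  have nt0: "\<phi> i ~= t0" if "i \<in> items" for i using \<phi>_cells[OF that] t0 home_nz by (auto simp: bins_def)
  have "\<exists>L\<in>valid_layouts I. layout_cost I L =
    (\<Sum>p \<in> source_pos I ` sources I. norm (p - sink_pos I (\<Phi> p)) * real (group_size I p) powr alpha I)"
  proof (rule ex_unsplit_layout[OF inst one])
    show "\<Phi> (source_pos I s) \<in> sinks I" if s: "s \<in> sources I" for s
      using \<phi>_cells \<Phi>s \<Phi>0 t0 by (cases rule: source_cases[OF s]) (auto simp: bins_def)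
    show "group_size I p <= capacities I ! 1" for p
    proof -
      consider "p = 0" | i where "i \<in> items" "p = spot i" | "p \<notin> sp ` sources I" using image by blast
      then show ?thesis
      proof cases
        case 1 then show ?thesis using size0 g_le caps by simp
      next
        case (2 i)
        obtain v where v: "v \<in> cells" "\<phi> i \<in> bins v" using \<phi>_cells 2 by blast
        have "item_size i <= (\<Sum>j | j \<in> items & \<phi> j = \<phi> i. item_size j)"
          using 2 fin_items by (intro member_le_sum) auto
        then show ?thesis using full[OF v] size[OF 2(1)] 2 caps by simp
      next
        case 3 then have "{s \<in> sources I. sp s = p} = {}" by auto
        then have "group_size I p = 0" by (simp only: group_size_def card.empty)
        then show ?thesis by simp
      qed
    qed
    show "card {s \<in> sources I. \<Phi> (sp s) = t} <= capacities I ! 0" for t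
    proof (cases "t = t0")
      case True then have "{p \<in> insert 0 (spot ` items). \<Phi> p = t} = {0}" using \<Phi>0 \<Phi>s nt0 by auto
      then show ?thesis using card_sources_if[of "\<lambda>p. \<Phi> p = t"] size0 g_le caps by simp
    next
      case False then have "{p \<in> insert 0 (spot ` items). \<Phi> p = t} = spot ` {i. i \<in> items & \<phi> i = t}"
        using \<Phi>0 \<Phi>s by auto
      then have "card {s \<in> sources I. \<Phi> (sp s) = t} = (\<Sum>i | i \<in> items & \<phi> i = t. A * item_size i)"
        using size card_sources_if[of "\<lambda>p. \<Phi> p = t"] inj_on_subset[OF spot_inj, of "{i. i \<in> items & \<phi> i = t}"]
        by (simp add: sum.reindex subset_iff)
      also have "\<dots> <= A * bin_size"
      proof (cases "\<exists>i. i \<in> items & \<phi> i = t")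
        case True then show ?thesis using full \<phi>_cells by (fastforce simp: sum_distrib_left[symmetric])
      next
        case False then show ?thesis by (metis (mono_tags, lifting) mem_Collect_eq sum.neutral zero_le)
      qed
      finally show ?thesis using caps by simp
    qed
  qed
  then obtain L where L: "L \<in> valid_layouts I" "layout_cost I L =
      (\<Sum>p \<in> source_pos I ` sources I. norm (p - sink_pos I (\<Phi> p)) * real (group_size I p) powr alpha I)" by blast
  have "layout_cost I L = (\<Sum>p \<in> source_pos I ` sources I. real (group_size I p) * nominal p)"
    unfolding L(2)
  proof (intro sum.cong refl)
    fix p assume "p \<in> sp ` sources I"
    then consider "p = 0" | i where "i \<in> items" "p = spot i" using image by blast
    then show "norm (p - sink_pos I (\<Phi> p)) * real (group_size I p) powr alpha I = real (group_size I p) * nominal p"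
    proof cases
      case 1 then show ?thesis using t0 \<Phi>0 d_0 by (simp add: nominal_def)
    next
      case (2 i)
      have "real (group_size I p) * real (group_size I p) powr (alpha I - 1) = real (group_size I p) powr alpha I"
        using size_ge[OF 2(1)] 2 Ag by (simp add: powr_diff)
      moreover have "norm (p - sink_pos I (\<Phi> p)) = d p"
        using \<phi>[OF 2(1)] d_spot(4)[OF 2(1)] \<Phi>s[OF 2(1)] 2 by auto
      ultimately show ?thesis by (simp add: nominal_def)
    qed
  qed
  also have "\<dots> = base_cost" using sum_over_groups[OF finI(1), where P = "\<lambda>_. True" and F = nominal] by simp
  finally show ?thesis unfolding min_cost_def using cINF_lower[OF bdd_cost L(1)] by simp
qed

end

lemma total_le: "base_cost <= real (card (sources I)) * (S * real A powr (alpha I - 1))"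
  using sum_bounded_above[of "sources I" "\<lambda>s. nominal (sp s)"] nominal_bound by (simp add: nominal_def)

text \<open>The base cost is at most \<open>n\<close> times
  \<open>S * A powr (\<alpha> - 1)\<close>, so the factor \<open>1 + 1 / n\<close> allows an
  additive error of at most this constant, which is below \<open>split_gap\<close>. Hence every
  group goes unsplit to a sink of one of its cells, and this defines a map \<open>\<psi>\<close>
  from items to bins. The conclusion speaks of sources and their sinks, because these are what a
  decoder sees.\<close>

theorem approximation_selection:
  assumes sel0: "selection sel0"
    and wt: "unique_weights M digits wt"
    and M: "\<And>v. v \<in> cells ==> card {i \<in> items. v \<in> acc i} * (K + 1) <= M" "K + 1 <= M"
    and approx: "is_approximation \<rho> I L" and \<rho>: "\<rho> <= 1 + 1 / real (card (sources I))"
  shows "\<exists>sel. selection sel & (\<forall>v \<theta> s s' t t'. v \<in> cells --> \<theta> \<in> tiles --> s \<in> sources I --> s' \<in> sources I -->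
     sp s = spot (TileItem v \<theta>) --> sp s' = spot (CellItem v 0) --> connects L s t --> connects L s' t' -->
     (t = t' \<longleftrightarrow> \<theta> = sel v))"
proof -
  note finC = fin(1,2)
  have "\<exists>\<phi>. (\<forall>i\<in>items. \<exists>v\<in>acc i. \<phi> i \<in> bins v) &
      (\<forall>v\<in>cells. \<forall>b\<in>bins v. (\<Sum>i | i \<in> items & \<phi> i = b. item_size i) = bin_size)"
    by (rule selection_packing[OF sel0]) (use bins(1) bins_disj in blast)+
  then obtain \<phi> where \<phi>: "\<And>i. i \<in> items ==> \<exists>v\<in>acc i. \<phi> i \<in> bins v"
      "\<And>v b. v \<in> cells ==> b \<in> bins v ==> (\<Sum>i | i \<in> items & \<phi> i = b. item_size i) = bin_size" by blast
  have L: "L \<in> valid_layouts I" "layout_cost I L <= \<rho> * min_cost I" using approx by (auto simp: is_approximation_def)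
  interpret near_optimal I d L by (rule near_optimalI[OF L(1)])
  let ?n = "real (card (sources I))"
  have n: "0 < ?n" using image finI by (auto simp: card_gt_0_iff)
  have near: "layout_cost I L < base_cost + split_gap (alpha I)"
  proof -
    have "layout_cost I L <= (1 + 1 / ?n) * min_cost I"
      using L(2) mult_right_mono[OF \<rho>, of "min_cost I"] min_cost_pos by linarith
    also have "\<dots> <= (1 + 1 / ?n) * base_cost" using packing_cost[OF \<phi>] by (intro mult_left_mono) auto
    also have "\<dots> <= base_cost + S * real A powr (alpha I - 1)" using total_le n by (simp add: field_simps)
    finally show ?thesis using gap by linarith
  qed
  have conn: "\<exists>t. connects L s t" if "s \<in> sources I" for s using ex_connects[OF that] by blast
  have "\<forall>i. \<exists>t. i \<in> items --> (\<forall>s\<in>sources I. sp s = spot i --> connects L s t) & (\<exists>v\<in>acc i. t \<in> bins v)"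
  proof
    fix i
    show "\<exists>t. i \<in> items --> (\<forall>s\<in>sources I. sp s = spot i --> connects L s t) & (\<exists>v\<in>acc i. t \<in> bins v)"
    proof (cases "i \<in> items")
      case True
      then obtain s where s: "s \<in> sources I" "sp s = spot i" using image by (metis imageE image_eqI insertCI)
      obtain t where t: "connects L s t" using conn[OF s(1)] by blast
      have "connects L s' t" if s': "s' \<in> sources I" "sp s' = spot i" for s'
      proof -
        obtain t' where t': "connects L s' t'" using conn[OF s'(1)] by blast
        have "t = t'" using near_optimal_unsplit[OF near s(1) s'(1) _ _ t t'] s' s d_spot(1)[OF True] by simp
        then show ?thesis using t' by simp
      qed
      moreover have "\<exists>v\<in>acc i. t \<in> bins v"
        using near_optimal_close[OF near s(1) t] d_spot(3)[OF True] s(2) by simp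
      ultimately show ?thesis by blast
    qed auto
  qed
  then obtain \<psi> where \<psi>: "\<And>i s. i \<in> items ==> s \<in> sources I ==> sp s = spot i ==> connects L s (\<psi> i)"
      "\<And>i. i \<in> items ==> \<exists>v\<in>acc i. \<psi> i \<in> bins v" by metis
  let ?U = "\<Union>v\<in>cells. bins v"
  have finU: "finite ?U" using finC(1) bins(1) by auto
  have inU: "\<phi> i \<in> ?U" "\<psi> i \<in> ?U" if "i \<in> items" for i using \<phi>(1)[OF that] \<psi>(2)[OF that] acc_cells[OF that] by auto
  have le: "(\<Sum>i\<in>{i \<in> items. \<psi> i = b}. item_size i) <= bin_size" for b
  proof -
    have "A * (\<Sum>i\<in>{i \<in> items. \<psi> i = b}. item_size i) = (\<Sum>p\<in>spot ` {i \<in> items. \<psi> i = b}. group_size I p)"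
      using size by (subst sum.reindex[OF inj_on_subset[OF spot_inj]]) (auto simp: sum_distrib_left)
    also have "\<dots> = card {s \<in> sources I. sp s \<in> spot ` {i \<in> items. \<psi> i = b}}"
      unfolding card_sources_if[of "\<lambda>p. p \<in> spot ` {i \<in> items. \<psi> i = b}"] by (intro sum.cong) auto
    also have "\<dots> <= card {s \<in> sources I. connects L s b}" using \<psi>(1) finI by (intro card_mono) auto
    also have "\<dots> <= A * bin_size" using connects_capacity[of b] caps by simp
    finally show ?thesis using Ag by simp
  qed
  have grp: "(\<Sum>b\<in>?U. \<Sum>i\<in>{i \<in> items. f i = b}. item_size i) = sum item_size items" if "\<forall>i\<in>items. f i \<in> ?U" for f
    by (rule sum.group[OF fin_items finU]) (use that in blast)
  have "(\<Sum>b\<in>?U. \<Sum>i\<in>{i \<in> items. \<psi> i = b}. item_size i) = (\<Sum>b\<in>?U. \<Sum>i\<in>{i \<in> items. \<phi> i = b}. item_size i)"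
    using grp[of \<psi>] grp[of \<phi>] inU by simp
  also have "\<dots> = (\<Sum>b\<in>?U. bin_size)" using \<phi>(2) by (intro sum.cong) auto
  \<comment> \<open>Capacities bound every bin from above, and the total size of the items equals
    the total size of the bins, as the perfect packing \<open>\<phi>\<close> shows; so no bin has
    room left.\<close>
  finally have full: "(\<Sum>i\<in>{i \<in> items. \<psi> i = b}. item_size i) = bin_size" if "b \<in> ?U" for b
    using sum_mono_inv[OF _ _ that finU] le by blast
  have "\<exists>sel. selection sel & (\<forall>v\<in>cells. \<forall>\<theta>\<in>tiles. \<psi> (TileItem v \<theta>) = \<psi> (CellItem v 0) \<longleftrightarrow> \<theta> = sel v)"
    by (rule packing_selection[where bins = bins, OF wt M _ \<psi>(2) _ selection_deg_pos[OF sel0] tiles_ne'])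
      (use bins_disj full in blast)+
  then obtain sel where sel: "selection sel"
    "\<And>v \<theta>. v \<in> cells ==> \<theta> \<in> tiles ==> \<psi> (TileItem v \<theta>) = \<psi> (CellItem v 0) \<longleftrightarrow> \<theta> = sel v" by blast
  have "0 < card tiles" using finC(2) tiles_ne' by (simp add: card_gt_0_iff)
  then have i: "TileItem v \<theta> \<in> items" "CellItem v 0 \<in> items" if "v \<in> cells" "\<theta> \<in> tiles" for v \<theta>
    using that by (auto simp: items_simps)
  show ?thesis
  proof (intro exI[of _ sel] conjI allI impI sel(1))
    fix v \<theta> s s' t t'
    assume v: "v \<in> cells" "\<theta> \<in> tiles" and s: "s \<in> sources I" "s' \<in> sources I" "sp s = spot (TileItem v \<theta>)"
      "sp s' = spot (CellItem v 0)" and c: "connects L s t" "connects L s' t'"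
    have "t = \<psi> (TileItem v \<theta>)" "t' = \<psi> (CellItem v 0)"
      using connects_unique[OF c(1) \<psi>(1)[OF i(1)[OF v] s(1,3)]] connects_unique[OF c(2) \<psi>(1)[OF i(2)[OF v] s(2,4)]] by simp_all
    then show "t = t' \<longleftrightarrow> \<theta> = sel v" using sel(2)[OF v] by simp
  qed
qed

end

section \<open>The hard instances\<close>

lemma count_list_concat: "count_list (concat xss) q = sum_list (map (\<lambda>xs. count_list xs q) xss)"
  by (induction xss) auto

lemma count_list_replicate: "count_list (replicate n x) q = (if x = q then n else 0)" by (induction n) auto

lemma count_list_distinct_map:
  "distinct xs ==> count_list (concat (map f xs)) q = (\<Sum>x\<in>set xs. count_list (f x) q)"
  by (simp add: count_list_concat sum_list_distinct_conv_sum_set comp_def)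

lemma count_list_card: "count_list xs q = card {i. i < length xs & xs ! i = q}"
  unfolding count_list_eq_length_filter by (simp add: length_filter_conv_card eq_commute)

definition rat_place :: "nat \<times> nat => rat \<times> rat" where
  "rat_place q = (of_nat (fst q), of_nat (snd q))"

definition grid_list :: "nat => nat => (nat \<times> nat => 'a list) => 'a list" where
  "grid_list H W F = concat (map (\<lambda>t. concat (map (\<lambda>c. F (t, c)) [1..<Suc W])) [1..<Suc H])"

lemma count_grid_list: "count_list (grid_list H W F) q = (\<Sum>v\<in>{1..H} \<times> {1..W}. count_list (F v) q)"
proof -
  have *: "set [1..<Suc n] = {1..n}" for n by auto
  show ?thesis unfolding grid_list_def count_list_distinct_map[OF distinct_upt] * by (simp add: sum.cartesian_product)
qed

lemma nth_concat_uniform: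
  assumes "\<And>c. length (F c) = m" "k < n" "j < m"
  shows "concat (map F [a..<a + n]) ! (k * m + j) = F (a + k) ! j" "k * m + j < length (concat (map F [a..<a + n]))"
proof -
  have len: "length (concat (map F [a..<a + n])) = n * m" for n by (simp add: length_concat comp_def assms(1) sum_list_triv)
  have "concat (map F [a..<a + n]) ! (k * m + j) = F (a + k) ! j & k * m + j < n * m" using assms(2)
  proof (induction n)
    case (Suc n) show ?case
    proof (cases "k < n")
      case True then show ?thesis using Suc.IH by (simp add: nth_append len)
    next
      case False then have "k = n" using Suc.prems by simp
      then show ?thesis using assms(1,3) by (simp add: nth_append len)
    qed
  qed simp
  then show "concat (map F [a..<a + n]) ! (k * m + j) = F (a + k) ! j" "k * m + j < length (concat (map F [a..<a + n]))"
    by (simp_all add: len)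
qed

context gadget
begin

definition "base_list = (SOME xs. set xs = base_parts & distinct xs)"
definition "part_list kd = (SOME xs. set xs = parts kd & distinct xs)"

lemma base_list: "set base_list = base_parts" "distinct base_list"
  using someI_ex[OF finite_distinct_list[OF finite_parts(2)]] unfolding base_list_def by blast+

lemma part_list: "set (part_list kd) = parts kd" "distinct (part_list kd)"
  using someI_ex[OF finite_distinct_list[OF finite_parts(1)], of kd] unfolding part_list_def by blast+

text \<open>In row 1 one source of every base part is already listed among the leading
  representatives and is withheld here.\<close>

fun copies :: "nat => 'v kind => ('h, 'v) part => nat" where
  "copies A (ot, oc, b1, bH, c1, cW, vb, vt) p =
     A * part_size (ot, oc, b1, bH, c1, cW, vb, vt) p - (if b1 & p \<in> base_parts then 1 else 0)"

definition cell_sources :: "nat => 'v kind => nat \<times> nat => (nat \<times> nat) list" where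
  "cell_sources A kd v = concat (map (\<lambda>p. replicate (copies A kd p) (place kd v p)) (part_list kd))"

text \<open>The first sources are representatives, in a fixed order, of the tile and cell items of the
  bottom row.\<close>

definition source_list :: "nat => nat => nat => nat => (nat \<times> nat => 'v kind) => (nat \<times> nat) list" where
  "source_list A g H W \<kappa> = concat (map (\<lambda>c. map (place (\<kappa> (1, c)) (1, c)) base_list) [1..<1 + W]) @
     grid_list H W (\<lambda>v. cell_sources A (\<kappa> v) v) @ replicate g (0, 0)"

definition sink_list :: "nat => nat => nat => (nat \<times> nat) list" where
  "sink_list n H W = replicate n (0, 0) @ grid_list H W (\<lambda>v. replicate (card \<Theta>) (S * fst v, S * snd v))"

end

locale scaled_gadget = numbered_gadget +
  fixes A g M :: nat and \<alpha> :: real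
  assumes \<alpha>: "0 <= \<alpha>" "\<alpha> < 1" and Ag: "1 <= g" "g <= A"
    and gap: "real S * real A powr (\<alpha> - 1) < split_gap \<alpha>"
    and unique: "unique_weights M ({Top, Flag, Cell} \<union> Side ` wang.sides Hs Vs) wt"
    and M: "(3 * card all_parts + 1) * (wang.K Hs Vs + 1) <= M"

locale hard_instance = scaled_gadget \<Theta> Hs Vs h0 wt S num A g M \<alpha> + placed \<Theta> Hs Vs h0 wt S num H W bc tc
  for \<Theta> :: "('h, 'v) tile set" and Hs Vs h0 wt S num A g M \<alpha> H W bc tc
begin

abbreviation "src \<equiv> source_list A g H W kd"
abbreviation "snk \<equiv> sink_list (length src) H W"

definition I :: "(nat, nat) flamecast" where
  "I = the_instance \<alpha> (map rat_place src) (map rat_place snk) [A * bin_weight, A * bin_weight, A * bin_weight]"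

lemma cells_eq: "cells = {1..H} \<times> {1..W}" by (simp add: cells_def)

lemma part_pos: "(v, p) \<in> slots ==> 1 <= part_size (kd v) p"
proof -
  assume s: "(v, p) \<in> slots"
  then have "part_item v p \<in> items" using part_item_bij by (auto simp: bij_betw_def)
  then show ?thesis using item_size_pos wt_pos part_size_eq[OF s] by simp
qed

lemma finite_slots: "finite slots"
  unfolding slots_def using fin(1) finite_parts by simp

lemma copies_eq:
  assumes "(v, p) \<in> slots"
  shows "copies A (kd v) p + (if fst v = 1 & p \<in> base_parts then 1 else 0) = A * part_size (kd v) p"
proof -
  have "1 <= A * part_size (kd v) p" using part_pos[OF assms] Ag by (metis le_trans mult_le_mono nat_mult_1)
  moreover have "copies A (kd v) p = A * part_size (kd v) p - (if fst v = 1 & p \<in> base_parts then 1 else 0)"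
    by (simp add: kd_def)
  ultimately show ?thesis by simp
qed

text \<open>The representatives in front make up for the copies withheld in row 1, so the
  multiplicity of a place no longer depends on the order of the list.\<close>

lemma count_src: "count_list src q =
  (\<Sum>x\<in>slots. if site (fst x) (snd x) = q then A * part_size (kd (fst x)) (snd x) else 0) + (if q = (0, 0) then g else 0)"
proof -
  let ?r = "\<lambda>v p. if site v p = q & p \<in> base_parts then 1 else 0 :: nat"
  have "count_list (concat (map (\<lambda>c. map (site (1, c)) base_list) [1..<1 + W])) q =
      (\<Sum>c\<in>{1..W}. \<Sum>p\<in>base_parts. if site (1, c) p = q then 1 else 0)"
  proof -
    have "count_list (map f base_list) q = (\<Sum>p\<in>base_parts. if f p = q then 1 else 0)" for f :: "('h, 'v) part => nat \<times> nat"
      using count_list_distinct_map[OF base_list(2), of "\<lambda>p. [f p]" q] base_list(1)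
      by (simp add: concat_map_singleton cong: if_cong)
    moreover have "set [1..<1 + W] = {1..W}" by auto
    ultimately show ?thesis unfolding count_list_distinct_map[OF distinct_upt] by simp
  qed
  also have "\<dots> = (\<Sum>c\<in>{1..W}. \<Sum>p\<in>parts (kd (1, c)). ?r (1, c) p)"
  proof (rule sum.cong[OF refl])
    fix c
    have "(\<Sum>p\<in>base_parts. if site (1, c) p = q then 1 else 0) = (\<Sum>p\<in>base_parts. ?r (1, c) p)"
      by (intro sum.cong) auto
    also have "\<dots> = (\<Sum>p\<in>parts (kd (1, c)). ?r (1, c) p)"
      using finite_parts(1) by (intro sum.mono_neutral_left) (auto simp: parts_def)
    finally show "(\<Sum>p\<in>base_parts. if site (1, c) p = q then 1 else 0) = \<dots>" .
  qed
  also have "\<dots> = (\<Sum>t\<in>{1..H}. if t = 1 then \<Sum>c\<in>{1..W}. \<Sum>p\<in>parts (kd (t, c)). ?r (t, c) p else 0)"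
    using HW by (subst sum.delta) auto
  also have "\<dots> = (\<Sum>t\<in>{1..H}. \<Sum>c\<in>{1..W}. \<Sum>p\<in>parts (kd (t, c)). if t = 1 then ?r (t, c) p else 0)"
    by (intro sum.cong refl) auto
  also have "\<dots> = (\<Sum>v\<in>cells. \<Sum>p\<in>parts (kd v). if fst v = 1 then ?r v p else 0)"
    unfolding cells_eq by (subst sum.cartesian_product) (intro sum.cong refl, auto)
  also have "\<dots> = (\<Sum>x\<in>slots. if fst (fst x) = 1 then ?r (fst x) (snd x) else 0)"
    unfolding slots_def using fin(1) finite_parts by (subst sum.Sigma) (auto simp: case_prod_unfold)
  finally have 1: "count_list (concat (map (\<lambda>c. map (site (1, c)) base_list) [1..<1 + W])) q = \<dots>" .
  have "count_list (grid_list H W (\<lambda>v. cell_sources A (kd v) v)) q =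
      (\<Sum>v\<in>cells. \<Sum>p\<in>parts (kd v). if site v p = q then copies A (kd v) p else 0)"
    unfolding count_grid_list cells_eq cell_sources_def count_list_distinct_map[OF part_list(2)] part_list(1)
    by (simp add: count_list_replicate)
  also have "\<dots> = (\<Sum>x\<in>slots. if site (fst x) (snd x) = q then copies A (kd (fst x)) (snd x) else 0)"
    unfolding slots_def using fin(1) finite_parts by (subst sum.Sigma) (auto simp: case_prod_unfold)
  finally have 2: "count_list (grid_list H W (\<lambda>v. cell_sources A (kd v) v)) q = \<dots>" .
  have "count_list src q = (\<Sum>x\<in>slots. (if fst (fst x) = 1 then ?r (fst x) (snd x) else 0) +
      (if site (fst x) (snd x) = q then copies A (kd (fst x)) (snd x) else 0)) + (if q = (0, 0) then g else 0)"
    unfolding source_list_def by (simp add: 1[simplified] 2 count_list_replicate sum.distrib)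
  also have "(\<Sum>x\<in>slots. (if fst (fst x) = 1 then ?r (fst x) (snd x) else 0) +
      (if site (fst x) (snd x) = q then copies A (kd (fst x)) (snd x) else 0)) =
    (\<Sum>x\<in>slots. if site (fst x) (snd x) = q then A * part_size (kd (fst x)) (snd x) else 0)"
  proof (intro sum.cong refl)
    fix x assume "x \<in> slots"
    then have "(fst x, snd x) \<in> slots" by simp
    from copies_eq[OF this] show "(if fst (fst x) = 1 then ?r (fst x) (snd x) else 0) +
      (if site (fst x) (snd x) = q then copies A (kd (fst x)) (snd x) else 0) =
      (if site (fst x) (snd x) = q then A * part_size (kd (fst x)) (snd x) else 0)" by (auto split: if_splits)
  qed
  finally show ?thesis .
qed

lemma count_snk: "count_list snk q = (\<Sum>v\<in>cells. if (S * fst v, S * snd v) = q then card \<Theta> else 0) +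
    (if q = (0, 0) then length src else 0)"
  unfolding sink_list_def by (auto simp: count_grid_list count_list_replicate cells_eq)

lemma site_nz: "(v, p) \<in> slots ==> site v p ~= (0, 0)"
  using offset_less[of v p] by (simp add: place_def)

lemma site_eq: "(v, p) \<in> slots ==> (v', p') \<in> slots ==> site v p = site v' p' \<longleftrightarrow> (v, p) = (v', p')"
  using at_inj by (auto simp: inj_on_def)

lemma count_site: "(v, p) \<in> slots ==> count_list src (site v p) = A * part_size (kd v) p"
proof -
  assume s: "(v, p) \<in> slots"
  have "(\<Sum>x\<in>slots. if site (fst x) (snd x) = site v p then A * part_size (kd (fst x)) (snd x) else 0) =
    (\<Sum>x\<in>slots. if x = (v, p) then A * part_size (kd (fst x)) (snd x) else 0)"
    using site_eq[OF _ s] by (intro sum.cong) (auto split: if_splits)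
  then show ?thesis unfolding count_src using s site_nz[OF s] finite_slots by simp
qed

lemma count_zero: "count_list src (0, 0) = g"
proof -
  have "(\<Sum>x\<in>slots. if site (fst x) (snd x) = (0, 0) then A * part_size (kd (fst x)) (snd x) else 0) = 0"
    using site_nz by (intro sum.neutral) auto
  then show ?thesis unfolding count_src by simp
qed

lemma set_src: "set src = insert (0, 0) ((\<lambda>(v, p). site v p) ` slots)"
proof (intro equalityI subsetI)
  fix q assume "q \<in> set src"
  then have "count_list src q ~= 0" by (simp add: count_list_0_iff)
  moreover have "count_list src q = 0" if "q ~= (0, 0)" "\<forall>x\<in>slots. site (fst x) (snd x) ~= q"
    unfolding count_src using that by simp
  ultimately have "q = (0, 0) \<or> (\<exists>x\<in>slots. site (fst x) (snd x) = q)" by metis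
  then show "q \<in> insert (0, 0) ((\<lambda>(v, p). site v p) ` slots)" by force
next
  fix q assume "q \<in> insert (0, 0) ((\<lambda>(v, p). site v p) ` slots)"
  then have "0 < count_list src q" using count_zero count_site part_pos Ag by (fastforce simp: Suc_le_eq)
  then show "q \<in> set src" by (metis count_list_0_iff less_numeral_extra(3))
qed

lemma real_rat_place: "real_point (rat_place q) = real_place q"
  by (simp add: real_point_def rat_place_def real_place_def)

lemma real_place_inj: "real_place q = real_place q' \<longleftrightarrow> q = q'" by (cases q; cases q') (simp add: real_place_def)

lemma real_place_0: "real_place q = 0 \<longleftrightarrow> q = (0, 0)" by (cases q) (simp add: real_place_def zero_prod_def)

lemma I_simps: "sources I = {..<length src}" "sinks I = {..<length snk}" "alpha I = \<alpha>"
  "capacities I = [A * bin_weight, A * bin_weight, A * bin_weight]"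
  "i < length src ==> source_pos I i = real_place (src ! i)"
  "j < length snk ==> sink_pos I j = real_place (snk ! j)"
  by (simp_all add: I_def the_instance_def real_rat_place)

lemma group_size_place: "group_size I (real_place q) = count_list src q"
  unfolding group_size_def count_list_card I_simps
  by (rule arg_cong[of _ _ card]) (auto simp: I_simps real_place_inj)

lemma card_sinks_place: "card {t \<in> sinks I. sink_pos I t = real_place q} = count_list snk q"
  unfolding count_list_card I_simps by (rule arg_cong[of _ _ card]) (auto simp: I_simps real_place_inj)

definition slot_of where "slot_of = inv_into slots (\<lambda>(v, p). part_item v p)"

definition spot where "spot i = real_place (case slot_of i of (v, p) => site v p)"

lemma slot_of: "(v, p) \<in> slots ==> slot_of (part_item v p) = (v, p)"
  using inv_into_f_f[of "\<lambda>(v, p). part_item v p" slots "(v, p)"] part_item_bij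
  by (auto simp: slot_of_def bij_betw_def)

lemma item_cases:
  assumes "i \<in> items"
  obtains v p where "(v, p) \<in> slots" "i = part_item v p" "spot i = real_place (site v p)"
proof -
  have "i \<in> (\<lambda>(v, p). part_item v p) ` slots" using assms part_item_bij by (simp add: bij_betw_def)
  then obtain v p where "(v, p) \<in> slots" "i = part_item v p" by (metis (no_types, lifting) case_prod_conv imageE surj_pair)
  then show ?thesis using that slot_of by (simp add: spot_def)
qed

lemma part_item_in: "(v, p) \<in> slots ==> part_item v p \<in> items"
  using part_item_bij by (auto simp: bij_betw_def)

lemma home_place: "lattice v = real_place (S * fst v, S * snd v)" by (simp add: lattice_def real_place_def)

text \<open>Cells own the elements on their right and upper edges, so an item that may go to
  \<open>v\<close> is owned by \<open>v\<close>, by its left or by its lower neighbour. This is the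
  origin of the 3 in the bound for \<open>M\<close>.\<close>

lemma card_acc:
  assumes "v \<in> cells"
  shows "card {i \<in> items. v \<in> acc i} * (K + 1) <= M"
proof -
  let ?N = "{v, (fst v, snd v - 1), (fst v - 1, snd v)}"
  have "{i \<in> items. v \<in> acc i} \<subseteq> (\<lambda>(u, p). part_item u p) ` (?N \<times> all_parts)"
  proof
    fix i assume i: "i \<in> {i \<in> items. v \<in> acc i}"
    then obtain u p where up: "(u, p) \<in> slots" "i = part_item u p" using item_cases[of i] by blast
    have "u \<in> ?N"
      using i up by (cases u; cases p) (auto simp: slots_simps cells_simps)
    moreover have "p \<in> all_parts" using up(1) parts_all[of "kd u"] by (auto simp: slots_def)
    ultimately show "i \<in> (\<lambda>(u, p). part_item u p) ` (?N \<times> all_parts)" using up(2) by blast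
  qed
  then have "card {i \<in> items. v \<in> acc i} <= card (?N \<times> all_parts)"
    using finite_all_parts by (intro surj_card_le) auto
  also have "\<dots> <= 3 * card all_parts"
    unfolding card_cartesian_product by (intro mult_right_mono) (auto simp: card_insert_if)
  finally have "card {i \<in> items. v \<in> acc i} * (K + 1) <= (3 * card all_parts + 1) * (K + 1)"
    by (intro mult_right_mono) auto
  then show ?thesis using M by linarith
qed

sublocale ci: cover_instance cells \<Theta> elems locs kap act need sides K wt I spot lattice A g "real S"
proof
  have "1 <= bin_size"
    unfolding bin_size_def using wt_pos[of Top] fin_digits
    by (intro order_trans[OF _ member_le_sum[of Top]]) (auto simp: digits_def target_def)
  then have "1 <= A * bin_weight" using Ag bin_weight_eq by simp
  then show "is_instance I" using \<alpha> by (simp add: is_instance_def I_simps)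
  show "intermediate_layers I = 1" by (simp add: intermediate_layers_def I_simps)
  show "alpha I < 1" using \<alpha> by (simp add: I_simps)
  show "capacities I = [A * bin_size, A * bin_size, A * bin_size]" by (simp add: I_simps bin_weight_eq)
  have "spot ` items = real_place ` (\<lambda>(v, p). site v p) ` slots"
  proof (intro equalityI subsetI)
    fix q assume "q \<in> spot ` items"
    then obtain i where "i \<in> items" "q = spot i" by blast
    then show "q \<in> real_place ` (\<lambda>(v, p). site v p) ` slots" by (elim item_cases) force
  next
    fix q assume "q \<in> real_place ` (\<lambda>(v, p). site v p) ` slots"
    then obtain v p where "(v, p) \<in> slots" "q = real_place (site v p)" by auto
    then show "q \<in> spot ` items" using part_item_in slot_of by (intro image_eqI[of _ _ "part_item v p"]) (simp_all add: spot_def)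
  qed
  then have spots: "insert 0 (spot ` items) = real_place ` set src"
    unfolding set_src by (simp add: real_place_def zero_prod_def)
  have "source_pos I ` sources I = real_place ` set src"
    unfolding set_conv_nth I_simps by (auto simp: I_simps image_iff)
  then show "source_pos I ` sources I = insert 0 (spot ` items)" using spots by simp
  show "inj_on spot items"
  proof (rule inj_onI)
    fix i j assume "i \<in> items" "j \<in> items" "spot i = spot j"
    then show "i = j" using real_place_inj site_eq by (elim item_cases) auto
  qed
  show "spot i ~= 0" if "i \<in> items" for i using that real_place_0 site_nz by (elim item_cases) auto
  show "group_size I (spot i) = A * item_size i" if "i \<in> items" for i
    using that count_site part_size_eq by (elim item_cases) (simp add: group_size_place)
  show "group_size I 0 = g" using group_size_place[of "(0, 0)"] count_zero by (simp add: real_place_def zero_prod_def)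
  show "1 <= norm (p - q)" if pq: "p \<in> insert 0 (spot ` items)" "q \<in> insert 0 (spot ` items)" "p ~= q" for p q
  proof -
    obtain a b a' b' where p: "p = real_place (a, b)" "q = real_place (a', b')"
      using pq(1,2) unfolding spots by (metis imageE surj_pair)
    have "1 <= \<bar>real a - real a'\<bar> \<or> 1 <= \<bar>real b - real b'\<bar>" using pq(3) p by (auto simp: real_place_def)
    then show ?thesis using norm_pair_bounds(1)[of "real a - real a'" "real b - real b'"]
      norm_pair_bounds(2)[of "real b - real b'" "real a - real a'"] p by (auto simp: real_place_def)
  qed
  show "sink_pos I t \<in> insert 0 (lattice ` cells)" if t: "t \<in> sinks I" for t
  proof -
    have "snk ! t \<in> set snk" using t by (simp add: I_simps)
    then have "count_list snk (snk ! t) ~= 0" by (simp add: count_list_0_iff)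
    then have "snk ! t = (0, 0) \<or> (\<exists>v\<in>cells. (S * fst v, S * snd v) = snk ! t)"
      unfolding count_snk using fin(1) by (auto split: if_splits)
    then consider "snk ! t = (0, 0)" | v where "v \<in> cells" "snk ! t = (S * fst v, S * snd v)" by fastforce
    then show ?thesis
    proof cases
      case 1 then show ?thesis using t by (simp add: I_simps real_place_0)
    next
      case (2 v) then have "sink_pos I t = lattice v" using t unfolding home_place by (simp add: I_simps)
      then show ?thesis using 2(1) by blast
    qed
  qed
  show inj: "inj_on lattice cells" using S2 by (auto simp: inj_on_def lattice_def)
  have S0: "S ~= 0" using S2 by simp
  show nz: "lattice v ~= 0" if "v \<in> cells" for v using that S0 by (auto simp: lattice_def zero_prod_def cells_def)
  show "card {t \<in> sinks I. sink_pos I t = lattice v} = card \<Theta>" if v: "v \<in> cells" for v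
  proof -
    have "(\<Sum>u\<in>cells. if (S * fst u, S * snd u) = (S * fst v, S * snd v) then card \<Theta> else 0) =
      (\<Sum>u\<in>cells. if u = v then card \<Theta> else 0)" using S0 by (intro sum.cong) (auto simp: prod_eq_iff)
    moreover have "(S * fst v, S * snd v) ~= (0, 0)" using nz[OF v] by (simp add: lattice_def zero_prod_def)
    ultimately show ?thesis unfolding home_place card_sinks_place count_snk using v fin(1) by (simp only: if_False sum.delta if_True add_0_right)
  qed
  show "card (sources I) <= card {t \<in> sinks I. sink_pos I t = 0}"
    using card_sinks_place[of "(0, 0)"] by (simp add: count_snk I_simps(1) real_place_def zero_prod_def)
  show "\<exists>\<delta>\<ge>1. \<delta> <= real S & acc i ~= {} & (\<forall>u\<in>acc i. norm (spot i - lattice u) = \<delta>) &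
      (\<forall>u\<in>cells - acc i. \<delta> + 1 / 4 <= norm (spot i - lattice u)) & \<delta> + 1 / 4 <= norm (spot i)" if i: "i \<in> items" for i
  proof -
    obtain v p where vp: "(v, p) \<in> slots" "i = part_item v p" "spot i = real_place (site v p)"
      using item_cases[OF i] by blast
    obtain \<delta> where \<delta>: "1 <= \<delta>" "\<delta> <= real S" "acc i ~= {}" "\<forall>u \<in> acc i. norm (spot i - lattice u) = \<delta>"
      "\<forall>u. u \<notin> acc i --> u \<in> insert (0, 0) cells --> \<delta> + 1 / 4 <= norm (spot i - lattice u)"
      using place_distance[OF vp(1)] vp(2,3) by metis
    have "acc i \<subseteq> cells" using i locs by (cases i) (auto simp: items_simps)
    then have "(0, 0) \<notin> acc i" by (auto simp: cells_def)
    then have "\<delta> + 1 / 4 <= norm (spot i - lattice (0, 0))" using \<delta>(5) by blast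
    then have "\<delta> + 1 / 4 <= norm (spot i)" by (simp add: lattice_def flip: zero_prod_def)
    then show ?thesis using \<delta> by blast
  qed
  show "1 <= wt D" for D using wt_pos by simp
  show "1 <= g" "g <= A" by (fact Ag)+
  show "real S * real A powr (alpha I - 1) < split_gap (alpha I)" using gap by (simp add: I_simps)
  show "cells ~= {}" using HW by (simp add: cells_def)
  show "\<Theta> ~= {}" by (fact tiles_ne)
qed

theorem ex_approximation:
  assumes "1 < \<rho>"
  shows "\<exists>vs es. is_approximation \<rho> I (the_layout vs es)"
  using ex_rational_approximation[OF _ _ assms, of \<alpha> "map rat_place src" "map rat_place snk"] ci.valid_ne ci.min_cost_pos
  unfolding I_def by blast

text \<open>The representatives form blocks of equal length, one per column, so a decoder finds the
  source of a given base part in a given column by arithmetic on indices.\<close>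

lemma rep_pos:
  assumes "c \<in> {1..W}" "j < length base_list"
  defines "i \<equiv> (c - 1) * length base_list + j"
  shows "i \<in> sources I" "source_pos I i = spot (part_item (1, c) (base_list ! j))"
proof -
  have c: "c - 1 < W" "1 + (c - 1) = c" using assms(1) by auto
  note n = nth_concat_uniform[of "\<lambda>c. map (site (1, c)) base_list" "length base_list" "c - 1" W j 1, OF _ c(1) assms(2), folded i_def]
  have i: "i < length src" using n(2) by (simp add: source_list_def)
  then show "i \<in> sources I" by (simp add: I_simps)
  have "src ! i = site (1, c) (base_list ! j)"
    using n assms(2) c(2) unfolding source_list_def by (simp add: nth_append)
  moreover have "((1, c), base_list ! j) \<in> slots"
    using assms(1,2) HW base_list(1) nth_mem[OF assms(2)] by (auto simp: slots_def cells_def parts_def)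
  ultimately show "source_pos I i = spot (part_item (1, c) (base_list ! j))"
    using i slot_of by (simp add: I_simps spot_def)
qed

theorem approximation_tiling:
  assumes til: "tiling \<Theta> h0 H W bc tc sel0" and L: "is_approximation \<rho> I L" "\<rho> <= 1 + 1 / real (length src)"
  obtains sel where "tiling \<Theta> h0 H W bc tc sel"
    "\<And>c j k \<theta> t t'. c \<in> {1..W} ==> j < length base_list ==> k < length base_list ==> base_list ! j = PTile \<theta> ==>
       base_list ! k = PCell 0 ==> connects L ((c - 1) * length base_list + j) t ==>
       connects L ((c - 1) * length base_list + k) t' ==> t = t' \<longleftrightarrow> \<theta> = sel (1, c)"
proof -
  have sel0: "selection sel0" using til by (simp add: selection_iff_tiling)
  have "K + 1 <= (3 * card all_parts + 1) * (K + 1)" by simp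
  then have M': "K + 1 <= M" using M by linarith
  have L': "\<rho> <= 1 + 1 / real (card (sources I))" using L(2) by (simp add: I_simps)
  obtain sel where sel: "selection sel" "\<And>v \<theta> s s' t t'. v \<in> cells ==> \<theta> \<in> \<Theta> ==> s \<in> sources I ==> s' \<in> sources I ==>
     source_pos I s = spot (TileItem v \<theta>) ==> source_pos I s' = spot (CellItem v 0) ==> connects L s t ==> connects L s' t' ==>
     (t = t' \<longleftrightarrow> \<theta> = sel v)"
    using ci.approximation_selection[OF sel0 unique[folded digits_def] card_acc M' L(1) L'] by blast
  show ?thesis
  proof (rule that)
    show "tiling \<Theta> h0 H W bc tc sel" using sel(1) by (simp add: selection_iff_tiling)
    fix c j k \<theta> t t'
    assume a: "c \<in> {1..W}" "j < length base_list" "k < length base_list" "base_list ! j = PTile \<theta>" "base_list ! k = PCell 0"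
      "connects L ((c - 1) * length base_list + j) t" "connects L ((c - 1) * length base_list + k) t'"
    have "\<theta> \<in> \<Theta>" using nth_mem[OF a(2)] base_list(1) a(4) by (auto simp: base_parts_def)
    moreover have "(1, c) \<in> cells" using a(1) HW by (simp add: cells_def)
    ultimately show "t = t' \<longleftrightarrow> \<theta> = sel (1, c)"
      using sel(2)[OF _ _ rep_pos(1)[OF a(1,2)] rep_pos(1)[OF a(1,3)]] rep_pos(2)[OF a(1,2)] rep_pos(2)[OF a(1,3)] a by simp
  qed
qed

end

section \<open>Computability: producing the instances, decoding layouts, and the reduction
  itself\<close>

section \<open>Computing the instances\<close>

text \<open>Numbers are computed in unary, since all quantities of the construction, coordinates
  included, are polynomial in the input length.\<close>

definition unary :: "(bool list => nat) => bool" where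
  "unary n \<longleftrightarrow> polytime (\<lambda>x. replicate (n x) True)"

lemma unary_length: "polytime f ==> unary (\<lambda>x. length (f x))"
  unfolding unary_def by (rule polytime_ones)

lemma unary_const: "unary (\<lambda>_. c)"
  unfolding unary_def by (rule polytime_const)

lemma unary_add: "unary m ==> unary n ==> unary (\<lambda>x. m x + n x)"
  unfolding unary_def replicate_add by (rule polytime_append)

lemma unary_mult: "unary m ==> unary n ==> unary (\<lambda>x. m x * n x)"
  unfolding unary_def using polytime_mult[of "\<lambda>x. replicate (m x) True" "\<lambda>x. replicate (n x) True"] by simp

lemma unary_power: "unary n ==> unary (\<lambda>x. n x ^ k)"
  unfolding unary_def using polytime_power[of "\<lambda>x. replicate (n x) True" k] by simp

lemma unary_diff: "unary m ==> unary n ==> unary (\<lambda>x. m x - n x)"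
  unfolding unary_def using polytime_drop[of "\<lambda>x. replicate (n x) True" "\<lambda>x. replicate (m x) True"] by simp

lemma unary_Suc: "unary n ==> unary (\<lambda>x. Suc (n x))"
  using unary_add[OF unary_const[of 1]] by simp

lemma unary_comp: "unary n ==> polytime f ==> unary (\<lambda>x. n (f x))"
  unfolding unary_def using polytime_comp[of "\<lambda>x. replicate (n x) True" f] .

lemmas unary_intros = unary_length unary_const unary_add unary_mult unary_power unary_diff unary_Suc

lemma polytime_unary_nat_bits: "unary n ==> polytime (\<lambda>x. nat_bits (n x))"
  unfolding unary_def using polytime_nat_bits[of "\<lambda>x. replicate (n x) True"] by simp

lemma polytime_unary_drop: "unary n ==> polytime f ==> polytime (\<lambda>x. drop (n x) (f x))"
  unfolding unary_def using polytime_drop[of "\<lambda>x. replicate (n x) True" f] by simp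

lemma polytime_loop:
  assumes "unary n" "polytime (\<lambda>z. F (length (unpair1 z)) (unpair2 z))"
  shows "polytime (\<lambda>x. concat (map (\<lambda>i. F i x) [0..<n x]))"
  using polytime_concat_map[OF assms(1)[unfolded unary_def] assms(2)] by simp

lemma polytime_loop_from_1:
  assumes "unary n" "polytime (\<lambda>z. F (Suc (length (unpair1 z))) (unpair2 z))"
  shows "polytime (\<lambda>x. concat (map (\<lambda>i. F i x) [1..<Suc (n x)]))"
proof -
  have "[1..<Suc m] = map Suc [0..<m]" for m by (simp add: map_Suc_upt)
  then show ?thesis using polytime_loop[of n "\<lambda>i. F (Suc i)"] assms by (simp add: comp_def)
qed

lemma polytime_concat_replicate: "polytime f ==> unary n ==> polytime (\<lambda>x. concat (replicate (n x) (f x)))"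
  using polytime_loop[of n "\<lambda>i x. f x"] polytime_comp[of f unpair2] polytime_unpair2[OF polytime_id]
  by (simp add: map_replicate_const)

text \<open>A selectable function is one whose value a polynomial-time computation can branch on.\<close>

definition selectable :: "(bool list => 'a) => bool" where
  "selectable k \<longleftrightarrow> (\<forall>E. (\<forall>v. polytime (E v)) --> polytime (\<lambda>x. E (k x) x))"

lemma selectableD: "selectable k ==> (\<And>v. polytime (E v)) ==> polytime (\<lambda>x. E (k x) x)"
  unfolding selectable_def by blast

lemma selectable_const: "selectable (\<lambda>_. c)" by (simp add: selectable_def)

lemma selectable_map:
  assumes "selectable k"
  shows "selectable (\<lambda>x. F (k x))"
  unfolding selectable_def
proof (intro allI impI)
  show "polytime (\<lambda>x. E (F (k x)) x)" if "\<forall>v. polytime (E v)" for E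
    using selectableD[OF assms, of "\<lambda>v. E (F v)"] that by simp
qed

lemma selectable_map2:
  fixes F :: "'a => 'b => 'c"
  assumes "selectable k" "selectable k'"
  shows "selectable (\<lambda>x. F (k x) (k' x))"
  unfolding selectable_def
proof (intro allI impI)
  fix E :: "'c => bool list => bool list" assume "\<forall>v. polytime (E v)"
  then have "polytime (\<lambda>x. E (F v (k' x)) x)" for v
    using selectableD[OF assms(2), of "\<lambda>u. E (F v u)"] by simp
  then show "polytime (\<lambda>x. E (F (k x) (k' x)) x)"
    using selectableD[OF assms(1), of "\<lambda>v x. E (F v (k' x)) x"] by simp
qed

lemma selectable_if:
  assumes "selectable b" "selectable k" "selectable k'"
  shows "selectable (\<lambda>x. if b x then k x else k' x)"
  using selectable_map2[OF assms(1) selectable_map2[OF assms(2,3), of Pair], of "\<lambda>b p. if b then fst p else snd p"]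
  unfolding fst_conv snd_conv .

lemma selectable_Pair: "selectable k ==> selectable k' ==> selectable (\<lambda>x. (k x, k' x))"
  by (rule selectable_map2)

lemma selectable_less:
  assumes "unary m" "unary n"
  shows "selectable (\<lambda>x. m x < n x)"
  unfolding selectable_def
proof (intro allI impI)
  fix E :: "bool => bool list => bool list" assume E: "\<forall>v. polytime (E v)"
  have "polytime (\<lambda>x. if drop (m x) (replicate (n x) True) = [] then E False x else E True x)"
    using E assms(2)[unfolded unary_def] by (intro polytime_basic polytime_unary_drop assms(1)) auto
  moreover have "(if drop (m x) (replicate (n x) True) = [] then E False x else E True x) = E (m x < n x) x" for x
    by auto
  ultimately show "polytime (\<lambda>x. E (m x < n x) x)" by simp
qed

lemma selectable_not: "selectable b ==> selectable (\<lambda>x. ~ b x)" by (rule selectable_map)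

lemma selectable_le: "unary m ==> unary n ==> selectable (\<lambda>x. m x <= n x)"
  using selectable_not[OF selectable_less] by (simp add: not_less)

lemma selectable_eq:
  assumes "unary m" "unary n"
  shows "selectable (\<lambda>x. m x = n x)"
  using selectable_map2[OF selectable_le[OF assms] selectable_le[OF assms(2,1)], of "(&)"] by (simp add: eq_iff)

lemma selectable_first_true: "polytime f ==> selectable (\<lambda>x. first_true (f x))"
  unfolding selectable_def
proof (intro allI impI)
  fix E :: "bool => bool list => bool list" assume f: "polytime f" and E: "\<forall>v. polytime (E v)"
  then have "polytime (\<lambda>x. if first_true (f x) then E True x else E False x)" by (intro polytime_basic) auto
  moreover have "(if first_true (f x) then E True x else E False x) = E (first_true (f x)) x" for x by simp
  ultimately show "polytime (\<lambda>x. E (first_true (f x)) x)" by simp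
qed

lemma selectable_odd: "unary n ==> selectable (\<lambda>x. odd (n x))"
proof -
  have "first_true (nat_bits m) = odd m" for m by (cases "m = 0") (simp_all add: nat_bits_0 nat_bits_pos)
  then show "unary n ==> ?thesis" using selectable_first_true[OF polytime_unary_nat_bits] by simp
qed

lemma selectable_disj: "selectable a ==> selectable b ==> selectable (\<lambda>x. a x \<or> b x)" by (rule selectable_map2)

lemmas selectable_intros = selectable_const selectable_if selectable_Pair selectable_less selectable_le
  selectable_eq selectable_odd selectable_disj selectable_first_true

text \<open>Abstracts from the word emitted per place: with the code of the point the list itself is
  produced, with the constant \<open>[True]\<close> its length in unary, which is the number of
  spare sinks.\<close>

definition place_map :: "(nat \<times> nat => bool list) => bool" where
  "place_map \<pi> \<longleftrightarrow> (\<forall>m n. unary m --> unary n --> polytime (\<lambda>x. \<pi> (m x, n x)))"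

lemma place_mapD: "place_map \<pi> ==> unary m ==> unary n ==> polytime (\<lambda>x. \<pi> (m x, n x))"
  unfolding place_map_def by blast

lemma place_map_code: "place_map (\<lambda>q. True # point_code (rat_place q))"
proof -
  have q: "quotient_of (of_nat n) = (int n, 1)" for n
    using quotient_of_int[of "int n"] by (simp add: of_int_def)
  have "int_code (int n) = False # delimited (nat_bits n)" for n by (simp add: int_code_def nat_code_def)
  then have "rat_code (of_nat n) = (False # delimited (nat_bits n)) @ int_code 1" for n
    by (simp add: rat_code_def q)
  then have "True # point_code (rat_place (m, n)) =
    True # ((False # delimited (nat_bits m)) @ int_code 1) @ ((False # delimited (nat_bits n)) @ int_code 1)" for m n
    by (simp add: point_code_def rat_place_def)
  then show ?thesis unfolding place_map_def by (simp only:) (intro allI impI polytime_basic polytime_unary_nat_bits)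
qed

lemma place_map_const: "place_map (\<lambda>_. c)"
  unfolding place_map_def by (simp add: polytime_const)

lemma concat_map_grid_list: "concat (map \<pi> (grid_list H W F)) = grid_list H W (\<lambda>v. concat (map \<pi> (F v)))"
proof -
  have c: "concat (map \<pi> (concat xss)) = concat (map (\<lambda>xs. concat (map \<pi> xs)) xss)" for xss
    by (induction xss) auto
  show ?thesis by (simp add: grid_list_def c comp_def)
qed

lemma polytime_grid_list:
  assumes H: "unary H" and W: "unary W"
    and F: "polytime (\<lambda>z. F (unpair2 (unpair2 z)) (Suc (length (unpair1 (unpair2 z))), Suc (length (unpair1 z))))"
  shows "polytime (\<lambda>x. grid_list (H x) (W x) (F x))"
proof -
  have "polytime (\<lambda>z. concat (map (\<lambda>c. F (unpair2 z) (Suc (length (unpair1 z)), c)) [1..<Suc (W (unpair2 z))]))"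
    using F unary_comp[OF W polytime_unpair2[OF polytime_id]]
    by (rule polytime_loop_from_1[where F = "\<lambda>c z. F (unpair2 z) (Suc (length (unpair1 z)), c)", rotated])
  then show ?thesis unfolding grid_list_def
    by (rule polytime_loop_from_1[OF H, where F = "\<lambda>t x. concat (map (\<lambda>c. F x (t, c)) [1..<Suc (W x)])"])
qed

context gadget
begin

lemma polytime_place:
  assumes "place_map \<pi>" "unary t" "unary c"
  shows "polytime (\<lambda>z. \<pi> (place kd (t z, c z) p))"
  unfolding place_def by (simp, intro place_mapD[OF assms(1)] unary_intros assms)

text \<open>For a fixed kind the parts of a cell and their multiplicities are constants, so its
  sources form a fixed concatenation with computed coordinates. Selectability supplies the kind of
  the current cell, and two nested loops run over the grid.\<close>

lemma polytime_source_list: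
  assumes H: "unary H" and W: "unary W" and \<pi>: "place_map \<pi>"
    and \<kappa>: "\<And>t c y. unary t ==> unary c ==> polytime y ==> selectable (\<lambda>z. \<kappa> (y z) (t z, c z))"
  shows "polytime (\<lambda>x. concat (map \<pi> (source_list A g (H x) (W x) (\<kappa> x))))"
proof -
  have u: "unary (\<lambda>z. Suc (length (unpair1 z)))" "unary (\<lambda>z. Suc (length (unpair1 (unpair2 z))))"
    by (intro unary_intros polytime_basic)+
  have "polytime (\<lambda>z. concat (map (\<lambda>p. \<pi> (place kd (1, Suc (length (unpair1 z))) p)) base_list))" for kd
    by (intro polytime_concat_list polytime_place[OF \<pi>, where t = "\<lambda>_. 1"] unary_const u)
  from selectableD[OF \<kappa>[OF unary_const[of 1] u(1) polytime_unpair2[OF polytime_id]] this]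
  have "polytime (\<lambda>z. concat (map (\<lambda>p. \<pi> (place (\<kappa> (unpair2 z) (1, Suc (length (unpair1 z)))) (1, Suc (length (unpair1 z))) p)) base_list))" .
  from polytime_loop_from_1[OF W, where F = "\<lambda>c x. concat (map (\<lambda>p. \<pi> (place (\<kappa> x (1, c)) (1, c) p)) base_list)", OF this]
  have 1: "polytime (\<lambda>x. concat (map (\<lambda>c. concat (map (\<lambda>p. \<pi> (place (\<kappa> x (1, c)) (1, c) p)) base_list)) [1..<Suc (W x)]))" .
  have c: "concat (map \<pi> (concat xss)) = concat (map (\<lambda>xs. concat (map \<pi> xs)) xss)" for xss
    by (induction xss) auto
  have cs: "concat (map \<pi> (cell_sources A kd v)) =
      concat (map (\<lambda>p. concat (replicate (copies A kd p) (\<pi> (place kd v p)))) (part_list kd))" for kd v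
    unfolding cell_sources_def c by (simp add: comp_def)
  have "polytime (\<lambda>z. concat (map \<pi> (cell_sources A kd (Suc (length (unpair1 (unpair2 z))), Suc (length (unpair1 z))))))" for kd
    unfolding cs by (intro polytime_concat_list polytime_concat_replicate unary_const polytime_place[OF \<pi>] u)
  from selectableD[OF \<kappa>[OF u(2,1) polytime_unpair2[OF polytime_unpair2[OF polytime_id]]], of "\<lambda>kd z.
      concat (map \<pi> (cell_sources A kd (Suc (length (unpair1 (unpair2 z))), Suc (length (unpair1 z)))))", OF this]
  have 2: "polytime (\<lambda>x. grid_list (H x) (W x) (\<lambda>v. concat (map \<pi> (cell_sources A (\<kappa> x v) v))))"
    by (rule polytime_grid_list[OF H W, where F = "\<lambda>x v. concat (map \<pi> (cell_sources A (\<kappa> x v) v))"])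
  have "concat (map \<pi> (source_list A g (H x) (W x) (\<kappa> x))) =
      concat (map (\<lambda>c. concat (map (\<lambda>p. \<pi> (place (\<kappa> x (1, c)) (1, c) p)) base_list)) [1..<Suc (W x)]) @
      grid_list (H x) (W x) (\<lambda>v. concat (map \<pi> (cell_sources A (\<kappa> x v) v))) @ concat (replicate g (\<pi> (0, 0)))" for x
    unfolding source_list_def map_append concat_append concat_map_grid_list c by (simp add: comp_def)
  then show ?thesis using 1 2 by (simp only:) (intro polytime_basic)
qed

lemma polytime_sink_list:
  assumes "unary n" "unary H" "unary W" and \<pi>: "place_map \<pi>"
  shows "polytime (\<lambda>x. concat (map \<pi> (sink_list (n x) (H x) (W x))))"
proof -
  have "polytime (\<lambda>z. \<pi> (S * Suc (length (unpair1 (unpair2 z))), S * Suc (length (unpair1 z))))"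
    by (intro place_mapD[OF \<pi>] unary_intros polytime_basic)
  then have "polytime (\<lambda>x. grid_list (H x) (W x) (\<lambda>v. concat (replicate (card \<Theta>) (\<pi> (S * fst v, S * snd v)))))"
    by (intro polytime_grid_list assms) (simp add: polytime_concat_replicate unary_const)
  moreover have "polytime (\<lambda>x. concat (replicate (n x) (\<pi> (0, 0))))"
    by (intro polytime_concat_replicate polytime_const assms)
  ultimately show ?thesis by (simp add: sink_list_def concat_map_grid_list polytime_append)
qed

end

context machine
begin

text \<open>Replaces integers and indexing by comparisons, truncated subtraction and
  \<open>drop\<close>, for which computability in unary is available.\<close>

lemma input_code_nat:
  "input_code X p (int c - int T - 2) = (if c < T + 2 then 0 else if c < T + 2 + length X then
     (if first_true (drop (c - (T + 2)) X) then 2 else 1) + (if c = T + 2 then 2 else 0)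
     else if c < T + 2 + length X + p then 5 else 0)"
proof (cases "c < T + 2")
  case True then show ?thesis by (simp add: input_code_def)
next
  case False
  define i where "i = c - (T + 2)"
  then have c: "int c - int T - 2 = int i" "c = T + 2 + i" using False by auto
  have "first_true (drop i X) = X ! i" if "i < length X"
    using that by (simp add: first_true_def hd_drop_conv_nth)
  then show ?thesis unfolding c(1) by (auto simp: input_code_def bit_sym_def c(2))
qed

lemma selectable_bottom_colour:
  assumes "polytime X" "unary p" "unary T" "unary W" "unary c"
  shows "selectable (\<lambda>x. bottom_colour (X x) (p x) (T x) (W x) (c x))"
  unfolding bottom_colour_def input_code_nat
  by (intro selectable_intros selectable_map[where F = VInput] selectable_map2[where F = "(+)"] unary_intros
      polytime_unary_drop assms)

lemma selectable_top_colour: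
  assumes "unary T" "unary W" "unary c"
  shows "selectable (\<lambda>x. top_colour (T x) (W x) (c x))"
  unfolding top_colour_def by (intro selectable_intros selectable_map[where F = VTest] unary_intros assms)

end

section \<open>Decoding layouts\<close>

lemma length_code_drop: "length (code_drop q x) <= length x"
proof -
  have "length (transduce (\<lambda>q b. (code_next q b, if q = 4 then [b] else [])) (\<lambda>_. []) x q) <= length x"
    by (induction x arbitrary: q) (auto intro: le_SucI)
  then show ?thesis by (simp add: code_drop_def)
qed

lemma length_funpow_le: "(\<And>x. length (f x) <= length (x :: 'a list)) ==> length ((f ^^ i) x) <= length x" for f :: "'a list => 'a list"
proof (induction i)
  case (Suc i)
  have "length ((f ^^ Suc i) x) <= length ((f ^^ i) x)" using Suc.prems by simp
  then show ?case using Suc.IH[OF Suc.prems] by linarith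
qed simp

lemma funpow_fixpoint: "f x = x ==> (f ^^ n) x = x" for f :: "'a => 'a" by (induction n) auto

text \<open>Removes one entry of the vertex list: the code of the vertex and four integers, the
  numerators and denominators of its two coordinates.\<close>

definition vertex_step :: "bool list => bool list" where
  "vertex_step r = (if first_true r
     then code_drop 1 (code_drop 1 (code_drop 1 (code_drop 1 (code_drop 0 (tl r))))) else r)"

text \<open>Each entry has at least one bit, so \<open>length y\<close> rounds pass all of them; the
  end marker stops the iteration and is removed by \<open>tl\<close>.\<close>

definition edges_string :: "bool list => bool list" where
  "edges_string y = tl ((vertex_step ^^ length y) y)"

definition edge_step :: "bool list => bool list => bool list" where
  "edge_step k r = (if first_true r then if code_take 0 (tl r) = k then r else code_drop 0 (code_drop 0 (tl r)) else r)"

text \<open>The iteration discards edges and stalls at the first one whose child has code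
  \<open>k\<close>; in a single-valued edge relation that edge names the parent.\<close>

definition parent_code :: "bool list => bool list => bool list" where
  "parent_code k r = code_take 0 (code_drop 0 (tl ((edge_step k ^^ length r) r)))"

lemma length_steps: "length (vertex_step r) <= length r" "length (edge_step k r) <= length r"
  using length_code_drop order_trans[OF _ diff_le_self[of "length r" 1]]
  by (auto simp: vertex_step_def edge_step_def intro!: order_trans[OF length_code_drop])

lemma polytime_edges_string: "polytime f ==> polytime (\<lambda>x. edges_string (f x))"
proof -
  have "polytime vertex_step"
    unfolding vertex_step_def[abs_def] by (intro polytime_basic polytime_code_drop) simp_all
  then have "polytime (\<lambda>y. (vertex_step ^^ length y) y)"
    by (rule polytime_iterate[OF polytime_id polytime_id _ poly_bounded_id]) (rule length_funpow_le[OF length_steps(1)])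
  from polytime_comp[OF polytime_tl[OF this]] show "polytime f ==> ?thesis" unfolding edges_string_def .
qed

lemma polytime_parent_code:
  assumes "polytime k" "polytime r"
  shows "polytime (\<lambda>x. parent_code (k x) (r x))"
proof -
  let ?step = "\<lambda>z. pair_code (unpair1 z) (if first_true (unpair2 z) then if code_take 0 (tl (unpair2 z)) = unpair1 z
      then unpair2 z else code_drop 0 (code_drop 0 (tl (unpair2 z))) else unpair2 z)"
  have it: "(?step ^^ i) (pair_code k r) = pair_code k ((edge_step k ^^ i) r)" for i k r
    by (induction i) (simp_all add: edge_step_def)
  have step: "polytime ?step" by (intro polytime_basic polytime_if_eq polytime_code_take polytime_code_drop) simp_all
  have v: "polytime (\<lambda>x. pair_code (k x) (r x))" by (intro polytime_basic assms)
  obtain b where b: "poly_bounded b" "\<And>x. length (pair_code (k x) (r x)) <= b (length x)"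
    using polytime_length_bound[OF v] by blast
  have "polytime (\<lambda>x. (?step ^^ length (r x)) (pair_code (k x) (r x)))"
  proof (rule polytime_iterate[OF assms(2) v step b(1)])
    show "length ((?step ^^ i) (pair_code (k x) (r x))) <= b (length x)" for x i
      using b(2)[of x] length_funpow_le[OF length_steps(2)[of "k x"], of i "r x"] unfolding it length_pair_code by linarith
  qed
  then have "polytime (\<lambda>x. code_take 0 (code_drop 0 (tl (unpair2 ((?step ^^ length (r x)) (pair_code (k x) (r x)))))))"
    by (intro polytime_basic polytime_code_take polytime_code_drop) simp_all
  then show ?thesis by (simp add: it parent_code_def)
qed

lemma list_code_simps: "list_code code [] = [False]" "list_code code (x # xs) = True # code x @ list_code code xs"
  by (simp_all add: list_code_def)

lemma length_list_code: "length xs < length (list_code code xs)" by (induction xs) (auto simp: list_code_simps)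

abbreviation "edge_list_code \<equiv> list_code (\<lambda>(u, v). vertex_code u @ vertex_code v)"

lemma edges_string_layout: "edges_string (layout_code vs es) = edge_list_code es"
proof -
  let ?c = "\<lambda>(v, p). vertex_code v @ point_code p"
  have step: "vertex_step (list_code ?c (v # vs) @ u) = list_code ?c vs @ u" for v vs u
    by (cases v) (simp add: list_code_simps vertex_step_def point_code_def rat_code_def code_vertex
        code_int[simplified])
  have "(vertex_step ^^ n) (list_code ?c vs @ u) = False # u" if "length vs <= n" for n u
    using that
  proof (induction vs arbitrary: n)
    case Nil then show ?case by (simp add: list_code_simps funpow_fixpoint vertex_step_def)
  next
    case (Cons v vs)
    then obtain m where "n = Suc m" "length vs <= m" by (cases n) auto
    then show ?case using Cons.IH step by (simp only: funpow_Suc_right comp_def)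
  qed
  moreover have "length vs <= length (layout_code vs es)"
    using length_list_code[of vs ?c] by (simp add: layout_code_def)
  ultimately show ?thesis by (simp add: edges_string_def layout_code_def)
qed

lemma vertex_code_inj: "vertex_code u = vertex_code v \<longleftrightarrow> u = v"
  using prefix_freeD[OF vertex_code_prefix_free, of u "[]" v "[]"] by auto

lemma parent_code_edges:
  assumes "(u, v) \<in> set es" "single_valued (set es)"
  shows "parent_code (vertex_code u) (edge_list_code es) = vertex_code v"
proof -
  let ?s = "edge_step (vertex_code u)"
  have "\<exists>es'. (?s ^^ n) (edge_list_code es) = edge_list_code ((u, v) # es')" if "length es <= n" for n
    using that assms
  proof (induction es arbitrary: n)
    case (Cons e es)
    obtain a b where e: "e = (a, b)" by fastforce
    show ?case
    proof (cases "a = u")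
      case True then have "b = v" using Cons.prems(2,3) e by (auto simp: single_valued_def)
      moreover have "?s (edge_list_code ((u, v) # es)) = edge_list_code ((u, v) # es)"
        by (simp add: edge_step_def list_code_simps code_vertex)
      ultimately show ?thesis using True e funpow_fixpoint[of ?s] by blast
    next
      case False then have "?s (edge_list_code (e # es)) = edge_list_code es"
        by (simp add: e edge_step_def list_code_simps code_vertex vertex_code_inj)
      moreover obtain m where "n = Suc m" "length es <= m" using Cons.prems(1) by (cases n) auto
      moreover have "(u, v) \<in> set es" "single_valued (set es)"
        using Cons.prems(2,3) False e by (auto simp: single_valued_def)
      ultimately show ?thesis using Cons.IH[of m] by (simp only: funpow_Suc_right comp_def)
    qed
  qed simp
  from this[OF less_imp_le[OF length_list_code[of es "\<lambda>(u, v). vertex_code u @ vertex_code v"]]] show ?thesis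
    by (auto simp: parent_code_def list_code_simps code_vertex)
qed

text \<open>Codes of Steiner vertices are those starting with \<open>True\<close>.\<close>

definition root_code :: "nat => bool list => bool list" where
  "root_code s r = (let k = parent_code (vertex_code (Source s)) r in if first_true k then parent_code k r else k)"

lemma polytime_root_code:
  assumes "unary s" "polytime r"
  shows "polytime (\<lambda>x. root_code (s x) (r x))"
  unfolding root_code_def Let_def vertex_code.simps nat_code_def
  by (simp, intro polytime_basic polytime_parent_code polytime_unary_nat_bits assms)

lemma root_code_connects:
  assumes "connects (the_layout vs es) s t" "single_valued (set es)"
  shows "root_code s (edge_list_code es) = vertex_code (Sink t)"
proof -
  note p = parent_code_edges[OF _ assms(2)]
  consider "(Source s, Sink t) \<in> set es" | z where "(Source s, Steiner z) \<in> set es" "(Steiner z, Sink t) \<in> set es"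
    using assms(1) by (auto simp: connects_def the_layout_def)
  then show ?thesis
  proof cases
    case 1 then show ?thesis unfolding root_code_def p[OF 1] by simp
  next
    case 2 then show ?thesis unfolding root_code_def p[OF 2(1)] Let_def p[OF 2(2)] by simp
  qed
qed

section \<open>The reduction\<close>

lemma tm_output_unique:
  assumes "tm_output c y" "tm_output c y'"
  shows "y = y'"
proof -
  have le: "length a <= length b" if "tm_output c a" "tm_output c b" for a b
  proof (rule ccontr)
    assume "~ length a <= length b"
    then show False using that by (auto simp: tm_output_def bit_sym_def split: if_splits)
  qed
  have "y ! i = y' ! i" if "i < length y" for i
  proof -
    have "bit_sym (y ! i) = bit_sym (y' ! i)" using that assms le[OF assms] by (auto simp: tm_output_def)
    then show ?thesis by (simp add: bit_sym_def split: if_splits)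
  qed
  then show ?thesis using le[OF assms] le[OF assms(2,1)] by (intro nth_equalityI) auto
qed

lemma concat_map_single:
  assumes "j < m" "\<And>i. i < m ==> i ~= j ==> F i = []"
  shows "concat (map F [0..<m]) = F j"
  using assms
proof (induction m)
  case (Suc m) show ?case
  proof (cases "j = m")
    case True then have "concat (map F [0..<m]) = []" using Suc.prems(2) by (auto simp: concat_eq_Nil_conv)
    then show ?thesis using True by simp
  next
    case False then show ?thesis using Suc by simp
  qed
qed simp

context machine
begin

lemma machine_tiles_ne: "machine_tiles ~= {}"
proof -
  have "(HEdge, HEdge, VEdge, VEdge) \<in> machine_tiles" by (simp add: machine_tiles_def side_tiles_def)
  then show ?thesis by blast
qed

lemma HEdge_in: "HEdge \<in> hcols" by (simp add: hcols_def)

lemma bottom_colour_in: "bottom_colour X p T W c \<in> vcols"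
  by (auto simp: bottom_colour_def input_code_def vcols_def bit_sym_def)

lemma top_colour_in: "top_colour T W c \<in> vcols" by (auto simp: top_colour_def vcols_def)

end

locale reduction = machine M + scaled_gadget machine_tiles hcols vcols HEdge wt S num A g m \<alpha>
  for M wt S num A g m \<alpha> +
  fixes fV :: "bool list => bool list" and e k :: nat
  assumes out: "\<And>z. tm_output ((tm_step M ^^ (length z ^ e + e)) (tm_init M z)) (fV z)"
begin

definition "plen (x :: bool list) = length x ^ k + k"
text \<open>The clock of the verifier for a pair with the longest admissible witness. On shorter
  words the machine has halted earlier and stands still, so one height serves all witnesses.\<close>

definition "time (x :: bool list) = (2 * length x + 1 + plen x) ^ e + e"
definition "height x = time x + 2"
definition "width x = 2 * time x + length (delimited x) + plen x + 3"

definition kind_at :: "bool list => nat \<times> nat => vcol kind" where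
  "kind_at x v = (odd (fst v), odd (snd v), fst v = 1, fst v = height x, snd v = 1, snd v = width x,
     bottom_colour (delimited x) (plen x) (time x) (width x) (snd v), top_colour (time x) (width x) (snd v))"

definition "sources_at x = source_list A g (height x) (width x) (kind_at x)"
definition "sinks_at x = sink_list (length (sources_at x)) (height x) (width x)"

definition instance_string :: "bool list => bool list" where
  "instance_string x = instance_code (map rat_place (sources_at x)) (map rat_place (sinks_at x))
     [A * bin_weight, A * bin_weight, A * bin_weight]"

lemma unary_plen: "unary plen" and unary_time: "unary time" and unary_height: "unary height" and unary_width: "unary width"
  unfolding width_def[abs_def] height_def[abs_def] time_def[abs_def] plen_def[abs_def] by (intro unary_intros polytime_basic)+

lemma polytime_sources: "place_map \<pi> ==> polytime (\<lambda>x. concat (map \<pi> (sources_at x)))"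
  unfolding sources_at_def
proof (rule polytime_source_list[OF unary_height unary_width])
  show "selectable (\<lambda>z. kind_at (y z) (t z, c z))" if "unary t" "unary c" "polytime y" for t c y
    unfolding kind_at_def fst_conv snd_conv
    by (intro selectable_intros selectable_bottom_colour selectable_top_colour unary_intros polytime_basic that
        unary_comp[OF unary_plen] unary_comp[OF unary_time] unary_comp[OF unary_height] unary_comp[OF unary_width])
qed

lemma polytime_instance_string: "polytime instance_string"
proof -
  have "concat (map (\<lambda>_. [True]) xs) = replicate (length xs) True" for xs :: "(nat \<times> nat) list" by (induction xs) auto
  then have n: "unary (\<lambda>x. length (sources_at x))"
    using polytime_sources[OF place_map_const[of "[True]"]] by (simp add: unary_def)
  have "instance_string x = concat (map (\<lambda>q. True # point_code (rat_place q)) (sources_at x)) @ [False] @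
      concat (map (\<lambda>q. True # point_code (rat_place q)) (sinks_at x)) @ [False] @
      list_code nat_code [A * bin_weight, A * bin_weight, A * bin_weight]" for x
    by (simp add: instance_string_def instance_code_def list_code_def comp_def)
  moreover have "polytime (\<lambda>x. concat (map (\<lambda>q. True # point_code (rat_place q)) (sources_at x)) @ [False] @
      concat (map (\<lambda>q. True # point_code (rat_place q)) (sinks_at x)) @ [False] @
      list_code nat_code [A * bin_weight, A * bin_weight, A * bin_weight])"
    unfolding sinks_at_def
    by (intro polytime_append polytime_const polytime_sources polytime_sink_list place_map_code n unary_height unary_width)
  ultimately show ?thesis by (metis (no_types, lifting) ext)
qed

lemma hard: "hard_instance machine_tiles hcols vcols HEdge wt S num A g m \<alpha> (height x) (width x)
    (bottom_colour (delimited x) (plen x) (time x) (width x)) (top_colour (time x) (width x))"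
  by unfold_locales (use finite_Hs finite_Vs sub h0_in ne bottom_colour_in top_colour_in in \<open>auto simp: height_def width_def\<close>)

lemma output_at:
  assumes "length w <= plen x"
  shows "tm_output ((tm_step M ^^ time x) (tm_init M (delimited x @ w))) y \<longleftrightarrow> y = fV (pair_code x w)"
proof -
  let ?z = "delimited x @ w"
  have "length ?z <= 2 * length x + 1 + plen x" using assms by (simp add: length_delimited)
  define N where "N = length ?z ^ e + e"
  have o: "tm_output ((tm_step M ^^ N) (tm_init M ?z)) (fV ?z)" unfolding N_def by (rule out)
  have "N <= time x"
    unfolding N_def time_def using \<open>length ?z <= _\<close> by (intro add_right_mono power_mono) auto
  then obtain d where "time x = d + N" by (metis add.commute le_Suc_ex)
  then have "(tm_step M ^^ time x) (tm_init M ?z) = (tm_step M ^^ d) ((tm_step M ^^ N) (tm_init M ?z))"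
    by (simp add: funpow_add)
  also have "\<dots> = (tm_step M ^^ N) (tm_init M ?z)" using o by (intro tm_steps_halted) (simp add: tm_output_def)
  finally have "tm_output ((tm_step M ^^ time x) (tm_init M ?z)) (fV (pair_code x w))"
    using o by (simp add: pair_code_def)
  then show ?thesis using tm_output_unique by blast
qed

definition "selector = (SOME j. j < length base_list & base_list ! j = PCell 0)"

lemma selector: "selector < length base_list" "base_list ! selector = PCell 0"
proof -
  have "0 < card machine_tiles" using ne finite_Theta by (simp add: card_gt_0_iff)
  then have "PCell 0 \<in> set base_list" unfolding base_list(1) by (simp add: base_parts_def)
  then have "\<exists>j. j < length base_list & base_list ! j = PCell 0" by (simp add: in_set_conv_nth)
  from someI_ex[OF this] show "selector < length base_list" "base_list ! selector = PCell 0"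
    by (simp_all add: selector_def)
qed

definition part_bit :: "(hcol, vcol) part => bool list" where
  "part_bit p = (case p of PTile \<theta> => witness_bit \<theta> | _ => [])"

text \<open>The selected tile of cell \<open>(1, c + 1)\<close> is the one whose item shares its sink with the cell item 0.\<close>

definition column_bit :: "nat => bool list => bool list" where
  "column_bit c r = concat (map (\<lambda>j. if root_code (c * length base_list + j) r =
     root_code (c * length base_list + selector) r then part_bit (base_list ! j) else []) [0..<length base_list])"

text \<open>The witness cell \<open>i\<close> is in column
  \<open>time x + 2 + length (delimited x) + i\<close> of the tiling, whose columns start at 1,
  whereas \<open>column_bit\<close> counts from 0.\<close>

definition witness :: "bool list => bool list => bool list" where
  "witness x r = concat (map (\<lambda>i. column_bit (time x + 1 + length (delimited x) + i) r) [0..<plen x])"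

text \<open>Soundness holds for any word \<open>y\<close>: the decoded word is accepted only after
  the verifier confirms it. The length test is part of this, since a bad layout may yield more bits
  than a witness can have.\<close>

definition answer :: "bool list => bool list" where
  "answer z = (if length (witness (unpair1 z) (edges_string (unpair2 z))) <= plen (unpair1 z)
     then fV (pair_code (unpair1 z) (witness (unpair1 z) (edges_string (unpair2 z)))) else [])"

lemma polytime_fV: "polytime fV"
  unfolding polytime_def using wf out by blast

lemma polytime_answer: "polytime answer"
proof -
  have col: "polytime (\<lambda>z. column_bit (c z) (r z))" if "unary c" "polytime r" for c r
    unfolding column_bit_def
    by (intro polytime_concat_list polytime_if_eq polytime_root_code unary_intros polytime_basic that)
  let ?w = "\<lambda>z. witness (unpair1 z) (edges_string (unpair2 z))"
  have w: "polytime ?w"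
    unfolding witness_def
    by (rule polytime_loop[where F = "\<lambda>i z. column_bit (time (unpair1 z) + 1 + length (delimited (unpair1 z)) + i) (edges_string (unpair2 z))"])
      (intro col unary_intros polytime_basic polytime_edges_string unary_comp[OF unary_plen] unary_comp[OF unary_time])+
  have "selectable (\<lambda>z. length (?w z) <= plen (unpair1 z))"
    by (intro selectable_le unary_intros w unary_comp[OF unary_plen] polytime_basic)
  moreover have "polytime (\<lambda>z. if b then fV (pair_code (unpair1 z) (?w z)) else [])" for b
    using polytime_comp[OF polytime_fV] w by (cases b) (simp_all add: polytime_basic)
  ultimately show ?thesis unfolding answer_def[abs_def] by (rule selectableD)
qed

context
  fixes x :: "bool list"
begin

interpretation hi: hard_instance machine_tiles hcols vcols HEdge wt S num A g m \<alpha> "height x" "width x"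
    "bottom_colour (delimited x) (plen x) (time x) (width x)" "top_colour (time x) (width x)" by (rule hard)

lemma kd_eq: "hi.kd = kind_at x" by (rule ext) (simp add: hi.kd_def kind_at_def)

lemma src_eq: "hi.src = sources_at x" "hi.snk = sinks_at x" by (simp_all add: sources_at_def sinks_at_def kd_eq)

lemma I_eq: "hi.I = the_instance \<alpha> (map rat_place (sources_at x)) (map rat_place (sinks_at x))
    [A * bin_weight, A * bin_weight, A * bin_weight]" by (simp add: hi.I_def src_eq sinks_at_def)

lemma card_I: "card (sources hi.I) = length (sources_at x)" by (simp add: hi.I_simps src_eq)

lemma sources_pos: "0 < length (sources_at x)"
  using Ag by (simp add: sources_at_def source_list_def)

lemma instance_in_Domain:
  assumes "1 < \<rho> (length (sources_at x))"
  shows "instance_string x \<in> Domain (flamecast_approx \<alpha> (has_min_group_size g) \<rho>)"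
proof -
  obtain vs es where "is_approximation (\<rho> (card (sources hi.I))) hi.I (the_layout vs es)"
    using hi.ex_approximation[OF assms] unfolding card_I by blast
  then have "(instance_string x, layout_code vs es) \<in> flamecast_approx \<alpha> (has_min_group_size g) \<rho>"
    unfolding flamecast_approx_def instance_string_def
    using hi.ci.inst hi.ci.one hi.ci.min_group_size unfolding I_eq
    by (intro CollectI exI conjI) (rule refl, assumption+)
  then show ?thesis by blast
qed

text \<open>The given witness only shows that some tiling, hence a perfect packing, exists. The
  tiling recovered from the approximate layout may be another one, and the decoded word is then a
  different but equally valid witness.\<close>

lemma answer_complete:
  assumes app: "(instance_string x, y) \<in> flamecast_approx \<alpha> (has_min_group_size g) \<rho>"
    and \<rho>: "\<rho> (length (sources_at x)) <= 1 + 1 / real (length (sources_at x))"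
    and w: "length w <= plen x" "fV (pair_code x w) = [True]"
  shows "answer (pair_code x y) = [True]"
proof -
  obtain ss ts cs vs es where eq: "instance_string x = instance_code ss ts cs" and y: "y = layout_code vs es"
    and a: "is_approximation (\<rho> (card (sources (the_instance \<alpha> ss ts cs)))) (the_instance \<alpha> ss ts cs) (the_layout vs es)"
    using app unfolding flamecast_approx_def by blast
  have "the_instance \<alpha> ss ts cs = hi.I" using instance_code_inj[OF eq[unfolded instance_string_def]] I_eq by simp
  with a card_I have a: "is_approximation (\<rho> (length (sources_at x))) hi.I (the_layout vs es)" by simp
  interpret two_level hi.I "the_layout vs es"
    using hi.ci.inst hi.ci.one a by unfold_locales (auto simp: is_approximation_def)
  have sv: "single_valued (set es)" unfolding single_valued_def using sv by (auto simp: the_layout_def)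
  have X: "delimited x ~= []" by (simp add: delimited_def)
  obtain sel0 where "tiling machine_tiles HEdge (time x + 2) (width x)
      (bottom_colour (delimited x) (plen x) (time x) (width x)) (top_colour (time x) (width x)) sel0"
    using run_tiling[OF width_def X w(1)] output_at[OF w(1)] w(2) by metis
  then obtain sel where sel: "tiling machine_tiles HEdge (time x + 2) (width x)
      (bottom_colour (delimited x) (plen x) (time x) (width x)) (top_colour (time x) (width x)) sel"
    and match: "\<And>c j k \<theta> t t'. c \<in> {1..width x} ==> j < length base_list ==> k < length base_list ==> base_list ! j = PTile \<theta> ==>
       base_list ! k = PCell 0 ==> connects (the_layout vs es) ((c - 1) * length base_list + j) t ==>
       connects (the_layout vs es) ((c - 1) * length base_list + k) t' ==> t = t' \<longleftrightarrow> \<theta> = sel (1, c)"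
    using hi.approximation_tiling[OF _ a] \<rho> unfolding height_def[symmetric] src_eq by blast
  have root: "\<exists>t. connects (the_layout vs es) (c * length base_list + j) t &
      root_code (c * length base_list + j) (edge_list_code es) = vertex_code (Sink t)"
    if "c < width x" "j < length base_list" for c j
  proof -
    have "c * length base_list + j \<in> sources hi.I" using hi.rep_pos(1)[of "Suc c" j] that by simp
    then show ?thesis using ex_connects root_code_connects[OF _ sv] by blast
  qed
  have bit: "column_bit c (edge_list_code es) = witness_bit (sel (1, Suc c))" if c: "c < width x" for c
  proof -
    have r: "root_code (c * length base_list + j) (edge_list_code es) = root_code (c * length base_list + selector) (edge_list_code es)
        \<longleftrightarrow> \<theta> = sel (1, Suc c)" if j: "j < length base_list" "base_list ! j = PTile \<theta>" for j \<theta>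
    proof -
      obtain t t' where t: "connects (the_layout vs es) (c * length base_list + j) t"
          "root_code (c * length base_list + j) (edge_list_code es) = vertex_code (Sink t)"
          "connects (the_layout vs es) (c * length base_list + selector) t'"
          "root_code (c * length base_list + selector) (edge_list_code es) = vertex_code (Sink t')"
        using root[OF c j(1)] root[OF c selector(1)] by blast
      then show ?thesis using match[of "Suc c" j selector \<theta> t t'] c j selector by (simp add: vertex_code_inj del: vertex_code.simps)
    qed
    have "sel (1, Suc c) \<in> machine_tiles" using sel c by (auto simp: tiling_def)
    then have "PTile (sel (1, Suc c)) \<in> set base_list" unfolding base_list(1) by (simp add: base_parts_def)
    then obtain j where j: "j < length base_list" "base_list ! j = PTile (sel (1, Suc c))" by (auto simp: in_set_conv_nth)
    have "column_bit c (edge_list_code es) = (if root_code (c * length base_list + j) (edge_list_code es) =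
     root_code (c * length base_list + selector) (edge_list_code es) then part_bit (base_list ! j) else [])"
      unfolding column_bit_def
    proof (rule concat_map_single[OF j(1)])
      fix i assume i: "i < length base_list" "i ~= j"
      then have ne: "base_list ! i ~= PTile (sel (1, Suc c))" using j base_list(2) by (metis nth_eq_iff_index_eq)
      show "(if root_code (c * length base_list + i) (edge_list_code es) =
          root_code (c * length base_list + selector) (edge_list_code es) then part_bit (base_list ! i) else []) = []"
        using r[OF i(1)] ne by (cases "base_list ! i") (auto simp: part_bit_def)
    qed
    then show ?thesis using r[OF j] j(2) by (simp add: part_bit_def)
  qed
  have "witness x (edge_list_code es) = concat (map (\<lambda>i. witness_bit (sel (1, time x + 2 + length (delimited x) + i))) [0..<plen x])"
    unfolding witness_def using bit by (intro arg_cong[of _ _ concat] map_cong) (auto simp: width_def)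
  note w' = tiling_run[OF width_def X sel, folded this]
  from w' have "fV (pair_code x (witness x (edge_list_code es))) = [True]" using output_at[OF w'(1)] by simp
  then show ?thesis using w'(1) by (simp add: answer_def y edges_string_layout)
qed

end

lemma answer_sound: "answer (pair_code x y) = [True] ==> \<exists>w. length w <= plen x & fV (pair_code x w) = [True]"
  by (auto simp: answer_def split: if_splits)

end

text \<open>The order of choices avoids circularity: \<open>m\<close> depends on the tiles and
  colours alone, the weights on \<open>m\<close>, the spacing on the number of parts, and finally
  \<open>A\<close> on the spacing. A suitable \<open>A\<close> exists because
  \<open>real A powr (\<alpha> - 1)\<close> tends to 0, which uses
  \<open>\<alpha> < 1\<close>.\<close>

lemma (in machine) ex_constants:
  assumes \<alpha>: "0 <= \<alpha>" "\<alpha> < 1" and g: "1 <= g"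
  shows "\<exists>wt S num A m. scaled_gadget machine_tiles hcols vcols HEdge wt S num A g m \<alpha>"
proof -
  have gad: "gadget machine_tiles hcols vcols HEdge wt S" if "\<And>D. 1 <= wt D" "even S" "2 <= S" for wt S
    using that finite_hcols finite_vcols machine_tiles_in HEdge_in machine_tiles_ne by unfold_locales auto
  \<comment> \<open>A grid with a single cell, introduced only for the finiteness of
    \<open>sides\<close>, which is independent of the grid.\<close>
  interpret w: wang machine_tiles hcols vcols HEdge 1 1 "\<lambda>_. VEdge" "\<lambda>_. VEdge"
    by unfold_locales (use finite_hcols finite_vcols machine_tiles_in HEdge_in machine_tiles_ne in \<open>auto simp: vcols_def\<close>)
  let ?D = "{Top, Flag, Cell} \<union> Side ` wang.sides hcols vcols" and ?P = "gadget.all_parts machine_tiles hcols vcols"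
  define m where "m = (3 * card ?P + 1) * (wang.K hcols vcols + 1)"
  have "finite ?D" using w.fin(4) by simp
  from ex_unique_weights[OF this, of m] obtain wt where wt: "\<And>i. 1 <= wt i" "unique_weights m ?D wt" by blast
  \<comment> \<open>The set of parts does not depend on the spacing, so the provisional value 2 may
    stand in before \<open>S\<close> is chosen.\<close>
  have "finite ?P" by (rule gadget.finite_all_parts[OF gad[OF wt(1), of 2]]) simp_all
  then obtain num0 and n :: nat where num0: "num0 ` ?P = {i. i < n}" "inj_on num0 ?P"
    by (elim exE[OF finite_imp_inj_to_nat_seg] exE conjE) (rule that)
  define S where "S = 8 * (n + 1)"
  have "((\<lambda>m. real m powr (\<alpha> - 1)) \<longlongrightarrow> 0) sequentially"
    using \<alpha> by (intro tendsto_neg_powr filterlim_real_sequentially) simp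
  moreover have "0 < split_gap \<alpha> / real S" using split_gap_pos[OF \<alpha>(2)] by (simp add: S_def)
  ultimately have "\<forall>\<^sub>F m in sequentially. real m powr (\<alpha> - 1) < split_gap \<alpha> / real S" by (rule order_tendstoD)
  then obtain A0 where A0: "\<And>m. A0 <= m ==> real m powr (\<alpha> - 1) < split_gap \<alpha> / real S"
    by (auto simp: eventually_sequentially)
  interpret gadget machine_tiles hcols vcols HEdge wt S "\<lambda>p. Suc (num0 p)" using wt(1) by (intro gad) (auto simp: S_def)
  have "scaled_gadget machine_tiles hcols vcols HEdge wt S (\<lambda>p. Suc (num0 p)) (max A0 g) g m \<alpha>"
  proof
    show "inj_on (\<lambda>p. Suc (num0 p)) ?P" using num0(2) by (simp add: inj_on_def)
    show "1 <= Suc (num0 p) & 8 * Suc (num0 p) <= S" if "p \<in> ?P" for p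
      using imageI[OF that, of num0] unfolding num0(1) by (simp add: S_def)
    show "real S * real (max A0 g) powr (\<alpha> - 1) < split_gap \<alpha>"
      using A0[of "max A0 g"] by (simp add: S_def field_simps)
  qed (use \<alpha> g wt in \<open>auto simp: m_def\<close>)
  then show ?thesis by blast
qed

theorem NP_hard_search_flamecast:
  assumes \<alpha>: "0 <= \<alpha>" "\<alpha> < 1" and g: "1 <= g"
    and \<rho>: "\<And>n. 0 < n ==> 1 < \<rho> n & \<rho> n <= 1 + 1 / real n"
  shows "NP_hard_search (flamecast_approx \<alpha> (has_min_group_size g) \<rho>)"
  unfolding NP_hard_search_def
proof
  fix L assume "L \<in> class_NP"
  then obtain V k where V: "V \<in> class_P" "\<And>x. x \<in> L \<longleftrightarrow> (\<exists>w. length w <= length x ^ k + k & pair_code x w \<in> V)"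
    unfolding class_NP_def by blast
  obtain fV where fV: "polytime fV" "\<And>x. fV x = [True] \<longleftrightarrow> x \<in> V" using V(1) unfolding class_P_def by blast
  obtain M e where M: "wf_tm M" "\<And>x. tm_output ((tm_step M ^^ (length x ^ e + e)) (tm_init M x)) (fV x)"
    using fV(1) unfolding polytime_def by blast
  interpret machine M by unfold_locales (rule M(1))
  obtain wt S num A m where "scaled_gadget machine_tiles hcols vcols HEdge wt S num A g m \<alpha>"
    using ex_constants[OF \<alpha> g] by blast
  then interpret reduction M wt S num A g m \<alpha> fV e k
    by (intro reduction.intro machine_axioms reduction_axioms.intro M(2))
  show "\<exists>f h. polytime f & polytime h & (\<forall>x. f x \<in> Domain (flamecast_approx \<alpha> (has_min_group_size g) \<rho>) &
    (\<forall>y. (f x, y) \<in> flamecast_approx \<alpha> (has_min_group_size g) \<rho> --> (h (pair_code x y) = [True] \<longleftrightarrow> x \<in> L)))"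
  proof (rule exI[of _ instance_string], rule exI[of _ answer], intro conjI allI impI)
    show "polytime instance_string" "polytime answer" by (fact polytime_instance_string, fact polytime_answer)
    show "instance_string x \<in> Domain (flamecast_approx \<alpha> (has_min_group_size g) \<rho>)" for x
      using \<rho>[OF sources_pos] by (intro instance_in_Domain) simp
    show "answer (pair_code x y) = [True] \<longleftrightarrow> x \<in> L"
      if "(instance_string x, y) \<in> flamecast_approx \<alpha> (has_min_group_size g) \<rho>" for x y
      using answer_complete[OF that] \<rho>[OF sources_pos[of x]] answer_sound[of x y] V(2)[of x] fV(2) unfolding plen_def by blast
  qed
qed

text \<open>The string determines the instance, so a solution of the unrestricted problem on a
  string of the restricted domain automatically satisfies \<open>Q\<close>. This lets a general
  solver be used on the hard instances.\<close>

lemma approx_restrict: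
  assumes "c \<in> Domain (flamecast_approx \<alpha> Q \<rho>)" "(c, y) \<in> flamecast_approx \<alpha> (\<lambda>_. True) \<rho>"
  shows "(c, y) \<in> flamecast_approx \<alpha> Q \<rho>"
proof -
  obtain ss ts cs where 1: "c = instance_code ss ts cs" "Q (the_instance \<alpha> ss ts cs)"
    using assms(1) unfolding flamecast_approx_def by blast
  obtain ss' ts' cs' vs es where 2: "c = instance_code ss' ts' cs'" "y = layout_code vs es"
    "is_instance (the_instance \<alpha> ss' ts' cs')" "intermediate_layers (the_instance \<alpha> ss' ts' cs') = 1"
    "is_approximation (\<rho> (card (sources (the_instance \<alpha> ss' ts' cs')))) (the_instance \<alpha> ss' ts' cs') (the_layout vs es)"
    using assms(2) unfolding flamecast_approx_def by blast
  have "Q (the_instance \<alpha> ss' ts' cs')" using 1 instance_code_inj[of ss ts cs ss' ts' cs'] 2(1) by metis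
  then show ?thesis unfolding flamecast_approx_def using 2 by blast
qed

lemma class_P_sub_NP: "class_P \<subseteq> class_NP"
proof
  fix L assume "L \<in> class_P"
  then obtain f where f: "polytime f" "\<And>x. f x = [True] \<longleftrightarrow> x \<in> L" unfolding class_P_def by blast
  have "polytime (\<lambda>z. f (unpair1 z))" by (intro polytime_comp[OF f(1)] polytime_basic)
  then have "{z. unpair1 z \<in> L} \<in> class_P" unfolding class_P_def using f(2) by blast
  moreover have "x \<in> L \<longleftrightarrow> (\<exists>w. length w <= length x ^ 0 + 0 & pair_code x w \<in> {z. unpair1 z \<in> L})" for x
    by (auto intro: exI[of _ "[]"])
  ultimately show "L \<in> class_NP" unfolding class_NP_def by blast
qed

text \<open>Composing the two halves of the reduction with the solver decides any language in
  \<open>class_NP\<close>: the query is always solvable, so the solver has to answer it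
  correctly.\<close>

lemma solver_class_P_eq_NP:
  assumes hard: "NP_hard_search (flamecast_approx \<alpha> Q \<rho>)"
    and f': "polytime f'" "solves f' (flamecast_approx \<alpha> (\<lambda>_. True) \<rho>)"
  shows "class_P = class_NP"
proof (intro equalityI class_P_sub_NP subsetI)
  fix L assume "L \<in> class_NP"
  then obtain f h where fh: "polytime f" "polytime h" "\<And>x. f x \<in> Domain (flamecast_approx \<alpha> Q \<rho>)"
      "\<And>x y. (f x, y) \<in> flamecast_approx \<alpha> Q \<rho> ==> (h (pair_code x y) = [True] \<longleftrightarrow> x \<in> L)"
    using hard unfolding NP_hard_search_def by metis
  have "(f x, f' (f x)) \<in> flamecast_approx \<alpha> Q \<rho>" for x
  proof -
    have "f x \<in> Domain (flamecast_approx \<alpha> (\<lambda>_. True) \<rho>)"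
      using fh(3)[of x] unfolding flamecast_approx_def by blast
    then show ?thesis using approx_restrict[OF fh(3)] f'(2) unfolding solves_def by blast
  qed
  then have "h (pair_code x (f' (f x))) = [True] \<longleftrightarrow> x \<in> L" for x using fh(4) by blast
  moreover have "polytime (\<lambda>x. h (pair_code x (f' (f x))))"
    by (intro polytime_comp[OF fh(2)] polytime_basic polytime_comp[OF f'(1)] fh(1))
  ultimately show "L \<in> class_P" unfolding class_P_def by blast
qed

text \<open>Write \<open>real g powr \<alpha>\<close> as \<open>g\<close> times
  \<open>real g powr (\<alpha> - 1)\<close>. As the latter power decreases in its base, the step
  from \<open>g - 1\<close> to \<open>g\<close> raises the power \<open>\<alpha>\<close> by at most
  \<open>real g powr (\<alpha> - 1)\<close>, which is below 1. So the numerator is in the interval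
  from 0, excluded, to 1, and the denominator is at least \<open>n\<close>.\<close>

lemma approximation_factor:
  fixes \<alpha> :: real and g n :: nat
  assumes \<alpha>: "0 <= \<alpha>" "\<alpha> < 1" and g: "2 <= g" and n: "0 < n"
  defines "\<rho> \<equiv> 1 + (1 + (real g - 1) powr \<alpha> - real g powr \<alpha>) / (real n * (2 * real g) powr \<alpha>)"
  shows "1 < \<rho> & \<rho> <= 1 + 1 / real n"
proof -
  have split: "real g powr \<alpha> = (real g - 1) * real g powr (\<alpha> - 1) + real g powr (\<alpha> - 1)"
    using g powr_add[of "real g" 1 "\<alpha> - 1"] by (simp add: algebra_simps)
  have "(real g - 1) * real g powr (\<alpha> - 1) <= (real g - 1) * (real g - 1) powr (\<alpha> - 1)"
    using g \<alpha> by (intro mult_left_mono powr_mono2') auto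
  also have "\<dots> = (real g - 1) powr \<alpha>" using g powr_add[of "real g - 1" 1 "\<alpha> - 1"] by simp
  finally have "real g powr \<alpha> <= (real g - 1) powr \<alpha> + real g powr (\<alpha> - 1)" using split by simp
  moreover have "real g powr (\<alpha> - 1) < 1" using g \<alpha> powr_less_mono[of "\<alpha> - 1" 0 "real g"] by simp
  moreover have "(real g - 1) powr \<alpha> <= real g powr \<alpha>" using g \<alpha> by (intro powr_mono2) auto
  ultimately have \<gamma>: "0 < 1 + (real g - 1) powr \<alpha> - real g powr \<alpha>" "1 + (real g - 1) powr \<alpha> - real g powr \<alpha> <= 1" by linarith+
  have d: "1 <= (2 * real g) powr \<alpha>" using g \<alpha> by (intro ge_one_powr_ge_zero) auto
  have "real n * 1 <= real n * (2 * real g) powr \<alpha>" using d by (intro mult_left_mono) auto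
  then have "(1 + (real g - 1) powr \<alpha> - real g powr \<alpha>) / (real n * (2 * real g) powr \<alpha>) <= 1 / real n"
    using \<gamma> n by (intro frac_le) auto
  moreover have "0 < (1 + (real g - 1) powr \<alpha> - real g powr \<alpha>) / (real n * (2 * real g) powr \<alpha>)"
    using \<gamma> d n g by (intro divide_pos_pos mult_pos_pos) auto
  ultimately show ?thesis by (simp add: \<rho>_def)
qed

theorem theorem17:
  fixes \<alpha> :: real
  assumes "0 \<le> \<alpha>" and "\<alpha> < 1"
  shows "(\<forall>g::nat. 7 \<le> g \<longrightarrow>
            NP_hard_search (flamecast_approx \<alpha> (has_min_group_size g)
              (\<lambda>n. 1 + (1 + (real g - 1) powr \<alpha> - real g powr \<alpha>) / (real n * (2 * real g) powr \<alpha>)))) \<and>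
         (class_P \<noteq> class_NP \<longrightarrow>
            \<not> (\<exists>f. polytime f \<and>
                   solves f (flamecast_approx \<alpha> (\<lambda>_. True)
                     (\<lambda>n. 1 + (1 + 6 powr \<alpha> - 7 powr \<alpha>) / (14 powr \<alpha> * real n)))))"
proof (intro conjI allI impI notI)
  show hard: "NP_hard_search (flamecast_approx \<alpha> (has_min_group_size g)
      (\<lambda>n. 1 + (1 + (real g - 1) powr \<alpha> - real g powr \<alpha>) / (real n * (2 * real g) powr \<alpha>)))" if "7 <= g" for g :: nat
    using that by (intro NP_hard_search_flamecast approximation_factor assms) auto
  assume "class_P ~= class_NP"
  moreover have "(\<lambda>n. 1 + (1 + 6 powr \<alpha> - 7 powr \<alpha>) / (14 powr \<alpha> * real n)) =
    (\<lambda>n. 1 + (1 + (real 7 - 1) powr \<alpha> - real 7 powr \<alpha>) / (real n * (2 * real 7) powr \<alpha>))"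
    by (simp add: mult.commute)
  moreover assume "\<exists>f. polytime f & solves f (flamecast_approx \<alpha> (\<lambda>_. True)
    (\<lambda>n. 1 + (1 + 6 powr \<alpha> - 7 powr \<alpha>) / (14 powr \<alpha> * real n)))"
  ultimately show False using solver_class_P_eq_NP[OF hard[of 7]] by auto
qed

end
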